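(* Let $f_0\in L^1_{2+\gamma}(\mathbb{R}^d)$ be a nonnegative distribution function. Then there exists a unique nonnegative solution $f\in\mathcal{C}([0,\infty);L^1_2(\mathbb{R}^d))\cap L^1_{\mathrm{loc}}((0,\infty),L^1_{2+\gamma}(\mathbb{R}^d))$ to the Boltzmann equation with ballistic annihilation $$\partial_tf(t,v)=(1-\alpha)\mathcal{Q}_+(f,f)(t,v)-\mathcal{Q}_-(f,f)(t,v)$$ such that $f(0,\cdot)=f_0$ and $$\int_{\mathbb{R}^d}f(t,v)\,dv\le\int_{\mathbb{R}^d}f_0(v)\,dv,\qquad\int_{\mathbb{R}^d}f(t,v)|v|^2\,dv\le\int_{\mathbb{R}^d}f_0(v)|v|^2\,dv\qquad\forall t\ge0.$$
   Context: Fix $d\ge2$, $\gamma\in(0,1]$, $\alpha\in(0,1)$ and a measurable $b:[-1,1]\to[0,\infty)$ with $|\mathbb{S}^{d-2}|\int_{-1}^1 b(t)(1-t^2)^{(d-3)/2}\,dt=1$. For $v,v_*\in\mathbb{R}^d$, $\sigma\in\mathbb{S}^{d-1}$ put $v'=\frac{v+v_*}2+\frac{|v-v_*|}2\sigma$, $v'_*=\frac{v+v_*}2-\frac{|v-v_*|}2\sigma$, $\cos\theta=\langle\frac{v-v_*}{|v-v_*|},\sigma\rangle$, and $$\mathcal{Q}_+(f,f)(v)=\int_{\mathbb{R}^d\times\mathbb{S}^{d-1}}|v-v_*|^\gamma b(\cos\theta)f(v')f(v'_* )\,dv_*d\sigma,\qquad \mathcal{Q}_-(f,f)(v)=f(v)\int_{\mathbb{R}^d}|v-v_*|^\gamma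 f(v_* )\,dv_*.$$ $\|f\|_{L^1_\eta}=\int|f(v)|(1+|v|^2)^{\eta/2}dv$. Solutions are understood in the weak sense (integrated in time and tested against $\varrho\in\mathcal{C}^1_c(\mathbb{R}^d)$): $\int f(t,v)\varrho(v)dv=\int f_0\varrho\,dv+\int_0^t\int[(1-\alpha)\mathcal{Q}_+(f,f)-\mathcal{Q}_-(f,f)](s,v)\varrho(v)\,dv\,ds$ for all $t\ge 0$. *)

theory Defs
  imports "HOL-Analysis.Analysis"
begin

(* Surface measure d sigma on the unit sphere, as the cone measure
   sigma(A) = d * |{r x. 0 < r < 1, x : A}|. Its underlying space is the sphere itself. *)
definition sphere_measure :: "'a::euclidean_space measure" where
  "sphere_measure =
     scale_measure (of_nat DIM('a))
       (distr (restrict_space lborel (ball 0 1 - {0})) (restrict_space borel (sphere 0 1))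
          (\<lambda>x. x /\<^sub>R norm x))"

(* |S^(n-1)|, the area of the unit sphere of R^n; for n = 1 this is 2, the cardinality of S^0. *)
definition sphere_area :: "nat \<Rightarrow> real" where
  "sphere_area n = real n * unit_ball_vol (real n)"

definition L1_weight :: "real \<Rightarrow> 'a::euclidean_space \<Rightarrow> real" where
  "L1_weight \<eta> v = (1 + (norm v)\<^sup>2) powr (\<eta> / 2)"

(* Elements of the weighted spaces are represented by Borel functions; equality in the space is
   equality almost everywhere. *)
definition L1 :: "real \<Rightarrow> ('a::euclidean_space \<Rightarrow> real) set" where
  "L1 \<eta> = {f. f \<in> borel_measurable borel \<and> integrable lborel (\<lambda>v. \<bar>f v\<bar> * L1_weight \<eta> v)}"

definition L1_norm :: "real \<Rightarrow> ('a::euclidean_space \<Rightarrow> real) \<Rightarrow> real" where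
  "L1_norm \<eta> f = (LINT v|lborel. \<bar>f v\<bar> * L1_weight \<eta> v)"

definition continuous_L1 ::
    "real \<Rightarrow> real set \<Rightarrow> (real \<Rightarrow> 'a::euclidean_space \<Rightarrow> real) \<Rightarrow> bool" where
  "continuous_L1 \<eta> I f \<longleftrightarrow>
     (\<forall>t\<in>I. f t \<in> L1 \<eta>) \<and>
     (\<forall>t\<in>I. ((\<lambda>s. L1_norm \<eta> (\<lambda>v. f s v - f t v)) \<longlongrightarrow> 0) (at t within I))"

(* Local Bochner integrability on I. The existential clause is strong measurability; it is spelled
   out because L1 is not a Banach space type here. *)
definition locally_integrable_L1 ::
    "real \<Rightarrow> real set \<Rightarrow> (real \<Rightarrow> 'a::euclidean_space \<Rightarrow> real) \<Rightarrow> bool" where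
  "locally_integrable_L1 \<eta> I f \<longleftrightarrow>
     (AE t in lborel. t \<in> I \<longrightarrow> f t \<in> L1 \<eta>) \<and>
     (\<exists>S. (\<forall>n. simple_function lborel (S n) \<and> (\<forall>t. S n t \<in> L1 \<eta>)) \<and>
          (AE t in lborel. t \<in> I \<longrightarrow>
             (\<lambda>n. L1_norm \<eta> (\<lambda>v. S n t v - f t v)) \<longlonglongrightarrow> 0)) \<and>
     (\<forall>K. compact K \<and> K \<subseteq> I \<longrightarrow> set_integrable lborel K (\<lambda>t. L1_norm \<eta> (f t)))"

definition C1_compact_support :: "('a::euclidean_space \<Rightarrow> real) \<Rightarrow> bool" where
  "C1_compact_support \<rho> \<longleftrightarrow>
     (\<exists>G. (\<forall>x. GDERIV \<rho> x :> G x) \<and> continuous_on UNIV G) \<and> compact (closure {x. \<rho> x \<noteq> 0})"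

definition post_coll :: "'a::euclidean_space \<Rightarrow> 'a \<Rightarrow> 'a \<Rightarrow> 'a" where
  "post_coll v w \<sigma> = (v + w) /\<^sub>R 2 + (norm (v - w) / 2) *\<^sub>R \<sigma>"

definition post_coll_star :: "'a::euclidean_space \<Rightarrow> 'a \<Rightarrow> 'a \<Rightarrow> 'a" where
  "post_coll_star v w \<sigma> = (v + w) /\<^sub>R 2 - (norm (v - w) / 2) *\<^sub>R \<sigma>"

(* For v = w this is 0, but then the factor |v - w|^gamma in the gain term vanishes. *)
definition cos_dev :: "'a::euclidean_space \<Rightarrow> 'a \<Rightarrow> 'a \<Rightarrow> real" where
  "cos_dev v w \<sigma> = ((v - w) /\<^sub>R norm (v - w)) \<bullet> \<sigma>"

definition Q_plus ::
    "real \<Rightarrow> (real \<Rightarrow> real) \<Rightarrow> ('a::euclidean_space \<Rightarrow> real) \<Rightarrow> 'a \<Rightarrow> real" where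
  "Q_plus \<gamma> b f v =
     (LINT (w, \<sigma>)|(lborel \<Otimes>\<^sub>M sphere_measure).
        norm (v - w) powr \<gamma> * b (cos_dev v w \<sigma>) * f (post_coll v w \<sigma>) * f (post_coll_star v w \<sigma>))"

definition Q_minus :: "real \<Rightarrow> ('a::euclidean_space \<Rightarrow> real) \<Rightarrow> 'a \<Rightarrow> real" where
  "Q_minus \<gamma> f v = f v * (LINT w|lborel. norm (v - w) powr \<gamma> * f w)"

(* If f is continuous from [0,oo) to L1 2 and 0 < gamma <= 2, all integrals below converge
   absolutely (those in Q_plus and Q_minus for almost every v). *)
definition weak_solution ::
    "real \<Rightarrow> real \<Rightarrow> (real \<Rightarrow> real) \<Rightarrow> ('a::euclidean_space \<Rightarrow> real) \<Rightarrow> (real \<Rightarrow> 'a \<Rightarrow> real) \<Rightarrow> bool" where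
  "weak_solution \<gamma> \<alpha> b f0 f \<longleftrightarrow>
     (\<forall>\<rho> t. C1_compact_support \<rho> \<and> 0 \<le> t \<longrightarrow>
        (LINT v|lborel. f t v * \<rho> v) =
        (LINT v|lborel. f0 v * \<rho> v) +
        (LINT s:{0..t}|lborel. (LINT v|lborel.
           ((1 - \<alpha>) * Q_plus \<gamma> b (f s) v - Q_minus \<gamma> (f s) v) * \<rho> v)))"

definition admissible_solution ::
    "real \<Rightarrow> real \<Rightarrow> (real \<Rightarrow> real) \<Rightarrow> ('a::euclidean_space \<Rightarrow> real) \<Rightarrow> (real \<Rightarrow> 'a \<Rightarrow> real) \<Rightarrow> bool" where
  "admissible_solution \<gamma> \<alpha> b f0 f \<longleftrightarrow>
     (\<forall>t\<ge>0. AE v in lborel. 0 \<le> f t v) \<and>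
     continuous_L1 2 {0..} f \<and>
     locally_integrable_L1 (2 + \<gamma>) {0<..} f \<and>
     weak_solution \<gamma> \<alpha> b f0 f \<and>
     (AE v in lborel. f 0 v = f0 v) \<and>
     (\<forall>t\<ge>0. (LINT v|lborel. f t v) \<le> (LINT v|lborel. f0 v)) \<and>
     (\<forall>t\<ge>0. (LINT v|lborel. f t v * (norm v)\<^sup>2) \<le> (LINT v|lborel. f0 v * (norm v)\<^sup>2))"

end

theory Submission
  imports Defs "HOL-Real_Asymp.Real_Asymp"
begin

text \<open>Write \<open>w(v) = 1 + |v|\<^sup>2\<close> and measure a function by \<open>N s u = \<integral>|u| w\<^sup>s\<close>.
Existence and uniqueness both come from one stability estimate for an explicit Euler step
\<open>f \<mapsto> f + \<delta> Q(f)\<close>. For two densities \<open>f, g\<close> put \<open>h = f - g\<close> and \<open>S = f + g\<close>;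
the bilinear operator gives \<open>Q(f) - Q(g) = Q(h, S)\<close>, symmetrised. Tested against \<open>sgn h \<cdot> w\<^sup>q\<close>, the
loss term removes \<open>1/2 \<integral>\<integral> |v - v\<^sub>*|\<^sup>\<gamma> |h(v)| S(v\<^sub>*) w\<^sup>q(v)\<close> and adds at most the same integral with
\<open>w\<^sup>q(v\<^sub>*)\<close> in place of \<open>w\<^sup>q(v)\<close>; the gain term adds at most the first integral with
\<open>w\<^sup>q(v)\<close> replaced by
\<open>(1 - \<alpha>)(w\<^sup>q(v') + w\<^sup>q(v'\<^sub>*))\<close>. A collision conserves \<open>w(v) + w(v\<^sub>*)\<close>, and the map
\<open>x \<mapsto> x\<^sup>q\<close> is concave and subadditive for \<open>q \<le> 1\<close>; hence
\<open>(1 - \<alpha>)(w\<^sup>q(v') + w\<^sup>q(v'\<^sub>*)) \<le> w\<^sup>q(v) + w\<^sup>q(v\<^sub>*)\<close> as soon as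
\<open>2\<^bsup>1-q\<^esup>(1 - \<alpha>) \<le> 1\<close>. Annihilation, \<open>\<alpha> > 0\<close>, is what leaves room for some \<open>q < 1\<close>. The term carrying
\<open>w\<^sup>q(v)\<close> is absorbed by the loss, and what remains, with the weight on the partner of \<open>h\<close>, is at most
\<open>2 N\<^bsub>q+\<gamma>/2\<^esub>(S) N\<^sub>q(h)\<close>. No moment of \<open>h\<close> above \<open>q\<close> enters, and the moment of \<open>S\<close> has order
\<open>q + \<gamma>/2 < a = 1 + \<gamma>/2\<close>, below the order that the initial datum controls
(\<open>euler_contraction\<close>).

The second ingredient is a Povzner estimate: the moment of order \<open>a\<close> grows at most linearly in time.
Since the weight \<open>w\<^sup>a\<close> is too large to be tested directly, the estimate is proved for
\<open>w min(w, R)\<^bsup>\<gamma>/2\<^esup>\<close> with constants independent of \<open>R\<close> (\<open>trunc_weight_bracket\<close>).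

Existence. Take time step \<open>2\<^bsup>-j\<^esup>\<close> and replace the collision rate \<open>|v - v\<^sub>*|\<^sup>\<gamma>\<close> by its minimum with a
constant of order \<open>2\<^sup>j\<close>. Then a step keeps densities nonnegative, mass and energy do not increase, and the
moment of order \<open>a\<close> obeys the Povzner bound (\<open>euler_invariants\<close>). One step on grid \<open>j\<close> differs from two
steps on grid \<open>j + 1\<close> by \<open>O(2\<^bsup>-j(1+\<beta>)\<^esup>)\<close> in \<open>N q\<close>, because both the removed part of the rate and the
change of the density within a step are small after interpolation between orders \<open>q\<close> and \<open>a\<close>. With the
stability estimate and a discrete Gronwall argument the schemes form a Cauchy sequence of geometric rate
(\<open>grid_comparison\<close>, \<open>fast_limit\<close>). The limit inherits all bounds by Fatou's lemma, and its weak equation is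
the limit of Riemann sums (\<open>sol_weak_form\<close>).

Uniqueness. For an arbitrary solution in the class, testing with the truncated weight gives the
moment bound of order \<open>a\<close> at every time (\<open>moment_bound\<close>). Together with continuity in \<open>N 1\<close> and duality with
test functions this shows that \<open>f(t) - f(s) - (t - s) Q(f(s))\<close> is \<open>o(t - s)\<close> in \<open>N q\<close>, uniformly on bounded
time intervals (\<open>local_expansion\<close>): every solution is an approximate orbit of the Euler scheme. Two orbits from
the same datum are compared step by step with the same stability estimate (\<open>weak_evolution_unique\<close>).

Two facts about the sphere support this. Exchanging the directions \<open>v - v\<^sub>*\<close> and \<open>\<sigma>\<close>, which moves test
functions from \<open>v\<close> to \<open>v'\<close>, is Fubini's theorem in polar coordinates (\<open>polar_decomposition\<close>). The normalisation of
\<open>b\<close> becomes the statement that \<open>b(\<omega> \<cdot> \<sigma>) d\<sigma>\<close> is a probability measure, by integration over the slices of the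
sphere (\<open>nn_integral_sphere_borel_slices\<close>).\<close>

section \<open>The surface measure of the sphere\<close>

text \<open>The surface measure as a Borel measure on the whole space, so that integrands need not be restricted to the sphere.\<close>

definition sphere_borel :: "'a::euclidean_space measure" where
  "sphere_borel = distr sphere_measure borel (\<lambda>x. x)"

lemma sets_sphere_borel [simp, measurable_cong]: "sets sphere_borel = sets borel"
  by (simp add: sphere_borel_def)

lemma space_sphere_borel [simp]: "space sphere_borel = UNIV"
  by (simp add: sphere_borel_def)

lemma sets_sphere_measure:
  "sets (sphere_measure :: 'a::euclidean_space measure) = sets (restrict_space borel (sphere 0 1))"
  by (simp add: sphere_measure_def)

lemma measurable_id_sphere_measure:
  "(\<lambda>x. x) \<in> measurable (sphere_measure :: 'a::euclidean_space measure) borel"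
  by (subst measurable_cong_sets[OF sets_sphere_measure refl]) (rule measurable_restrict_space1, simp)

lemma nn_integral_sphere_borel:
  fixes f :: "'a::euclidean_space \<Rightarrow> ennreal"
  assumes f: "f \<in> borel_measurable borel"
  shows "(\<integral>\<^sup>+x. f x \<partial>sphere_borel) =
    of_nat DIM('a) * (\<integral>\<^sup>+x. f (sgn x) * indicator (ball 0 1 - {0}) x \<partial>lborel)"
proof -
  have m1: "(\<lambda>x::'a. x /\<^sub>R norm x)
      \<in> measurable (restrict_space lborel (ball 0 1 - {0})) (restrict_space borel (sphere 0 1))"
    by (intro measurable_restrict_space3) auto
  have m2: "f \<in> borel_measurable (restrict_space borel (sphere 0 1))"
    using f by (rule measurable_restrict_space1)
  have m3: "f \<in> borel_measurable (sphere_measure :: 'a measure)"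
    using m2 by (subst measurable_cong_sets[OF sets_sphere_measure refl])
  have "(\<integral>\<^sup>+x. f x \<partial>sphere_borel) = (\<integral>\<^sup>+x. f x \<partial>(sphere_measure :: 'a measure))"
    unfolding sphere_borel_def by (rule nn_integral_distr[OF measurable_id_sphere_measure]) (use f in simp)
  also have "\<dots> = of_nat DIM('a) *
      (\<integral>\<^sup>+x. f (x /\<^sub>R norm x) \<partial>(restrict_space lborel (ball 0 1 - {0})))"
    unfolding sphere_measure_def using m1 m2
    by (subst nn_integral_scale_measure) (simp_all add: nn_integral_distr)
  also have "(\<integral>\<^sup>+x. f (x /\<^sub>R norm x) \<partial>(restrict_space lborel (ball 0 1 - {0})))
      = (\<integral>\<^sup>+x. f (sgn x) * indicator (ball 0 1 - {0}) x \<partial>lborel)"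
    by (subst nn_integral_restrict_space) (auto simp: sgn_div_norm)
  finally show ?thesis .
qed

lemma emeasure_sphere_borel:
  fixes B :: "'a::euclidean_space set"
  assumes [measurable]: "B \<in> sets borel"
  shows "emeasure sphere_borel B =
    of_nat DIM('a) * emeasure lborel {x \<in> ball 0 1 - {0}. sgn x \<in> B}"
proof -
  have "emeasure sphere_borel B = (\<integral>\<^sup>+x. indicator B x \<partial>sphere_borel)"
    by simp
  also have "\<dots> = of_nat DIM('a) *
      (\<integral>\<^sup>+x. indicator B (sgn x) * indicator (ball 0 1 - {0}) x \<partial>lborel)"
    by (rule nn_integral_sphere_borel) simp
  also have "(\<lambda>x::'a. indicator B (sgn x) * indicator (ball 0 1 - {0}) x)
     = (indicator {x \<in> ball 0 1 - {0}. sgn x \<in> B} :: 'a \<Rightarrow> ennreal)"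
    by (auto simp: indicator_def fun_eq_iff)
  also have "(\<integral>\<^sup>+x. indicator {x \<in> ball 0 1 - {0}. sgn x \<in> B} x \<partial>lborel)
     = emeasure lborel {x \<in> ball (0::'a) 1 - {0}. sgn x \<in> B}"
    by (rule nn_integral_indicator) measurable
  finally show ?thesis .
qed

lemma AE_sphere_borel: "AE \<sigma> in (sphere_borel :: 'a::euclidean_space measure). norm \<sigma> = 1"
proof (rule AE_I)
  have [measurable]: "{\<sigma> :: 'a. norm \<sigma> \<noteq> 1} \<in> sets borel" by measurable
  have "{x \<in> ball 0 1 - {0}. sgn x \<in> {\<sigma> :: 'a. norm \<sigma> \<noteq> 1}} = {}"
    by (auto simp: norm_sgn)
  then show "emeasure sphere_borel {\<sigma> :: 'a. norm \<sigma> \<noteq> 1} = 0"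
    by (subst emeasure_sphere_borel) (auto simp: norm_sgn)
qed auto

lemma finite_measure_sphere_borel: "finite_measure (sphere_borel :: 'a::euclidean_space measure)"
proof
  have "emeasure lborel {x \<in> ball 0 1 - {0}. sgn x \<in> (UNIV :: 'a set)} \<le> emeasure lborel (ball (0::'a) 1)"
    by (rule emeasure_mono) auto
  also have "\<dots> < \<infinity>"
    by (rule emeasure_lborel_ball_finite)
  finally show "emeasure sphere_borel (space (sphere_borel :: 'a measure)) \<noteq> \<infinity>"
    by (subst emeasure_sphere_borel)
      (auto simp: ennreal_mult_eq_top_iff ennreal_of_nat_eq_real_of_nat)
qed

interpretation sphere_borel: finite_measure "sphere_borel :: 'a::euclidean_space measure"
  by (rule finite_measure_sphere_borel)

lemma emeasure_sphere_borel_pos: "emeasure (sphere_borel :: 'a::euclidean_space measure) UNIV \<noteq> 0"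
proof
  assume "emeasure (sphere_borel :: 'a measure) UNIV = 0"
  then have z: "emeasure lborel {x \<in> ball 0 1 - {0}. sgn x \<in> (UNIV :: 'a set)} = 0"
    by (simp add: emeasure_sphere_borel)
  have "emeasure lborel (ball (0::'a) 1) \<le>
      emeasure lborel ({x \<in> ball 0 1 - {0}. sgn x \<in> (UNIV :: 'a set)} \<union> {0})"
    by (rule emeasure_mono) auto
  also have "\<dots> \<le> emeasure lborel {x \<in> ball 0 1 - {0}. sgn x \<in> (UNIV :: 'a set)} + emeasure lborel {0::'a}"
    by (rule emeasure_subadditive) auto
  finally have "emeasure lborel (ball (0::'a) 1) = 0"
    using z by simp
  moreover have "unit_ball_vol (real DIM('a)) > 0" by (rule unit_ball_vol_pos) simp
  ultimately show False
    by (simp add: emeasure_ball)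
qed

lemma nn_integral_lborel_scaleR:
  fixes f :: "'a::euclidean_space \<Rightarrow> ennreal"
  assumes [measurable]: "f \<in> borel_measurable borel" and c: "c \<noteq> 0"
  shows "(\<integral>\<^sup>+x. f x \<partial>lborel) = ennreal (\<bar>c\<bar> ^ DIM('a)) * (\<integral>\<^sup>+x. f (t + c *\<^sub>R x) \<partial>lborel)"
  using c
  by (subst lborel_affine[of c t])
     (simp_all add: nn_integral_density nn_integral_distr nn_integral_cmult)

lemma emeasure_norm_sgn_scale:
  fixes B :: "'a::euclidean_space set"
  assumes [measurable]: "B \<in> sets borel" and R: "0 < R"
  shows "emeasure lborel {u. norm u < R \<and> sgn u \<in> B}
    = ennreal (R ^ DIM('a)) * emeasure lborel {u. norm u < 1 \<and> sgn u \<in> B}"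
proof -
  have "emeasure lborel {u. norm u < R \<and> sgn u \<in> B} = (\<integral>\<^sup>+x. indicator {u. norm u < R \<and> sgn u \<in> B} x \<partial>lborel)"
    by (rule nn_integral_indicator[symmetric]) measurable
  also have "\<dots> = ennreal (\<bar>R\<bar> ^ DIM('a)) * (\<integral>\<^sup>+x. indicator {u. norm u < R \<and> sgn u \<in> B} (0 + R *\<^sub>R x) \<partial>lborel)"
    using R by (intro nn_integral_lborel_scaleR) auto
  also have "(\<lambda>x. indicator {u. norm u < R \<and> sgn u \<in> B} (0 + R *\<^sub>R x) :: ennreal)
      = indicator {u. norm u < 1 \<and> sgn u \<in> B}"
    using R by (auto simp: indicator_def fun_eq_iff sgn_scaleR)
  also have "(\<integral>\<^sup>+x. indicator {u. norm u < 1 \<and> sgn u \<in> B} x \<partial>lborel)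
      = emeasure lborel {u. norm u < 1 \<and> sgn u \<in> B}"
    by (rule nn_integral_indicator) measurable
  finally show ?thesis using R by simp
qed

lemma emeasure_cone:
  fixes B :: "'a::euclidean_space set"
  assumes [measurable]: "B \<in> sets borel"
  shows "emeasure sphere_borel B = of_nat DIM('a) * emeasure lborel {u. norm u < 1 \<and> sgn u \<in> B}"
proof -
  have "emeasure lborel {x \<in> ball 0 1 - {0}. sgn x \<in> B} = emeasure lborel {u. norm u < 1 \<and> sgn u \<in> B}"
  proof (rule emeasure_eq_AE)
    have "AE x in lborel. x \<noteq> (0::'a)"
      by (rule AE_lborel_singleton)
    then show "AE x in lborel. (x \<in> {x \<in> ball 0 1 - {0}. sgn x \<in> B}) = (x \<in> {u. norm u < 1 \<and> sgn u \<in> B})"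
      by eventually_elim auto
  qed measurable
  then show ?thesis by (simp add: emeasure_sphere_borel)
qed

text \<open>Lebesgue measure scales by \<open>R\<^sup>d\<close> on cones, so for a fixed set \<open>B\<close> of directions the law of the
norm on the cone over \<open>B\<close> is proportional to its law on the whole space: both agree on the half-lines
\<open>{..<R}\<close>, which generate the Borel sets. The total masses appear crosswise to avoid a division.\<close>

lemma emeasure_norm_sgn_product:
  fixes B :: "'a::euclidean_space set"
  assumes A: "A \<in> sets borel" and B[measurable]: "B \<in> sets borel"
  shows "emeasure lborel {u. norm u \<in> A \<and> sgn u \<in> B} * emeasure (sphere_borel :: 'a measure) UNIV
    = emeasure lborel {u::'a. norm u \<in> A} * emeasure sphere_borel B"
proof -
  let ?\<nu> = "sphere_borel :: 'a measure"
  define M where "M = scale_measure (emeasure ?\<nu> UNIV) (distr (restrict_space lborel {u. sgn u \<in> B}) borel norm)"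
  define N where "N = scale_measure (emeasure ?\<nu> B) (distr (lborel :: 'a measure) borel norm)"
  have Bm: "{u::'a. sgn u \<in> B} \<in> sets borel" by measurable
  have nm: "norm \<in> borel_measurable (restrict_space lborel {u. sgn u \<in> B})"
    by (rule measurable_restrict_space1) simp
  have eM: "emeasure M A = emeasure ?\<nu> UNIV * emeasure lborel {u. norm u \<in> A \<and> sgn u \<in> B}"
    if [measurable]: "A \<in> sets borel" for A
    unfolding M_def using Bm
    apply (simp add: emeasure_distr[OF nm] space_restrict_space)
    apply (subst emeasure_restrict_space)
      apply (auto intro!: arg_cong[where f="\<lambda>x. _ * emeasure lborel x"])
    done
  have eN: "emeasure N A = emeasure ?\<nu> B * emeasure lborel {u::'a. norm u \<in> A}"
    if [measurable]: "A \<in> sets borel" for A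
    unfolding N_def by (simp add: emeasure_distr vimage_def)
  have "M = N"
  proof (rule measure_eqI_generator_eq[where \<Omega>=UNIV and E="range lessThan" and A="\<lambda>i. {..<real i}"])
    show "Int_stable (range (lessThan :: real \<Rightarrow> _))"
    proof (rule Int_stableI)
      fix a b :: "real set" assume "a \<in> range lessThan" "b \<in> range lessThan"
      then obtain x y where "a = {..<x}" "b = {..<y}" by auto
      then have "a \<inter> b = {..<min x y}" by auto
      then show "a \<inter> b \<in> range lessThan" by simp
    qed
    show "(\<Union>i. {..<real i}) = UNIV"
      by (auto simp: reals_Archimedean2)
    show "sets M = sigma_sets UNIV (range lessThan)" "sets N = sigma_sets UNIV (range lessThan)"
      unfolding M_def N_def by (simp_all add: borel_Iio)
    have key: "emeasure M {..<R} = emeasure N {..<R}" for R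
    proof (cases "R > 0")
      case True
      have "emeasure M {..<R} = emeasure ?\<nu> UNIV * (ennreal (R ^ DIM('a)) * emeasure lborel {u. norm u < 1 \<and> sgn u \<in> B})"
        using emeasure_norm_sgn_scale[OF B True] by (subst eM) (auto simp: lessThan_def)
      also have "\<dots> = of_nat DIM('a) * emeasure lborel {u::'a. norm u < 1 \<and> sgn u \<in> UNIV}
           * (ennreal (R ^ DIM('a)) * emeasure lborel {u. norm u < 1 \<and> sgn u \<in> B})"
        by (subst emeasure_cone) auto
      also have "\<dots> = of_nat DIM('a) * emeasure lborel {u. norm u < 1 \<and> sgn u \<in> B} 
            * (ennreal (R ^ DIM('a)) * emeasure lborel {u::'a. norm u < 1 \<and> sgn u \<in> UNIV})"
        by (simp add: mult_ac)
      also have "\<dots> = emeasure ?\<nu> B * emeasure lborel {u::'a. norm u < R \<and> sgn u \<in> UNIV}"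
        using emeasure_norm_sgn_scale[OF _ True, of "UNIV :: 'a set"] emeasure_cone[OF B] by simp
      also have "\<dots> = emeasure N {..<R}"
        by (subst eN) (auto simp: lessThan_def)
      finally show ?thesis .
    next
      case False
      then have "\<not> norm u < R" for u :: 'a
        using norm_ge_zero[of u] by linarith
      then show ?thesis by (simp add: eM eN)
    qed
    then show "emeasure M X = emeasure N X" if "X \<in> range lessThan" for X
      using that by auto
    have "emeasure lborel {u::'a. norm u \<in> {..<real i}} < \<infinity>" for i
      using emeasure_lborel_ball_finite[of "0::'a" "real i"] by (simp add: ball_def)
    then show "emeasure M {..<real i} \<noteq> \<infinity>" for i
      unfolding key by (subst eN) (auto simp: ennreal_mult_eq_top_iff sphere_borel.emeasure_finite less_top)
  qed auto
  then have "emeasure M A = emeasure N A" by simp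
  then show ?thesis using A by (simp add: eM eN mult_ac)
qed

text \<open>The factor \<open>r\<^bsup>d-1\<^esup> dr\<close> of polar coordinates, as the normalised law of the norm.\<close>

definition radial :: "'a::euclidean_space itself \<Rightarrow> real measure" where
  "radial _ = scale_measure (inverse (emeasure (sphere_borel :: 'a measure) UNIV))
     (distr (lborel :: 'a measure) borel norm)"

lemma sets_radial [simp, measurable_cong]: "sets (radial TYPE('a::euclidean_space)) = sets borel"
  by (simp add: radial_def)

lemma emeasure_radial:
  assumes [measurable]: "A \<in> sets borel"
  shows "emeasure (radial TYPE('a::euclidean_space)) A =
    inverse (emeasure (sphere_borel :: 'a measure) UNIV) * emeasure lborel {u::'a. norm u \<in> A}"
  unfolding radial_def by (simp add: emeasure_distr vimage_def)

lemma sigma_finite_radial: "sigma_finite_measure (radial TYPE('a::euclidean_space))"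
proof
  have fin: "emeasure (radial TYPE('a)) {..<real i} \<noteq> \<infinity>" for i
  proof -
    have "emeasure lborel {u::'a. norm u \<in> {..<real i}} < \<infinity>"
      using emeasure_lborel_ball_finite[of "0::'a" "real i"] by (simp add: ball_def)
    then show ?thesis
      by (subst emeasure_radial)
        (auto simp: ennreal_mult_eq_top_iff emeasure_sphere_borel_pos less_top)
  qed
  show "\<exists>A. countable A \<and> A \<subseteq> sets (radial TYPE('a)) \<and> \<Union> A = space (radial TYPE('a)) \<and>
        (\<forall>a\<in>A. emeasure (radial TYPE('a)) a \<noteq> \<infinity>)"
    using fin
    by (intro exI[of _ "range (\<lambda>i. {..<real i})"])
       (auto simp: reals_Archimedean2 radial_def space_scale_measure)
qed

text \<open>Both sides agree on measurable rectangles by the proportionality of cones, and a product of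
sigma-finite measures is determined by its rectangles.\<close>

lemma polar_decomposition:
  "distr lborel (borel \<Otimes>\<^sub>M borel) (\<lambda>u::'a::euclidean_space. (norm u, sgn u))
    = radial TYPE('a) \<Otimes>\<^sub>M sphere_borel"
proof (rule pair_measure_eqI[symmetric])
  show "sigma_finite_measure (radial TYPE('a))" by (rule sigma_finite_radial)
  show "sigma_finite_measure (sphere_borel :: 'a measure)" by unfold_locales
  show "sets (radial TYPE('a) \<Otimes>\<^sub>M sphere_borel) =
      sets (distr lborel (borel \<Otimes>\<^sub>M borel) (\<lambda>u::'a. (norm u, sgn u)))"
    by (simp cong: sets_pair_measure_cong)
  fix A and B :: "'a set"
  assume "A \<in> sets (radial TYPE('a))" "B \<in> sets sphere_borel"
  then have [measurable]: "A \<in> sets borel" "B \<in> sets borel" by auto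
  let ?c = "emeasure (sphere_borel :: 'a measure) UNIV"
  have c: "?c \<noteq> 0" "?c \<noteq> \<infinity>"
    using emeasure_sphere_borel_pos sphere_borel.emeasure_finite by auto
  have "emeasure (radial TYPE('a)) A * emeasure sphere_borel B
    = inverse ?c * (emeasure lborel {u::'a. norm u \<in> A} * emeasure sphere_borel B)"
    by (simp add: emeasure_radial mult_ac)
  also have "\<dots> = inverse ?c * (emeasure lborel {u. norm u \<in> A \<and> sgn u \<in> B} * ?c)"
    by (subst emeasure_norm_sgn_product) auto
  also have "\<dots> = (inverse ?c * ?c) * emeasure lborel {u. norm u \<in> A \<and> sgn u \<in> B}"
    by (simp add: mult_ac)
  also have "inverse ?c * ?c = 1"
    using ennreal_divide_self[of ?c] c
    by (metis divide_ennreal_def infinity_ennreal_def less_top mult.commute)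
  also have "1 * emeasure lborel {u. norm u \<in> A \<and> sgn u \<in> B} =
      emeasure (distr lborel (borel \<Otimes>\<^sub>M borel) (\<lambda>u::'a. (norm u, sgn u))) (A \<times> B)"
    by (subst emeasure_distr) (auto simp: vimage_def)
  finally show "emeasure (radial TYPE('a)) A * emeasure sphere_borel B =
      emeasure (distr lborel (borel \<Otimes>\<^sub>M borel) (\<lambda>u::'a. (norm u, sgn u))) (A \<times> B)" .
qed

lemma nn_integral_polar:
  fixes h :: "real \<times> 'a::euclidean_space \<Rightarrow> ennreal"
  assumes [measurable]: "h \<in> borel_measurable (borel \<Otimes>\<^sub>M borel)"
  shows "(\<integral>\<^sup>+u. h (norm u, sgn u) \<partial>lborel) = (\<integral>\<^sup>+r. \<integral>\<^sup>+\<omega>. h (r, \<omega>) \<partial>sphere_borel \<partial>radial TYPE('a))"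
proof -
  have "(\<integral>\<^sup>+u. h (norm u, sgn u) \<partial>lborel)
     = (\<integral>\<^sup>+p. h p \<partial>distr lborel (borel \<Otimes>\<^sub>M borel) (\<lambda>u::'a. (norm u, sgn u)))"
    by (subst nn_integral_distr) auto
  also have "\<dots> = (\<integral>\<^sup>+p. h p \<partial>(radial TYPE('a) \<Otimes>\<^sub>M sphere_borel))"
    by (simp add: polar_decomposition)
  also have "\<dots> = (\<integral>\<^sup>+r. \<integral>\<^sup>+\<omega>. h (r, \<omega>) \<partial>sphere_borel \<partial>radial TYPE('a))"
    by (rule sphere_borel.nn_integral_fst[symmetric]) measurable
  finally show ?thesis .
qed

text \<open>In polar coordinates the direction of \<open>u\<close> and \<open>\<sigma>\<close> are two independent points of the sphere
with the same law, so Fubini's theorem exchanges them. For collisions this is the change of variables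
between pre- and post-collisional velocities.\<close>

lemma nn_integral_direction_swap:
  fixes H :: "real \<times> 'a::euclidean_space \<times> 'a \<Rightarrow> ennreal"
  assumes [measurable]: "H \<in> borel_measurable (borel \<Otimes>\<^sub>M borel \<Otimes>\<^sub>M borel)"
  shows "(\<integral>\<^sup>+u. \<integral>\<^sup>+\<sigma>. H (norm u, sgn u, \<sigma>) \<partial>sphere_borel \<partial>lborel)
       = (\<integral>\<^sup>+u. \<integral>\<^sup>+\<sigma>. H (norm u, \<sigma>, sgn u) \<partial>sphere_borel \<partial>lborel)"
proof -
  interpret pair_sigma_finite "sphere_borel :: 'a measure" "sphere_borel :: 'a measure" ..
  have "(\<integral>\<^sup>+u. \<integral>\<^sup>+\<sigma>. H (norm u, sgn u, \<sigma>) \<partial>sphere_borel \<partial>lborel) =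
      (\<integral>\<^sup>+r. \<integral>\<^sup>+\<omega>. \<integral>\<^sup>+\<sigma>. H (r, \<omega>, \<sigma>) \<partial>sphere_borel \<partial>sphere_borel \<partial>radial TYPE('a))"
    using nn_integral_polar[of "\<lambda>p. \<integral>\<^sup>+\<sigma>. H (fst p, snd p, \<sigma>) \<partial>sphere_borel"] by simp
  also have "\<dots> = (\<integral>\<^sup>+r. \<integral>\<^sup>+\<omega>. \<integral>\<^sup>+\<sigma>. H (r, \<sigma>, \<omega>) \<partial>sphere_borel \<partial>sphere_borel \<partial>radial TYPE('a))"
    by (intro nn_integral_cong Fubini'[symmetric]) simp
  also have "\<dots> = (\<integral>\<^sup>+u. \<integral>\<^sup>+\<sigma>. H (norm u, \<sigma>, sgn u) \<partial>sphere_borel \<partial>lborel)"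
    using nn_integral_polar[of "\<lambda>p. \<integral>\<^sup>+\<sigma>. H (fst p, \<sigma>, snd p) \<partial>sphere_borel"] by simp
  finally show ?thesis .
qed

lemma nn_integral_sphere_borel_uminus:
  fixes f :: "'a::euclidean_space \<Rightarrow> ennreal"
  assumes [measurable]: "f \<in> borel_measurable borel"
  shows "(\<integral>\<^sup>+x. f (- x) \<partial>sphere_borel) = (\<integral>\<^sup>+x. f x \<partial>sphere_borel)"
proof -
  have "(\<integral>\<^sup>+x. f (sgn x) * indicator (ball 0 1 - {0}) x \<partial>lborel)
      = (\<integral>\<^sup>+x. f (- sgn x) * indicator (ball 0 1 - {0}) x \<partial>lborel)"
    by (subst nn_integral_lborel_scaleR[where c="-1" and t=0])
       (auto simp: sgn_minus indicator_def intro!: nn_integral_cong)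
  then show ?thesis
    by (simp add: nn_integral_sphere_borel)
qed

text \<open>Layer-cake formula: \<open>\<rho> - |y|\<close> is the length of the set of radii \<open>s \<le> \<rho>\<close> with \<open>|y| \<le> s\<close>, so its integral
over the ball is \<open>\<integral>\<^sub>0\<^sup>\<rho> vol(ball s) ds\<close>, and the integral of \<open>|y|\<close> is what is left of \<open>\<rho> vol(ball \<rho>)\<close>.\<close>

lemma nn_integral_norm_ball_PiM:
  fixes \<rho> :: real
  assumes I: "finite I" "I \<noteq> {}" and \<rho>: "0 < \<rho>"
  shows "(\<integral>\<^sup>+y. ennreal (sqrt (\<Sum>i\<in>I. (y i)\<^sup>2)) * indicator {y. sqrt (\<Sum>i\<in>I. (y i)\<^sup>2) \<le> \<rho>} y
      \<partial>Pi\<^sub>M I (\<lambda>_. lborel)) =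
    ennreal (unit_ball_vol (real (card I)) * real (card I) / (real (card I) + 1) * \<rho> ^ (card I + 1))"
proof -
  let ?P = "Pi\<^sub>M I (\<lambda>_. lborel :: real measure)"
  define N where "N y = sqrt (\<Sum>i\<in>I. (y i)\<^sup>2)" for y :: "'a \<Rightarrow> real"
  define n where "n = card I"
  define k where "k = unit_ball_vol (real n)"
  have k: "0 \<le> k" by (simp add: k_def)
  have [measurable]: "N \<in> borel_measurable ?P"
    unfolding N_def using I by measurable
  have N0: "0 \<le> N y" for y by (simp add: N_def sum_nonneg)
  interpret P: product_sigma_finite "\<lambda>_::'a. lborel :: real measure" ..
  interpret Ps: sigma_finite_measure ?P by (rule P.sigma_finite) (rule I)
  interpret pair_sigma_finite ?P "lborel :: real measure" ..
  have vol: "(\<integral>\<^sup>+y. indicator {y. N y \<le> r} y \<partial>?P) = ennreal (k * r ^ n)" if r: "0 < r" for r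
  proof -
    have "(\<integral>\<^sup>+y. indicator {y. N y \<le> r} y \<partial>?P) = (\<integral>\<^sup>+y. indicator ({y. N y \<le> r} \<inter> space ?P) y \<partial>?P)"
      by (intro nn_integral_cong) (auto simp: indicator_def)
    also have "\<dots> = emeasure ?P ({y. N y \<le> r} \<inter> space ?P)"
      by (rule nn_integral_indicator) measurable
    also have "\<dots> = ennreal (k * r ^ n)"
      unfolding N_def k_def n_def by (rule emeasure_cball_aux) (use I r in auto)
    finally show ?thesis .
  qed
  have "(\<integral>\<^sup>+y. ennreal (\<rho> - N y) * indicator {y. N y \<le> \<rho>} y \<partial>?P) =
      (\<integral>\<^sup>+y. (\<integral>\<^sup>+s. indicator {0..\<rho>} s * indicator {y. N y \<le> s} y \<partial>lborel) \<partial>?P)"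
  proof (rule nn_integral_cong)
    fix y
    have "(\<integral>\<^sup>+s. indicator {0..\<rho>} s * indicator {y. N y \<le> s} y \<partial>lborel) = (\<integral>\<^sup>+s. indicator {N y..\<rho>} s \<partial>lborel)"
      using N0[of y] by (intro nn_integral_cong) (auto simp: indicator_def)
    also have "\<dots> = ennreal (\<rho> - N y) * indicator {y. N y \<le> \<rho>} y"
      by (cases "N y \<le> \<rho>") simp_all
    finally show "ennreal (\<rho> - N y) * indicator {y. N y \<le> \<rho>} y =
      (\<integral>\<^sup>+s. indicator {0..\<rho>} s * indicator {y. N y \<le> s} y \<partial>lborel)" by simp
  qed
  also have "\<dots> = (\<integral>\<^sup>+s. (\<integral>\<^sup>+y. indicator {0..\<rho>} s * indicator {y. N y \<le> s} y \<partial>?P) \<partial>lborel)"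
  proof (rule Fubini'[symmetric])
    have "(\<lambda>p. indicator {0..\<rho>} (snd p) * indicator {p. N (fst p) \<le> snd p} p :: ennreal)
       \<in> borel_measurable (?P \<Otimes>\<^sub>M lborel)"
      by measurable
    then show "(\<lambda>(y, s). indicator {0..\<rho>} s * indicator {y. N y \<le> s} y :: ennreal)
       \<in> borel_measurable (?P \<Otimes>\<^sub>M lborel)"
      by (simp add: case_prod_unfold indicator_def)
  qed
  also have "\<dots> = (\<integral>\<^sup>+s. ennreal (k * s ^ n) * indicator {0..\<rho>} s \<partial>lborel)"
  proof (rule nn_integral_cong_AE)
    have "AE s in lborel. s \<noteq> (0::real)" by (rule AE_lborel_singleton)
    then show "AE s in lborel. (\<integral>\<^sup>+y. indicator {0..\<rho>} s * indicator {y. N y \<le> s} y \<partial>?P)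
        = ennreal (k * s ^ n) * indicator {0..\<rho>} s"
    proof eventually_elim
      case (elim s)
      show ?case
      proof (cases "s \<in> {0..\<rho>}")
        case True
        then show ?thesis using vol[of s] elim by simp
      qed simp
    qed
  qed
  also have "\<dots> = ennreal (k / (real n + 1) * \<rho> ^ Suc n - k / (real n + 1) * 0 ^ Suc n)"
  proof (rule nn_integral_FTC_Icc)
    show "((\<lambda>s. k / (real n + 1) * s ^ Suc n) has_real_derivative k * s ^ n) (at s)" for s
      using DERIV_cmult[OF DERIV_pow[of "Suc n" s], of "k / (real n + 1)"]
      by (simp add: add.commute)
  qed (use \<rho> k in auto)
  finally have c: "(\<integral>\<^sup>+y. ennreal (\<rho> - N y) * indicator {y. N y \<le> \<rho>} y \<partial>?P)
     = ennreal (k * \<rho> ^ (n + 1) / (real n + 1))" by simp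
  have "(\<integral>\<^sup>+y. ennreal (N y) * indicator {y. N y \<le> \<rho>} y \<partial>?P) + ennreal (k * \<rho> ^ (n + 1) / (real n + 1))
     = (\<integral>\<^sup>+y. ennreal (N y) * indicator {y. N y \<le> \<rho>} y + ennreal (\<rho> - N y) * indicator {y. N y \<le> \<rho>} y \<partial>?P)"
    unfolding c[symmetric] by (rule nn_integral_add[symmetric]) measurable
  also have "\<dots> = (\<integral>\<^sup>+y. ennreal \<rho> * indicator {y. N y \<le> \<rho>} y \<partial>?P)"
    using N0 by (intro nn_integral_cong) (auto simp: indicator_def simp flip: ennreal_plus)
  also have "\<dots> = ennreal \<rho> * ennreal (k * \<rho> ^ n)"
    by (subst nn_integral_cmult) (auto simp: vol \<rho>)
  also have "\<dots> = ennreal (k * \<rho> ^ (n + 1))"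
    using \<rho> k by (simp add: ennreal_mult[symmetric] mult_ac)
  also have "\<dots> = ennreal (k * real n / (real n + 1) * \<rho> ^ (n + 1)) + ennreal (k * \<rho> ^ (n + 1) / (real n + 1))"
  proof -
    have "k * \<rho> ^ (n + 1) = k * real n / (real n + 1) * \<rho> ^ (n + 1) + k * \<rho> ^ (n + 1) / (real n + 1)"
      by (simp add: divide_simps) (simp add: algebra_simps)
    then show ?thesis using \<rho> k by (subst ennreal_plus[symmetric]) auto
  qed
  finally have "(\<integral>\<^sup>+y. ennreal (N y) * indicator {y. N y \<le> \<rho>} y \<partial>?P)
     = ennreal (k * real n / (real n + 1) * \<rho> ^ (n + 1))"
    by (subst (asm) (1 2) add.commute) (simp add: ennreal_add_left_cancel)
  then show ?thesis by (simp add: N_def k_def n_def)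
qed

text \<open>Substitution \<open>t = x / sqrt(1 + x\<^sup>2)\<close>, carried out on the compact intervals
\<open>{-k..k}\<close> and passed to the limit by monotone convergence.\<close>

lemma nn_integral_line_to_interval:
  fixes g :: "real \<Rightarrow> ennreal"
  assumes [measurable]: "g \<in> borel_measurable borel"
  shows "(\<integral>\<^sup>+t. g t * indicator {-1<..<1} t \<partial>lborel)
    = (\<integral>\<^sup>+x. g (x / sqrt (1 + x\<^sup>2)) * ennreal ((1 + x\<^sup>2) powr (- 3 / 2)) \<partial>lborel)"
proof -
  let ?h = "\<lambda>x::real. x / sqrt (1 + x\<^sup>2)"
  let ?h' = "\<lambda>x::real. (1 + x\<^sup>2) powr (- 3 / 2)"
  have pos: "0 < 1 + x\<^sup>2" for x :: real by (simp add: add_pos_nonneg)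
  have dh: "(?h has_real_derivative ?h' x) (at x)" for x
  proof -
    have s: "sqrt (1 + x\<^sup>2) \<noteq> 0" "sqrt (1 + x\<^sup>2) > 0" using pos[of x] by simp_all
    have e: "?h' x = 1 / (sqrt (1 + x\<^sup>2) * (1 + x\<^sup>2))"
    proof -
      have "(1 + x\<^sup>2) powr (3 / 2) = (1 + x\<^sup>2) powr (1 / 2 + 1)" by simp
      also have "\<dots> = sqrt (1 + x\<^sup>2) * (1 + x\<^sup>2)"
        using pos[of x] by (subst powr_add) (simp add: powr_half_sqrt)
      finally show ?thesis by (simp add: powr_minus divide_simps)
    qed
    have "(?h has_real_derivative (sqrt (1 + x\<^sup>2) - x * (x / sqrt (1 + x\<^sup>2))) / (1 + x\<^sup>2)) (at x)"
      using pos[of x] s by (auto intro!: derivative_eq_intros simp: power2_eq_square field_simps)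
    moreover have "(sqrt (1 + x\<^sup>2) - x * (x / sqrt (1 + x\<^sup>2))) / (1 + x\<^sup>2) = ?h' x"
    proof -
      have "sqrt (1 + x\<^sup>2) - x * (x / sqrt (1 + x\<^sup>2)) = 1 / sqrt (1 + x\<^sup>2)"
        using s pos[of x] by (simp add: field_simps) (simp add: power2_eq_square)
      then show ?thesis unfolding e by simp
    qed
    ultimately show ?thesis by simp
  qed
  have h1: "\<bar>?h x\<bar> < 1" for x
  proof -
    have "\<bar>x\<bar> = sqrt (x\<^sup>2)" by simp
    also have "\<dots> < sqrt (1 + x\<^sup>2)" by (rule real_sqrt_less_mono) simp
    finally show ?thesis using pos[of x] by (simp add: divide_simps)
  qed
  have mono: "?h x \<le> ?h y" if "x \<le> y" for x y
    using that by (intro DERIV_nonneg_imp_nondecreasing[OF that]) (use dh in \<open>auto intro!: exI\<close>)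
  have odd: "?h (- x) = - ?h x" for x by simp
  have lim: "(\<lambda>k. ?h (real k)) \<longlonglongrightarrow> 1" by real_asymp
  have cov: "\<exists>k::nat. t \<in> {?h (- real k)..?h (real k)}" if "\<bar>t\<bar> < 1" for t
  proof -
    have "\<forall>\<^sub>F k in sequentially. ?h (real k) > \<bar>t\<bar>"
      by (rule order_tendstoD(1)[OF lim that])
    then obtain k where "?h (real k) > \<bar>t\<bar>" by (auto simp: eventually_sequentially)
    then show ?thesis by (intro exI[of _ k]) (auto simp: abs_less_iff)
  qed
  have step: "(\<integral>\<^sup>+t. g t * indicator {?h (- real k)..?h (real k)} t \<partial>lborel) =
      (\<integral>\<^sup>+x. g (?h x) * ennreal (?h' x) * indicator {- real k..real k} x \<partial>lborel)" for k
  proof (cases "k = 0")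
    case False
    show ?thesis
      by (rule nn_integral_substitution_aux)
         (use False dh in \<open>auto intro!: continuous_intros simp: add_nonneg_eq_0_iff\<close>)
  next
    case True
    have "AE x in lborel. x \<noteq> (0::real)" by (rule AE_lborel_singleton)
    then have "(\<integral>\<^sup>+x. g (?h x) * ennreal (?h' x) * indicator {- real k..real k} x \<partial>lborel) = (\<integral>\<^sup>+(x::real). 0 \<partial>lborel)"
      "(\<integral>\<^sup>+t. g t * indicator {?h (- real k)..?h (real k)} t \<partial>lborel) = (\<integral>\<^sup>+(x::real). 0 \<partial>lborel)"
      by (auto intro!: nn_integral_cong_AE elim!: eventually_mono simp: True)
    then show ?thesis by simp
  qed
  have "(\<integral>\<^sup>+t. g t * indicator {-1<..<1} t \<partial>lborel)
     = (\<integral>\<^sup>+t. (SUP k. g t * indicator {?h (- real k)..?h (real k)} t) \<partial>lborel)"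
  proof (rule nn_integral_cong)
    fix t :: real
    show "g t * indicator {-1<..<1} t = (SUP k. g t * indicator {?h (- real k)..?h (real k)} t)"
    proof (cases "\<bar>t\<bar> < 1")
      case True
      then obtain k where k: "t \<in> {?h (- real k)..?h (real k)}" using cov by blast
      have "(SUP k. g t * indicator {?h (- real k)..?h (real k)} t) = g t"
      proof (rule antisym)
        show "(SUP k. g t * indicator {?h (- real k)..?h (real k)} t) \<le> g t"
          by (rule SUP_least) (auto simp: indicator_def)
        show "g t \<le> (SUP k. g t * indicator {?h (- real k)..?h (real k)} t)"
          by (rule SUP_upper2[of k]) (use k in \<open>auto simp: indicator_def abs_le_iff\<close>)
      qed
      then show ?thesis using True by (auto simp: indicator_def abs_less_iff)
    next
      case False
      have "indicator {?h (- real k)..?h (real k)} t = (0::ennreal)" for k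
        using False h1[of "real k"] h1[of "- real k"] by (auto simp: indicator_def abs_less_iff not_less)
      then have "(SUP k. g t * indicator {?h (- real k)..?h (real k)} t) = 0"
        by (simp only: mult_zero_right) simp
      moreover have "g t * indicator {-1<..<1} t = 0"
        using False by (auto simp: indicator_def abs_less_iff)
      ultimately show ?thesis by metis
    qed
  qed
  also have "\<dots> = (SUP k. \<integral>\<^sup>+t. g t * indicator {?h (- real k)..?h (real k)} t \<partial>lborel)"
  proof (rule nn_integral_monotone_convergence_SUP)
    show "incseq (\<lambda>k t. g t * indicator {?h (- real k)..?h (real k)} t)"
    proof (rule incseq_SucI, rule le_funI)
      fix k t
      have "?h (- real (Suc k)) \<le> ?h (- real k)" "?h (real k) \<le> ?h (real (Suc k))"
        by (rule mono; simp)+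
      then show "g t * indicator {?h (- real k)..?h (real k)} t \<le> g t * indicator {?h (- real (Suc k))..?h (real (Suc k))} t"
        by (auto intro!: mult_left_mono simp: indicator_def)
    qed
  qed measurable
  also have "\<dots> = (SUP k. \<integral>\<^sup>+x. g (?h x) * ennreal (?h' x) * indicator {- real k..real k} x \<partial>lborel)"
    by (simp only: step)
  also have "\<dots> = (\<integral>\<^sup>+x. (SUP k. g (?h x) * ennreal (?h' x) * indicator {- real k..real k} x) \<partial>lborel)"
    by (rule nn_integral_monotone_convergence_SUP[symmetric])
       (auto intro!: incseq_SucI le_funI mult_left_mono simp: indicator_def)
  also have "\<dots> = (\<integral>\<^sup>+x. g (?h x) * ennreal (?h' x) \<partial>lborel)"
  proof (rule nn_integral_cong)
    fix x :: real
    obtain k where k: "\<bar>x\<bar> \<le> real k" using real_arch_simple by blast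
    show "(SUP k. g (?h x) * ennreal (?h' x) * indicator {- real k..real k} x) = g (?h x) * ennreal (?h' x)"
    proof (rule antisym)
      show "(SUP k. g (?h x) * ennreal (?h' x) * indicator {- real k..real k} x) \<le> g (?h x) * ennreal (?h' x)"
        by (rule SUP_least) (auto simp: indicator_def)
      show "g (?h x) * ennreal (?h' x) \<le> (SUP k. g (?h x) * ennreal (?h' x) * indicator {- real k..real k} x)"
        by (rule SUP_upper2[of k]) (use k in \<open>auto simp: indicator_def abs_le_iff\<close>)
    qed
  qed
  finally show ?thesis .
qed

text \<open>The sphere integral is an integral over the unit ball of a function of the direction. Split
\<open>x = (s, y)\<close> along \<open>e\<close> and its complement and put \<open>s = |y| x\<close>: the cosine becomes \<open>x / sqrt(1 + x\<^sup>2)\<close>,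
independent of \<open>|y|\<close>, so the integral over \<open>y\<close> can be evaluated first. The remaining integral over \<open>x\<close> is
transformed to the cosine as variable.\<close>

lemma nn_integral_sphere_borel_Basis:
  fixes e :: "'a::euclidean_space" and g :: "real \<Rightarrow> ennreal"
  assumes e: "e \<in> Basis" and d: "2 \<le> DIM('a)" and g[measurable]: "g \<in> borel_measurable borel"
  shows "(\<integral>\<^sup>+\<sigma>. g (\<sigma> \<bullet> e) \<partial>(sphere_borel :: 'a measure)) = ennreal (sphere_area (DIM('a) - 1)) *
    (\<integral>\<^sup>+t. g t * ennreal ((1 - t\<^sup>2) powr ((real DIM('a) - 3) / 2)) * indicator {-1<..<1} t \<partial>lborel)"
proof -
  define I where "I = (Basis - {e} :: 'a set)"
  define d where "d = DIM('a)"
  let ?P = "Pi\<^sub>M I (\<lambda>_. lborel :: real measure)"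
  define N where "N y = sqrt (\<Sum>i\<in>I. (y i)\<^sup>2)" for y :: "'a \<Rightarrow> real"
  have fin: "finite I" and eI: "e \<notin> I" and B: "Basis = insert e I"
    using e by (auto simp: I_def)
  have cI: "card I = d - 1" using e by (simp add: I_def d_def)
  have d2: "2 \<le> d" using d by (simp add: d_def)
  have ne: "I \<noteq> {}"
  proof
    assume "I = {}"
    then show False using cI d2 by simp
  qed
  have [measurable]: "N \<in> borel_measurable ?P"
    unfolding N_def using fin by measurable
  have N0: "0 \<le> N y" for y by (simp add: N_def sum_nonneg)
  interpret P: product_sigma_finite "\<lambda>_::'a. lborel :: real measure" ..
  interpret Ps: sigma_finite_measure ?P by (rule P.sigma_finite) (rule fin)
  interpret pair_sigma_finite ?P "lborel :: real measure" ..
  \<comment> \<open>\<open>N y = 0\<close> only at the origin of a space of dimension at least 1.\<close>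
  have NAE: "AE y in ?P. N y \<noteq> 0"
  proof (rule AE_I)
    have "emeasure ?P (Pi\<^sub>E I (\<lambda>_. {0})) = (\<Prod>i\<in>I. emeasure lborel {0::real})"
      by (rule P.emeasure_PiM) (use fin in auto)
    also have "\<dots> = 0" using fin ne by (simp add: card_gt_0_iff)
    finally show "emeasure ?P (Pi\<^sub>E I (\<lambda>_. {0})) = 0" .
    show "Pi\<^sub>E I (\<lambda>_. {0}) \<in> sets ?P" by (rule sets_PiM_I_finite) (use fin in auto)
    show "{y \<in> space ?P. \<not> N y \<noteq> 0} \<subseteq> Pi\<^sub>E I (\<lambda>_. {0})"
      using fin by (auto simp: N_def space_PiM PiE_def sum_nonneg_eq_0_iff Pi_def extensional_def fun_eq_iff restrict_def)
  qed
  have pos: "0 < 1 + x\<^sup>2" for x :: real by (simp add: add_pos_nonneg)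
  let ?G = "\<lambda>s n. g (s / sqrt (s\<^sup>2 + n\<^sup>2)) * (indicator {..1} (sqrt (s\<^sup>2 + n\<^sup>2)) :: ennreal)"
  have "(\<integral>\<^sup>+x. g (sgn x \<bullet> e) * indicator (ball 0 1 - {0}) x \<partial>(lborel :: 'a measure))
     = (\<integral>\<^sup>+x. g ((x \<bullet> e) / norm x) * indicator {..1} (norm x) \<partial>(lborel :: 'a measure))"
  proof (rule nn_integral_cong_AE)
    have "AE x in lborel. x \<noteq> (0::'a)" by (rule AE_lborel_singleton)
    moreover have "AE x in lborel. x \<notin> sphere (0::'a) 1"
      using negligible_sphere[of "0::'a" 1]
      by (intro AE_not_in) (simp add: negligible_iff_null_sets null_sets_completion_iff)
    ultimately show "AE x in (lborel :: 'a measure). g (sgn x \<bullet> e) * indicator (ball 0 1 - {0}) x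
        = g ((x \<bullet> e) / norm x) * indicator {..1} (norm x)"
      by eventually_elim (auto simp: indicator_def sgn_div_norm divide_inverse mult.commute)
  qed
  also have "\<dots> = (\<integral>\<^sup>+f. ?G (f e) (N f) \<partial>Pi\<^sub>M Basis (\<lambda>_. lborel))"
  proof -
    have nf: "norm (\<Sum>b\<in>Basis. f b *\<^sub>R b :: 'a) = sqrt ((f e)\<^sup>2 + (N f)\<^sup>2)" for f :: "'a \<Rightarrow> real"
    proof -
      have "norm (\<Sum>b\<in>Basis. f b *\<^sub>R b :: 'a) = sqrt (\<Sum>b\<in>Basis. (f b)\<^sup>2)"
      proof -
        let ?X = "\<Sum>b\<in>Basis. f b *\<^sub>R b :: 'a"
        have "?X \<bullet> ?X = (\<Sum>b\<in>Basis. (?X \<bullet> b) * (?X \<bullet> b))" by (rule euclidean_inner)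
        also have "\<dots> = (\<Sum>b\<in>Basis. (f b)\<^sup>2)"
          by (intro sum.cong refl) (simp only: inner_sum_left_Basis power2_eq_square)
        finally show ?thesis by (simp only: norm_eq_sqrt_inner)
      qed
      also have "(\<Sum>b\<in>Basis. (f b)\<^sup>2) = (f e)\<^sup>2 + (N f)\<^sup>2"
        unfolding B using fin eI by (simp add: N_def sum_nonneg)
      finally show ?thesis .
    qed
    show ?thesis
      by (subst lborel_eq, subst nn_integral_distr)
         (auto simp: nf e inner_sum_left_Basis)
  qed
  also have "\<dots> = (\<integral>\<^sup>+y. (\<integral>\<^sup>+s. ?G s (N y) \<partial>lborel) \<partial>?P)"
  proof -
    have Nu: "N (y(e := s)) = N y" for y s
      unfolding N_def using eI by (auto intro!: sum.cong arg_cong[where f=sqrt])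
    have [measurable]: "N \<in> borel_measurable (Pi\<^sub>M (insert e I) (\<lambda>_. lborel))"
      unfolding N_def using fin by measurable
    show ?thesis
      unfolding B by (subst P.product_nn_integral_insert[OF fin eI]) (auto simp: Nu)
  qed
  also have "\<dots> = (\<integral>\<^sup>+y. (\<integral>\<^sup>+x. g (x / sqrt (1 + x\<^sup>2)) *
       (ennreal (N y) * indicator {y. N y \<le> 1 / sqrt (1 + x\<^sup>2)} y) \<partial>lborel) \<partial>?P)"
  proof (rule nn_integral_cong_AE, use NAE in eventually_elim)
    case (elim y)
    then have n: "0 < N y" using N0[of y] by simp
    have sq: "sqrt ((N y * x)\<^sup>2 + (N y)\<^sup>2) = N y * sqrt (1 + x\<^sup>2)" for x
    proof -
      have "(N y * x)\<^sup>2 + (N y)\<^sup>2 = (N y)\<^sup>2 * (1 + x\<^sup>2)" by (simp add: algebra_simps power_mult_distrib)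
      then show ?thesis using n by (simp add: real_sqrt_mult)
    qed
    have "(\<integral>\<^sup>+s. ?G s (N y) \<partial>lborel) = ennreal \<bar>N y\<bar> * (\<integral>\<^sup>+x. ?G (0 + N y * x) (N y) \<partial>lborel)"
      using n by (intro nn_integral_real_affine) auto
    also have "\<dots> = (\<integral>\<^sup>+x. ennreal (N y) * ?G (0 + N y * x) (N y) \<partial>lborel)"
      using n by (subst nn_integral_cmult) auto
    also have "\<dots> = (\<integral>\<^sup>+x. g (x / sqrt (1 + x\<^sup>2)) * (ennreal (N y) * indicator {y. N y \<le> 1 / sqrt (1 + x\<^sup>2)} y) \<partial>lborel)"
    proof (rule nn_integral_cong)
      fix x :: real
      have "N y * sqrt (1 + x\<^sup>2) \<le> 1 \<longleftrightarrow> N y \<le> 1 / sqrt (1 + x\<^sup>2)"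
        using pos[of x] by (simp add: field_simps)
      then show "ennreal (N y) * ?G (0 + N y * x) (N y) =
          g (x / sqrt (1 + x\<^sup>2)) * (ennreal (N y) * indicator {y. N y \<le> 1 / sqrt (1 + x\<^sup>2)} y)"
        using n by (auto simp: sq indicator_def) (rule mult.commute)
    qed
    finally show ?case .
  qed
  also have "\<dots> = (\<integral>\<^sup>+x. (\<integral>\<^sup>+y. g (x / sqrt (1 + x\<^sup>2)) *
       (ennreal (N y) * indicator {y. N y \<le> 1 / sqrt (1 + x\<^sup>2)} y) \<partial>?P) \<partial>lborel)"
  proof (rule Fubini'[symmetric])
    have "(\<lambda>p. g (snd p / sqrt (1 + (snd p)\<^sup>2)) * (ennreal (N (fst p)) * indicator {p. N (fst p) \<le> 1 / sqrt (1 + (snd p)\<^sup>2)} p))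
       \<in> borel_measurable (?P \<Otimes>\<^sub>M lborel)"
      by measurable
    then show "(\<lambda>(y, x). g (x / sqrt (1 + x\<^sup>2)) * (ennreal (N y) * indicator {y. N y \<le> 1 / sqrt (1 + x\<^sup>2)} y))
       \<in> borel_measurable (?P \<Otimes>\<^sub>M lborel)"
      by (simp add: case_prod_unfold indicator_def)
  qed
  also have "\<dots> = (\<integral>\<^sup>+x. ennreal (unit_ball_vol (real (d - 1)) * real (d - 1) / real d) *
      (g (x / sqrt (1 + x\<^sup>2)) * ennreal ((1 + x\<^sup>2) powr (- (real d / 2)))) \<partial>lborel)"
  proof (rule nn_integral_cong)
    fix x :: real
    have p: "(1 / sqrt (1 + x\<^sup>2)) ^ d = (1 + x\<^sup>2) powr (- (real d / 2))"
    proof -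
      have "(1 / sqrt (1 + x\<^sup>2)) ^ d = ((1 + x\<^sup>2) powr (- (1/2))) powr (real d)"
        using pos[of x] by (subst powr_realpow) (simp_all add: powr_minus_divide powr_half_sqrt)
      then show ?thesis by (simp add: powr_powr)
    qed
    have "(\<integral>\<^sup>+y. g (x / sqrt (1 + x\<^sup>2)) * (ennreal (N y) * indicator {y. N y \<le> 1 / sqrt (1 + x\<^sup>2)} y) \<partial>?P)
      = g (x / sqrt (1 + x\<^sup>2)) * (\<integral>\<^sup>+y. ennreal (N y) * indicator {y. N y \<le> 1 / sqrt (1 + x\<^sup>2)} y \<partial>?P)"
      by (rule nn_integral_cmult) measurable
    also have "(\<integral>\<^sup>+y. ennreal (N y) * indicator {y. N y \<le> 1 / sqrt (1 + x\<^sup>2)} y \<partial>?P)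
      = ennreal (unit_ball_vol (real (card I)) * real (card I) / (real (card I) + 1) * (1 / sqrt (1 + x\<^sup>2)) ^ (card I + 1))"
      unfolding N_def by (rule nn_integral_norm_ball_PiM) (use fin ne pos[of x] in auto)
    also have "\<dots> = ennreal (unit_ball_vol (real (d - 1)) * real (d - 1) / real d) * ennreal ((1 + x\<^sup>2) powr (- (real d / 2)))"
    proof -
      have c: "card I + 1 = d" "real (card I) + 1 = real d" using cI d2 by auto
      show ?thesis unfolding c p unfolding cI
        by (rule ennreal_mult) auto
    qed
    finally show "(\<integral>\<^sup>+y. g (x / sqrt (1 + x\<^sup>2)) * (ennreal (N y) * indicator {y. N y \<le> 1 / sqrt (1 + x\<^sup>2)} y) \<partial>?P) =
       ennreal (unit_ball_vol (real (d - 1)) * real (d - 1) / real d) *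
      (g (x / sqrt (1 + x\<^sup>2)) * ennreal ((1 + x\<^sup>2) powr (- (real d / 2))))"
      by (simp add: mult_ac)
  qed
  also have "\<dots> = ennreal (unit_ball_vol (real (d - 1)) * real (d - 1) / real d) *
      (\<integral>\<^sup>+x. (g (x / sqrt (1 + x\<^sup>2)) * ennreal ((1 + x\<^sup>2) powr (- (real d / 2)))) \<partial>lborel)"
    by (rule nn_integral_cmult) measurable
  also have "(\<integral>\<^sup>+x. (g (x / sqrt (1 + x\<^sup>2)) * ennreal ((1 + x\<^sup>2) powr (- (real d / 2)))) \<partial>lborel)
     = (\<integral>\<^sup>+t. g t * ennreal ((1 - t\<^sup>2) powr ((real d - 3) / 2)) * indicator {-1<..<1} t \<partial>lborel)"
  proof -
    have "(1 + x\<^sup>2) powr (- (real d / 2)) =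
        (1 - (x / sqrt (1 + x\<^sup>2))\<^sup>2) powr ((real d - 3) / 2) * (1 + x\<^sup>2) powr (- 3 / 2)" for x :: real
    proof -
      have "1 - (x / sqrt (1 + x\<^sup>2))\<^sup>2 = (1 + x\<^sup>2) powr (-1)"
        using pos[of x] by (simp add: power_divide powr_minus_divide field_simps)
      then have "(1 - (x / sqrt (1 + x\<^sup>2))\<^sup>2) powr ((real d - 3) / 2) = (1 + x\<^sup>2) powr (- ((real d - 3) / 2))"
        by (simp only: powr_powr mult_minus_left mult_1_left)
      moreover have "- ((real d - 3) / 2) + (- 3 / 2) = - (real d / 2)" by (simp add: field_simps)
      ultimately show ?thesis by (metis powr_add)
    qed
    then show ?thesis
      by (subst nn_integral_line_to_interval) (auto simp: ennreal_mult mult.assoc)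
  qed
  finally have "(\<integral>\<^sup>+x. g (sgn x \<bullet> e) * indicator (ball 0 1 - {0}) x \<partial>(lborel :: 'a measure)) =
     ennreal (unit_ball_vol (real (d - 1)) * real (d - 1) / real d) *
     (\<integral>\<^sup>+t. g t * ennreal ((1 - t\<^sup>2) powr ((real d - 3) / 2)) * indicator {-1<..<1} t \<partial>lborel)" .
  moreover have "of_nat d * ennreal (unit_ball_vol (real (d - 1)) * real (d - 1) / real d) = ennreal (sphere_area (d - 1))"
    using d2 by (simp add: sphere_area_def ennreal_of_nat_eq_real_of_nat ennreal_mult[symmetric] mult.commute)
  ultimately show ?thesis
    by (subst nn_integral_sphere_borel) (auto simp: d_def mult.assoc[symmetric])
qed

text \<open>Rotation invariance from translation invariance alone: average over the unit ball, which the
orthogonal map preserves, and apply Fubini's theorem twice.\<close>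

lemma nn_integral_lborel_orthogonal:
  fixes f :: "'a::euclidean_space \<Rightarrow> 'a"
  assumes f: "orthogonal_transformation f" and h[measurable]: "h \<in> borel_measurable borel"
  shows "(\<integral>\<^sup>+x. h (f x) \<partial>lborel) = (\<integral>\<^sup>+x. h x \<partial>lborel)"
proof -
  have lin: "linear f" using f by (rule orthogonal_transformation_linear)
  have m[measurable]: "f \<in> borel_measurable borel"
    using lin by (intro borel_measurable_continuous_onI linear_continuous_on linear_conv_bounded_linear[THEN iffD1])
  obtain f' where ff': "\<And>x. f (f' x) = x"
    using orthogonal_transformation_surj[OF f] by (metis surj_f_inv_f)
  have nf: "norm (f x) = norm x" for x using f by (rule orthogonal_transformation_norm)
  \<comment> \<open>Volume of the unit ball, the normalisation of the average.\<close>
  define K where "K = emeasure lborel (ball (0::'a) 1)"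
  have K: "K \<noteq> 0" "K \<noteq> top"
    using unit_ball_vol_pos[of "real DIM('a)"] by (auto simp: K_def emeasure_ball simp del: unit_ball_vol_pos)
  let ?B = "\<lambda>x::'a. indicator {x. norm x < 1} x :: ennreal"
  have intB: "(\<integral>\<^sup>+z. ?B (y - z) \<partial>lborel) = K" for y
  proof -
    have "(\<integral>\<^sup>+z. ?B (y - z) \<partial>lborel) = (\<integral>\<^sup>+z. indicator (ball y 1) z \<partial>lborel)"
      by (intro nn_integral_cong) (auto simp: indicator_def dist_norm)
    also have "\<dots> = emeasure lborel (ball y 1)" by simp
    also have "\<dots> = K" by (simp add: K_def emeasure_ball)
    finally show ?thesis .
  qed
  have "K * (\<integral>\<^sup>+z. h (f z) \<partial>lborel) = (\<integral>\<^sup>+x. ?B x * (\<integral>\<^sup>+z. h (f z) \<partial>lborel) \<partial>lborel)"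
    using nn_integral_lborel_scaleR[of ?B "-1" 0] intB[of 0]
    by (subst nn_integral_multc) auto
  also have "\<dots> = (\<integral>\<^sup>+x. \<integral>\<^sup>+z. ?B x * h (x + f z) \<partial>lborel \<partial>lborel)"
  proof (rule nn_integral_cong)
    fix x
    have "(\<integral>\<^sup>+z. h (f z) \<partial>lborel) = (\<integral>\<^sup>+z. h (f (f' x + 1 *\<^sub>R z)) \<partial>lborel)"
      by (subst nn_integral_lborel_scaleR[of _ 1 "f' x"]) auto
    also have "\<dots> = (\<integral>\<^sup>+z. h (x + f z) \<partial>lborel)"
      using linear_add[OF lin] by (simp add: ff')
    finally show "?B x * (\<integral>\<^sup>+z. h (f z) \<partial>lborel) = (\<integral>\<^sup>+z. ?B x * h (x + f z) \<partial>lborel)"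
      by (subst nn_integral_cmult) auto
  qed
  also have "\<dots> = (\<integral>\<^sup>+z. \<integral>\<^sup>+x. ?B x * h (x + f z) \<partial>lborel \<partial>lborel)"
    by (rule lborel_pair.Fubini') measurable
  also have "\<dots> = (\<integral>\<^sup>+z. \<integral>\<^sup>+x. ?B (x - f z) * h x \<partial>lborel \<partial>lborel)"
  proof (rule nn_integral_cong)
    fix z
    show "(\<integral>\<^sup>+x. ?B x * h (x + f z) \<partial>lborel) = (\<integral>\<^sup>+x. ?B (x - f z) * h x \<partial>lborel)"
      by (subst nn_integral_lborel_scaleR[of "\<lambda>x. ?B (x - f z) * h x" 1 "f z"]) (auto simp: add.commute)
  qed
  also have "\<dots> = (\<integral>\<^sup>+x. \<integral>\<^sup>+z. ?B (x - f z) * h x \<partial>lborel \<partial>lborel)"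
    by (rule lborel_pair.Fubini'[symmetric]) measurable
  also have "\<dots> = (\<integral>\<^sup>+x. K * h x \<partial>lborel)"
  proof (rule nn_integral_cong)
    fix x
    have "?B (x - f z) = ?B (f' x - z)" for z
      using nf[of "f' x - z"] linear_diff[OF lin, of "f' x" z] by (simp add: ff' indicator_def)
    then show "(\<integral>\<^sup>+z. ?B (x - f z) * h x \<partial>lborel) = K * h x"
      using intB[of "f' x"] by (subst nn_integral_multc) auto
  qed
  also have "\<dots> = K * (\<integral>\<^sup>+x. h x \<partial>lborel)"
    by (rule nn_integral_cmult) simp
  finally show ?thesis using K by (simp add: ennreal_mult_cancel_left)
qed

text \<open>A rotation takes the polar axis to a coordinate axis.\<close>

lemma nn_integral_sphere_borel_slices:
  fixes \<omega> :: "real ^ 'n" and g :: "real \<Rightarrow> ennreal"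
  assumes \<omega>: "norm \<omega> = 1" and d: "2 \<le> CARD('n)" and g[measurable]: "g \<in> borel_measurable borel"
  shows "(\<integral>\<^sup>+\<sigma>. g (\<omega> \<bullet> \<sigma>) \<partial>sphere_borel) = ennreal (sphere_area (CARD('n) - 1)) *
    (\<integral>\<^sup>+t. g t * ennreal ((1 - t\<^sup>2) powr ((real CARD('n) - 3) / 2)) * indicator {-1<..<1} t \<partial>lborel)"
proof -
  obtain e :: "real ^ 'n" where e: "e \<in> Basis" using nonempty_Basis by blast
  obtain f where f: "orthogonal_transformation f" "f e = \<omega>"
    using orthogonal_transformation_exists_1[of e \<omega>] e \<omega> by (auto simp: norm_Basis)
  have ff: "f x \<bullet> f y = x \<bullet> y" "norm (f x) = norm x" for x y
    using f by (auto simp: orthogonal_transformation_def orthogonal_transformation_norm)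
  have lin: "linear f" using f(1) by (rule orthogonal_transformation_linear)
  have "(\<integral>\<^sup>+x. g (\<omega> \<bullet> sgn x) * indicator (ball 0 1 - {0}) x \<partial>lborel)
      = (\<integral>\<^sup>+x. g (\<omega> \<bullet> sgn (f x)) * indicator (ball 0 1 - {0}) (f x) \<partial>lborel)"
  proof (rule nn_integral_lborel_orthogonal[OF f(1), symmetric])
    have "ball (0 :: real ^ 'n) 1 - {0} \<in> sets borel" by simp
    then show "(\<lambda>x. g (\<omega> \<bullet> sgn x) * indicator (ball 0 1 - {0}) x) \<in> borel_measurable borel"
      by (intro borel_measurable_times_ennreal borel_measurable_indicator) measurable
  qed
  also have "\<dots> = (\<integral>\<^sup>+x. g (sgn x \<bullet> e) * indicator (ball 0 1 - {0}) x \<partial>lborel)"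
  proof (rule nn_integral_cong)
    fix x
    have "f x = 0 \<longleftrightarrow> x = 0" using ff(2)[of x] by (metis norm_eq_zero)
    moreover have "\<omega> \<bullet> sgn (f x) = sgn x \<bullet> e"
      using ff(1)[of e x] unfolding f(2) by (simp add: sgn_div_norm ff(2) inner_commute)
    ultimately show "g (\<omega> \<bullet> sgn (f x)) * indicator (ball 0 1 - {0}) (f x)
        = g (sgn x \<bullet> e) * indicator (ball 0 1 - {0}) x"
      by (simp add: indicator_def ff(2))
  qed
  finally have "(\<integral>\<^sup>+\<sigma>. g (\<omega> \<bullet> \<sigma>) \<partial>sphere_borel) = (\<integral>\<^sup>+\<sigma>. g (\<sigma> \<bullet> e) \<partial>sphere_borel)"
    by (simp add: nn_integral_sphere_borel)
  then show ?thesis using nn_integral_sphere_borel_Basis[OF e _ g] d by simp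
qed

section \<open>Weak forms of the gain and loss operators\<close>

lemma half_plus_half: "(1 / 2) *\<^sub>R u + (1 / 2) *\<^sub>R u = (u :: 'a::real_vector)"
  by (simp flip: scaleR_left_distrib)

lemma nn_integral_centre_of_mass:
  fixes G :: "'a::euclidean_space \<times> 'a \<Rightarrow> ennreal"
  assumes [measurable]: "G \<in> borel_measurable (borel \<Otimes>\<^sub>M borel)"
  shows "(\<integral>\<^sup>+v. \<integral>\<^sup>+w. G (v, w) \<partial>lborel \<partial>lborel)
    = (\<integral>\<^sup>+z. \<integral>\<^sup>+u. G (z + (1 / 2) *\<^sub>R u, z - (1 / 2) *\<^sub>R u) \<partial>lborel \<partial>lborel)"
proof -
  have "(\<integral>\<^sup>+v. \<integral>\<^sup>+w. G (v, w) \<partial>lborel \<partial>lborel) = (\<integral>\<^sup>+v. \<integral>\<^sup>+u. G (v, v - u) \<partial>lborel \<partial>lborel)"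
  proof (rule nn_integral_cong)
    fix v
    show "(\<integral>\<^sup>+w. G (v, w) \<partial>lborel) = (\<integral>\<^sup>+u. G (v, v - u) \<partial>lborel)"
      using nn_integral_lborel_scaleR[of "\<lambda>w. G (v, w)" "-1" v] by simp
  qed
  also have "\<dots> = (\<integral>\<^sup>+u. \<integral>\<^sup>+v. G (v, v - u) \<partial>lborel \<partial>lborel)"
    by (rule lborel_pair.Fubini'[symmetric]) measurable
  also have "\<dots> = (\<integral>\<^sup>+u. \<integral>\<^sup>+z. G (z + (1 / 2) *\<^sub>R u, z - (1 / 2) *\<^sub>R u) \<partial>lborel \<partial>lborel)"
  proof (rule nn_integral_cong)
    fix u :: 'a
    define h where "h = (1 / 2) *\<^sub>R u"
    have hh: "h + h = u" by (simp add: h_def half_plus_half)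
    have "(\<integral>\<^sup>+v. G (v, v - u) \<partial>lborel) = (\<integral>\<^sup>+z. G (h + 1 *\<^sub>R z, h + 1 *\<^sub>R z - u) \<partial>lborel)"
      by (subst nn_integral_lborel_scaleR[of _ 1 h]) auto
    also have "\<dots> = (\<integral>\<^sup>+z. G (z + h, z - h) \<partial>lborel)"
      by (intro nn_integral_cong arg_cong[where f=G]) (simp flip: hh)
    finally show "(\<integral>\<^sup>+v. G (v, v - u) \<partial>lborel) = (\<integral>\<^sup>+z. G (z + (1 / 2) *\<^sub>R u, z - (1 / 2) *\<^sub>R u) \<partial>lborel)"
      by (simp add: h_def)
  qed
  also have "\<dots> = (\<integral>\<^sup>+z. \<integral>\<^sup>+u. G (z + (1 / 2) *\<^sub>R u, z - (1 / 2) *\<^sub>R u) \<partial>lborel \<partial>lborel)"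
    by (rule lborel_pair.Fubini') measurable
  finally show ?thesis .
qed

lemma measurable_post_coll [measurable]:
  assumes [measurable]: "f \<in> borel_measurable M" "g \<in> borel_measurable M" "h \<in> borel_measurable M"
  shows "(\<lambda>x. post_coll (f x) (g x) (h x) :: 'a::euclidean_space) \<in> borel_measurable M"
    and "(\<lambda>x. post_coll_star (f x) (g x) (h x) :: 'a::euclidean_space) \<in> borel_measurable M"
  unfolding post_coll_def post_coll_star_def by measurable

lemma post_coll_centre_of_mass:
  "post_coll (z + (1 / 2) *\<^sub>R u) (z - (1 / 2) *\<^sub>R u) \<sigma> = z + (norm u / 2) *\<^sub>R \<sigma>"
  "post_coll_star (z + (1 / 2) *\<^sub>R u) (z - (1 / 2) *\<^sub>R u) \<sigma> = z - (norm u / 2) *\<^sub>R \<sigma>"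
proof -
  have "z + (1 / 2) *\<^sub>R u - (z - (1 / 2) *\<^sub>R u) = u" "z + (1 / 2) *\<^sub>R u + (z - (1 / 2) *\<^sub>R u) = z + z"
    by (simp_all add: half_plus_half)
  then show "post_coll (z + (1 / 2) *\<^sub>R u) (z - (1 / 2) *\<^sub>R u) \<sigma> = z + (norm u / 2) *\<^sub>R \<sigma>"
    "post_coll_star (z + (1 / 2) *\<^sub>R u) (z - (1 / 2) *\<^sub>R u) \<sigma> = z - (norm u / 2) *\<^sub>R \<sigma>"
    by (simp_all only: post_coll_def post_coll_star_def) (simp_all add: scaleR_half_double)
qed

lemma post_coll_swap:
  "post_coll w v (- \<sigma>) = post_coll_star v w \<sigma>" "post_coll_star w v (- \<sigma>) = post_coll v w \<sigma>"
  by (simp_all add: post_coll_def post_coll_star_def add.commute norm_minus_commute)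

lemma norm_post_coll_diff:
  "norm \<sigma> = 1 \<Longrightarrow> norm (post_coll v w \<sigma> - post_coll_star v w \<sigma>) = norm (v - w)"
  by (simp add: post_coll_def post_coll_star_def scaleR_add_left[symmetric])

lemma norm_post_coll_energy:
  fixes v w \<sigma> :: "'a::euclidean_space"
  assumes "norm \<sigma> = 1"
  shows "(norm (post_coll v w \<sigma>))\<^sup>2 + (norm (post_coll_star v w \<sigma>))\<^sup>2 = (norm v)\<^sup>2 + (norm w)\<^sup>2"
proof -
  have par: "(norm (x + y))\<^sup>2 + (norm (x - y))\<^sup>2 = 2 * (norm x)\<^sup>2 + 2 * (norm y)\<^sup>2" for x y :: 'a
    by (simp add: power2_norm_eq_inner inner_add_left inner_add_right inner_diff_left inner_diff_right)
  have "norm ((v + w) /\<^sub>R 2) = norm (v + w) / 2" by simp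
  moreover have "norm ((norm (v - w) / 2) *\<^sub>R \<sigma>) = norm (v - w) / 2" using assms by simp
  ultimately have "(norm (post_coll v w \<sigma>))\<^sup>2 + (norm (post_coll_star v w \<sigma>))\<^sup>2
      = 2 * (norm (v + w) / 2)\<^sup>2 + 2 * (norm (v - w) / 2)\<^sup>2"
    unfolding post_coll_def post_coll_star_def by (metis par)
  also have "\<dots> = ((norm (v + w))\<^sup>2 + (norm (v - w))\<^sup>2) / 2"
    by (simp add: power_divide)
  also have "\<dots> = (norm v)\<^sup>2 + (norm w)\<^sup>2"
    by (simp add: par)
  finally show ?thesis .
qed

text \<open>\<open>B \<omega> \<sigma>\<close> is the density of scattering from direction \<open>\<omega>\<close> into direction \<open>\<sigma>\<close>. Its symmetry makes
collisions reversible; invariance under reversal of both directions makes the collision partners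
interchangeable.\<close>

locale scattering =
  fixes B :: "'a::euclidean_space \<Rightarrow> 'a \<Rightarrow> real"
  assumes B_measurable_pair: "case_prod B \<in> borel_measurable (borel \<Otimes>\<^sub>M borel)"
    and B_nonneg: "0 \<le> B x y"
    and B_sym: "B x y = B y x"
    and B_minus: "B (- x) (- y) = B x y"
    and B_mass: "norm \<omega> = 1 \<Longrightarrow> (\<integral>\<^sup>+\<sigma>. ennreal (B \<omega> \<sigma>) \<partial>sphere_borel) = 1"
begin

lemma B_measurable [measurable]:
  assumes [measurable]: "f \<in> borel_measurable M" "g \<in> borel_measurable M"
  shows "(\<lambda>x. B (f x) (g x)) \<in> borel_measurable M"
  using measurable_compose[OF _ B_measurable_pair, of "\<lambda>x. (f x, g x)" M] by simp

definition nn_gain :: "('a \<times> 'a \<Rightarrow> ennreal) \<Rightarrow> 'a \<Rightarrow> ennreal" where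
  "nn_gain F v = (\<integral>\<^sup>+p. ennreal (B (sgn (v - fst p)) (snd p)) *
     F (post_coll v (fst p) (snd p), post_coll_star v (fst p) (snd p)) \<partial>(lborel \<Otimes>\<^sub>M sphere_borel))"

text \<open>The gain and loss operators act on functions of a pair of velocities, so that the same operators serve
for \<open>k(|v - v\<^sub>*|) f(v) f(v\<^sub>*)\<close> with different rates \<open>k\<close> and for differences of such products.\<close>

definition gain :: "('a \<times> 'a \<Rightarrow> real) \<Rightarrow> 'a \<Rightarrow> real" where
  "gain F v = (LINT p|(lborel \<Otimes>\<^sub>M sphere_borel). B (sgn (v - fst p)) (snd p) *
     F (post_coll v (fst p) (snd p), post_coll_star v (fst p) (snd p)))"

definition loss :: "('a \<times> 'a \<Rightarrow> real) \<Rightarrow> 'a \<Rightarrow> real" where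
  "loss F v = (LINT w|lborel. F (v, w))"

sublocale pair: pair_sigma_finite "lborel :: 'a measure" "sphere_borel :: 'a measure" ..

lemma measurable_nn_gain [measurable]:
  assumes [measurable]: "F \<in> borel_measurable (borel \<Otimes>\<^sub>M borel)"
  shows "nn_gain F \<in> borel_measurable borel"
  unfolding nn_gain_def[abs_def] by measurable

lemma measurable_gain [measurable]:
  assumes [measurable]: "F \<in> borel_measurable (borel \<Otimes>\<^sub>M borel)"
  shows "gain F \<in> borel_measurable borel"
  unfolding gain_def[abs_def] by measurable

lemma measurable_loss [measurable]:
  assumes [measurable]: "F \<in> borel_measurable (borel \<Otimes>\<^sub>M borel)"
  shows "loss F \<in> borel_measurable borel"
  unfolding loss_def[abs_def] by measurable

text \<open>In the variables centre of mass and relative velocity, the exchange of the two directions turns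
\<open>F(v', v'\<^sub>*) \<rho>(v)\<close> into \<open>F(v, v\<^sub>*) \<rho>(v')\<close>.\<close>

lemma nn_gain_duality:
  assumes [measurable]: "F \<in> borel_measurable (borel \<Otimes>\<^sub>M borel)" "\<rho> \<in> borel_measurable borel"
  shows "(\<integral>\<^sup>+v. nn_gain F v * \<rho> v \<partial>lborel) =
    (\<integral>\<^sup>+v. \<integral>\<^sup>+w. \<integral>\<^sup>+\<sigma>. ennreal (B (sgn (v - w)) \<sigma>) * (F (v, w) * \<rho> (post_coll v w \<sigma>))
      \<partial>sphere_borel \<partial>lborel \<partial>lborel)"
proof -
  \<comment> \<open>The integrand in terms of the centre of mass, the relative speed and the two directions.\<close>
  define H where "H z p = (case p of (r, \<omega>, \<sigma>) \<Rightarrow>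
      ennreal (B \<omega> \<sigma>) * F (z + (r / 2) *\<^sub>R \<sigma>, z - (r / 2) *\<^sub>R \<sigma>) * \<rho> (z + (r / 2) *\<^sub>R \<omega>))" for z p
  have [measurable]: "H z \<in> borel_measurable (borel \<Otimes>\<^sub>M borel \<Otimes>\<^sub>M borel)" for z
    unfolding H_def[abs_def] by measurable
  have un: "norm u *\<^sub>R sgn u = u" for u :: 'a
    by (cases "u = 0") (simp_all add: sgn_div_norm)
  have half: "(norm u / 2) *\<^sub>R sgn u = (1 / 2) *\<^sub>R u" for u :: 'a
  proof -
    have "(norm u / 2) *\<^sub>R sgn u = (1 / 2) *\<^sub>R (norm u *\<^sub>R sgn u)" by simp
    then show ?thesis by (simp only: un)
  qed
  have "(\<integral>\<^sup>+v. nn_gain F v * \<rho> v \<partial>lborel) =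
    (\<integral>\<^sup>+v. \<integral>\<^sup>+w. \<integral>\<^sup>+\<sigma>. ennreal (B (sgn (v - w)) \<sigma>) *
      F (post_coll v w \<sigma>, post_coll_star v w \<sigma>) * \<rho> v \<partial>sphere_borel \<partial>lborel \<partial>lborel)"
  proof (rule nn_integral_cong)
    fix v
    have "nn_gain F v * \<rho> v = (\<integral>\<^sup>+p. ennreal (B (sgn (v - fst p)) (snd p)) *
     F (post_coll v (fst p) (snd p), post_coll_star v (fst p) (snd p)) * \<rho> v \<partial>(lborel \<Otimes>\<^sub>M sphere_borel))"
      unfolding nn_gain_def by (rule nn_integral_multc[symmetric]) measurable
    also have "\<dots> = (\<integral>\<^sup>+w. \<integral>\<^sup>+\<sigma>. ennreal (B (sgn (v - w)) \<sigma>) *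
      F (post_coll v w \<sigma>, post_coll_star v w \<sigma>) * \<rho> v \<partial>sphere_borel \<partial>lborel)"
      by (subst sphere_borel.nn_integral_fst[symmetric]) auto
    finally show "nn_gain F v * \<rho> v = (\<integral>\<^sup>+w. \<integral>\<^sup>+\<sigma>. ennreal (B (sgn (v - w)) \<sigma>) *
      F (post_coll v w \<sigma>, post_coll_star v w \<sigma>) * \<rho> v \<partial>sphere_borel \<partial>lborel)" .
  qed
  also have "\<dots> = (\<integral>\<^sup>+z. \<integral>\<^sup>+u. \<integral>\<^sup>+\<sigma>. H z (norm u, sgn u, \<sigma>) \<partial>sphere_borel \<partial>lborel \<partial>lborel)"
    using nn_integral_centre_of_mass[of "\<lambda>(v, w). \<integral>\<^sup>+\<sigma>. ennreal (B (sgn (v - w)) \<sigma>) *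
      F (post_coll v w \<sigma>, post_coll_star v w \<sigma>) * \<rho> v \<partial>sphere_borel"]
    by (simp add: post_coll_centre_of_mass half_plus_half H_def half)
  also have "\<dots> = (\<integral>\<^sup>+z. \<integral>\<^sup>+u. \<integral>\<^sup>+\<sigma>. H z (norm u, \<sigma>, sgn u) \<partial>sphere_borel \<partial>lborel \<partial>lborel)"
    by (intro nn_integral_cong nn_integral_direction_swap) measurable
  also have "\<dots> = (\<integral>\<^sup>+v. \<integral>\<^sup>+w. \<integral>\<^sup>+\<sigma>. ennreal (B (sgn (v - w)) \<sigma>) * (F (v, w) * \<rho> (post_coll v w \<sigma>))
      \<partial>sphere_borel \<partial>lborel \<partial>lborel)"
    using nn_integral_centre_of_mass[of "\<lambda>(v, w). \<integral>\<^sup>+\<sigma>. ennreal (B (sgn (v - w)) \<sigma>) *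
      (F (v, w) * \<rho> (post_coll v w \<sigma>)) \<partial>sphere_borel"]
    by (simp add: post_coll_centre_of_mass half_plus_half H_def half mult.assoc B_sym[of "sgn u" for u])
  finally show ?thesis .
qed

lemma AE_B_mass: "AE w in lborel. (\<integral>\<^sup>+\<sigma>. ennreal (B (sgn (v - w)) \<sigma>) \<partial>sphere_borel) = 1"
proof -
  have "AE w in lborel. w \<noteq> v" by (rule AE_lborel_singleton)
  then show ?thesis by eventually_elim (rule B_mass, simp add: norm_sgn)
qed

lemma nn_integral_B_le:
  assumes [measurable]: "F \<in> borel_measurable (borel \<Otimes>\<^sub>M borel)" "H \<in> borel_measurable (borel \<Otimes>\<^sub>M borel \<Otimes>\<^sub>M borel)"
    and le: "\<And>v w \<sigma>. norm \<sigma> = 1 \<Longrightarrow> H (v, w, \<sigma>) \<le> F (v, w)"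
  shows "(\<integral>\<^sup>+v. \<integral>\<^sup>+w. \<integral>\<^sup>+\<sigma>. ennreal (B (sgn (v - w)) \<sigma>) * H (v, w, \<sigma>) \<partial>sphere_borel \<partial>lborel \<partial>lborel)
    \<le> (\<integral>\<^sup>+v. \<integral>\<^sup>+w. F (v, w) \<partial>lborel \<partial>lborel)"
proof (rule nn_integral_mono, rule nn_integral_mono_AE)
  fix v
  show "AE w in lborel. (\<integral>\<^sup>+\<sigma>. ennreal (B (sgn (v - w)) \<sigma>) * H (v, w, \<sigma>) \<partial>sphere_borel) \<le> F (v, w)"
    using AE_B_mass[of v]
  proof eventually_elim
    case (elim w)
    have "(\<integral>\<^sup>+\<sigma>. ennreal (B (sgn (v - w)) \<sigma>) * H (v, w, \<sigma>) \<partial>sphere_borel) \<le>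
        (\<integral>\<^sup>+\<sigma>. ennreal (B (sgn (v - w)) \<sigma>) * F (v, w) \<partial>sphere_borel)"
      by (intro nn_integral_mono_AE, use AE_sphere_borel in eventually_elim) (auto intro: mult_left_mono le)
    also have "\<dots> = F (v, w)"
      by (subst nn_integral_multc) (auto simp: elim)
    finally show ?case .
  qed
qed

lemma nn_gain_le:
  assumes [measurable]: "F \<in> borel_measurable (borel \<Otimes>\<^sub>M borel)" "\<rho> \<in> borel_measurable borel"
      "R \<in> borel_measurable (borel \<Otimes>\<^sub>M borel)"
    and le: "\<And>v w \<sigma>. norm \<sigma> = 1 \<Longrightarrow> \<rho> (post_coll v w \<sigma>) \<le> R (v, w)"
  shows "(\<integral>\<^sup>+v. nn_gain F v * \<rho> v \<partial>lborel) \<le> (\<integral>\<^sup>+v. \<integral>\<^sup>+w. F (v, w) * R (v, w) \<partial>lborel \<partial>lborel)"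
proof -
  have "(\<integral>\<^sup>+v. \<integral>\<^sup>+w. \<integral>\<^sup>+\<sigma>. ennreal (B (sgn (v - w)) \<sigma>) *
       (\<lambda>(v, w, \<sigma>). F (v, w) * \<rho> (post_coll v w \<sigma>)) (v, w, \<sigma>) \<partial>sphere_borel \<partial>lborel \<partial>lborel)
     \<le> (\<integral>\<^sup>+v. \<integral>\<^sup>+w. (\<lambda>p. F p * R p) (v, w) \<partial>lborel \<partial>lborel)"
    by (rule nn_integral_B_le) (auto intro: mult_left_mono le)
  then show ?thesis
    by (simp add: nn_gain_duality[OF assms(1,2)])
qed
text \<open>For symmetric \<open>F\<close> the two partners are interchangeable, so \<open>\<rho>(v')\<close> may be replaced by the mean of
\<open>\<rho>(v')\<close> and \<open>\<rho>(v'\<^sub>*)\<close>; only this sum is controlled by the conservation laws. The factor 2 avoids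
division in the extended reals, and \<open>G\<close> is room for a remainder.\<close>

lemma nn_gain_symmetric_le:
  assumes [measurable]: "F \<in> borel_measurable (borel \<Otimes>\<^sub>M borel)" "\<rho> \<in> borel_measurable borel"
      "G \<in> borel_measurable (borel \<Otimes>\<^sub>M borel)"
    and sym: "\<And>v w. F (v, w) = F (w, v)"
    and le: "\<And>v w \<sigma>. norm \<sigma> = 1 \<Longrightarrow>
       c * (F (v, w) * (\<rho> (post_coll v w \<sigma>) + \<rho> (post_coll_star v w \<sigma>))) \<le> F (v, w) * (\<rho> v + \<rho> w) + G (v, w)"
  shows "2 * (c * (\<integral>\<^sup>+v. nn_gain F v * \<rho> v \<partial>lborel)) \<le>
    2 * (\<integral>\<^sup>+v. \<integral>\<^sup>+w. F (v, w) * \<rho> v \<partial>lborel \<partial>lborel) + (\<integral>\<^sup>+v. \<integral>\<^sup>+w. G (v, w) \<partial>lborel \<partial>lborel)"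
proof -
  let ?I = "\<integral>\<^sup>+v. nn_gain F v * \<rho> v \<partial>lborel"
  let ?J = "\<lambda>\<phi>. \<integral>\<^sup>+v. \<integral>\<^sup>+w. \<integral>\<^sup>+\<sigma>. ennreal (B (sgn (v - w)) \<sigma>) * (F (v, w) * \<phi> v w \<sigma>)
      \<partial>sphere_borel \<partial>lborel \<partial>lborel"
  have I1: "?I = ?J (\<lambda>v w \<sigma>. \<rho> (post_coll v w \<sigma>))"
    by (rule nn_gain_duality) measurable
  also have "\<dots> = (\<integral>\<^sup>+w. \<integral>\<^sup>+v. \<integral>\<^sup>+\<sigma>. ennreal (B (sgn (v - w)) \<sigma>) * (F (v, w) * \<rho> (post_coll v w \<sigma>))
      \<partial>sphere_borel \<partial>lborel \<partial>lborel)"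
    by (rule lborel_pair.Fubini'[symmetric]) measurable
  also have "\<dots> = ?J (\<lambda>v w \<sigma>. \<rho> (post_coll_star v w \<sigma>))"
  proof (rule nn_integral_cong, rule nn_integral_cong)
    fix v w :: 'a
    have m: "sgn (w - v) = - sgn (v - w)" by (metis minus_diff_eq sgn_minus)
    have "(\<integral>\<^sup>+\<sigma>. ennreal (B (sgn (w - v)) \<sigma>) * (F (w, v) * \<rho> (post_coll w v \<sigma>)) \<partial>sphere_borel) =
        (\<integral>\<^sup>+\<sigma>. ennreal (B (sgn (w - v)) (- \<sigma>)) * (F (w, v) * \<rho> (post_coll w v (- \<sigma>))) \<partial>sphere_borel)"
      by (rule nn_integral_sphere_borel_uminus[symmetric]) measurable
    then show "(\<integral>\<^sup>+\<sigma>. ennreal (B (sgn (w - v)) \<sigma>) * (F (w, v) * \<rho> (post_coll w v \<sigma>)) \<partial>sphere_borel) =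
        (\<integral>\<^sup>+\<sigma>. ennreal (B (sgn (v - w)) \<sigma>) * (F (v, w) * \<rho> (post_coll_star v w \<sigma>)) \<partial>sphere_borel)"
      by (simp add: m B_minus post_coll_swap sym[of w v])
  qed
  finally have I2: "?I = ?J (\<lambda>v w \<sigma>. \<rho> (post_coll_star v w \<sigma>))" .
  have "2 * (c * ?I) = c * (?I + ?I)" by (simp add: mult_2 distrib_left)
  also have "?I + ?I = ?J (\<lambda>v w \<sigma>. \<rho> (post_coll v w \<sigma>)) + ?J (\<lambda>v w \<sigma>. \<rho> (post_coll_star v w \<sigma>))"
    using I1 I2 by simp
  also have "c * \<dots> = (\<integral>\<^sup>+v. \<integral>\<^sup>+w. \<integral>\<^sup>+\<sigma>. c * (ennreal (B (sgn (v - w)) \<sigma>) * (F (v, w) * \<rho> (post_coll v w \<sigma>))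
      + ennreal (B (sgn (v - w)) \<sigma>) * (F (v, w) * \<rho> (post_coll_star v w \<sigma>))) \<partial>sphere_borel \<partial>lborel \<partial>lborel)"
    by (simp add: nn_integral_add nn_integral_cmult)
  also have "\<dots> = (\<integral>\<^sup>+v. \<integral>\<^sup>+w. \<integral>\<^sup>+\<sigma>. ennreal (B (sgn (v - w)) \<sigma>) *
      (c * (F (v, w) * (\<rho> (post_coll v w \<sigma>) + \<rho> (post_coll_star v w \<sigma>)))) \<partial>sphere_borel \<partial>lborel \<partial>lborel)"
    by (intro nn_integral_cong) (simp add: distrib_left mult.left_commute)
  also have "\<dots> \<le> (\<integral>\<^sup>+v. \<integral>\<^sup>+w. F (v, w) * (\<rho> v + \<rho> w) + G (v, w) \<partial>lborel \<partial>lborel)"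
    using nn_integral_B_le[of "\<lambda>(v, w). F (v, w) * (\<rho> v + \<rho> w) + G (v, w)"
       "\<lambda>(v, w, \<sigma>). c * (F (v, w) * (\<rho> (post_coll v w \<sigma>) + \<rho> (post_coll_star v w \<sigma>)))"] le
    by simp
  also have "\<dots> = (\<integral>\<^sup>+v. \<integral>\<^sup>+w. F (v, w) * \<rho> v \<partial>lborel \<partial>lborel) +
      (\<integral>\<^sup>+v. \<integral>\<^sup>+w. F (v, w) * \<rho> w \<partial>lborel \<partial>lborel) + (\<integral>\<^sup>+v. \<integral>\<^sup>+w. G (v, w) \<partial>lborel \<partial>lborel)"
    by (simp add: nn_integral_add distrib_left)
  also have "(\<integral>\<^sup>+v. \<integral>\<^sup>+w. F (v, w) * \<rho> w \<partial>lborel \<partial>lborel) = (\<integral>\<^sup>+v. \<integral>\<^sup>+w. F (v, w) * \<rho> v \<partial>lborel \<partial>lborel)"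
    by (subst lborel_pair.Fubini') (auto simp: sym intro!: nn_integral_cong)
  finally show ?thesis by (simp add: mult_2)
qed

lemma ennreal_abs_gain_le:
  assumes [measurable]: "F \<in> borel_measurable (borel \<Otimes>\<^sub>M borel)"
  shows "ennreal \<bar>gain F v\<bar> \<le> nn_gain (\<lambda>p. ennreal \<bar>F p\<bar>) v"
proof -
  let ?g = "\<lambda>p. B (sgn (v - fst p)) (snd p) * F (post_coll v (fst p) (snd p), post_coll_star v (fst p) (snd p))"
  have eq: "(\<integral>\<^sup>+p. ennreal (norm (?g p)) \<partial>(lborel \<Otimes>\<^sub>M sphere_borel)) = nn_gain (\<lambda>p. ennreal \<bar>F p\<bar>) v"
    unfolding nn_gain_def by (intro nn_integral_cong) (simp add: abs_mult B_nonneg ennreal_mult)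
  show ?thesis
  proof (cases "integrable (lborel \<Otimes>\<^sub>M sphere_borel) ?g")
    case True
    then show ?thesis
      using integral_norm_bound_ennreal[OF True] eq by (simp add: gain_def)
  next
    case False
    then show ?thesis by (simp add: gain_def not_integrable_integral_eq)
  qed
qed

lemma ennreal_abs_loss_le:
  assumes [measurable]: "F \<in> borel_measurable (borel \<Otimes>\<^sub>M borel)"
  shows "ennreal \<bar>loss F v\<bar> \<le> (\<integral>\<^sup>+w. ennreal \<bar>F (v, w)\<bar> \<partial>lborel)"
proof (cases "integrable lborel (\<lambda>w. F (v, w))")
  case True
  then show ?thesis
    using integral_norm_bound_ennreal[OF True] by (simp add: loss_def)
next
  case False
  then show ?thesis by (simp add: loss_def not_integrable_integral_eq)
qed

lemma AE_gain_integrable: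
  assumes [measurable]: "F \<in> borel_measurable (borel \<Otimes>\<^sub>M borel)"
    and fin: "(\<integral>\<^sup>+v. \<integral>\<^sup>+w. ennreal \<bar>F (v, w)\<bar> \<partial>lborel \<partial>lborel) < \<infinity>"
  shows "AE v in lborel. integrable (lborel \<Otimes>\<^sub>M sphere_borel) (\<lambda>p. B (sgn (v - fst p)) (snd p) *
     F (post_coll v (fst p) (snd p), post_coll_star v (fst p) (snd p)))"
proof -
  have "(\<integral>\<^sup>+v. nn_gain (\<lambda>p. ennreal \<bar>F p\<bar>) v * 1 \<partial>lborel) \<le> (\<integral>\<^sup>+v. \<integral>\<^sup>+w. ennreal \<bar>F (v, w)\<bar> * 1 \<partial>lborel \<partial>lborel)"
    by (rule nn_gain_le[where R="\<lambda>_. 1"]) auto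
  then have "(\<integral>\<^sup>+v. nn_gain (\<lambda>p. ennreal \<bar>F p\<bar>) v \<partial>lborel) < \<infinity>" using fin by simp
  then have "AE v in lborel. nn_gain (\<lambda>p. ennreal \<bar>F p\<bar>) v \<noteq> \<infinity>"
    by (intro nn_integral_PInf_AE) auto
  then show ?thesis
  proof eventually_elim
    case (elim v)
    show ?case
    proof (rule integrableI_bounded)
      have "(\<integral>\<^sup>+p. ennreal (norm (B (sgn (v - fst p)) (snd p) * F (post_coll v (fst p) (snd p), post_coll_star v (fst p) (snd p))))
         \<partial>(lborel \<Otimes>\<^sub>M sphere_borel)) = nn_gain (\<lambda>p. ennreal \<bar>F p\<bar>) v"
        unfolding nn_gain_def by (intro nn_integral_cong) (simp add: abs_mult B_nonneg ennreal_mult)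
      then show "(\<integral>\<^sup>+p. ennreal (norm (B (sgn (v - fst p)) (snd p) * F (post_coll v (fst p) (snd p), post_coll_star v (fst p) (snd p))))
         \<partial>(lborel \<Otimes>\<^sub>M sphere_borel)) < \<infinity>"
        using elim by (simp add: less_top)
    qed measurable
  qed
qed

lemma AE_loss_integrable:
  assumes [measurable]: "F \<in> borel_measurable (borel \<Otimes>\<^sub>M borel)"
    and fin: "(\<integral>\<^sup>+v. \<integral>\<^sup>+w. ennreal \<bar>F (v, w)\<bar> \<partial>lborel \<partial>lborel) < \<infinity>"
  shows "AE v in lborel. integrable lborel (\<lambda>w. F (v, w))"
proof -
  have "AE v in lborel. (\<integral>\<^sup>+w. ennreal \<bar>F (v, w)\<bar> \<partial>lborel) \<noteq> \<infinity>"
    using fin by (intro nn_integral_PInf_AE) auto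
  then show ?thesis
    by eventually_elim (auto intro!: integrableI_bounded simp: less_top)
qed

lemma AE_gain_diff:
  assumes [measurable]: "F \<in> borel_measurable (borel \<Otimes>\<^sub>M borel)" "G \<in> borel_measurable (borel \<Otimes>\<^sub>M borel)"
    and fin: "(\<integral>\<^sup>+v. \<integral>\<^sup>+w. ennreal \<bar>F (v, w)\<bar> \<partial>lborel \<partial>lborel) < \<infinity>" "(\<integral>\<^sup>+v. \<integral>\<^sup>+w. ennreal \<bar>G (v, w)\<bar> \<partial>lborel \<partial>lborel) < \<infinity>"
  shows "AE v in lborel. gain F v - gain G v = gain (\<lambda>p. F p - G p) v"
proof -
  have "AE v in lborel. integrable (lborel \<Otimes>\<^sub>M sphere_borel) (\<lambda>p. B (sgn (v - fst p)) (snd p) *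
     F (post_coll v (fst p) (snd p), post_coll_star v (fst p) (snd p)))"
    "AE v in lborel. integrable (lborel \<Otimes>\<^sub>M sphere_borel) (\<lambda>p. B (sgn (v - fst p)) (snd p) *
     G (post_coll v (fst p) (snd p), post_coll_star v (fst p) (snd p)))"
    by (rule AE_gain_integrable; use fin in simp)+
  then show ?thesis by eventually_elim (simp add: gain_def right_diff_distrib)
qed

lemma AE_loss_diff:
  assumes [measurable]: "F \<in> borel_measurable (borel \<Otimes>\<^sub>M borel)" "G \<in> borel_measurable (borel \<Otimes>\<^sub>M borel)"
    and fin: "(\<integral>\<^sup>+v. \<integral>\<^sup>+w. ennreal \<bar>F (v, w)\<bar> \<partial>lborel \<partial>lborel) < \<infinity>" "(\<integral>\<^sup>+v. \<integral>\<^sup>+w. ennreal \<bar>G (v, w)\<bar> \<partial>lborel \<partial>lborel) < \<infinity>"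
  shows "AE v in lborel. loss F v - loss G v = loss (\<lambda>p. F p - G p) v"
proof -
  have "AE v in lborel. integrable lborel (\<lambda>w. F (v, w))" "AE v in lborel. integrable lborel (\<lambda>w. G (v, w))"
    by (rule AE_loss_integrable; use fin in simp)+
  then show ?thesis by eventually_elim (simp add: loss_def)
qed

lemma gain_nonneg: "(\<And>p. 0 \<le> F p) \<Longrightarrow> 0 \<le> gain F v"
  by (simp add: gain_def integral_nonneg_AE B_nonneg)

end

section \<open>Weighted norms and convexity inequalities\<close>

definition weight :: "'a::euclidean_space \<Rightarrow> real" where
  "weight v = 1 + (norm v)\<^sup>2"

lemma weight_ge_1 [simp]: "1 \<le> weight v" by (simp add: weight_def)
lemma weight_pos [simp]: "0 < weight v" using weight_ge_1[of v] by linarith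
lemma weight_nonneg [simp]: "0 \<le> weight v" using weight_pos[of v] by linarith
lemma weight_neq_0 [simp]: "weight v \<noteq> 0" using weight_pos[of v] by linarith

lemma measurable_weight [measurable]: "weight \<in> borel_measurable borel"
  unfolding weight_def[abs_def] by measurable

lemma weight_conservation:
  assumes "norm \<sigma> = 1"
  shows "weight (post_coll v w \<sigma>) + weight (post_coll_star v w \<sigma>) = weight v + weight w"
  using norm_post_coll_energy[OF assms, of v w] by (simp add: weight_def)

lemma weight_post_coll_le:
  assumes "norm \<sigma> = 1"
  shows "weight (post_coll v w \<sigma>) \<le> weight v * weight w"
proof -
  have "weight (post_coll v w \<sigma>) \<le> 1 + (norm v)\<^sup>2 + (norm w)\<^sup>2"
    using norm_post_coll_energy[OF assms, of v w] zero_le_power2[of "norm (post_coll_star v w \<sigma>)"]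
    unfolding weight_def by linarith
  also have "\<dots> \<le> weight v * weight w"
    by (simp add: weight_def algebra_simps)
  finally show ?thesis .
qed

lemma one_le_weight_powr [simp]: "0 \<le> s \<Longrightarrow> 1 \<le> weight v powr s"
  by (simp add: ge_one_powr_ge_zero)

lemma norm_diff_powr_le_product:
  assumes "0 \<le> s" "s \<le> 2"
  shows "norm (v - w) powr s \<le> 2 * (weight v powr (s / 2) * weight w powr (s / 2))"
proof (cases "v = w")
  case False
  have n: "0 < norm (v - w)" using False by simp
  have "(norm (v - w))\<^sup>2 \<le> (norm v + norm w)\<^sup>2"
    by (intro power_mono norm_triangle_ineq4) simp
  also have "\<dots> \<le> 2 * (norm v)\<^sup>2 + 2 * (norm w)\<^sup>2"
    using sum_squares_bound[of "norm v" "norm w"] by (simp add: power2_sum)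
  also have "\<dots> \<le> 2 * (weight v * weight w)"
    by (simp add: weight_def algebra_simps)
  finally have le: "(norm (v - w))\<^sup>2 \<le> 2 * (weight v * weight w)" .
  have "norm (v - w) powr s = ((norm (v - w))\<^sup>2) powr (s / 2)"
    using n by (simp add: powr_powr flip: powr_numeral)
  also have "\<dots> \<le> (2 * (weight v * weight w)) powr (s / 2)"
    using le assms by (intro powr_mono2) auto
  also have "\<dots> = 2 powr (s / 2) * (weight v powr (s / 2) * weight w powr (s / 2))"
    by (simp add: powr_mult)
  also have "\<dots> \<le> 2 powr 1 * (weight v powr (s / 2) * weight w powr (s / 2))"
    using assms by (intro mult_right_mono powr_mono) auto
  finally show ?thesis by simp
qed simp

lemma norm_diff_powr_le_sum:
  assumes "0 \<le> s" "s \<le> 1"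
  shows "norm (v - w) powr s \<le> 2 * (weight v powr (s / 2) + weight w powr (s / 2))"
proof -
  have rt: "(sqrt (weight x)) powr s = weight x powr (s / 2)" for x :: 'a
    by (simp add: powr_half_sqrt[symmetric] powr_powr)
  have nw: "norm x \<le> sqrt (weight x)" for x :: 'a
    by (rule real_le_rsqrt) (simp add: weight_def)
  define m where "m = max (sqrt (weight v)) (sqrt (weight w))"
  have "norm (v - w) \<le> norm v + norm w" by (rule norm_triangle_ineq4)
  also have "\<dots> \<le> 2 * m" using nw[of v] nw[of w] unfolding m_def by linarith
  finally have "norm (v - w) powr s \<le> (2 * m) powr s" using assms by (intro powr_mono2) auto
  also have "\<dots> = 2 powr s * m powr s"
    by (rule powr_mult)
  also have "\<dots> \<le> 2 powr 1 * m powr s"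
    using assms by (intro mult_right_mono powr_mono) auto
  also have "m powr s \<le> weight v powr (s / 2) + weight w powr (s / 2)"
    unfolding m_def max_def by (simp add: rt)
  finally show ?thesis by simp
qed

lemma powr_subadditive:
  fixes x y q :: real
  assumes "0 \<le> x" "0 \<le> y" "0 \<le> q" "q \<le> 1"
  shows "(x + y) powr q \<le> x powr q + y powr q"
proof (cases "x = 0 \<or> y = 0")
  case False
  then have p: "0 < x" "0 < y" using assms by auto
  have *: "z * (x + y) powr (q - 1) \<le> z powr q" if "0 < z" "z \<le> x + y" for z
  proof -
    have "(x + y) powr (q - 1) \<le> z powr (q - 1)"
      using that assms by (intro powr_mono2') auto
    then have "z * (x + y) powr (q - 1) \<le> z * z powr (q - 1)"
      using that by simp
    also have "\<dots> = z powr q" using that by (simp add: powr_diff)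
    finally show ?thesis .
  qed
  have "(x + y) powr q = (x + y) * (x + y) powr (q - 1)"
    using p by (simp add: powr_diff)
  also have "\<dots> = x * (x + y) powr (q - 1) + y * (x + y) powr (q - 1)"
    using p by (simp add: distrib_right)
  also have "\<dots> \<le> x powr q + y powr q"
    using p by (intro add_mono *) auto
  finally show ?thesis .
qed (use assms in auto)

text \<open>The sum of the tangent lines of \<open>z \<mapsto> z\<^sup>q\<close> at the midpoint.\<close>

lemma powr_midpoint_concave:
  fixes x y q :: real
  assumes "0 < x" "0 < y" "0 \<le> q" "q \<le> 1"
  shows "x powr q + y powr q \<le> 2 powr (1 - q) * (x + y) powr q"
proof -
  define m where "m = (x + y) / 2"
  have m: "0 < m" using assms by (simp add: m_def)
  have tangent: "z powr q \<le> m powr q + q * m powr (q - 1) * (z - m)" if "0 < z" for z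
  proof -
    have "(z / m) powr q \<le> 1 + q * (z / m - 1)"
    proof -
      have "(z / m) powr q * 1 powr (1 - q) \<le> q * (z / m) + (1 - q) * 1"
        using that m assms by (intro Youngs_inequality_0) auto
      then show ?thesis by (simp add: algebra_simps)
    qed
    then have "m powr q * (z / m) powr q \<le> m powr q * (1 + q * (z / m - 1))"
      by (intro mult_left_mono) auto
    moreover have "m powr q * (z / m) powr q = z powr q"
      using that m by (simp flip: powr_mult)
    moreover have "m powr q * (1 + q * (z / m - 1)) = m powr q + q * m powr (q - 1) * (z - m)"
      using m by (simp add: powr_diff field_simps)
    ultimately show ?thesis by simp
  qed
  have "x powr q + y powr q \<le> 2 * m powr q + (q * m powr (q - 1)) * ((x + y) - 2 * m)"
    using tangent[OF assms(1)] tangent[OF assms(2)] by (simp add: algebra_simps)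
  also have "\<dots> = 2 * m powr q" by (simp add: m_def)
  also have "\<dots> = 2 powr (1 - q) * (x + y) powr q"
    using assms by (simp add: m_def powr_divide powr_diff)
  finally show ?thesis .
qed

text \<open>Concavity loses the factor \<open>2\<^bsup>1-q\<^esup>\<close> on the outgoing pair, conservation of
\<open>w(v) + w(v\<^sub>*)\<close> passes to the incoming pair, and subadditivity separates it. Annihilation pays for the factor.\<close>

lemma gain_concave_weight_le:
  fixes \<alpha> q :: real
  assumes \<sigma>: "norm \<sigma> = 1" and q: "0 \<le> q" "q \<le> 1" "\<alpha> \<le> 1" "2 powr (1 - q) * (1 - \<alpha>) \<le> 1"
  shows "(1 - \<alpha>) * (weight (post_coll v w \<sigma>) powr q + weight (post_coll_star v w \<sigma>) powr q)
    \<le> weight v powr q + weight w powr q"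
proof -
  have "weight (post_coll v w \<sigma>) powr q + weight (post_coll_star v w \<sigma>) powr q
      \<le> 2 powr (1 - q) * (weight v + weight w) powr q"
    using powr_midpoint_concave[of "weight (post_coll v w \<sigma>)" "weight (post_coll_star v w \<sigma>)" q] q
    by (simp add: weight_conservation[OF \<sigma>])
  then have "(1 - \<alpha>) * (weight (post_coll v w \<sigma>) powr q + weight (post_coll_star v w \<sigma>) powr q)
      \<le> (1 - \<alpha>) * (2 powr (1 - q) * (weight v + weight w) powr q)"
    using q by (intro mult_left_mono) auto
  also have "\<dots> = (2 powr (1 - q) * (1 - \<alpha>)) * (weight v + weight w) powr q"
    by simp
  also have "\<dots> \<le> 1 * (weight v + weight w) powr q"
    using q by (intro mult_right_mono) auto
  also have "\<dots> \<le> weight v powr q + weight w powr q"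
    using powr_subadditive[of "weight v" "weight w" q] q by simp
  finally show ?thesis .
qed

text \<open>\<open>x min(x, R)\<^bsup>\<gamma>/2\<^esup>\<close> grows linearly, so it can be tested against densities of finite energy, and it
increases to \<open>x\<^bsup>1+\<gamma>/2\<^esup>\<close> with \<open>R\<close>.\<close>

definition trunc_weight :: "real \<Rightarrow> real \<Rightarrow> real \<Rightarrow> real" where
  "trunc_weight \<gamma> R x = x * min x R powr (\<gamma> / 2)"

text \<open>Povzner's inequality for the truncated weight, with a constant independent of \<open>R\<close>. The outgoing pair
has at most \<open>(x + y) h(x + y)\<close> with \<open>h(z) = min(z, R)\<^bsup>\<gamma>/2\<^esup>\<close>. The excess of
\<open>(1 - \<alpha>) x h(x + y)\<close> over \<open>x h(x)\<close> is positive only if \<open>x < R\<close> and \<open>\<alpha> x\<^bsup>\<gamma>/2\<^esup> \<le> y\<^bsup>\<gamma>/2\<^esup>\<close>; then both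
the rate and the excess are controlled by \<open>y\<^bsup>\<gamma>/2\<^esup>\<close>, and \<open>y\<^sup>\<gamma> \<le> y\<close> since \<open>\<gamma> \<le> 1\<close>.\<close>

lemma trunc_weight_bracket:
  fixes \<alpha> \<gamma> R x y x' y' k :: real
  assumes \<gamma>: "0 < \<gamma>" "\<gamma> \<le> 1" and \<alpha>: "0 < \<alpha>" "\<alpha> < 1" and R: "1 \<le> R"
    and xy: "1 \<le> x" "1 \<le> y" and xy': "0 \<le> x'" "0 \<le> y'" "x' + y' = x + y"
    and k: "0 \<le> k" "k \<le> 2 * (x powr (\<gamma> / 2) + y powr (\<gamma> / 2))"
  shows "k * ((1 - \<alpha>) * (trunc_weight \<gamma> R x' + trunc_weight \<gamma> R y'))
    \<le> k * (trunc_weight \<gamma> R x + trunc_weight \<gamma> R y) + 4 * (1 + 1 / \<alpha>) * (x * y)"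
proof -
  define h where "h z = min z R powr (\<gamma> / 2)" for z
  have h0: "0 \<le> h z" for z by (simp add: h_def)
  have hmono: "h u \<le> h z" if "0 \<le> u" "u \<le> z" for u z
    unfolding h_def using that R \<gamma> by (intro powr_mono2) auto
  have hsub: "h (u + z) \<le> h u + h z" if "0 \<le> u" "0 \<le> z" for u z
  proof -
    have "h (u + z) \<le> (min u R + min z R) powr (\<gamma> / 2)"
      unfolding h_def using that R \<gamma> by (intro powr_mono2) auto
    also have "\<dots> \<le> h u + h z"
      unfolding h_def using that R \<gamma> by (intro powr_subadditive) auto
    finally show ?thesis .
  qed
  have hle: "h z \<le> z powr (\<gamma> / 2)" if "0 \<le> z" for z
    unfolding h_def using that R \<gamma> by (intro powr_mono2) auto
  have one_sided: "k * (u * ((1 - \<alpha>) * h (u + z) - h u)) \<le> 2 * (1 + 1 / \<alpha>) * (u * z)"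
    if uz: "1 \<le> u" "1 \<le> z" and ku: "k \<le> 2 * (u powr (\<gamma> / 2) + z powr (\<gamma> / 2))" for u z
  proof (cases "(1 - \<alpha>) * h (u + z) - h u \<le> 0")
    case True
    then have "k * (u * ((1 - \<alpha>) * h (u + z) - h u)) \<le> 0"
      using k uz by (intro mult_nonneg_nonpos mult_nonneg_nonpos) auto
    also have "0 \<le> 2 * (1 + 1 / \<alpha>) * (u * z)" using \<alpha> uz by simp
    finally show ?thesis .
  next
    case False
    have "(1 - \<alpha>) * h (u + z) \<le> h (u + z)" using h0[of "u + z"] \<alpha> by (simp add: algebra_simps)
    then have "h u < h (u + z)" using False by linarith
    \<comment> \<open>Above \<open>R\<close> the function \<open>h\<close> is constant and there is no excess.\<close>
    then have uR: "u < R"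
      using R uz by (cases "u < R") (auto simp: h_def min_absorb2)
    have hu: "h u = u powr (\<gamma> / 2)" using uR by (simp add: h_def)
    have s: "h (u + z) \<le> h u + h z" using uz by (intro hsub) auto
    have hz: "h z \<le> z powr (\<gamma> / 2)" using uz by (intro hle) auto
    have m: "h u \<le> h (u + z)" using uz by (intro hmono) auto
    have a: "\<alpha> * h u \<le> \<alpha> * h (u + z)" using m \<alpha> by (intro mult_left_mono) auto
    have a0: "0 \<le> \<alpha> * h (u + z)" using \<alpha> h0 by simp
    have d: "(1 - \<alpha>) * h (u + z) - h u = h (u + z) - h u - \<alpha> * h (u + z)" by (simp add: algebra_simps)
    have d1: "(1 - \<alpha>) * h (u + z) - h u \<le> z powr (\<gamma> / 2)" using d s hz a0 by linarith
    have "\<alpha> * h u \<le> z powr (\<gamma> / 2)" using d s hz a False by linarith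
    then have d2: "\<alpha> * u powr (\<gamma> / 2) \<le> z powr (\<gamma> / 2)" by (simp add: hu)
    then have d3: "u powr (\<gamma> / 2) \<le> z powr (\<gamma> / 2) / \<alpha>" using \<alpha> by (simp add: field_simps)
    have kz: "k \<le> 2 * (1 + 1 / \<alpha>) * z powr (\<gamma> / 2)"
      using ku d3 by (simp add: algebra_simps)
    have "k * (u * ((1 - \<alpha>) * h (u + z) - h u)) \<le> k * (u * z powr (\<gamma> / 2))"
      using k uz d1 by (intro mult_left_mono) auto
    also have "\<dots> \<le> (2 * (1 + 1 / \<alpha>) * z powr (\<gamma> / 2)) * (u * z powr (\<gamma> / 2))"
      using kz uz by (intro mult_right_mono) auto
    also have "\<dots> = 2 * (1 + 1 / \<alpha>) * (u * z powr \<gamma>)"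
      by (simp flip: powr_add add: mult_ac)
    also have "\<dots> \<le> 2 * (1 + 1 / \<alpha>) * (u * z powr 1)"
      using \<alpha> uz \<gamma> by (intro mult_left_mono powr_mono) auto
    finally show ?thesis using uz by simp
  qed
  have "trunc_weight \<gamma> R x' + trunc_weight \<gamma> R y' \<le> x' * h (x + y) + y' * h (x + y)"
    unfolding trunc_weight_def h_def[symmetric] using xy'
    by (intro add_mono mult_left_mono hmono) auto
  also have "\<dots> = (x + y) * h (x + y)" using xy' by (simp flip: distrib_right)
  finally have "k * ((1 - \<alpha>) * (trunc_weight \<gamma> R x' + trunc_weight \<gamma> R y')) \<le> k * ((1 - \<alpha>) * ((x + y) * h (x + y)))"
    using k \<alpha> by (intro mult_left_mono) auto
  also have "\<dots> = k * (x * h x + y * h y) + k * (x * ((1 - \<alpha>) * h (x + y) - h x)) + k * (y * ((1 - \<alpha>) * h (y + x) - h y))"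
    by (simp add: algebra_simps)
  also have "\<dots> \<le> k * (x * h x + y * h y) + 2 * (1 + 1 / \<alpha>) * (x * y) + 2 * (1 + 1 / \<alpha>) * (y * x)"
    using xy k by (intro add_mono one_sided) auto
  finally show ?thesis by (simp add: trunc_weight_def h_def algebra_simps)
qed

definition N :: "real \<Rightarrow> ('a::euclidean_space \<Rightarrow> real) \<Rightarrow> ennreal" where
  "N s u = (\<integral>\<^sup>+v. ennreal (\<bar>u v\<bar> * weight v powr s) \<partial>lborel)"

lemma N_mono_exponent: "s \<le> t \<Longrightarrow> N s u \<le> N t u"
  unfolding N_def by (intro nn_integral_mono ennreal_leI mult_left_mono powr_mono) auto

lemma N_mono_AE: "AE v in lborel. \<bar>u v\<bar> \<le> \<bar>u' v\<bar> \<Longrightarrow> N s u \<le> N s u'"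
  unfolding N_def by (intro nn_integral_mono_AE) (auto elim!: eventually_mono intro!: ennreal_leI mult_right_mono)

lemma N_cong_AE: "AE v in lborel. u v = u' v \<Longrightarrow> N s u = N s u'"
  unfolding N_def by (intro nn_integral_cong_AE) auto

lemma N_triangle_AE:
  fixes u x y :: "'a::euclidean_space \<Rightarrow> real"
  assumes [measurable]: "x \<in> borel_measurable borel" "y \<in> borel_measurable borel"
    and le: "AE v in lborel. \<bar>u v\<bar> \<le> \<bar>x v\<bar> + \<bar>y v\<bar>"
  shows "N s u \<le> N s x + N s y"
proof -
  have "N s u \<le> (\<integral>\<^sup>+v. ennreal (\<bar>x v\<bar> * weight v powr s) + ennreal (\<bar>y v\<bar> * weight v powr s) \<partial>lborel)"
    unfolding N_def
    by (intro nn_integral_mono_AE)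
      (use le in \<open>auto elim!: eventually_mono intro!: ennreal_leI mult_right_mono simp flip: ennreal_plus distrib_right\<close>)
  then show ?thesis by (simp add: N_def nn_integral_add)
qed

lemmas N_triangle = N_triangle_AE[OF _ _ AE_I2]

lemma N_mult: "N s (\<lambda>v. c * u v) = ennreal \<bar>c\<bar> * N s u"
  if "u \<in> borel_measurable borel" for u :: "'a::euclidean_space \<Rightarrow> real"
  using that unfolding N_def
  by (subst nn_integral_cmult[symmetric]) (auto simp: abs_mult ennreal_mult mult.assoc)

text \<open>Split at \<open>w = K\<close> with \<open>K = \<epsilon>\<^bsup>-1/a\<^esup>\<close>, the level that balances the two contributions.\<close>

lemma N_interpolation:
  fixes u :: "'a::euclidean_space \<Rightarrow> real"
  assumes [measurable]: "u \<in> borel_measurable borel"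
    and \<epsilon>: "0 < \<epsilon>" "\<epsilon> \<le> 1" and s: "0 \<le> s" "s \<le> a" "0 < a" and q: "0 \<le> q"
    and Nq: "N q u \<le> ennreal (c * \<epsilon>)" and Na: "N a u \<le> ennreal M" and M: "0 \<le> M" "0 \<le> c"
  shows "N s u \<le> ennreal ((c + M) * \<epsilon> powr (1 - s / a))"
proof -
  define K where "K = \<epsilon> powr (- 1 / a)"
  have K: "1 \<le> K" "0 < K"
    using \<epsilon> s by (auto simp: K_def powr_minus_divide field_simps powr_le1)
  have Ks: "K powr s * \<epsilon> = \<epsilon> powr (1 - s / a)" "K powr (s - a) = \<epsilon> powr (1 - s / a)"
  proof -
    have "K powr s * \<epsilon> = \<epsilon> powr (- 1 / a * s) * \<epsilon> powr 1" using \<epsilon> by (simp add: K_def powr_powr)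
    also have "\<dots> = \<epsilon> powr (- 1 / a * s + 1)" by (simp only: powr_add)
    finally show "K powr s * \<epsilon> = \<epsilon> powr (1 - s / a)" by (simp add: algebra_simps)
    have "- 1 / a * (s - a) = 1 - s / a" using s by (simp add: field_simps)
    then show "K powr (s - a) = \<epsilon> powr (1 - s / a)" by (simp only: K_def powr_powr)
  qed
  \<comment> \<open>Below \<open>K\<close> the order \<open>s\<close> is paid by the level, above \<open>K\<close> by the order \<open>a\<close>.\<close>
  have pw: "weight v powr s \<le> K powr s * weight v powr q + K powr (s - a) * weight v powr a" for v :: 'a
  proof (cases "weight v \<le> K")
    case True
    have "weight v powr s \<le> K powr s * 1" using True s by (auto intro: powr_mono2)
    also have "\<dots> \<le> K powr s * weight v powr q" using q by (intro mult_left_mono) auto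
    finally show ?thesis using K by (simp add: add_increasing2)
  next
    case False
    have "weight v powr s = weight v powr (s - a) * weight v powr a" by (simp flip: powr_add)
    also have "\<dots> \<le> K powr (s - a) * weight v powr a"
      using False s K by (intro mult_right_mono powr_mono2') auto
    finally show ?thesis by (simp add: add_increasing)
  qed
  have "N s u \<le> (\<integral>\<^sup>+v. ennreal (K powr s) * ennreal (\<bar>u v\<bar> * weight v powr q)
      + ennreal (K powr (s - a)) * ennreal (\<bar>u v\<bar> * weight v powr a) \<partial>lborel)"
    unfolding N_def
  proof (rule nn_integral_mono)
    fix v :: 'a
    have "\<bar>u v\<bar> * weight v powr s \<le> \<bar>u v\<bar> * (K powr s * weight v powr q + K powr (s - a) * weight v powr a)"
      by (intro mult_left_mono pw) auto
    then show "ennreal (\<bar>u v\<bar> * weight v powr s) \<le> ennreal (K powr s) * ennreal (\<bar>u v\<bar> * weight v powr q)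
      + ennreal (K powr (s - a)) * ennreal (\<bar>u v\<bar> * weight v powr a)"
      by (auto simp flip: ennreal_mult ennreal_plus intro!: ennreal_leI simp: algebra_simps)
  qed
  also have "\<dots> = ennreal (K powr s) * N q u + ennreal (K powr (s - a)) * N a u"
    by (simp add: N_def nn_integral_add nn_integral_cmult)
  also have "\<dots> \<le> ennreal (K powr s) * ennreal (c * \<epsilon>) + ennreal (K powr (s - a)) * ennreal M"
    by (intro add_mono mult_left_mono Nq Na) auto
  also have "\<dots> = ennreal (c * (K powr s * \<epsilon>) + K powr (s - a) * M)"
    using \<epsilon> M by (simp add: ennreal_mult[symmetric] ennreal_plus[symmetric] mult_ac del: ennreal_plus)
  finally show ?thesis by (simp only: Ks) (simp add: algebra_simps)
qed

section \<open>The collision operator and one Euler step\<close>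

locale annihilation = scattering B
  for B :: "'a::euclidean_space \<Rightarrow> 'a \<Rightarrow> real" +
  fixes \<gamma> \<alpha> :: real
  assumes \<gamma>: "0 < \<gamma>" "\<gamma> \<le> 1" and \<alpha>: "0 < \<alpha>" "\<alpha> < 1"
begin

definition collide :: "('a \<times> 'a \<Rightarrow> real) \<Rightarrow> 'a \<Rightarrow> real" where
  "collide F v = (1 - \<alpha>) * gain F v - loss F v"

definition pairs :: "(real \<Rightarrow> real) \<Rightarrow> ('a \<Rightarrow> real) \<Rightarrow> 'a \<times> 'a \<Rightarrow> real" where
  "pairs k f p = k (norm (fst p - snd p)) * f (fst p) * f (snd p)"

text \<open>Collision rates dominated by hard potentials: the original rate and all its truncations.\<close>

definition rate :: "(real \<Rightarrow> real) \<Rightarrow> bool" where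
  "rate k \<longleftrightarrow> k \<in> borel_measurable borel \<and> (\<forall>r. 0 \<le> k r \<and> k r \<le> r powr \<gamma>)"

lemma measurable_pairs [measurable]:
  assumes [measurable]: "k \<in> borel_measurable borel" "f \<in> borel_measurable borel"
  shows "pairs k f \<in> borel_measurable (borel \<Otimes>\<^sub>M borel)"
  unfolding pairs_def[abs_def] by measurable

lemma measurable_collide [measurable]:
  assumes [measurable]: "F \<in> borel_measurable (borel \<Otimes>\<^sub>M borel)"
  shows "collide F \<in> borel_measurable borel"
  unfolding collide_def[abs_def] by measurable

text \<open>The norm on functions of a pair that the gain operator respects, because
\<open>w(v') \<le> w(v) w(v\<^sub>*)\<close>.\<close>

definition N2 :: "real \<Rightarrow> ('a \<times> 'a \<Rightarrow> real) \<Rightarrow> ennreal" where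
  "N2 s F = (\<integral>\<^sup>+v. \<integral>\<^sup>+w. ennreal (\<bar>F (v, w)\<bar> * (weight v powr s * weight w powr s)) \<partial>lborel \<partial>lborel)"

lemma nn_integral_abs_le_N2: "0 \<le> s \<Longrightarrow> (\<integral>\<^sup>+v. \<integral>\<^sup>+w. ennreal \<bar>F (v, w)\<bar> \<partial>lborel \<partial>lborel) \<le> N2 s F"
proof -
  assume s: "0 \<le> s"
  have "\<bar>F (v, w)\<bar> * 1 \<le> \<bar>F (v, w)\<bar> * (weight v powr s * weight w powr s)" for v w
    using s mult_mono[of 1 "weight v powr s" 1 "weight w powr s"] by (intro mult_left_mono) auto
  then show ?thesis unfolding N2_def by (intro nn_integral_mono ennreal_leI) simp
qed

lemma N2_product:
  assumes [measurable]: "f \<in> borel_measurable borel" "g \<in> borel_measurable borel" "F \<in> borel_measurable (borel \<Otimes>\<^sub>M borel)"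
    and r: "0 \<le> r" "r \<le> 2" and c: "0 \<le> c"
    and F: "\<And>v w. \<bar>F (v, w)\<bar> \<le> c * (norm (v - w) powr r * (\<bar>f v\<bar> * \<bar>g w\<bar>))"
  shows "N2 s F \<le> ennreal (2 * c) * (N (s + r / 2) f * N (s + r / 2) g)"
proof -
  have "N2 s F \<le> (\<integral>\<^sup>+v. \<integral>\<^sup>+w. ennreal (2 * c) * (ennreal (\<bar>f v\<bar> * weight v powr (s + r / 2)) *
      ennreal (\<bar>g w\<bar> * weight w powr (s + r / 2))) \<partial>lborel \<partial>lborel)"
    unfolding N2_def
  proof (intro nn_integral_mono)
    fix v w :: 'a
    have "\<bar>F (v, w)\<bar> * (weight v powr s * weight w powr s)
       \<le> (c * (norm (v - w) powr r * (\<bar>f v\<bar> * \<bar>g w\<bar>))) * (weight v powr s * weight w powr s)"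
      by (intro mult_right_mono F) auto
    also have "\<dots> \<le> (c * ((2 * (weight v powr (r / 2) * weight w powr (r / 2))) * (\<bar>f v\<bar> * \<bar>g w\<bar>))) * (weight v powr s * weight w powr s)"
      using c r by (intro mult_right_mono mult_left_mono norm_diff_powr_le_product) auto
    also have "\<dots> = 2 * c * ((\<bar>f v\<bar> * weight v powr (s + r / 2)) * (\<bar>g w\<bar> * weight w powr (s + r / 2)))"
      by (simp add: powr_add)
    finally have "ennreal (\<bar>F (v, w)\<bar> * (weight v powr s * weight w powr s)) \<le>
      ennreal (2 * c * ((\<bar>f v\<bar> * weight v powr (s + r / 2)) * (\<bar>g w\<bar> * weight w powr (s + r / 2))))"
      by (rule ennreal_leI)
    also have "\<dots> = ennreal (2 * c) * (ennreal (\<bar>f v\<bar> * weight v powr (s + r / 2)) *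
      ennreal (\<bar>g w\<bar> * weight w powr (s + r / 2)))"
      using c by (simp only: ennreal_mult mult_nonneg_nonneg abs_ge_zero powr_ge_zero zero_le_numeral)
    finally show "ennreal (\<bar>F (v, w)\<bar> * (weight v powr s * weight w powr s)) \<le>
        ennreal (2 * c) * (ennreal (\<bar>f v\<bar> * weight v powr (s + r / 2)) * ennreal (\<bar>g w\<bar> * weight w powr (s + r / 2)))" .
  qed
  also have "\<dots> = ennreal (2 * c) * (N (s + r / 2) f * N (s + r / 2) g)"
    by (simp add: N_def nn_integral_cmult nn_integral_multc)
  finally show ?thesis .
qed

lemma N2_add:
  assumes [measurable]: "F \<in> borel_measurable (borel \<Otimes>\<^sub>M borel)" "G \<in> borel_measurable (borel \<Otimes>\<^sub>M borel)"
     and le: "\<And>v w. \<bar>H (v, w)\<bar> \<le> \<bar>F (v, w)\<bar> + \<bar>G (v, w)\<bar>"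
  shows "N2 s H \<le> N2 s F + N2 s G"
proof -
  have "N2 s H \<le> (\<integral>\<^sup>+v. \<integral>\<^sup>+w. ennreal (\<bar>F (v, w)\<bar> * (weight v powr s * weight w powr s)) +
     ennreal (\<bar>G (v, w)\<bar> * (weight v powr s * weight w powr s)) \<partial>lborel \<partial>lborel)"
    unfolding N2_def
    by (intro nn_integral_mono) (auto intro!: ennreal_leI mult_right_mono le simp flip: ennreal_plus distrib_right)
  then show ?thesis by (simp add: N2_def nn_integral_add)
qed

lemma N_gain_le:
  assumes [measurable]: "F \<in> borel_measurable (borel \<Otimes>\<^sub>M borel)" and s: "0 \<le> s"
  shows "N s (gain F) \<le> N2 s F"
proof -
  have "N s (gain F) \<le> (\<integral>\<^sup>+v. nn_gain (\<lambda>p. ennreal \<bar>F p\<bar>) v * ennreal (weight v powr s) \<partial>lborel)"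
    unfolding N_def by (intro nn_integral_mono) (simp add: ennreal_mult mult_right_mono ennreal_abs_gain_le)
  also have "\<dots> \<le> (\<integral>\<^sup>+v. \<integral>\<^sup>+w. ennreal \<bar>F (v, w)\<bar> * (\<lambda>(v, w). ennreal (weight v powr s * weight w powr s)) (v, w) \<partial>lborel \<partial>lborel)"
    by (rule nn_gain_le)
       (use s in \<open>auto intro!: ennreal_leI powr_mono2 weight_post_coll_le simp flip: powr_mult\<close>)
  also have "\<dots> = N2 s F"
    unfolding N2_def by (intro nn_integral_cong) (simp add: ennreal_mult)
  finally show ?thesis .
qed

lemma N_loss_le:
  assumes [measurable]: "F \<in> borel_measurable (borel \<Otimes>\<^sub>M borel)" and s: "0 \<le> s"
  shows "N s (loss F) \<le> N2 s F"
proof -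
  have "N s (loss F) \<le> (\<integral>\<^sup>+v. (\<integral>\<^sup>+w. ennreal \<bar>F (v, w)\<bar> \<partial>lborel) * ennreal (weight v powr s) \<partial>lborel)"
    unfolding N_def by (intro nn_integral_mono) (simp add: ennreal_mult mult_right_mono ennreal_abs_loss_le)
  also have "\<dots> = (\<integral>\<^sup>+v. (\<integral>\<^sup>+w. ennreal \<bar>F (v, w)\<bar> * ennreal (weight v powr s) \<partial>lborel) \<partial>lborel)"
    by (simp add: nn_integral_multc)
  also have "\<dots> \<le> N2 s F"
    unfolding N2_def
  proof (intro nn_integral_mono)
    fix v w
    have "\<bar>F (v, w)\<bar> * (weight v powr s * 1) \<le> \<bar>F (v, w)\<bar> * (weight v powr s * weight w powr s)"
      using s by (intro mult_left_mono) auto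
    then show "ennreal \<bar>F (v, w)\<bar> * ennreal (weight v powr s) \<le> ennreal (\<bar>F (v, w)\<bar> * (weight v powr s * weight w powr s))"
      by (simp flip: ennreal_mult add: ennreal_leI)
  qed
  finally show ?thesis .
qed

lemma N_collide_le:
  assumes [measurable]: "F \<in> borel_measurable (borel \<Otimes>\<^sub>M borel)" and s: "0 \<le> s"
  shows "N s (collide F) \<le> 2 * N2 s F"
proof -
  have "\<bar>(1 - \<alpha>) * gain F v - loss F v\<bar> \<le> \<bar>gain F v\<bar> + \<bar>loss F v\<bar>" for v
  proof -
    have "\<bar>(1 - \<alpha>) * gain F v\<bar> \<le> 1 * \<bar>gain F v\<bar>" unfolding abs_mult using \<alpha> by (intro mult_right_mono) auto
    then show ?thesis by linarith
  qed
  then have "N s (collide F) \<le> N s (gain F) + N s (loss F)"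
    by (intro N_triangle) (auto simp: collide_def)
  also have "\<dots> \<le> N2 s F + N2 s F"
    using s by (intro add_mono N_gain_le N_loss_le) auto
  finally show ?thesis by (simp add: mult_2)
qed

lemma AE_collide_diff:
  assumes [measurable]: "F \<in> borel_measurable (borel \<Otimes>\<^sub>M borel)" "G \<in> borel_measurable (borel \<Otimes>\<^sub>M borel)"
    and s: "0 \<le> s" and fin: "N2 s F < \<infinity>" "N2 s G < \<infinity>"
  shows "AE v in lborel. collide F v - collide G v = collide (\<lambda>p. F p - G p) v"
proof -
  have F: "(\<integral>\<^sup>+v. \<integral>\<^sup>+w. ennreal \<bar>F (v, w)\<bar> \<partial>lborel \<partial>lborel) < \<infinity>"
   and G: "(\<integral>\<^sup>+v. \<integral>\<^sup>+w. ennreal \<bar>G (v, w)\<bar> \<partial>lborel \<partial>lborel) < \<infinity>"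
    using nn_integral_abs_le_N2[OF s, of F] nn_integral_abs_le_N2[OF s, of G] fin
    by (auto intro: le_less_trans)
  have "AE v in lborel. gain F v - gain G v = gain (\<lambda>p. F p - G p) v"
    "AE v in lborel. loss F v - loss G v = loss (\<lambda>p. F p - G p) v"
    by (rule AE_gain_diff AE_loss_diff; use F G in simp)+
  then show ?thesis
    by eventually_elim (simp add: collide_def algebra_simps flip: right_diff_distrib)
qed

lemma rateD: "rate k \<Longrightarrow> k \<in> borel_measurable borel" "rate k \<Longrightarrow> 0 \<le> k r" "rate k \<Longrightarrow> k r \<le> r powr \<gamma>"
  by (auto simp: rate_def)

lemma N2_pairs:
  assumes k: "rate k" and [measurable]: "f \<in> borel_measurable borel"
  shows "N2 s (pairs k f) \<le> 2 * (N (s + \<gamma> / 2) f * N (s + \<gamma> / 2) f)"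
proof -
  note [measurable] = rateD(1)[OF k]
  have "N2 s (pairs k f) \<le> ennreal (2 * 1) * (N (s + \<gamma> / 2) f * N (s + \<gamma> / 2) f)"
    by (rule N2_product)
       (use \<gamma> rateD[OF k] in \<open>auto simp: pairs_def abs_mult mult.assoc intro!: mult_right_mono\<close>)
  then show ?thesis by simp
qed

lemma N_collide_pairs_le:
  assumes k: "rate k" and [measurable]: "f \<in> borel_measurable borel" and s: "0 \<le> s"
  shows "N s (collide (pairs k f)) \<le> 4 * (N (s + \<gamma> / 2) f * N (s + \<gamma> / 2) f)"
proof -
  note [measurable] = rateD(1)[OF k]
  have "N s (collide (pairs k f)) \<le> 2 * N2 s (pairs k f)" using s by (intro N_collide_le) auto
  also have "\<dots> \<le> 2 * (2 * (N (s + \<gamma> / 2) f * N (s + \<gamma> / 2) f))"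
    by (intro mult_left_mono N2_pairs k) auto
  finally show ?thesis by (simp add: mult.assoc[symmetric])
qed

text \<open>Telescoping the trilinear expression \<open>k f f\<close> into three terms, each with one difference.\<close>

lemma N_collide_pairs_diff_le:
  assumes k: "rate k" "rate k'" and [measurable]: "f \<in> borel_measurable borel" "g \<in> borel_measurable borel"
    and s: "0 \<le> s" and \<kappa>: "0 \<le> \<kappa>" "\<kappa> \<le> 1" and \<epsilon>: "0 \<le> \<epsilon>"
    and kk: "\<And>r. \<bar>k r - k' r\<bar> \<le> \<epsilon> * r powr (\<gamma> * (1 + \<kappa>))"
    and fin: "N (s + \<gamma> / 2) f < \<infinity>" "N (s + \<gamma> / 2) g < \<infinity>"
  shows "N s (\<lambda>v. collide (pairs k f) v - collide (pairs k' g) v) \<le>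
      4 * (N (s + \<gamma> / 2) (\<lambda>v. f v - g v) * (N (s + \<gamma> / 2) f + N (s + \<gamma> / 2) g)) +
      ennreal (4 * \<epsilon>) * (N (s + \<gamma> * (1 + \<kappa>) / 2) g * N (s + \<gamma> * (1 + \<kappa>) / 2) g)"
proof -
  let ?p = "s + \<gamma> / 2" and ?h = "\<lambda>v. f v - g v"
  note [measurable] = rateD(1)[OF k(1)] rateD(1)[OF k(2)]
  define F1 where "F1 p = k (norm (fst p - snd p)) * (?h (fst p) * f (snd p))" for p
  define F2 where "F2 p = k (norm (fst p - snd p)) * (g (fst p) * ?h (snd p))" for p
  define F3 where "F3 p = (k (norm (fst p - snd p)) - k' (norm (fst p - snd p))) * (g (fst p) * g (snd p))" for p
  have [measurable]: "F1 \<in> borel_measurable (borel \<Otimes>\<^sub>M borel)" "F2 \<in> borel_measurable (borel \<Otimes>\<^sub>M borel)"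
    "F3 \<in> borel_measurable (borel \<Otimes>\<^sub>M borel)"
    unfolding F1_def[abs_def] F2_def[abs_def] F3_def[abs_def] by measurable
  have sum: "pairs k f p - pairs k' g p = F1 p + F2 p + F3 p" for p
    by (simp add: pairs_def F1_def F2_def F3_def algebra_simps)
  have fin2: "N2 s (pairs k f) < \<infinity>" "N2 s (pairs k' g) < \<infinity>"
    using N2_pairs[OF k(1), of f s] N2_pairs[OF k(2), of g s] fin
    by (auto elim!: le_less_trans simp: ennreal_mult_less_top)
  have "N s (\<lambda>v. collide (pairs k f) v - collide (pairs k' g) v) = N s (collide (\<lambda>p. pairs k f p - pairs k' g p))"
    by (intro N_cong_AE AE_collide_diff[where s=s]) (use s fin2 in auto)
  also have "\<dots> \<le> 2 * N2 s (\<lambda>p. pairs k f p - pairs k' g p)"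
    using s by (intro N_collide_le) auto
  also have "\<dots> \<le> 2 * (N2 s F1 + (N2 s F2 + N2 s F3))"
  proof (intro mult_left_mono)
    have "N2 s (\<lambda>p. pairs k f p - pairs k' g p) \<le> N2 s F1 + N2 s (\<lambda>p. F2 p + F3 p)"
      by (rule N2_add) (auto simp: sum)
    also have "N2 s (\<lambda>p. F2 p + F3 p) \<le> N2 s F2 + N2 s F3"
      by (rule N2_add) auto
    finally show "N2 s (\<lambda>p. pairs k f p - pairs k' g p) \<le> N2 s F1 + (N2 s F2 + N2 s F3)"
      by (simp add: add_left_mono)
  qed simp
  also have "\<dots> \<le> 2 * (2 * (N ?p ?h * N ?p f) + (2 * (N ?p g * N ?p ?h) +
      ennreal (2 * \<epsilon>) * (N (s + \<gamma> * (1 + \<kappa>) / 2) g * N (s + \<gamma> * (1 + \<kappa>) / 2) g)))"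
  proof (intro mult_left_mono add_mono)
    have "N2 s F1 \<le> ennreal (2 * 1) * (N ?p ?h * N ?p f)"
      by (rule N2_product)
         (use \<gamma> rateD[OF k(1)] in \<open>auto simp: F1_def abs_mult intro!: mult_right_mono\<close>)
    then show "N2 s F1 \<le> 2 * (N ?p ?h * N ?p f)" by simp
    have "N2 s F2 \<le> ennreal (2 * 1) * (N ?p g * N ?p ?h)"
      by (rule N2_product)
         (use \<gamma> rateD[OF k(1)] in \<open>auto simp: F2_def abs_mult intro!: mult_right_mono\<close>)
    then show "N2 s F2 \<le> 2 * (N ?p g * N ?p ?h)" by simp
    have "\<gamma> * (1 + \<kappa>) \<le> 1 * 2" using \<gamma> \<kappa> by (intro mult_mono) auto
    then show "N2 s F3 \<le> ennreal (2 * \<epsilon>) * (N (s + \<gamma> * (1 + \<kappa>) / 2) g * N (s + \<gamma> * (1 + \<kappa>) / 2) g)"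
      using \<gamma> \<kappa> \<epsilon> kk
      by (intro N2_product) (auto simp: F3_def abs_mult mult.assoc[symmetric] intro!: mult_right_mono)
  qed simp
  also have "\<dots> = 4 * (N ?p ?h * (N ?p f + N ?p g)) +
      ennreal (4 * \<epsilon>) * (N (s + \<gamma> * (1 + \<kappa>) / 2) g * N (s + \<gamma> * (1 + \<kappa>) / 2) g)"
  proof -
    have "ennreal (4 * \<epsilon>) = 2 * ennreal (2 * \<epsilon>)"
      using \<epsilon> by (simp add: ennreal_mult[of 4] ennreal_mult[of 2] mult.assoc[symmetric])
    then show ?thesis by (simp add: distrib_left mult_ac)
  qed
  finally show ?thesis .
qed

definition freq :: "(real \<Rightarrow> real) \<Rightarrow> ('a \<Rightarrow> real) \<Rightarrow> 'a \<Rightarrow> real" where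
  "freq k f v = (LINT w|lborel. k (norm (v - w)) * f w)"

lemma loss_pairs: "loss (pairs k f) v = f v * freq k f v"
proof -
  have "loss (pairs k f) v = (LINT w|lborel. f v * (k (norm (v - w)) * f w))"
    unfolding loss_def pairs_def by (intro Bochner_Integration.integral_cong) auto
  then show ?thesis by (simp add: freq_def)
qed

lemma measurable_freq [measurable]:
  assumes [measurable]: "k \<in> borel_measurable borel" "f \<in> borel_measurable borel"
  shows "freq k f \<in> borel_measurable borel"
  unfolding freq_def[abs_def] by measurable

lemma freq_integrable:
  assumes k: "rate k" "\<And>r. k r \<le> n" and [measurable]: "f \<in> borel_measurable borel" and fin: "N 0 f < \<infinity>"
  shows "integrable lborel (\<lambda>w. k (norm (v - w)) * f w)"
proof (rule integrableI_bounded)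
  note [measurable] = rateD(1)[OF k(1)]
  have n: "0 \<le> n" using rateD(2)[OF k(1), of 0] k(2)[of 0] by linarith
  have "(\<integral>\<^sup>+w. ennreal (norm (k (norm (v - w)) * f w)) \<partial>lborel) \<le> (\<integral>\<^sup>+w. ennreal n * ennreal (\<bar>f w\<bar> * weight w powr 0) \<partial>lborel)"
    using rateD(2)[OF k(1)] k(2) n
    by (intro nn_integral_mono) (auto simp: abs_mult intro!: ennreal_leI mult_right_mono simp flip: ennreal_mult)
  also have "\<dots> = ennreal n * N 0 f" by (simp add: N_def nn_integral_cmult)
  finally show "(\<integral>\<^sup>+w. ennreal (norm (k (norm (v - w)) * f w)) \<partial>lborel) < \<infinity>"
    using fin by (auto elim!: le_less_trans simp: ennreal_mult_less_top)
qed (use rateD(1)[OF k(1)] in measurable)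

text \<open>The purpose of truncating the rate: a step then removes at most a fixed fraction of the density.\<close>

lemma freq_bounds:
  assumes k: "rate k" "\<And>r. k r \<le> n" and [measurable]: "f \<in> borel_measurable borel"
    and f: "AE v in lborel. 0 \<le> f v" and m: "N 0 f \<le> ennreal m" "0 \<le> m"
  shows "0 \<le> freq k f v" "freq k f v \<le> n * m"
proof -
  have n: "0 \<le> n" using rateD(2)[OF k(1), of 0] k(2)[of 0] by linarith
  have int: "integrable lborel (\<lambda>w. k (norm (v - w)) * f w)"
    using m by (intro freq_integrable[OF k]) (auto elim!: le_less_trans)
  show nn: "0 \<le> freq k f v"
    unfolding freq_def using f rateD(2)[OF k(1)]
    by (intro integral_nonneg_AE) (auto elim!: eventually_mono)
  have "ennreal (freq k f v) = (\<integral>\<^sup>+w. ennreal (k (norm (v - w)) * f w) \<partial>lborel)"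
    unfolding freq_def using f rateD(2)[OF k(1)] int
    by (intro nn_integral_eq_integral[symmetric]) (auto elim!: eventually_mono)
  also have "\<dots> \<le> (\<integral>\<^sup>+w. ennreal n * ennreal (\<bar>f w\<bar> * weight w powr 0) \<partial>lborel)"
    using f rateD(2)[OF k(1)] k(2) n
    by (intro nn_integral_mono_AE)
      (auto elim!: eventually_mono intro!: ennreal_leI mult_mono simp flip: ennreal_mult)
  also have "\<dots> = ennreal n * N 0 f" by (simp add: N_def nn_integral_cmult)
  also have "\<dots> \<le> ennreal n * ennreal m" using m by (intro mult_left_mono) auto
  finally show "freq k f v \<le> n * m"
    using n m by (simp flip: ennreal_mult)
qed

lemma AE_loss_pairs:
  assumes k: "rate k" and [measurable]: "f \<in> borel_measurable borel"
    and f: "AE v in lborel. 0 \<le> f v" and fin: "N (\<gamma> / 2) f < \<infinity>"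
  shows "AE v in lborel. 0 \<le> loss (pairs k f) v \<and>
    ennreal (loss (pairs k f) v) = (\<integral>\<^sup>+w. ennreal \<bar>pairs k f (v, w)\<bar> \<partial>lborel)"
proof -
  note [measurable] = rateD(1)[OF k]
  have "N2 0 (pairs k f) < \<infinity>"
    using N2_pairs[OF k, of f 0] fin by (auto elim!: le_less_trans simp: ennreal_mult_less_top)
  then have "(\<integral>\<^sup>+v. \<integral>\<^sup>+w. ennreal \<bar>pairs k f (v, w)\<bar> \<partial>lborel \<partial>lborel) < \<infinity>"
    using nn_integral_abs_le_N2[of 0 "pairs k f"] by (auto elim!: le_less_trans)
  then have "AE v in lborel. integrable lborel (\<lambda>w. pairs k f (v, w))"
    by (intro AE_loss_integrable) auto
  with f show ?thesis
  proof eventually_elim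
    case (elim v)
    have nn: "AE w in lborel. 0 \<le> pairs k f (v, w)"
      using f by eventually_elim (use elim rateD(2)[OF k] in \<open>auto simp: pairs_def\<close>)
    have "(\<integral>\<^sup>+w. ennreal \<bar>pairs k f (v, w)\<bar> \<partial>lborel) = (\<integral>\<^sup>+w. ennreal (pairs k f (v, w)) \<partial>lborel)"
      by (intro nn_integral_cong_AE) (use nn in \<open>auto elim!: eventually_mono\<close>)
    then show ?case
      using elim nn by (simp add: loss_def nn_integral_eq_integral integral_nonneg_AE)
  qed
qed

text \<open>After annihilation, a collision raises the sum of \<open>\<phi>\<close> over the pair, weighted with the rate, by at most a
multiple of \<open>w(v) w(v\<^sub>*)\<close>. For \<open>C = 0\<close> the corresponding moment does not increase.\<close>

definition collision_bound :: "(real \<Rightarrow> real) \<Rightarrow> ('a \<Rightarrow> real) \<Rightarrow> real \<Rightarrow> bool" where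
  "collision_bound k \<phi> C \<longleftrightarrow> (\<forall>v w \<sigma>. norm \<sigma> = 1 \<longrightarrow>
     k (norm (v - w)) * ((1 - \<alpha>) * (\<phi> (post_coll v w \<sigma>) + \<phi> (post_coll_star v w \<sigma>)))
       \<le> k (norm (v - w)) * (\<phi> v + \<phi> w) + C * (weight v * weight w))"

text \<open>The symmetric weak form turns the pointwise collision bound into a bound of the gain by the loss.\<close>

lemma gain_moment_le:
  assumes k: "rate k" and [measurable]: "f \<in> borel_measurable borel" "\<phi> \<in> borel_measurable borel"
    and f: "AE v in lborel. 0 \<le> f v" and fin: "N (\<gamma> / 2) f < \<infinity>"
    and \<phi>: "\<And>v. 0 \<le> \<phi> v" and C: "0 \<le> C" and cb: "collision_bound k \<phi> C"
  shows "2 * (ennreal (1 - \<alpha>) * (\<integral>\<^sup>+v. ennreal (\<bar>gain (pairs k f) v\<bar> * \<phi> v) \<partial>lborel)) \<le>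
    2 * (\<integral>\<^sup>+v. ennreal (loss (pairs k f) v * \<phi> v) \<partial>lborel) + ennreal C * (N 1 f * N 1 f)"
proof -
  note [measurable] = rateD(1)[OF k]
  let ?F = "\<lambda>p. ennreal \<bar>pairs k f p\<bar>"
  let ?G = "\<lambda>p. ennreal (C * ((\<bar>f (fst p)\<bar> * weight (fst p) powr 1) * (\<bar>f (snd p)\<bar> * weight (snd p) powr 1)))"
  have pw: "ennreal (1 - \<alpha>) * (?F (v, w) * (ennreal (\<phi> (post_coll v w \<sigma>)) + ennreal (\<phi> (post_coll_star v w \<sigma>))))
      \<le> ?F (v, w) * (ennreal (\<phi> v) + ennreal (\<phi> w)) + ?G (v, w)" if \<sigma>: "norm \<sigma> = 1" for v w \<sigma> :: 'a
  proof -
    let ?k = "k (norm (v - w))"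
    have "(\<bar>f v\<bar> * \<bar>f w\<bar>) * (?k * ((1 - \<alpha>) * (\<phi> (post_coll v w \<sigma>) + \<phi> (post_coll_star v w \<sigma>))))
       \<le> (\<bar>f v\<bar> * \<bar>f w\<bar>) * (?k * (\<phi> v + \<phi> w) + C * (weight v * weight w))"
      using cb \<sigma> unfolding collision_bound_def by (intro mult_left_mono) auto
    then have "(1 - \<alpha>) * (\<bar>pairs k f (v, w)\<bar> * (\<phi> (post_coll v w \<sigma>) + \<phi> (post_coll_star v w \<sigma>)))
       \<le> \<bar>pairs k f (v, w)\<bar> * (\<phi> v + \<phi> w) + C * ((\<bar>f v\<bar> * weight v powr 1) * (\<bar>f w\<bar> * weight w powr 1))"
      using rateD(2)[OF k] by (simp add: pairs_def abs_mult algebra_simps)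
    then show ?thesis
      using \<alpha> \<phi> C by (simp flip: ennreal_mult ennreal_plus add: ennreal_leI)
  qed
  have "2 * (ennreal (1 - \<alpha>) * (\<integral>\<^sup>+v. ennreal (\<bar>gain (pairs k f) v\<bar> * \<phi> v) \<partial>lborel))
      \<le> 2 * (ennreal (1 - \<alpha>) * (\<integral>\<^sup>+v. nn_gain ?F v * ennreal (\<phi> v) \<partial>lborel))"
    using \<phi> by (intro mult_left_mono nn_integral_mono) (auto simp: ennreal_mult intro!: mult_right_mono ennreal_abs_gain_le)
  also have "\<dots> \<le> 2 * (\<integral>\<^sup>+v. \<integral>\<^sup>+w. ?F (v, w) * ennreal (\<phi> v) \<partial>lborel \<partial>lborel)
      + (\<integral>\<^sup>+v. \<integral>\<^sup>+w. ?G (v, w) \<partial>lborel \<partial>lborel)"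
    by (rule nn_gain_symmetric_le) (auto simp: pairs_def norm_minus_commute mult_ac intro: pw[unfolded pairs_def, simplified])
  also have "(\<integral>\<^sup>+v. \<integral>\<^sup>+w. ?F (v, w) * ennreal (\<phi> v) \<partial>lborel \<partial>lborel) = (\<integral>\<^sup>+v. ennreal (loss (pairs k f) v * \<phi> v) \<partial>lborel)"
  proof (rule nn_integral_cong_AE)
    have "AE v in lborel. 0 \<le> loss (pairs k f) v \<and>
        ennreal (loss (pairs k f) v) = (\<integral>\<^sup>+w. ennreal \<bar>pairs k f (v, w)\<bar> \<partial>lborel)"
      by (rule AE_loss_pairs[OF k _ f fin]) simp
    then show "AE v in lborel. (\<integral>\<^sup>+w. ?F (v, w) * ennreal (\<phi> v) \<partial>lborel) = ennreal (loss (pairs k f) v * \<phi> v)"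
      by eventually_elim (simp add: nn_integral_multc ennreal_mult \<phi>)
  qed
  also have "(\<integral>\<^sup>+v. \<integral>\<^sup>+w. ?G (v, w) \<partial>lborel \<partial>lborel) = ennreal C * (N 1 f * N 1 f)"
  proof -
    have "?G (v, w) = ennreal C * (ennreal (\<bar>f v\<bar> * weight v powr 1) * ennreal (\<bar>f w\<bar> * weight w powr 1))" for v w
      unfolding fst_conv snd_conv using C
      by (simp only: ennreal_mult mult_nonneg_nonneg abs_ge_zero powr_ge_zero)
    then show ?thesis by (simp only: N_def) (simp add: nn_integral_cmult nn_integral_multc del: powr_one)
  qed
  finally show ?thesis .
qed

definition euler :: "(real \<Rightarrow> real) \<Rightarrow> real \<Rightarrow> ('a \<Rightarrow> real) \<Rightarrow> 'a \<Rightarrow> real" where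
  "euler k \<delta> f v = f v + \<delta> * collide (pairs k f) v"

lemma measurable_euler [measurable]:
  assumes "rate k" and [measurable]: "f \<in> borel_measurable borel"
  shows "euler k \<delta> f \<in> borel_measurable borel"
proof -
  note [measurable] = rateD(1)[OF assms(1)]
  show ?thesis unfolding euler_def[abs_def] by measurable
qed

text \<open>A step of length at most the mean free time cannot remove more than is present.\<close>

lemma euler_nonneg:
  assumes k: "rate k" "\<And>r. k r \<le> n" and [measurable]: "f \<in> borel_measurable borel"
    and f: "\<And>v. 0 \<le> f v" and m: "N 0 f \<le> ennreal m" "0 \<le> m" and \<delta>: "0 \<le> \<delta>" "\<delta> * (n * m) \<le> 1"
  shows "0 \<le> euler k \<delta> f v"
proof -
  have "\<delta> * freq k f v \<le> \<delta> * (n * m)"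
    using \<delta> f m by (intro mult_left_mono freq_bounds[OF k]) auto
  then have "\<delta> * freq k f v \<le> 1" using \<delta> by linarith
  then have "0 \<le> f v * (1 - \<delta> * freq k f v)" using f by (intro mult_nonneg_nonneg) auto
  moreover have "0 \<le> \<delta> * ((1 - \<alpha>) * gain (pairs k f) v)"
    using \<delta> \<alpha> f rateD(2)[OF k(1)] by (intro mult_nonneg_nonneg gain_nonneg) (auto simp: pairs_def)
  ultimately show ?thesis
    by (simp add: euler_def collide_def loss_pairs algebra_simps)
qed

text \<open>The loss is added to both sides before integrating, which keeps all terms nonnegative; being finite, it
can be cancelled at the end.\<close>

lemma euler_moment_le:
  assumes k: "rate k" and [measurable]: "f \<in> borel_measurable borel" "\<phi> \<in> borel_measurable borel"
    and f: "AE v in lborel. 0 \<le> f v" and fin: "N (1 + \<gamma> / 2) f < \<infinity>"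
    and \<phi>: "\<And>v. 0 \<le> \<phi> v" "\<And>v. \<phi> v \<le> c * weight v" and C: "0 \<le> C" and cb: "collision_bound k \<phi> C"
    and \<delta>: "0 \<le> \<delta>" and E: "AE v in lborel. 0 \<le> euler k \<delta> f v"
  shows "(\<integral>\<^sup>+v. ennreal (euler k \<delta> f v * \<phi> v) \<partial>lborel) \<le>
    (\<integral>\<^sup>+v. ennreal (f v * \<phi> v) \<partial>lborel) + ennreal (\<delta> * C / 2) * (N 1 f * N 1 f)"
proof -
  note [measurable] = rateD(1)[OF k] and [measurable] = measurable_euler[OF k]
  let ?g = "gain (pairs k f)" and ?l = "loss (pairs k f)"
  let ?L = "\<integral>\<^sup>+v. ennreal (?l v * \<phi> v) \<partial>lborel" and ?E = "\<integral>\<^sup>+v. ennreal (euler k \<delta> f v * \<phi> v) \<partial>lborel"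
    and ?I = "\<integral>\<^sup>+v. ennreal (f v * \<phi> v) \<partial>lborel" and ?G = "\<integral>\<^sup>+v. ennreal (\<bar>?g v\<bar> * \<phi> v) \<partial>lborel"
  have fin2: "N (\<gamma> / 2) f < \<infinity>" using fin N_mono_exponent[of "\<gamma> / 2" "1 + \<gamma> / 2" f] by (auto elim: le_less_trans)
  have l0: "AE v in lborel. 0 \<le> ?l v" using AE_loss_pairs[OF k _ f fin2] by (auto elim!: eventually_mono)
  have Lfin: "?L < \<infinity>"
  proof -
    have c: "0 \<le> c" using \<phi>(1)[of 0] \<phi>(2)[of 0] by (simp add: weight_def)
    have "?l v * \<phi> v \<le> c * (\<bar>?l v\<bar> * weight v powr 1)" for v
    proof -
      have "?l v * \<phi> v \<le> \<bar>?l v\<bar> * (c * weight v)" using \<phi> by (intro mult_mono) auto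
      then show ?thesis by (simp add: mult_ac)
    qed
    then have "?L \<le> (\<integral>\<^sup>+v. ennreal c * ennreal (\<bar>?l v\<bar> * weight v powr 1) \<partial>lborel)"
      using c by (intro nn_integral_mono) (auto intro!: ennreal_leI simp flip: ennreal_mult)
    also have "\<dots> = ennreal c * N 1 ?l" unfolding N_def by (rule nn_integral_cmult) measurable
    also have "\<dots> \<le> ennreal c * (2 * (N (1 + \<gamma> / 2) f * N (1 + \<gamma> / 2) f))"
      by (intro mult_left_mono order.trans[OF N_loss_le N2_pairs[OF k]]) auto
    also have "\<dots> < \<infinity>" using fin by (simp add: ennreal_mult_less_top)
    finally show ?thesis .
  qed
  have "?E + ennreal \<delta> * ?L \<le> (\<integral>\<^sup>+v. ennreal (euler k \<delta> f v * \<phi> v) + ennreal \<delta> * ennreal (?l v * \<phi> v) \<partial>lborel)"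
    by (simp add: nn_integral_add nn_integral_cmult)
  also have "\<dots> \<le> (\<integral>\<^sup>+v. ennreal (f v * \<phi> v) + ennreal \<delta> * (ennreal (1 - \<alpha>) * ennreal (\<bar>?g v\<bar> * \<phi> v)) \<partial>lborel)"
  proof (intro nn_integral_mono_AE, use f l0 E in eventually_elim)
    case (elim v)
    have "\<delta> * ((1 - \<alpha>) * ?g v) \<le> \<delta> * ((1 - \<alpha>) * \<bar>?g v\<bar>)"
      using \<delta> \<alpha> by (intro mult_left_mono) auto
    then have "euler k \<delta> f v + \<delta> * ?l v \<le> f v + \<delta> * ((1 - \<alpha>) * \<bar>?g v\<bar>)"
      by (simp add: euler_def collide_def algebra_simps)
    then have "(euler k \<delta> f v + \<delta> * ?l v) * \<phi> v \<le> (f v + \<delta> * ((1 - \<alpha>) * \<bar>?g v\<bar>)) * \<phi> v"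
      using \<phi>(1) by (intro mult_right_mono) auto
    then have "ennreal (euler k \<delta> f v * \<phi> v + \<delta> * (?l v * \<phi> v))
        \<le> ennreal (f v * \<phi> v + \<delta> * ((1 - \<alpha>) * (\<bar>?g v\<bar> * \<phi> v)))"
      by (intro ennreal_leI) (simp add: algebra_simps)
    then show ?case
      using elim \<phi>(1)[of v] \<delta> \<alpha> by (simp add: ennreal_mult ennreal_plus)
  qed
  also have "\<dots> = ?I + ennreal \<delta> * (ennreal (1 - \<alpha>) * ?G)"
    by (simp add: nn_integral_add nn_integral_cmult)
  finally have 1: "?E + ennreal \<delta> * ?L \<le> ?I + ennreal \<delta> * (ennreal (1 - \<alpha>) * ?G)" .
  have "ennreal (\<delta> / 2) * (2 * (ennreal (1 - \<alpha>) * ?G)) \<le> ennreal (\<delta> / 2) * (2 * ?L + ennreal C * (N 1 f * N 1 f))"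
    using gain_moment_le[OF k _ _ f fin2 \<phi>(1) C cb] by (intro mult_left_mono) auto
  moreover have "ennreal (\<delta> / 2) * (2 * x) = ennreal \<delta> * x" for x
  proof -
    have "ennreal (\<delta> / 2) * 2 = ennreal \<delta>" using \<delta> ennreal_mult[of "\<delta> / 2" 2] by simp
    then show ?thesis by (metis mult.assoc)
  qed
  moreover have "ennreal (\<delta> / 2) * (ennreal C * x) = ennreal (\<delta> * C / 2) * x" for x
    using \<delta> C ennreal_mult[of "\<delta> / 2" C] by (simp add: mult.assoc[symmetric])
  ultimately have 2: "ennreal \<delta> * (ennreal (1 - \<alpha>) * ?G) \<le> ennreal \<delta> * ?L + ennreal (\<delta> * C / 2) * (N 1 f * N 1 f)"
    by (simp add: distrib_left)
  have "ennreal \<delta> * ?L + ?E \<le> ennreal \<delta> * ?L + (?I + ennreal (\<delta> * C / 2) * (N 1 f * N 1 f))"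
    using order.trans[OF 1 add_left_mono[OF 2, of ?I]] by (simp add: ac_simps)
  moreover have "ennreal \<delta> * ?L \<noteq> \<infinity>" using Lfin by (simp add: ennreal_mult_eq_top_iff less_top)
  ultimately show ?thesis by (simp add: ennreal_add_left_cancel_le)
qed

text \<open>The stability estimate. With \<open>h = f - g\<close> and \<open>S = f + g\<close>, the difference of the two steps is
\<open>h (1 - \<delta>/2 L) - \<delta>/2 S (Lf - Lg) + \<delta> (1 - \<alpha>) gain D\<close>, where \<open>Lf\<close>, \<open>Lg\<close> are the collision frequencies and \<open>L\<close> is
their sum. The first factor is nonnegative for a short step, so the loss takes away \<open>\<delta>/2 X\<close> from the norm of \<open>h\<close>. The
second term is at most \<open>\<delta>/2 Y\<close> and, by concavity of the weight, the third at most \<open>\<delta>/2 (X + Y)\<close>. The \<open>X\<close> terms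
cancel, and in \<open>Y\<close> the weight sits on \<open>S\<close>.\<close>

lemma euler_contraction:
  assumes k: "rate k" "\<And>r. k r \<le> n"
    and [measurable]: "f \<in> borel_measurable borel" "g \<in> borel_measurable borel"
    and f: "AE v in lborel. 0 \<le> f v" and g: "AE v in lborel. 0 \<le> g v"
    and m: "N 0 f \<le> ennreal m" "N 0 g \<le> ennreal m" "0 \<le> m" and \<delta>: "0 \<le> \<delta>" "\<delta> * (n * m) \<le> 1"
    and q: "\<gamma> / 2 \<le> q" "q \<le> 1" "2 powr (1 - q) * (1 - \<alpha>) \<le> 1"
    and fin: "N (q + \<gamma> / 2) f < \<infinity>" "N (q + \<gamma> / 2) g < \<infinity>"
  shows "N q (\<lambda>v. euler k \<delta> f v - euler k \<delta> g v) \<le>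
    N q (\<lambda>v. f v - g v) + ennreal (2 * \<delta>) * (N (q + \<gamma> / 2) (\<lambda>v. f v + g v) * N q (\<lambda>v. f v - g v))"
proof -
  note [measurable] = rateD(1)[OF k(1)] and [measurable] = measurable_euler[OF k(1)]
  have k0: "0 \<le> k r" for r using rateD(2)[OF k(1)] .
  have q0: "0 \<le> q" using q \<gamma> by linarith
  define h where "h v = f v - g v" for v
  define S where "S v = f v + g v" for v
  have [measurable]: "h \<in> borel_measurable borel" "S \<in> borel_measurable borel"
    unfolding h_def[abs_def] S_def[abs_def] by measurable
  define D where "D p = pairs k f p - pairs k g p" for p
  have [measurable]: "D \<in> borel_measurable (borel \<Otimes>\<^sub>M borel)"
    unfolding D_def[abs_def] by measurable
  \<comment> \<open>\<open>A\<close> puts the difference on the first velocity, \<open>A'\<close> on its partner; \<open>X\<close> and \<open>Y\<close> are the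
  integrals of these against the weight of the first velocity.\<close>
  define A where "A p = ennreal (k (norm (fst p - snd p)) * (\<bar>h (fst p)\<bar> * \<bar>S (snd p)\<bar>))" for p
  define A' where "A' p = ennreal (k (norm (fst p - snd p)) * (\<bar>S (fst p)\<bar> * \<bar>h (snd p)\<bar>))" for p
  have [measurable]: "A \<in> borel_measurable (borel \<Otimes>\<^sub>M borel)" "A' \<in> borel_measurable (borel \<Otimes>\<^sub>M borel)"
    unfolding A_def[abs_def] A'_def[abs_def] by measurable
  let ?w = "\<lambda>v::'a. weight v powr q"
  define X where "X = (\<integral>\<^sup>+v. \<integral>\<^sup>+w. A (v, w) * ennreal (?w v) \<partial>lborel \<partial>lborel)"
  define Y where "Y = (\<integral>\<^sup>+v. \<integral>\<^sup>+w. A' (v, w) * ennreal (?w v) \<partial>lborel \<partial>lborel)"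
  have fin0: "N 0 f < \<infinity>" "N 0 g < \<infinity>"
    using m by (auto elim!: le_less_trans)
  have int: "integrable lborel (\<lambda>w. k (norm (v - w)) * f w)" "integrable lborel (\<lambda>w. k (norm (v - w)) * g w)" for v
    by (rule freq_integrable[OF k]; use fin0 in simp)+
  define L where "L v = freq k f v + freq k g v" for v
  \<comment> \<open>Each collision frequency is at most \<open>n m\<close>, and \<open>\<delta> n m \<le> 1\<close>.\<close>
  have L: "0 \<le> L v" "\<delta> * L v \<le> 2" for v
  proof -
    have b: "0 \<le> freq k f v" "freq k f v \<le> n * m" "0 \<le> freq k g v" "freq k g v \<le> n * m"
      using freq_bounds[OF k _ f m(1,3)] freq_bounds[OF k _ g m(2,3)] by auto
    show "0 \<le> L v" using b by (simp add: L_def)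
    have "\<delta> * freq k f v \<le> \<delta> * (n * m)" "\<delta> * freq k g v \<le> \<delta> * (n * m)"
      using b \<delta> by (auto intro: mult_left_mono)
    then show "\<delta> * L v \<le> 2" using \<delta> by (simp add: L_def distrib_left)
  qed
  have [measurable]: "L \<in> borel_measurable borel" unfolding L_def[abs_def] by measurable
  \<comment> \<open>\<open>A\<close> is exactly what the loss term removes, \<open>A'\<close> dominates what the change of the frequency adds.\<close>
  have AL: "(\<integral>\<^sup>+w. A (v, w) \<partial>lborel) = ennreal (\<bar>h v\<bar> * L v)" for v
  proof -
    have "(\<integral>\<^sup>+w. A (v, w) \<partial>lborel) = (\<integral>\<^sup>+w. ennreal \<bar>h v\<bar> * ennreal (k (norm (v - w)) * f w + k (norm (v - w)) * g w) \<partial>lborel)"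
    proof (rule nn_integral_cong_AE, use f g in eventually_elim)
      case (elim w)
      then show ?case using k0
        by (simp add: A_def S_def ennreal_mult[symmetric] algebra_simps del: ennreal_plus)
    qed
    also have "\<dots> = ennreal \<bar>h v\<bar> * (\<integral>\<^sup>+w. ennreal (k (norm (v - w)) * f w + k (norm (v - w)) * g w) \<partial>lborel)"
      by (rule nn_integral_cmult) measurable
    also have "(\<integral>\<^sup>+w. ennreal (k (norm (v - w)) * f w + k (norm (v - w)) * g w) \<partial>lborel) = ennreal (L v)"
    proof (subst nn_integral_eq_integral)
      show "integrable lborel (\<lambda>w. k (norm (v - w)) * f w + k (norm (v - w)) * g w)"
        using int by (intro Bochner_Integration.integrable_add)
      show "AE w in lborel. 0 \<le> k (norm (v - w)) * f w + k (norm (v - w)) * g w"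
        using f g by eventually_elim (simp add: k0)
    qed (simp add: int L_def freq_def)
    finally show ?thesis by (simp add: ennreal_mult L)
  qed
  have A'h: "ennreal (\<bar>S v\<bar> * \<bar>freq k f v - freq k g v\<bar>) \<le> (\<integral>\<^sup>+w. A' (v, w) \<partial>lborel)" for v
  proof -
    have "freq k f v - freq k g v = (LINT w|lborel. k (norm (v - w)) * f w - k (norm (v - w)) * g w)"
      by (simp add: freq_def int)
    also have "ennreal \<bar>\<dots>\<bar> \<le> (\<integral>\<^sup>+w. ennreal \<bar>k (norm (v - w)) * f w - k (norm (v - w)) * g w\<bar> \<partial>lborel)"
      using integral_norm_bound_ennreal[OF Bochner_Integration.integrable_diff[OF int[of v]]] by simp
    finally have "ennreal \<bar>S v\<bar> * ennreal \<bar>freq k f v - freq k g v\<bar> \<le>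
        ennreal \<bar>S v\<bar> * (\<integral>\<^sup>+w. ennreal \<bar>k (norm (v - w)) * f w - k (norm (v - w)) * g w\<bar> \<partial>lborel)"
      by (rule mult_left_mono) simp
    also have "\<dots> = (\<integral>\<^sup>+w. ennreal \<bar>S v\<bar> * ennreal \<bar>k (norm (v - w)) * f w - k (norm (v - w)) * g w\<bar> \<partial>lborel)"
      by (rule nn_integral_cmult[symmetric]) measurable
    also have "\<dots> = (\<integral>\<^sup>+w. A' (v, w) \<partial>lborel)"
    proof (rule nn_integral_cong)
      fix w
      have "\<bar>k (norm (v - w)) * f w - k (norm (v - w)) * g w\<bar> = k (norm (v - w)) * \<bar>h w\<bar>"
        using k0[of "norm (v - w)"] by (simp add: h_def abs_mult flip: right_diff_distrib)
      then show "ennreal \<bar>S v\<bar> * ennreal \<bar>k (norm (v - w)) * f w - k (norm (v - w)) * g w\<bar> = A' (v, w)"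
        using k0[of "norm (v - w)"] by (simp add: A'_def mult.left_commute flip: ennreal_mult)
    qed
    finally show ?thesis by (simp add: ennreal_mult)
  qed
  have fin2: "N2 0 (pairs k f) < \<infinity>" "N2 0 (pairs k g) < \<infinity>"
  proof -
    have "N (0 + \<gamma> / 2) f < \<infinity>" "N (0 + \<gamma> / 2) g < \<infinity>"
      using le_less_trans[OF N_mono_exponent[of "0 + \<gamma> / 2" "q + \<gamma> / 2" f] fin(1)]
        le_less_trans[OF N_mono_exponent[of "0 + \<gamma> / 2" "q + \<gamma> / 2" g] fin(2)] q0 by auto
    then show "N2 0 (pairs k f) < \<infinity>" "N2 0 (pairs k g) < \<infinity>"
      using N2_pairs[OF k(1), of f 0] N2_pairs[OF k(1), of g 0]
      by (auto elim!: le_less_trans simp: ennreal_mult_less_top)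
  qed
  have gain_diff: "AE v in lborel. gain (pairs k f) v - gain (pairs k g) v = gain D v"
    unfolding D_def
    using fin2 nn_integral_abs_le_N2[of 0 "pairs k f"] nn_integral_abs_le_N2[of 0 "pairs k g"]
    by (intro AE_gain_diff) (auto elim!: le_less_trans)
  \<comment> \<open>The polarised pair density \<open>D\<close> is dominated by the symmetric function \<open>(A + A')/2\<close>.\<close>
  have gain_D: "ennreal (1 - \<alpha>) * (\<integral>\<^sup>+v. ennreal (\<bar>gain D v\<bar> * ?w v) \<partial>lborel) \<le> ennreal (1 / 2) * (X + Y)"
  proof -
    let ?F = "\<lambda>p. ennreal (1 / 2) * (A p + A' p)"
    have DF: "ennreal \<bar>D p\<bar> \<le> ?F p" for p
    proof -
      obtain v w where p: "p = (v, w)" by (cases p)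
      have "D p = (1 / 2) * (k (norm (v - w)) * (h v * S w) + k (norm (v - w)) * (S v * h w))"
        by (simp add: D_def pairs_def h_def S_def p algebra_simps)
      also have "\<bar>\<dots>\<bar> \<le> (1 / 2) * (k (norm (v - w)) * (\<bar>h v\<bar> * \<bar>S w\<bar>) + k (norm (v - w)) * (\<bar>S v\<bar> * \<bar>h w\<bar>))"
        unfolding abs_mult using k0 by (simp add: abs_mult order.trans[OF abs_triangle_ineq])
      finally have "ennreal \<bar>D p\<bar> \<le> ennreal ((1 / 2) * (k (norm (v - w)) * (\<bar>h v\<bar> * \<bar>S w\<bar>) + k (norm (v - w)) * (\<bar>S v\<bar> * \<bar>h w\<bar>)))"
        by (rule ennreal_leI)
      also have "\<dots> = ?F p"
        using k0 by (simp only: A_def A'_def p fst_conv snd_conv ennreal_mult[symmetric] ennreal_plus[symmetric]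
            mult_nonneg_nonneg abs_ge_zero add_nonneg_nonneg k0)
      finally show ?thesis .
    qed
    have "(\<integral>\<^sup>+v. ennreal (\<bar>gain D v\<bar> * ?w v) \<partial>lborel) \<le> (\<integral>\<^sup>+v. nn_gain ?F v * ennreal (?w v) \<partial>lborel)"
    proof (rule nn_integral_mono)
      fix v
      have "ennreal \<bar>gain D v\<bar> \<le> nn_gain (\<lambda>p. ennreal \<bar>D p\<bar>) v" by (rule ennreal_abs_gain_le) simp
      also have "\<dots> \<le> nn_gain ?F v"
        unfolding nn_gain_def by (intro nn_integral_mono mult_left_mono DF) auto
      finally show "ennreal (\<bar>gain D v\<bar> * ?w v) \<le> nn_gain ?F v * ennreal (?w v)"
        by (simp add: ennreal_mult mult_right_mono)
    qed
    then have "2 * (ennreal (1 - \<alpha>) * (\<integral>\<^sup>+v. ennreal (\<bar>gain D v\<bar> * ?w v) \<partial>lborel)) \<le>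
        2 * (ennreal (1 - \<alpha>) * (\<integral>\<^sup>+v. nn_gain ?F v * ennreal (?w v) \<partial>lborel))"
      by (intro mult_left_mono) auto
    also have "\<dots> \<le> 2 * (\<integral>\<^sup>+v. \<integral>\<^sup>+w. ?F (v, w) * ennreal (?w v) \<partial>lborel \<partial>lborel) + (\<integral>\<^sup>+v. \<integral>\<^sup>+w. 0 \<partial>(lborel :: 'a measure) \<partial>(lborel :: 'a measure))"
    proof (rule nn_gain_symmetric_le[where G="\<lambda>_. 0"])
      show "?F (v, w) = ?F (w, v)" for v w
        by (simp add: A_def A'_def norm_minus_commute mult_ac add.commute)
      fix v w \<sigma> :: 'a assume \<sigma>: "norm \<sigma> = 1"
      have "ennreal (1 - \<alpha>) * (ennreal (?w (post_coll v w \<sigma>)) + ennreal (?w (post_coll_star v w \<sigma>))) \<le> ennreal (?w v) + ennreal (?w w)"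
        using gain_concave_weight_le[OF \<sigma> q0 q(2) _ q(3), of v w] \<alpha>
        by (simp flip: ennreal_plus ennreal_mult add: ennreal_leI)
      then have "?F (v, w) * (ennreal (1 - \<alpha>) * (ennreal (?w (post_coll v w \<sigma>)) + ennreal (?w (post_coll_star v w \<sigma>))))
          \<le> ?F (v, w) * (ennreal (?w v) + ennreal (?w w))"
        by (rule mult_left_mono) simp
      then show "ennreal (1 - \<alpha>) * (?F (v, w) * (ennreal (?w (post_coll v w \<sigma>)) + ennreal (?w (post_coll_star v w \<sigma>))))
          \<le> ?F (v, w) * (ennreal (?w v) + ennreal (?w w)) + 0"
        by (simp only: mult.left_commute add_0_right)
    qed measurable
    also have "(\<integral>\<^sup>+v. \<integral>\<^sup>+w. ?F (v, w) * ennreal (?w v) \<partial>lborel \<partial>lborel) = ennreal (1 / 2) * (X + Y)"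
    proof -
      have "(\<integral>\<^sup>+v. \<integral>\<^sup>+w. ?F (v, w) * ennreal (?w v) \<partial>lborel \<partial>lborel) =
        (\<integral>\<^sup>+v. \<integral>\<^sup>+w. ennreal (1 / 2) * (A (v, w) * ennreal (?w v) + A' (v, w) * ennreal (?w v)) \<partial>lborel \<partial>lborel)"
        by (intro nn_integral_cong) (simp only: distrib_right mult.assoc)
      also have "\<dots> = ennreal (1 / 2) * (X + Y)"
        unfolding X_def Y_def by (simp add: nn_integral_cmult nn_integral_add)
      finally show ?thesis .
    qed
    finally show ?thesis by (simp add: ennreal_mult_le_mult_iff)
  qed
  have Xh: "X = (\<integral>\<^sup>+v. ennreal (\<bar>h v\<bar> * L v) * ennreal (?w v) \<partial>lborel)"
    unfolding X_def by (simp add: nn_integral_multc AL)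
  have Yh: "(\<integral>\<^sup>+v. ennreal (\<bar>S v\<bar> * \<bar>freq k f v - freq k g v\<bar>) * ennreal (?w v) \<partial>lborel) \<le> Y"
    unfolding Y_def by (simp add: nn_integral_multc) (intro nn_integral_mono mult_right_mono A'h, simp)
  \<comment> \<open>In \<open>Y\<close> the function \<open>h\<close> only meets the weight of the rate, of order \<open>\<gamma>/2 \<le> q\<close>.\<close>
  have Y_le: "Y \<le> 2 * (N (q + \<gamma> / 2) S * N q h)"
  proof -
    have "Y \<le> (\<integral>\<^sup>+v. \<integral>\<^sup>+w. 2 * (ennreal (\<bar>S v\<bar> * weight v powr (q + \<gamma> / 2)) * ennreal (\<bar>h w\<bar> * weight w powr q)) \<partial>lborel \<partial>lborel)"
      unfolding Y_def
    proof (intro nn_integral_mono)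
      fix v w :: 'a
      have "k (norm (v - w)) \<le> 2 * (weight v powr (\<gamma> / 2) * weight w powr (\<gamma> / 2))"
        using norm_diff_powr_le_product[of \<gamma> v w] rateD(3)[OF k(1), of "norm (v - w)"] \<gamma> by simp
      also have "\<dots> \<le> 2 * (weight v powr (\<gamma> / 2) * weight w powr q)"
        using q by (intro mult_left_mono powr_mono) auto
      finally have "k (norm (v - w)) * (\<bar>S v\<bar> * \<bar>h w\<bar>) * ?w v
          \<le> (2 * (weight v powr (\<gamma> / 2) * weight w powr q)) * (\<bar>S v\<bar> * \<bar>h w\<bar>) * ?w v"
        by (intro mult_right_mono) auto
      also have "\<dots> = 2 * ((\<bar>S v\<bar> * weight v powr (q + \<gamma> / 2)) * (\<bar>h w\<bar> * weight w powr q))"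
        by (simp add: powr_add mult_ac)
      finally have "ennreal (k (norm (v - w)) * (\<bar>S v\<bar> * \<bar>h w\<bar>) * ?w v) \<le>
        ennreal (2 * ((\<bar>S v\<bar> * weight v powr (q + \<gamma> / 2)) * (\<bar>h w\<bar> * weight w powr q)))"
        by (rule ennreal_leI)
      then show "A' (v, w) * ennreal (?w v) \<le>
        2 * (ennreal (\<bar>S v\<bar> * weight v powr (q + \<gamma> / 2)) * ennreal (\<bar>h w\<bar> * weight w powr q))"
        using k0 by (simp add: A'_def ennreal_mult)
    qed
    also have "\<dots> = 2 * (N (q + \<gamma> / 2) S * N q h)"
      by (simp add: N_def nn_integral_cmult nn_integral_multc)
    finally show ?thesis .
  qed
  let ?D = "\<lambda>v. euler k \<delta> f v - euler k \<delta> g v"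
  have pw: "AE v in lborel. \<bar>?D v\<bar> + \<delta> / 2 * (\<bar>h v\<bar> * L v) \<le>
      \<bar>h v\<bar> + \<delta> / 2 * (\<bar>S v\<bar> * \<bar>freq k f v - freq k g v\<bar>) + \<delta> * ((1 - \<alpha>) * \<bar>gain D v\<bar>)"
    using gain_diff
  proof eventually_elim
    case (elim v)
    let ?a = "freq k f v" and ?b = "freq k g v"
    have "?D v = h v * (1 - \<delta> / 2 * L v) - \<delta> / 2 * (S v * (?a - ?b)) + \<delta> * ((1 - \<alpha>) * (gain (pairs k f) v - gain (pairs k g) v))"
      by (simp add: euler_def collide_def loss_pairs h_def S_def L_def field_simps)
    then have "?D v = h v * (1 - \<delta> / 2 * L v) - \<delta> / 2 * (S v * (?a - ?b)) + \<delta> * ((1 - \<alpha>) * gain D v)"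
      by (simp only: elim)
    then have "\<bar>?D v\<bar> \<le> \<bar>h v * (1 - \<delta> / 2 * L v)\<bar> + \<bar>\<delta> / 2 * (S v * (?a - ?b))\<bar> + \<bar>\<delta> * ((1 - \<alpha>) * gain D v)\<bar>"
      by linarith
    also have "\<bar>h v * (1 - \<delta> / 2 * L v)\<bar> = \<bar>h v\<bar> * (1 - \<delta> / 2 * L v)"
      using L(2)[of v] by (subst abs_mult) simp
    also have "\<dots> = \<bar>h v\<bar> - \<delta> / 2 * (\<bar>h v\<bar> * L v)"
      by (simp add: right_diff_distrib)
    also have "\<bar>\<delta> / 2 * (S v * (?a - ?b))\<bar> = \<delta> / 2 * (\<bar>S v\<bar> * \<bar>?a - ?b\<bar>)"
      using \<delta> by (simp add: abs_mult)
    also have "\<bar>\<delta> * ((1 - \<alpha>) * gain D v)\<bar> = \<delta> * ((1 - \<alpha>) * \<bar>gain D v\<bar>)"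
      using \<delta> \<alpha> by (simp add: abs_mult)
    finally show ?case by linarith
  qed
  \<comment> \<open>The loss contribution stays on the left, so that all terms remain nonnegative.\<close>
  have main: "N q ?D + ennreal (\<delta> / 2) * X \<le> N q h + ennreal (\<delta> / 2) * Y +
      ennreal \<delta> * (ennreal (1 - \<alpha>) * (\<integral>\<^sup>+v. ennreal (\<bar>gain D v\<bar> * ?w v) \<partial>lborel))"
  proof -
    have "N q ?D + ennreal (\<delta> / 2) * X = (\<integral>\<^sup>+v. ennreal (\<bar>?D v\<bar> * ?w v) +
        ennreal (\<delta> / 2) * (ennreal (\<bar>h v\<bar> * L v) * ennreal (?w v)) \<partial>lborel)"
      unfolding N_def Xh by (simp add: nn_integral_add nn_integral_cmult)
    also have "\<dots> \<le> (\<integral>\<^sup>+v. ennreal (\<bar>h v\<bar> * ?w v) + ennreal (\<delta> / 2) * (ennreal (\<bar>S v\<bar> * \<bar>freq k f v - freq k g v\<bar>) * ennreal (?w v))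
        + ennreal \<delta> * (ennreal (1 - \<alpha>) * ennreal (\<bar>gain D v\<bar> * ?w v)) \<partial>lborel)"
    proof (intro nn_integral_mono_AE, use pw in eventually_elim)
      case (elim v)
      have "(\<bar>?D v\<bar> + \<delta> / 2 * (\<bar>h v\<bar> * L v)) * ?w v \<le>
        (\<bar>h v\<bar> + \<delta> / 2 * (\<bar>S v\<bar> * \<bar>freq k f v - freq k g v\<bar>) + \<delta> * ((1 - \<alpha>) * \<bar>gain D v\<bar>)) * ?w v"
        by (rule mult_right_mono[OF elim]) simp
      then have "ennreal (\<bar>?D v\<bar> * ?w v + \<delta> / 2 * ((\<bar>h v\<bar> * L v) * ?w v)) \<le>
        ennreal (\<bar>h v\<bar> * ?w v + \<delta> / 2 * ((\<bar>S v\<bar> * \<bar>freq k f v - freq k g v\<bar>) * ?w v) + \<delta> * ((1 - \<alpha>) * (\<bar>gain D v\<bar> * ?w v)))"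
        by (intro ennreal_leI) (simp only: distrib_right mult.assoc)
      moreover have "0 \<le> \<delta> / 2" "0 \<le> 1 - \<alpha>" using \<delta> \<alpha> by auto
      ultimately show ?case
        using \<delta>(1) L(1)[of v]
        by (simp only: ennreal_mult ennreal_plus mult_nonneg_nonneg add_nonneg_nonneg abs_ge_zero powr_ge_zero)
    qed
    also have "\<dots> = N q h + ennreal (\<delta> / 2) * (\<integral>\<^sup>+v. ennreal (\<bar>S v\<bar> * \<bar>freq k f v - freq k g v\<bar>) * ennreal (?w v) \<partial>lborel) +
      ennreal \<delta> * (ennreal (1 - \<alpha>) * (\<integral>\<^sup>+v. ennreal (\<bar>gain D v\<bar> * ?w v) \<partial>lborel))"
      unfolding N_def by (simp add: nn_integral_add nn_integral_cmult)
    also have "\<dots> \<le> N q h + ennreal (\<delta> / 2) * Y + ennreal \<delta> * (ennreal (1 - \<alpha>) * (\<integral>\<^sup>+v. ennreal (\<bar>gain D v\<bar> * ?w v) \<partial>lborel))"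
      by (intro add_mono mult_left_mono Yh) auto
    finally show ?thesis .
  qed
  also have "\<dots> \<le> N q h + ennreal (\<delta> / 2) * Y + ennreal \<delta> * (ennreal (1 / 2) * (X + Y))"
    by (intro add_mono mult_left_mono gain_D) auto
  also have "ennreal \<delta> * (ennreal (1 / 2) * (X + Y)) = ennreal (\<delta> / 2) * X + ennreal (\<delta> / 2) * Y"
    using \<delta> ennreal_mult[of \<delta> "1 / 2"] by (simp add: distrib_left mult.assoc[symmetric])
  finally have "ennreal (\<delta> / 2) * X + N q ?D \<le> ennreal (\<delta> / 2) * X + (N q h + (ennreal (\<delta> / 2) * Y + ennreal (\<delta> / 2) * Y))"
    by (simp add: ac_simps)
  \<comment> \<open>\<open>X\<close> is finite because the step is short, so it may be cancelled.\<close>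
  moreover have "ennreal (\<delta> / 2) * X \<noteq> \<infinity>"
  proof -
    have "ennreal (\<delta> / 2) * X = (\<integral>\<^sup>+v. ennreal (\<delta> / 2) * (ennreal (\<bar>h v\<bar> * L v) * ennreal (?w v)) \<partial>lborel)"
      unfolding Xh by (rule nn_integral_cmult[symmetric]) measurable
    also have "\<dots> \<le> N q h"
      unfolding N_def
    proof (rule nn_integral_mono)
      fix v
      have "(\<delta> / 2 * L v) * (\<bar>h v\<bar> * ?w v) \<le> 1 * (\<bar>h v\<bar> * ?w v)"
        using L(2)[of v] by (intro mult_right_mono) auto
      then have "ennreal (\<delta> / 2 * ((\<bar>h v\<bar> * L v) * ?w v)) \<le> ennreal (\<bar>h v\<bar> * ?w v)"
        by (intro ennreal_leI) (simp add: mult_ac)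
      moreover have "0 \<le> \<delta> / 2" using \<delta> by auto
      ultimately show "ennreal (\<delta> / 2) * (ennreal (\<bar>h v\<bar> * L v) * ennreal (?w v)) \<le> ennreal (\<bar>h v\<bar> * ?w v)"
        using L(1)[of v] by (simp only: ennreal_mult mult_nonneg_nonneg abs_ge_zero powr_ge_zero)
    qed
    also have "\<dots> \<le> N q f + N q g"
      by (rule N_triangle) (auto simp: h_def)
    also have "\<dots> < \<infinity>"
      using fin N_mono_exponent[of q "q + \<gamma> / 2" f] N_mono_exponent[of q "q + \<gamma> / 2" g] \<gamma>
      by (auto intro: le_less_trans)
    finally show ?thesis by simp
  qed
  ultimately have "N q ?D \<le> N q h + (ennreal (\<delta> / 2) * Y + ennreal (\<delta> / 2) * Y)"
    by (simp add: ennreal_add_left_cancel_le)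
  also have "ennreal (\<delta> / 2) * Y + ennreal (\<delta> / 2) * Y = ennreal \<delta> * Y"
    using \<delta> ennreal_plus[of "\<delta> / 2" "\<delta> / 2"] by (simp add: distrib_right[symmetric])
  also have "N q h + ennreal \<delta> * Y \<le> N q h + ennreal \<delta> * (2 * (N (q + \<gamma> / 2) S * N q h))"
    by (intro add_left_mono mult_left_mono Y_le) auto
  also have "\<dots> = N q h + ennreal (2 * \<delta>) * (N (q + \<gamma> / 2) S * N q h)"
    using \<delta> by (simp add: ennreal_mult mult_ac)
  finally show ?thesis by (simp add: h_def[abs_def] S_def[abs_def])
qed

end

section \<open>Admissible exponents and the moments of an Euler step\<close>

text \<open>Induction step of the discrete Gronwall inequality
\<open>x\<^sub>k\<^sub>+\<^sub>1 \<le> (1 + A \<delta>) x\<^sub>k + \<delta> b\<close>.\<close>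

lemma gronwall_step:
  fixes A \<delta> b :: real
  assumes "0 \<le> A" "0 \<le> \<delta>" "0 \<le> b"
  shows "(1 + A * \<delta>) * (real k * \<delta> * b * exp (A * (real k * \<delta>))) + \<delta> * b
    \<le> real (Suc k) * \<delta> * b * exp (A * (real (Suc k) * \<delta>))"
proof -
  have e: "exp (A * (real (Suc k) * \<delta>)) = exp (A * \<delta>) * exp (A * (real k * \<delta>))"
    by (simp add: algebra_simps flip: exp_add)
  have "1 + A * \<delta> \<le> exp (A * \<delta>)" by (rule exp_ge_add_one_self)
  then have "(1 + A * \<delta>) * (real k * \<delta> * b * exp (A * (real k * \<delta>))) \<le>
      exp (A * \<delta>) * (real k * \<delta> * b * exp (A * (real k * \<delta>)))"
    using assms by (intro mult_right_mono) auto
  moreover have "\<delta> * b * 1 \<le> \<delta> * b * exp (A * (real (Suc k) * \<delta>))"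
    using assms by (intro mult_left_mono) auto
  ultimately show ?thesis unfolding e by (simp add: algebra_simps)
qed

context annihilation
begin

text \<open>\<open>q\<close> is the order of the norm in which solutions are compared. The second argument of the maximum is the smallest order
with \<open>2\<^bsup>1-q\<^esup>(1 - \<alpha>) \<le> 1\<close>; the first ensures \<open>\<gamma>/2 \<le> q\<close>. The order \<open>a\<close> is that of the space
\<open>L1 (2 + \<gamma>)\<close>, \<open>p\<close> is the order needed to estimate the collision operator in order \<open>q\<close>, \<open>\<theta>\<close> is the interpolation
exponent of \<open>p\<close> between 0 and \<open>a\<close>, and \<open>\<kappa>\<close> is the power of the rate that can be given up when truncating it.\<close>

definition q :: real where "q = max (1 / 2) (1 + log 2 (1 - \<alpha>))"
definition a :: real where "a = 1 + \<gamma> / 2"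
definition p :: real where "p = q + \<gamma> / 2"
definition \<kappa> :: real where "\<kappa> = 1 - q"
definition \<theta> :: real where "\<theta> = 1 - p / a"

lemma q_bounds: "1 / 2 \<le> q" "q < 1" "2 powr (1 - q) * (1 - \<alpha>) \<le> 1" "\<gamma> / 2 \<le> q" "0 \<le> q"
proof -
  show "1 / 2 \<le> q" by (simp add: q_def)
  then show "\<gamma> / 2 \<le> q" "0 \<le> q" using \<gamma> by auto
  have "log 2 (1 - \<alpha>) < 0" using \<alpha> by (subst log_less_zero_cancel_iff) auto
  then show "q < 1" by (simp add: q_def)
  have "2 powr (1 - q) \<le> 2 powr (- log 2 (1 - \<alpha>))"
    by (rule powr_mono) (auto simp: q_def)
  also have "\<dots> = 1 / (1 - \<alpha>)"
    using \<alpha> by (simp add: powr_minus_divide)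
  finally have "2 powr (1 - q) * (1 - \<alpha>) \<le> 1 / (1 - \<alpha>) * (1 - \<alpha>)"
    using \<alpha> by (intro mult_right_mono) auto
  then show "2 powr (1 - q) * (1 - \<alpha>) \<le> 1" using \<alpha> by simp
qed

lemma exponents: "0 < \<kappa>" "\<kappa> \<le> 1" "0 < \<theta>" "\<theta> \<le> 1" "0 < a" "1 < a" "q \<le> p" "p < a" "0 \<le> p" "0 \<le> q"
    "q + \<gamma> * (1 + \<kappa>) / 2 \<le> a" "\<gamma> / 2 \<le> p" "\<gamma> / 2 \<le> a" "\<gamma> * (1 + \<kappa>) / 2 \<le> a"
proof -
  show k: "0 < \<kappa>" "\<kappa> \<le> 1" and a: "0 < a" "1 < a" and "q \<le> p" and pa: "p < a" and p: "0 \<le> p" and "0 \<le> q"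
     and "\<gamma> / 2 \<le> p" "\<gamma> / 2 \<le> a"
    using q_bounds \<gamma> by (auto simp: \<kappa>_def a_def p_def)
  show "0 < \<theta>" "\<theta> \<le> 1" using a pa p by (auto simp: \<theta>_def)
  have "\<gamma> * \<kappa> \<le> 1 * \<kappa>" using \<gamma> k by (intro mult_right_mono) auto
  moreover have "q + \<gamma> * (1 + \<kappa>) / 2 = q + \<gamma> / 2 + \<gamma> * \<kappa> / 2" by (simp add: field_simps)
  moreover have "\<kappa> = 1 - q" by (simp add: \<kappa>_def)
  ultimately show *: "q + \<gamma> * (1 + \<kappa>) / 2 \<le> a" using k unfolding a_def by linarith
  then show "\<gamma> * (1 + \<kappa>) / 2 \<le> a" using q_bounds by linarith
qed

definition hard :: "real \<Rightarrow> real" where "hard r = r powr \<gamma>"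
definition cutoff :: "real \<Rightarrow> real \<Rightarrow> real" where "cutoff n r = min (r powr \<gamma>) n"

lemma rate_hard: "rate hard"
proof -
  have "(\<lambda>r::real. r powr \<gamma>) \<in> borel_measurable borel" by measurable
  then show ?thesis by (simp add: rate_def hard_def[abs_def])
qed

lemma rate_cutoff: "0 \<le> n \<Longrightarrow> rate (cutoff n)"
proof -
  assume "0 \<le> n"
  moreover have "(\<lambda>r::real. min (r powr \<gamma>) n) \<in> borel_measurable borel" by measurable
  ultimately show ?thesis by (simp add: rate_def cutoff_def[abs_def])
qed

lemma cutoff_le: "cutoff n r \<le> n" by (simp add: cutoff_def)

text \<open>Where the rate exceeds \<open>n\<close>, a factor \<open>(x/n)\<^sup>\<kappa> \<ge> 1\<close> may be inserted.\<close>

lemma excess_le: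
  assumes n: "0 < n" and x: "x = r powr \<gamma>" "n < x"
  shows "x \<le> n powr (- \<kappa>) * r powr (\<gamma> * (1 + \<kappa>))"
proof -
  have "1 \<le> (x / n) powr \<kappa>" using n x exponents by (intro ge_one_powr_ge_zero) auto
  then have "x * 1 \<le> x * (x / n) powr \<kappa>" using n x by (intro mult_left_mono) auto
  also have "\<dots> = n powr (- \<kappa>) * (x powr 1 * x powr \<kappa>)"
    using n x by (simp add: powr_divide powr_minus_divide)
  also have "x powr 1 * x powr \<kappa> = r powr (\<gamma> * (1 + \<kappa>))"
    unfolding x(1) by (simp only: powr_add[symmetric] powr_powr distrib_left mult_1_right)
  finally show ?thesis by simp
qed

lemma cutoff_hard_diff: "0 < n \<Longrightarrow> \<bar>cutoff n r - hard r\<bar> \<le> n powr (- \<kappa>) * r powr (\<gamma> * (1 + \<kappa>))"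
  using excess_le[of n "r powr \<gamma>" r] by (auto simp: cutoff_def hard_def min_def)

lemma cutoff_diff: "0 < n \<Longrightarrow> n \<le> n' \<Longrightarrow> \<bar>cutoff n' r - cutoff n r\<bar> \<le> n powr (- \<kappa>) * r powr (\<gamma> * (1 + \<kappa>))"
  using excess_le[of n "r powr \<gamma>" r] by (auto simp: cutoff_def min_def)

lemma collision_bound_conserved:
  assumes k: "rate k" and \<phi>: "\<And>v. 0 \<le> \<phi> v"
    and cons: "\<And>v w \<sigma>. norm \<sigma> = 1 \<Longrightarrow> \<phi> (post_coll v w \<sigma>) + \<phi> (post_coll_star v w \<sigma>) = \<phi> v + \<phi> w"
  shows "collision_bound k \<phi> 0"
  unfolding collision_bound_def
proof (intro allI impI)
  fix v w \<sigma> :: 'a assume \<sigma>: "norm \<sigma> = 1"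
  have "(1 - \<alpha>) * (\<phi> v + \<phi> w) \<le> 1 * (\<phi> v + \<phi> w)"
    using \<alpha> \<phi> by (intro mult_right_mono add_nonneg_nonneg) auto
  then have "k (norm (v - w)) * ((1 - \<alpha>) * (\<phi> v + \<phi> w)) \<le> k (norm (v - w)) * (1 * (\<phi> v + \<phi> w))"
    by (rule mult_left_mono) (rule rateD(2)[OF k])
  then show "k (norm (v - w)) * ((1 - \<alpha>) * (\<phi> (post_coll v w \<sigma>) + \<phi> (post_coll_star v w \<sigma>)))
       \<le> k (norm (v - w)) * (\<phi> v + \<phi> w) + 0 * (weight v * weight w)"
    by (simp only: cons[OF \<sigma>])
qed

lemma collision_bound_mass: "rate k \<Longrightarrow> collision_bound k (\<lambda>_. 1) 0"
  by (rule collision_bound_conserved) auto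

lemma collision_bound_energy: "rate k \<Longrightarrow> collision_bound k (\<lambda>v. (norm v)\<^sup>2) 0"
  by (rule collision_bound_conserved) (auto simp: norm_post_coll_energy)

text \<open>Half of the constant in the collision bound for the truncated weight.\<close>

definition povzner_const :: real where "povzner_const = 2 * (1 + 1 / \<alpha>)"

lemma povzner_const_nonneg: "0 \<le> povzner_const" using \<alpha> by (simp add: povzner_const_def)

lemma collision_bound_trunc:
  assumes k: "rate k" and R: "1 \<le> R"
  shows "collision_bound k (\<lambda>v. trunc_weight \<gamma> R (weight v)) (2 * povzner_const)"
  unfolding collision_bound_def
proof (intro allI impI)
  fix v w \<sigma> :: 'a assume \<sigma>: "norm \<sigma> = 1"
  have "k (norm (v - w)) \<le> 2 * (weight v powr (\<gamma> / 2) + weight w powr (\<gamma> / 2))"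
    using rateD(3)[OF k, of "norm (v - w)"] norm_diff_powr_le_sum[of \<gamma> v w] \<gamma> by linarith
  then show "k (norm (v - w)) * ((1 - \<alpha>) * (trunc_weight \<gamma> R (weight (post_coll v w \<sigma>)) + trunc_weight \<gamma> R (weight (post_coll_star v w \<sigma>))))
       \<le> k (norm (v - w)) * (trunc_weight \<gamma> R (weight v) + trunc_weight \<gamma> R (weight w)) + 2 * povzner_const * (weight v * weight w)"
    using trunc_weight_bracket[OF \<gamma> \<alpha> R, of "weight v" "weight w" "weight (post_coll v w \<sigma>)" "weight (post_coll_star v w \<sigma>)" "k (norm (v - w))"]
      rateD(2)[OF k] weight_conservation[OF \<sigma>]
    by (simp add: povzner_const_def)
qed

lemma trunc_weight_bounds:
  assumes "1 \<le> R"
  shows "0 \<le> trunc_weight \<gamma> R (weight v)" "trunc_weight \<gamma> R (weight v) \<le> R powr (\<gamma> / 2) * weight v"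
    "trunc_weight \<gamma> R (weight v) \<le> weight v powr a"
proof -
  show "0 \<le> trunc_weight \<gamma> R (weight v)" by (simp add: trunc_weight_def)
  have "min (weight v) R powr (\<gamma> / 2) \<le> R powr (\<gamma> / 2)"
    using assms \<gamma> by (intro powr_mono2) auto
  then show "trunc_weight \<gamma> R (weight v) \<le> R powr (\<gamma> / 2) * weight v"
    by (simp add: trunc_weight_def mult.commute)
  have "min (weight v) R powr (\<gamma> / 2) \<le> weight v powr (\<gamma> / 2)"
    using assms \<gamma> by (intro powr_mono2) auto
  then have "weight v * min (weight v) R powr (\<gamma> / 2) \<le> weight v powr 1 * weight v powr (\<gamma> / 2)"
    by simp
  also have "\<dots> = weight v powr a" unfolding a_def by (rule powr_add[symmetric])
  finally show "trunc_weight \<gamma> R (weight v) \<le> weight v powr a" by (simp add: trunc_weight_def)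
qed

lemma measurable_trunc_weight [measurable]: "(\<lambda>v::'a. trunc_weight \<gamma> R (weight v)) \<in> borel_measurable borel"
  unfolding trunc_weight_def by measurable

text \<open>Fatou's lemma as the truncation level increases.\<close>

lemma N_a_le_of_trunc:
  fixes f :: "'a \<Rightarrow> real"
  assumes [measurable]: "f \<in> borel_measurable borel" and f: "AE v in lborel. 0 \<le> f v"
    and le: "\<And>R::nat. 1 \<le> R \<Longrightarrow> (\<integral>\<^sup>+v. ennreal (f v * trunc_weight \<gamma> (real R) (weight v)) \<partial>lborel) \<le> x"
  shows "N a f \<le> x"
proof -
  have "N a f = (\<integral>\<^sup>+v. liminf (\<lambda>n. ennreal (\<bar>f v\<bar> * trunc_weight \<gamma> (real (Suc n)) (weight v))) \<partial>lborel)"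
    unfolding N_def
  proof (rule nn_integral_cong)
    fix v :: 'a
    obtain n0 :: nat where n0: "weight v \<le> real n0" using real_arch_simple by blast
    have "trunc_weight \<gamma> (real (Suc n)) (weight v) = weight v powr a" if "n \<ge> n0" for n
    proof -
      have "min (weight v) (real (Suc n)) = weight v" using that n0 by simp
      moreover have "weight v * weight v powr (\<gamma> / 2) = weight v powr a"
        using powr_add[of "weight v" 1 "\<gamma> / 2"] by (simp add: a_def)
      ultimately show ?thesis by (simp add: trunc_weight_def)
    qed
    then have "\<forall>\<^sub>F n in sequentially. ennreal (\<bar>f v\<bar> * trunc_weight \<gamma> (real (Suc n)) (weight v)) = ennreal (\<bar>f v\<bar> * weight v powr a)"
      by (intro eventually_sequentiallyI[of n0]) simp
    then have "(\<lambda>n. ennreal (\<bar>f v\<bar> * trunc_weight \<gamma> (real (Suc n)) (weight v))) \<longlonglongrightarrow> ennreal (\<bar>f v\<bar> * weight v powr a)"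
      by (rule tendsto_eventually)
    then show "ennreal (\<bar>f v\<bar> * weight v powr a) = liminf (\<lambda>n. ennreal (\<bar>f v\<bar> * trunc_weight \<gamma> (real (Suc n)) (weight v)))"
      by (intro lim_imp_Liminf[symmetric]) auto
  qed
  also have "\<dots> \<le> liminf (\<lambda>n. \<integral>\<^sup>+v. ennreal (\<bar>f v\<bar> * trunc_weight \<gamma> (real (Suc n)) (weight v)) \<partial>lborel)"
    by (rule nn_integral_liminf) measurable
  also have "\<dots> \<le> x"
  proof (rule Liminf_le)
    have "(\<integral>\<^sup>+v. ennreal (\<bar>f v\<bar> * trunc_weight \<gamma> (real (Suc n)) (weight v)) \<partial>lborel) =
       (\<integral>\<^sup>+v. ennreal (f v * trunc_weight \<gamma> (real (Suc n)) (weight v)) \<partial>lborel)" for n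
      by (intro nn_integral_cong_AE) (use f in \<open>auto elim!: eventually_mono\<close>)
    then show "\<forall>\<^sub>F n in sequentially. (\<integral>\<^sup>+v. ennreal (\<bar>f v\<bar> * trunc_weight \<gamma> (real (Suc n)) (weight v)) \<partial>lborel) \<le> x"
      using le[of "Suc n" for n] by simp
  qed simp
  finally show ?thesis .
qed

lemma trunc_moment_le_N_a:
  fixes f :: "'a \<Rightarrow> real"
  assumes [measurable]: "f \<in> borel_measurable borel" and "1 \<le> R"
  shows "(\<integral>\<^sup>+v. ennreal (f v * trunc_weight \<gamma> R (weight v)) \<partial>lborel) \<le> N a f"
  unfolding N_def
  using trunc_weight_bounds[OF assms(2)] by (intro nn_integral_mono ennreal_leI mult_mono) auto

definition energy :: "('a \<Rightarrow> real) \<Rightarrow> ennreal" where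
  "energy f = (\<integral>\<^sup>+v. ennreal (f v * (norm v)\<^sup>2) \<partial>lborel)"

lemma N_0_eq: "AE v in lborel. 0 \<le> f v \<Longrightarrow> N 0 f = (\<integral>\<^sup>+v. ennreal (f v) \<partial>(lborel :: 'a measure))"
  unfolding N_def by (intro nn_integral_cong_AE) (auto elim!: eventually_mono)

lemma N_1_eq:
  fixes f :: "'a \<Rightarrow> real"
  assumes [measurable]: "f \<in> borel_measurable borel" and f: "AE v in lborel. 0 \<le> f v"
  shows "N 1 f = N 0 f + energy f"
proof -
  have "N 1 f = (\<integral>\<^sup>+v. ennreal (f v) + ennreal (f v * (norm v)\<^sup>2) \<partial>lborel)"
    unfolding N_def
  proof (rule nn_integral_cong_AE, use f in eventually_elim)
    case (elim v)
    then show ?case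
      by (simp add: weight_def distrib_left flip: ennreal_plus)
  qed
  then show ?thesis by (simp add: nn_integral_add N_0_eq[OF f] energy_def)
qed

lemma N_diff_le: "N s (\<lambda>v. f v - g v) \<le> N s f + N s g"
  if [measurable]: "f \<in> borel_measurable borel" "g \<in> borel_measurable borel" for f g :: "'a \<Rightarrow> real"
  by (rule N_triangle) auto

lemma N_diff_commute: "N s (\<lambda>v. f v - g v) = N s (\<lambda>v. g v - f v)" for f g :: "'a \<Rightarrow> real"
  unfolding N_def by (simp add: abs_minus_commute)

lemma N_diff_trans: "N s (\<lambda>v. f v - h v) \<le> N s (\<lambda>v. f v - g v) + N s (\<lambda>v. g v - h v)"
  if [measurable]: "f \<in> borel_measurable borel" "g \<in> borel_measurable borel" "h \<in> borel_measurable borel"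
  for f g h :: "'a \<Rightarrow> real"
  by (rule N_triangle) auto

lemma N_le_a: "s \<le> a \<Longrightarrow> N a f \<le> x \<Longrightarrow> N s f \<le> x" for f :: "'a \<Rightarrow> real"
  using N_mono_exponent[of s a f] by (rule order.trans)

text \<open>Mass and energy are the conserved test functions 1 and \<open>|v|\<^sup>2\<close>; the moment of order \<open>a\<close> is reached
through the truncated weights.\<close>

lemma euler_invariants:
  assumes k: "0 \<le> n" and [measurable]: "f \<in> borel_measurable borel" and f: "\<And>v. 0 \<le> f v"
    and \<delta>: "0 \<le> \<delta>" "\<delta> * (n * M) \<le> 1" and M: "0 \<le> M" "N 1 f \<le> ennreal M" and fin: "N a f < \<infinity>"
  defines "g \<equiv> euler (cutoff n) \<delta> f"
  shows "g \<in> borel_measurable borel" "\<And>v. 0 \<le> g v" "N 0 g \<le> N 0 f" "energy g \<le> energy f"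
    "N a g \<le> N a f + ennreal (\<delta> * povzner_const * M\<^sup>2)"
proof -
  note rc = rate_cutoff[OF k]
  show gm[measurable]: "g \<in> borel_measurable borel" unfolding g_def using rc by measurable
  have m0: "N 0 f \<le> ennreal M" using M N_mono_exponent[of 0 1 f] by (auto intro: order.trans)
  show g: "0 \<le> g v" for v
    unfolding g_def by (rule euler_nonneg[OF rc cutoff_le _ f m0]) (use M \<delta> in auto)
  have fin': "N (1 + \<gamma> / 2) f < \<infinity>" using fin by (simp add: a_def)
  have step: "(\<integral>\<^sup>+v. ennreal (g v * \<phi> v) \<partial>lborel) \<le> (\<integral>\<^sup>+v. ennreal (f v * \<phi> v) \<partial>lborel) + ennreal (\<delta> * C / 2) * (N 1 f * N 1 f)"
    if "\<phi> \<in> borel_measurable borel" "\<And>v. 0 \<le> \<phi> v" "\<And>v. \<phi> v \<le> c * weight v" "0 \<le> C" "collision_bound (cutoff n) \<phi> C" for \<phi> c C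
    unfolding g_def
    by (rule euler_moment_le[OF rc _ that(1) _ fin' that(2-5) \<delta>(1)]) (use f g in \<open>auto simp: g_def\<close>)
  have "(\<integral>\<^sup>+v. ennreal (g v * 1) \<partial>lborel) \<le> (\<integral>\<^sup>+v. ennreal (f v * 1) \<partial>lborel) + ennreal (\<delta> * 0 / 2) * (N 1 f * N 1 f)"
    by (rule step[of _ 1]) (auto intro: collision_bound_mass rc)
  then show "N 0 g \<le> N 0 f" using f g by (simp add: N_0_eq)
  have "(\<integral>\<^sup>+v. ennreal (g v * (norm v)\<^sup>2) \<partial>lborel) \<le> (\<integral>\<^sup>+v. ennreal (f v * (norm v)\<^sup>2) \<partial>lborel) + ennreal (\<delta> * 0 / 2) * (N 1 f * N 1 f)"
    by (rule step[of _ 1]) (auto intro: collision_bound_energy rc simp: weight_def)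
  then show "energy g \<le> energy f" by (simp add: energy_def)
  show "N a g \<le> N a f + ennreal (\<delta> * povzner_const * M\<^sup>2)"
  proof (rule N_a_le_of_trunc)
    fix R :: nat assume "1 \<le> R"
    then have R: "1 \<le> real R" by simp
    have "(\<integral>\<^sup>+v. ennreal (g v * trunc_weight \<gamma> (real R) (weight v)) \<partial>lborel) \<le>
       (\<integral>\<^sup>+v. ennreal (f v * trunc_weight \<gamma> (real R) (weight v)) \<partial>lborel) + ennreal (\<delta> * (2 * povzner_const) / 2) * (N 1 f * N 1 f)"
      by (rule step[OF _ trunc_weight_bounds(1,2)[OF R]])
        (use povzner_const_nonneg collision_bound_trunc[OF rc R] in auto)
    also have "\<dots> \<le> N a f + ennreal (\<delta> * (2 * povzner_const) / 2) * (ennreal M * ennreal M)"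
      by (intro add_mono mult_left_mono mult_mono trunc_moment_le_N_a R M) auto
    also have "ennreal (\<delta> * (2 * povzner_const) / 2) * (ennreal M * ennreal M) = ennreal (\<delta> * povzner_const * M\<^sup>2)"
      using M \<delta> povzner_const_nonneg by (simp flip: ennreal_mult add: power2_eq_square)
    finally show "(\<integral>\<^sup>+v. ennreal (g v * trunc_weight \<gamma> (real R) (weight v)) \<partial>lborel) \<le> N a f + ennreal (\<delta> * povzner_const * M\<^sup>2)" .
  qed (use g in auto)
qed

lemma N_p_interpolation:
  fixes u :: "'a \<Rightarrow> real"
  assumes "u \<in> borel_measurable borel" "0 < \<epsilon>" "\<epsilon> \<le> 1" "0 \<le> s" "N s u \<le> ennreal (c * \<epsilon>)" "N a u \<le> ennreal M" "0 \<le> M" "0 \<le> c"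
  shows "N p u \<le> ennreal ((c + M) * \<epsilon> powr \<theta>)"
  unfolding \<theta>_def using assms exponents
  by (intro N_interpolation[where q=s]) auto

text \<open>Two errors at once: the densities differ by \<open>e\<close> in order \<open>p\<close>, and the rates differ by at most
\<open>n\<^bsup>-\<kappa>\<^esup> r\<^bsup>\<gamma>(1+\<kappa>)\<^esup>\<close>, which the moment of order \<open>a\<close> can afford.\<close>

lemma cutoff_collide_diff:
  assumes n: "0 < n" and k: "rate k" "\<And>r. \<bar>k r - cutoff n r\<bar> \<le> n powr (- \<kappa>) * r powr (\<gamma> * (1 + \<kappa>))"
    and [measurable]: "f \<in> borel_measurable borel" "g \<in> borel_measurable borel"
    and M: "N a f \<le> ennreal M" "N a g \<le> ennreal M" "0 \<le> M"
    and fg: "N p (\<lambda>v. f v - g v) \<le> ennreal e" "0 \<le> e" and s: "0 \<le> s" "s \<le> q"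
  shows "N s (\<lambda>v. collide (pairs k f) v - collide (pairs (cutoff n) g) v) \<le> ennreal (8 * M * e + 4 * M\<^sup>2 * n powr (- \<kappa>))"
proof -
  have e: "s + \<gamma> / 2 \<le> p" "s + \<gamma> / 2 \<le> a" "s + \<gamma> * (1 + \<kappa>) / 2 \<le> a"
    using exponents s by (auto simp: p_def)
  have "N s (\<lambda>v. collide (pairs k f) v - collide (pairs (cutoff n) g) v) \<le>
      4 * (N (s + \<gamma> / 2) (\<lambda>v. f v - g v) * (N (s + \<gamma> / 2) f + N (s + \<gamma> / 2) g)) +
      ennreal (4 * n powr (- \<kappa>)) * (N (s + \<gamma> * (1 + \<kappa>) / 2) g * N (s + \<gamma> * (1 + \<kappa>) / 2) g)"
    using N_le_a[OF e(2) M(1)] N_le_a[OF e(2) M(2)]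
    by (intro N_collide_pairs_diff_le k rate_cutoff)
       (use n s exponents in \<open>auto elim!: le_less_trans\<close>)
  also have "\<dots> \<le> ennreal 4 * (ennreal e * (ennreal M + ennreal M)) + ennreal (4 * n powr (- \<kappa>)) * (ennreal M * ennreal M)"
    by (intro add_mono mult_mono mult_left_mono N_le_a[OF e(2)] N_le_a[OF e(3)] M
        order.trans[OF N_mono_exponent[OF e(1)] fg(1)]) auto
  also have "\<dots> = ennreal (8 * M * e + 4 * M\<^sup>2 * n powr (- \<kappa>))"
    using M fg by (simp del: ennreal_numeral flip: ennreal_mult ennreal_plus add: power2_eq_square algebra_simps)
  finally show ?thesis .
qed

lemma collide_bound:
  assumes k: "rate k" and [measurable]: "f \<in> borel_measurable borel"
    and M: "N a f \<le> ennreal M" "0 \<le> M" and s: "0 \<le> s" "s \<le> q"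
  shows "N s (collide (pairs k f)) \<le> ennreal (4 * M\<^sup>2)"
proof -
  have e: "s + \<gamma> / 2 \<le> a" using exponents s by (auto simp: p_def)
  have "N s (collide (pairs k f)) \<le> ennreal 4 * (N (s + \<gamma> / 2) f * N (s + \<gamma> / 2) f)"
    using N_collide_pairs_le[OF k _ s(1)] by simp
  also have "\<dots> \<le> ennreal 4 * (ennreal M * ennreal M)"
    by (intro mult_left_mono mult_mono N_le_a[OF e] M) auto
  finally show ?thesis using M by (simp del: ennreal_numeral flip: ennreal_mult add: power2_eq_square)
qed

lemma euler_increment:
  assumes k: "rate k" and [measurable]: "f \<in> borel_measurable borel"
    and M: "N a f \<le> ennreal M" "0 \<le> M" and s: "0 \<le> s" "s \<le> q" and \<delta>: "0 \<le> \<delta>"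
  shows "N s (\<lambda>v. euler k \<delta> f v - f v) \<le> ennreal (4 * M\<^sup>2 * \<delta>)"
proof -
  note [measurable] = rateD(1)[OF k]
  have "N s (\<lambda>v. euler k \<delta> f v - f v) = N s (\<lambda>v. \<delta> * collide (pairs k f) v)"
    by (simp add: euler_def)
  also have "\<dots> = ennreal \<delta> * N s (collide (pairs k f))" using \<delta> by (subst N_mult) auto
  also have "\<dots> \<le> ennreal \<delta> * ennreal (4 * M\<^sup>2)"
    by (intro mult_left_mono collide_bound assms) auto
  finally show ?thesis using \<delta> by (simp flip: ennreal_mult add: mult.commute)
qed

end

section \<open>The explicit Euler scheme on dyadic grids\<close>

text \<open>The bound \<open>M0\<close> is taken at least 1 so that powers of it can be compared.\<close>

locale initial_value = annihilation B \<gamma> \<alpha> for B :: "'a::euclidean_space \<Rightarrow> 'a \<Rightarrow> real" and \<gamma> \<alpha> +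
  fixes f0 :: "'a \<Rightarrow> real" and M0 :: real
  assumes f0_measurable [measurable]: "f0 \<in> borel_measurable borel" and f0_nonneg: "0 \<le> f0 v"
    and M0: "1 \<le> M0" "N a f0 \<le> ennreal M0"
begin

lemma N_p_le: "N a f \<le> x \<Longrightarrow> N p f \<le> x" for f :: "'a \<Rightarrow> real"
  using exponents by (auto intro: N_le_a[of p])

text \<open>The cutoff level \<open>n j\<close> grows like the inverse time step \<open>\<delta> j\<close>, as fast as positivity permits:
\<open>\<delta> j \<cdot> n j \<cdot> M0 = 1\<close>. The function \<open>growth_bound\<close> is the linear bound of the moment of order \<open>a\<close>.\<close>

definition \<delta> :: "nat \<Rightarrow> real" where "\<delta> j = (1 / 2) ^ j"
definition n :: "nat \<Rightarrow> real" where "n j = 2 ^ j / M0"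
definition iterate :: "nat \<Rightarrow> nat \<Rightarrow> 'a \<Rightarrow> real" where "iterate j k = (euler (cutoff (n j)) (\<delta> j) ^^ k) f0"
definition growth_bound :: "real \<Rightarrow> real" where "growth_bound T = M0 + povzner_const * M0\<^sup>2 * T"

lemma iterate_0 [simp]: "iterate j 0 = f0" by (simp add: iterate_def)
lemma iterate_Suc: "iterate j (Suc k) = euler (cutoff (n j)) (\<delta> j) (iterate j k)" by (simp add: iterate_def)

lemma \<delta>_pos: "0 < \<delta> j" "0 \<le> \<delta> j" "\<delta> j \<le> 1" "\<delta> (Suc j) = \<delta> j / 2"
  by (simp_all add: \<delta>_def power_le_one)

lemma n_pos: "0 < n j" "0 \<le> n j" "\<delta> j * (n j * M0) \<le> 1" "n j \<le> n (Suc j)"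
proof -
  have M: "0 < M0" using M0 by linarith
  show "0 < n j" "0 \<le> n j" using M by (simp_all add: n_def)
  show "\<delta> j * (n j * M0) \<le> 1" using M by (simp add: \<delta>_def n_def power_divide)
  have "(2::real) ^ j \<le> 2 ^ Suc j" by simp
  then show "n j \<le> n (Suc j)" unfolding n_def using M by (intro divide_right_mono) simp_all
qed

lemma growth_bound_mono: "S \<le> T \<Longrightarrow> growth_bound S \<le> growth_bound T"
  unfolding growth_bound_def using povzner_const_nonneg by (intro add_left_mono mult_left_mono) auto

lemma growth_bound_ge_1: "0 \<le> T \<Longrightarrow> 1 \<le> growth_bound T" "0 \<le> T \<Longrightarrow> 0 \<le> growth_bound T"
proof -
  show "1 \<le> growth_bound T" if "0 \<le> T"
  proof -
    have "0 \<le> povzner_const * M0\<^sup>2 * T" using that povzner_const_nonneg by simp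
    then show ?thesis using M0(1) unfolding growth_bound_def by linarith
  qed
  then show "0 \<le> growth_bound T" if "0 \<le> T" using that by force
qed

lemma iterate_invariants:
  "iterate j k \<in> borel_measurable borel \<and> (\<forall>v. 0 \<le> iterate j k v) \<and> N 0 (iterate j k) \<le> N 0 f0 \<and>
   energy (iterate j k) \<le> energy f0 \<and> N a (iterate j k) \<le> ennreal (growth_bound (real k * \<delta> j))"
proof (induction k)
  case 0
  then show ?case using f0_nonneg M0 by (simp add: growth_bound_def)
next
  case (Suc k)
  then have [measurable]: "iterate j k \<in> borel_measurable borel" and nn: "\<And>v. 0 \<le> iterate j k v" by auto
  have "N 1 (iterate j k) = N 0 (iterate j k) + energy (iterate j k)" using nn by (intro N_1_eq) auto
  also have "\<dots> \<le> N 0 f0 + energy f0" using Suc by (intro add_mono) auto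
  also have "\<dots> = N 1 f0" using f0_nonneg by (intro N_1_eq[symmetric]) auto
  also have "\<dots> \<le> ennreal M0" by (rule N_le_a[OF _ M0(2)]) (use exponents in simp)
  finally have N1: "N 1 (iterate j k) \<le> ennreal M0" .
  have fin: "N a (iterate j k) < \<infinity>" using Suc by (auto elim!: le_less_trans)
  note inv = euler_invariants[OF n_pos(2)[of j] _ nn \<delta>_pos(2)[of j] n_pos(3)[of j] _ N1 fin, folded iterate_Suc]
  have "N a (iterate j (Suc k)) \<le> N a (iterate j k) + ennreal (\<delta> j * povzner_const * M0\<^sup>2)"
    using inv(5) M0(1) by simp
  also have "\<dots> \<le> ennreal (growth_bound (real k * \<delta> j)) + ennreal (\<delta> j * povzner_const * M0\<^sup>2)"
    using Suc by (intro add_right_mono) auto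
  also have "\<dots> = ennreal (growth_bound (real k * \<delta> j) + \<delta> j * povzner_const * M0\<^sup>2)"
    using growth_bound_ge_1(2)[of "real k * \<delta> j"] \<delta>_pos(2)[of j] povzner_const_nonneg by (intro ennreal_plus[symmetric]) auto
  also have "growth_bound (real k * \<delta> j) + \<delta> j * povzner_const * M0\<^sup>2 = growth_bound (real (Suc k) * \<delta> j)"
    by (simp add: growth_bound_def algebra_simps)
  finally have "N a (iterate j (Suc k)) \<le> ennreal (growth_bound (real (Suc k) * \<delta> j))" .
  then show ?case
    using inv(1-4) M0(1) Suc by (simp; meson order.trans)
qed

lemma measurable_it [measurable]: "iterate j k \<in> borel_measurable borel"
  and iterate_nonneg: "0 \<le> iterate j k v"
  and iterate_mass: "N 0 (iterate j k) \<le> N 0 f0"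
  and iterate_energy: "energy (iterate j k) \<le> energy f0"
  using iterate_invariants[of j k] by auto

lemma iterate_bd: "real k * \<delta> j \<le> T \<Longrightarrow> N a (iterate j k) \<le> ennreal (growth_bound T)"
  using iterate_invariants[of j k] growth_bound_mono[of "real k * \<delta> j" T] by (meson ennreal_leI order.trans)

lemma iterate_mass_M0: "N 0 (iterate j k) \<le> ennreal M0"
  using iterate_mass[of j k] N_le_a[of 0, OF _ M0(2)] exponents by (meson less_imp_le order.trans)

lemma n_powr_le: "n j powr (- \<kappa>) \<le> M0 * \<delta> j powr \<kappa>"
proof -
  have "n j powr (- \<kappa>) = (M0 * \<delta> j) powr \<kappa>"
    using M0 by (simp add: n_def \<delta>_def powr_minus_divide powr_divide powr_mult power_divide)
  also have "\<dots> = M0 powr \<kappa> * \<delta> j powr \<kappa>" by (simp add: powr_mult)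
  also have "\<dots> \<le> M0 powr 1 * \<delta> j powr \<kappa>"
    using M0 exponents by (intro mult_right_mono powr_mono) auto
  finally show ?thesis using M0 by simp
qed

definition \<beta> :: real where "\<beta> = min \<kappa> \<theta>"

lemma \<beta>: "0 < \<beta>" "\<beta> \<le> 1" "\<delta> j powr \<kappa> \<le> \<delta> j powr \<beta>" "\<delta> j powr \<theta> \<le> \<delta> j powr \<beta>" "\<delta> j \<le> \<delta> j powr \<beta>"
proof -
  show b: "0 < \<beta>" "\<beta> \<le> 1" using exponents by (auto simp: \<beta>_def)
  show "\<delta> j powr \<kappa> \<le> \<delta> j powr \<beta>" "\<delta> j powr \<theta> \<le> \<delta> j powr \<beta>"
    using \<delta>_pos by (auto intro!: powr_mono' simp: \<beta>_def)
  have "\<delta> j powr 1 \<le> \<delta> j powr \<beta>" using \<delta>_pos b by (intro powr_mono') auto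
  then show "\<delta> j \<le> \<delta> j powr \<beta>" using \<delta>_pos[of j] by simp
qed

definition refine_const :: "real \<Rightarrow> real" where
  "refine_const M = 4 * M * (2 * M\<^sup>2 + 2 * M) + 4 * M\<^sup>2 * M0"

text \<open>Both steps of the fine grid use the finer cutoff, and the second starts from a density that has moved by
\<open>O(\<delta>)\<close> in order 0, hence by \<open>O(\<delta>\<^sup>\<theta>)\<close> in order \<open>p\<close>.\<close>

lemma refinement_error:
  assumes [measurable]: "g \<in> borel_measurable borel"
    and M: "N a g \<le> ennreal M" "N a (euler (cutoff (n (Suc j))) (\<delta> (Suc j)) g) \<le> ennreal M" "0 \<le> M"
  shows "N q (\<lambda>v. euler (cutoff (n j)) (\<delta> j) g v -
      euler (cutoff (n (Suc j))) (\<delta> (Suc j)) (euler (cutoff (n (Suc j))) (\<delta> (Suc j)) g) v)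
    \<le> ennreal (\<delta> j * (refine_const M * \<delta> j powr \<beta>))"
proof -
  let ?k = "cutoff (n j)" and ?k' = "cutoff (n (Suc j))" and ?d = "\<delta> (Suc j)"
  note r = rate_cutoff[OF n_pos(2)[of j]] rate_cutoff[OF n_pos(2)[of "Suc j"]]
  note [measurable] = rateD(1)[OF r(1)] rateD(1)[OF r(2)] measurable_euler[OF r(1)] measurable_euler[OF r(2)]
  \<comment> \<open>The intermediate density after one fine step.\<close>
  define g1 where "g1 = euler ?k' ?d g"
  have [measurable]: "g1 \<in> borel_measurable borel" unfolding g1_def by measurable
  have M1: "N a g1 \<le> ennreal M" using M by (simp add: g1_def)
  have d: "?d = \<delta> j / 2" by (rule \<delta>_pos)
  have "N 0 (\<lambda>v. g1 v - g v) \<le> ennreal (4 * M\<^sup>2 * ?d)"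
    unfolding g1_def using exponents \<delta>_pos by (intro euler_increment r M) auto
  then have i0: "N 0 (\<lambda>v. g1 v - g v) \<le> ennreal (2 * M\<^sup>2 * \<delta> j)" by (simp add: d mult_ac)
  have ia: "N a (\<lambda>v. g1 v - g v) \<le> ennreal (2 * M)"
  proof -
    have "N a (\<lambda>v. g1 v - g v) \<le> N a g1 + N a g" by (rule N_diff_le) auto
    also have "\<dots> \<le> ennreal M + ennreal M" by (intro add_mono M M1)
    finally show ?thesis using M by (simp flip: ennreal_plus)
  qed
  have ip: "N p (\<lambda>v. g1 v - g v) \<le> ennreal ((2 * M\<^sup>2 + 2 * M) * \<delta> j powr \<theta>)"
    using M \<delta>_pos by (intro N_p_interpolation[OF _ _ _ _ i0 ia]) auto
  have kk: "\<bar>?k' r - ?k r\<bar> \<le> n j powr (- \<kappa>) * r powr (\<gamma> * (1 + \<kappa>))" for r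
    using n_pos by (intro cutoff_diff) auto
  define e where "e = n j powr (- \<kappa>)"
  have e: "0 \<le> e" "e \<le> M0 * \<delta> j powr \<beta>"
    using n_powr_le[of j] \<beta>(3)[of j] M0 order.trans[OF n_powr_le mult_left_mono[OF \<beta>(3)]] by (auto simp: e_def)
  have z: "N p (\<lambda>v. g v - g v) \<le> ennreal 0" by (simp add: N_def)
  have c1: "N q (\<lambda>v. collide (pairs ?k' g) v - collide (pairs ?k g) v) \<le> ennreal (8 * M * 0 + 4 * M\<^sup>2 * e)"
    unfolding e_def using exponents by (intro cutoff_collide_diff[OF n_pos(1) r(2) kk _ _ M(1) M(1) M(3) z]) auto
  have c2: "N q (\<lambda>v. collide (pairs ?k' g1) v - collide (pairs ?k g) v) \<le>
      ennreal (8 * M * ((2 * M\<^sup>2 + 2 * M) * \<delta> j powr \<theta>) + 4 * M\<^sup>2 * e)"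
    unfolding e_def using exponents M by (intro cutoff_collide_diff[OF n_pos(1) r(2) kk _ _ M1 M(1) M(3) ip]) auto
  let ?x = "\<lambda>v. ?d * (collide (pairs ?k' g) v - collide (pairs ?k g) v)"
  let ?y = "\<lambda>v. ?d * (collide (pairs ?k' g1) v - collide (pairs ?k g) v)"
  have "N q (\<lambda>v. euler ?k (\<delta> j) g v - euler ?k' ?d (euler ?k' ?d g) v) \<le> N q ?x + N q ?y"
  proof (rule N_triangle)
    fix v
    have "euler ?k (\<delta> j) g v - euler ?k' ?d (euler ?k' ?d g) v = - (?x v + ?y v)"
    proof -
      have "euler ?k (\<delta> j) g v = g v + \<delta> j * collide (pairs ?k g) v"
        "euler ?k' ?d g1 v = g1 v + ?d * collide (pairs ?k' g1) v"
        "g1 v = g v + ?d * collide (pairs ?k' g) v"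
        by (simp_all add: euler_def g1_def)
      then show ?thesis unfolding g1_def[symmetric] by (simp add: d field_simps)
    qed
    then show "\<bar>euler ?k (\<delta> j) g v - euler ?k' ?d (euler ?k' ?d g) v\<bar> \<le> \<bar>?x v\<bar> + \<bar>?y v\<bar>" by linarith
  qed measurable
  also have "\<dots> = ennreal ?d * N q (\<lambda>v. collide (pairs ?k' g) v - collide (pairs ?k g) v) +
      ennreal ?d * N q (\<lambda>v. collide (pairs ?k' g1) v - collide (pairs ?k g) v)"
    using \<delta>_pos(2)[of "Suc j"]
      N_mult[of "\<lambda>v. collide (pairs ?k' g) v - collide (pairs ?k g) v" q ?d]
      N_mult[of "\<lambda>v. collide (pairs ?k' g1) v - collide (pairs ?k g) v" q ?d] by simp
  also have "\<dots> \<le> ennreal ?d * ennreal (8 * M * 0 + 4 * M\<^sup>2 * e) +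
      ennreal ?d * ennreal (8 * M * ((2 * M\<^sup>2 + 2 * M) * \<delta> j powr \<theta>) + 4 * M\<^sup>2 * e)"
    by (intro add_mono mult_left_mono c1 c2) auto
  also have "\<dots> = ennreal (?d * (4 * M\<^sup>2 * e) + ?d * (8 * M * ((2 * M\<^sup>2 + 2 * M) * \<delta> j powr \<theta>) + 4 * M\<^sup>2 * e))"
    using \<delta>_pos(2)[of "Suc j"] M e by (simp flip: ennreal_mult ennreal_plus)
  also have "?d * (4 * M\<^sup>2 * e) + ?d * (8 * M * ((2 * M\<^sup>2 + 2 * M) * \<delta> j powr \<theta>) + 4 * M\<^sup>2 * e)
      = \<delta> j * (4 * M * (2 * M\<^sup>2 + 2 * M) * \<delta> j powr \<theta> + 4 * M\<^sup>2 * e)"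
    by (simp add: d algebra_simps)
  also have "ennreal \<dots> \<le> ennreal (\<delta> j * (4 * M * (2 * M\<^sup>2 + 2 * M) * \<delta> j powr \<beta> + 4 * M\<^sup>2 * (M0 * \<delta> j powr \<beta>)))"
    using M e \<beta>(4)[of j] \<delta>_pos(2)[of j]
    by (intro ennreal_leI mult_left_mono add_mono) auto
  finally show ?thesis by (simp add: refine_const_def algebra_simps)
qed

lemma refine_const_nonneg: "0 \<le> M \<Longrightarrow> 0 \<le> refine_const M"
  using M0 by (simp add: refine_const_def)

text \<open>The local errors of \<open>refinement_error\<close>, propagated by \<open>euler_contraction\<close>.\<close>

lemma grid_comparison:
  assumes T: "real k * \<delta> j \<le> T"
  shows "N q (\<lambda>v. iterate j k v - iterate (Suc j) (2 * k) v) \<le>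
    ennreal (real k * \<delta> j * (refine_const (growth_bound T) * \<delta> j powr \<beta>) * exp (4 * growth_bound T * (real k * \<delta> j)))"
  using T
proof (induction k)
  case 0
  then show ?case by (simp add: N_def)
next
  case (Suc k)
  define M where "M = growth_bound T"
  define b where "b = refine_const M * \<delta> j powr \<beta>"
  let ?E = "euler (cutoff (n j)) (\<delta> j)" and ?E' = "euler (cutoff (n (Suc j))) (\<delta> (Suc j))"
  have T0: "0 \<le> T" using Suc.prems \<delta>_pos(2)[of j] by (auto intro: order.trans[rotated])
  have M: "0 \<le> M" using growth_bound_ge_1[OF T0] by (simp add: M_def)
  have b: "0 \<le> b" using refine_const_nonneg[OF M] by (simp add: b_def)
  have kT: "real k * \<delta> j \<le> T" using Suc.prems \<delta>_pos(2)[of j] by (simp add: algebra_simps)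
  let ?f = "iterate j k" and ?g = "iterate (Suc j) (2 * k)"
  have g2: "iterate (Suc j) (2 * Suc k) = ?E' (?E' ?g)" by (simp add: iterate_Suc)
  have Mf: "N a ?f \<le> ennreal M" unfolding M_def using kT by (rule iterate_bd)
  have Mg: "N a ?g \<le> ennreal M" unfolding M_def using kT by (intro iterate_bd) (simp add: \<delta>_pos(4))
  have Mg1: "N a (?E' ?g) \<le> ennreal M" unfolding M_def iterate_Suc[symmetric]
    using Suc.prems \<delta>_pos(2)[of j] by (intro iterate_bd) (simp add: \<delta>_pos(4) field_simps)
  note r = rate_cutoff[OF n_pos(2)[of j]] rate_cutoff[OF n_pos(2)[of "Suc j"]]
  note [measurable] = measurable_euler[OF r(1)] measurable_euler[OF r(2)]
  have Mp: "N p (\<lambda>v. ?f v + ?g v) \<le> ennreal (2 * M)"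
  proof -
    have "N p (\<lambda>v. ?f v + ?g v) \<le> N p ?f + N p ?g" by (rule N_triangle) auto
    also have "\<dots> \<le> ennreal M + ennreal M" by (intro add_mono N_p_le Mf Mg)
    finally show ?thesis using M by (simp flip: ennreal_plus)
  qed
  have fin: "N p ?f < \<infinity>" "N p ?g < \<infinity>"
    using N_le_a[OF _ Mf, of p] N_le_a[OF _ Mg, of p] exponents by (auto elim!: le_less_trans)
  let ?d = "N q (\<lambda>v. ?f v - ?g v)"
  have IH: "?d \<le> ennreal (real k * \<delta> j * b * exp (4 * M * (real k * \<delta> j)))"
    using Suc.IH[OF kT] by (simp add: b_def M_def)
  have "N q (\<lambda>v. iterate j (Suc k) v - iterate (Suc j) (2 * Suc k) v) \<le>
      N q (\<lambda>v. ?E ?f v - ?E ?g v) + N q (\<lambda>v. ?E ?g v - ?E' (?E' ?g) v)"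
    unfolding g2 iterate_Suc by (rule N_diff_trans) measurable
  also have "\<dots> \<le> (?d + ennreal (2 * \<delta> j) * (N p (\<lambda>v. ?f v + ?g v) * ?d)) + ennreal (\<delta> j * b)"
  proof (rule add_mono)
    show "N q (\<lambda>v. ?E ?f v - ?E ?g v) \<le> ?d + ennreal (2 * \<delta> j) * (N p (\<lambda>v. ?f v + ?g v) * ?d)"
      unfolding p_def
      by (rule euler_contraction[OF r(1) cutoff_le _ _ _ _ iterate_mass_M0 iterate_mass_M0])
         (use M0 \<delta>_pos n_pos q_bounds fin iterate_nonneg in \<open>auto simp: p_def\<close>)
    show "N q (\<lambda>v. ?E ?g v - ?E' (?E' ?g) v) \<le> ennreal (\<delta> j * b)"
      unfolding b_def by (rule refinement_error[OF _ Mg Mg1 M]) simp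
  qed
  also have "\<dots> \<le> (?d + ennreal (2 * \<delta> j) * (ennreal (2 * M) * ?d)) + ennreal (\<delta> j * b)"
    by (intro add_mono mult_left_mono mult_right_mono Mp) auto
  also have "\<dots> = ennreal (1 + 4 * M * \<delta> j) * ?d + ennreal (\<delta> j * b)"
  proof -
    have "ennreal (1 + 4 * M * \<delta> j) = 1 + ennreal (2 * \<delta> j) * ennreal (2 * M)"
      using M \<delta>_pos(2)[of j] by (simp flip: ennreal_mult ennreal_plus ennreal_1 add: mult_ac)
    then show ?thesis by (simp add: distrib_right mult.assoc)
  qed
  also have "\<dots> \<le> ennreal (1 + 4 * M * \<delta> j) * ennreal (real k * \<delta> j * b * exp (4 * M * (real k * \<delta> j))) + ennreal (\<delta> j * b)"
    by (intro add_mono mult_left_mono IH) auto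
  also have "\<dots> = ennreal ((1 + 4 * M * \<delta> j) * (real k * \<delta> j * b * exp (4 * M * (real k * \<delta> j))) + \<delta> j * b)"
    using M \<delta>_pos(2)[of j] b by (simp flip: ennreal_mult ennreal_plus)
  also have "\<dots> \<le> ennreal (real (Suc k) * \<delta> j * b * exp (4 * M * (real (Suc k) * \<delta> j)))"
    using M \<delta>_pos(2)[of j] b by (intro ennreal_leI gronwall_step) auto
  finally show ?case by (simp add: b_def M_def)
qed

end

section \<open>Convergence of the scheme\<close>

lemma weighted_fatou:
  fixes u :: "nat \<Rightarrow> 'a::euclidean_space \<Rightarrow> real"
  assumes [measurable]: "\<And>m. u m \<in> borel_measurable borel" "\<omega> \<in> borel_measurable borel"
    and conv: "AE v in lborel. (\<lambda>m. u m v) \<longlonglongrightarrow> l v"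
    and le: "\<forall>\<^sub>F m in sequentially. (\<integral>\<^sup>+v. ennreal (\<bar>u m v\<bar> * \<omega> v) \<partial>lborel) \<le> x"
  shows "(\<integral>\<^sup>+v. ennreal (\<bar>l v\<bar> * \<omega> v) \<partial>lborel) \<le> x"
proof -
  have "(\<integral>\<^sup>+v. ennreal (\<bar>l v\<bar> * \<omega> v) \<partial>lborel) =
      (\<integral>\<^sup>+v. liminf (\<lambda>m. ennreal (\<bar>u m v\<bar> * \<omega> v)) \<partial>lborel)"
  proof (rule nn_integral_cong_AE, use conv in eventually_elim)
    case (elim v)
    then have "(\<lambda>m. ennreal (\<bar>u m v\<bar> * \<omega> v)) \<longlonglongrightarrow> ennreal (\<bar>l v\<bar> * \<omega> v)"
      by (intro tendsto_intros tendsto_ennrealI)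
    then show ?case by (intro lim_imp_Liminf[symmetric]) auto
  qed
  also have "\<dots> \<le> liminf (\<lambda>m. \<integral>\<^sup>+v. ennreal (\<bar>u m v\<bar> * \<omega> v) \<partial>lborel)"
    by (rule nn_integral_liminf) measurable
  also have "\<dots> \<le> x" by (rule Liminf_le) (use le in auto)
  finally show ?thesis .
qed

lemma N_fatou:
  fixes u :: "nat \<Rightarrow> 'a::euclidean_space \<Rightarrow> real"
  assumes "\<And>m. u m \<in> borel_measurable borel" "AE v in lborel. (\<lambda>m. u m v) \<longlonglongrightarrow> l v"
    "\<forall>\<^sub>F m in sequentially. N s (u m) \<le> x"
  shows "N s l \<le> x"
  using assms unfolding N_def by (intro weighted_fatou[where u=u]) auto

text \<open>A sequence with geometrically small increments in a weighted L1 norm has summable increments almost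
everywhere; the distance to the limit follows from Fatou's lemma.\<close>

lemma fast_limit:
  fixes u :: "nat \<Rightarrow> 'a::euclidean_space \<Rightarrow> real"
  assumes [measurable]: "\<And>j. u j \<in> borel_measurable borel"
    and \<rho>: "0 < \<rho>" "\<rho> < 1" and C: "0 \<le> C"
    and step: "\<And>j. N s (\<lambda>v. u j v - u (Suc j) v) \<le> ennreal (C * \<rho> ^ j)"
  shows "AE v in lborel. (\<lambda>j. u j v) \<longlonglongrightarrow> lim (\<lambda>j. u j v)"
    and "N s (\<lambda>v. u i v - lim (\<lambda>j. u j v)) \<le> ennreal (C * \<rho> ^ i / (1 - \<rho>))"
proof -
  let ?d = "\<lambda>j v. \<bar>u j v - u (Suc j) v\<bar> * weight v powr s"
  have "(\<integral>\<^sup>+v. (\<Sum>j. ennreal (?d j v)) \<partial>lborel) = (\<Sum>j. N s (\<lambda>v. u j v - u (Suc j) v))"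
    unfolding N_def by (rule nn_integral_suminf) measurable
  also have "\<dots> \<le> (\<Sum>j. ennreal (C * \<rho> ^ j))"
    by (intro suminf_le step) auto
  also have "\<dots> = ennreal (\<Sum>j. C * \<rho> ^ j)"
    using \<rho> C by (intro suminf_ennreal2 summable_mult summable_geometric) auto
  finally have "(\<integral>\<^sup>+v. (\<Sum>j. ennreal (?d j v)) \<partial>lborel) < \<infinity>"
    by (rule le_less_trans) simp
  then have "AE v in lborel. (\<Sum>j. ennreal (?d j v)) \<noteq> \<infinity>"
    by (intro nn_integral_PInf_AE) auto
  then show conv: "AE v in lborel. (\<lambda>j. u j v) \<longlonglongrightarrow> lim (\<lambda>j. u j v)"
  proof eventually_elim
    case (elim v)
    have "summable (\<lambda>j. ?d j v)"
      by (rule summable_suminf_not_top) (use elim in \<open>auto simp: less_top\<close>)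
    then have "summable (\<lambda>j. ?d j v * (1 / weight v powr s))"
      by (rule summable_mult2)
    then have "summable (\<lambda>j. \<bar>u (Suc j) v - u j v\<bar>)"
      by (simp add: abs_minus_commute)
    then have "summable (\<lambda>j. u (Suc j) v - u j v)"
      by (rule summable_rabs_cancel)
    then have "(\<lambda>k. \<Sum>j<k. u (Suc j) v - u j v) \<longlonglongrightarrow> (\<Sum>j. u (Suc j) v - u j v)"
      by (rule summable_LIMSEQ)
    then have "(\<lambda>k. u k v - u 0 v) \<longlonglongrightarrow> (\<Sum>j. u (Suc j) v - u j v)"
      by (simp only: sum_lessThan_telescope[of "\<lambda>j. u j v"])
    then have "(\<lambda>k. (u k v - u 0 v) + u 0 v) \<longlonglongrightarrow> (\<Sum>j. u (Suc j) v - u j v) + u 0 v"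
      by (rule tendsto_add) simp
    then have "convergent (\<lambda>k. u k v)" by (auto simp: convergent_def)
    then show ?case by (simp add: convergent_LIMSEQ_iff)
  qed
  have partial: "N s (\<lambda>v. u i v - u (i + m) v) \<le> ennreal (C * \<rho> ^ i * (1 - \<rho> ^ m) / (1 - \<rho>))" for m
  proof (induction m)
    case 0
    then show ?case by (simp add: N_def)
  next
    case (Suc m)
    have pos: "0 \<le> C * \<rho> ^ i * (1 - \<rho> ^ m) / (1 - \<rho>)"
      using \<rho> C by (auto simp: power_le_one)
    have "N s (\<lambda>v. u i v - u (i + Suc m) v) \<le>
        N s (\<lambda>v. u i v - u (i + m) v) + N s (\<lambda>v. u (i + m) v - u (Suc (i + m)) v)"
      by (rule N_triangle) auto
    also have "\<dots> \<le> ennreal (C * \<rho> ^ i * (1 - \<rho> ^ m) / (1 - \<rho>)) + ennreal (C * \<rho> ^ (i + m))"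
      by (intro add_mono Suc step)
    also have "\<dots> = ennreal (C * \<rho> ^ i * (1 - \<rho> ^ m) / (1 - \<rho>) + C * \<rho> ^ (i + m))"
      using pos \<rho> C by (intro ennreal_plus[symmetric]) auto
    also have "C * \<rho> ^ i * (1 - \<rho> ^ m) / (1 - \<rho>) + C * \<rho> ^ (i + m) = C * \<rho> ^ i * (1 - \<rho> ^ Suc m) / (1 - \<rho>)"
      using \<rho> by (simp add: field_simps power_add)
    finally show ?case .
  qed
  show "N s (\<lambda>v. u i v - lim (\<lambda>j. u j v)) \<le> ennreal (C * \<rho> ^ i / (1 - \<rho>))"
  proof (rule N_fatou)
    show "AE v in lborel. (\<lambda>m. u i v - u m v) \<longlonglongrightarrow> u i v - lim (\<lambda>j. u j v)"
      using conv by eventually_elim (intro tendsto_intros)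
    have "N s (\<lambda>v. u i v - u m v) \<le> ennreal (C * \<rho> ^ i / (1 - \<rho>))" if "m \<ge> i" for m
    proof -
      have "C * \<rho> ^ i * (1 - \<rho> ^ (m - i)) \<le> C * \<rho> ^ i * 1"
        using \<rho> C by (intro mult_left_mono) auto
      then have "C * \<rho> ^ i * (1 - \<rho> ^ (m - i)) / (1 - \<rho>) \<le> C * \<rho> ^ i / (1 - \<rho>)"
        using \<rho> by (intro divide_right_mono) auto
      then show ?thesis using partial[of "m - i"] that by (auto intro: order.trans ennreal_leI)
    qed
    then show "\<forall>\<^sub>F m in sequentially. N s (\<lambda>v. u i v - u m v) \<le> ennreal (C * \<rho> ^ i / (1 - \<rho>))"
      by (auto simp: eventually_sequentially)
  qed measurable
qed

context annihilation
begin

lemma hard_collide_diff: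
  assumes [measurable]: "f \<in> borel_measurable borel" "g \<in> borel_measurable borel"
    and M: "N p f \<le> ennreal M" "N p g \<le> ennreal M" "0 \<le> M"
    and fin: "N s f < \<infinity>"
    and fg: "N p (\<lambda>v. f v - g v) \<le> ennreal e" "0 \<le> e" and s: "0 \<le> s" "s \<le> q"
  shows "N s (\<lambda>v. collide (pairs hard f) v - collide (pairs hard g) v) \<le> ennreal (8 * M * e)"
proof -
  have e: "s + \<gamma> / 2 \<le> p" using exponents s by (auto simp: p_def)
  have Np: "N (s + \<gamma> / 2) h \<le> x" if "N p h \<le> x" for h :: "'a \<Rightarrow> real" and x
    using N_mono_exponent[OF e, of h] that by (rule order.trans)
  have "N s (\<lambda>v. collide (pairs hard f) v - collide (pairs hard g) v) \<le>
      4 * (N (s + \<gamma> / 2) (\<lambda>v. f v - g v) * (N (s + \<gamma> / 2) f + N (s + \<gamma> / 2) g)) +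
      ennreal (4 * 0) * (N (s + \<gamma> * (1 + 0) / 2) g * N (s + \<gamma> * (1 + 0) / 2) g)"
    using Np[OF M(1)] Np[OF M(2)] s
    by (intro N_collide_pairs_diff_le rate_hard) (auto elim!: le_less_trans)
  also have "\<dots> \<le> ennreal 4 * (ennreal e * (ennreal M + ennreal M)) + 0"
    by (intro add_mono mult_left_mono mult_mono Np fg M) auto
  also have "\<dots> = ennreal (8 * M * e)"
    using M fg by (simp del: ennreal_numeral flip: ennreal_mult ennreal_plus add: mult_ac)
  finally show ?thesis .
qed

lemma N_diff_le_double:
  fixes f g :: "'a \<Rightarrow> real"
  assumes "f \<in> borel_measurable borel" "g \<in> borel_measurable borel" "N s f \<le> ennreal M" "N s g \<le> ennreal M" "0 \<le> M"
  shows "N s (\<lambda>v. f v - g v) \<le> ennreal (2 * M)"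
proof -
  have "N s (\<lambda>v. f v - g v) \<le> N s f + N s g" using assms by (intro N_diff_le)
  also have "\<dots> \<le> ennreal M + ennreal M" using assms by (intro add_mono)
  finally show ?thesis using assms by (simp flip: ennreal_plus)
qed

end

context initial_value
begin

text \<open>At time \<open>t\<close> the scheme on grid \<open>j\<close> stands at the last grid point up to \<open>t\<close>. For fixed \<open>t\<close> its values converge
almost everywhere; where they do not, the value of \<open>lim\<close> is immaterial.\<close>

definition grid_index :: "nat \<Rightarrow> real \<Rightarrow> nat" where "grid_index j t = nat \<lfloor>t * 2 ^ j\<rfloor>"
definition u :: "nat \<Rightarrow> real \<Rightarrow> 'a \<Rightarrow> real" where "u j t = iterate j (grid_index j t)"
definition sol :: "real \<Rightarrow> 'a \<Rightarrow> real" where "sol t v = lim (\<lambda>j. u j t v)"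

lemma grid_index_bounds:
  assumes "0 \<le> t"
  shows "real (grid_index j t) * \<delta> j \<le> t" "t < real (Suc (grid_index j t)) * \<delta> j"
proof -
  have r: "real (grid_index j t) = of_int \<lfloor>t * 2 ^ j\<rfloor>" using assms by (simp add: grid_index_def)
  have d: "\<delta> j * 2 ^ j = 1" by (simp add: \<delta>_def power_divide)
  have "of_int \<lfloor>t * 2 ^ j\<rfloor> * \<delta> j \<le> (t * 2 ^ j) * \<delta> j" "(t * 2 ^ j) * \<delta> j < (of_int \<lfloor>t * 2 ^ j\<rfloor> + 1) * \<delta> j"
    using \<delta>_pos by (auto intro!: mult_right_mono mult_strict_right_mono)
  moreover have "(t * 2 ^ j) * \<delta> j = t" using d by (simp add: mult_ac)
  ultimately show "real (grid_index j t) * \<delta> j \<le> t" "t < real (Suc (grid_index j t)) * \<delta> j"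
    unfolding r of_nat_Suc by (auto simp: add.commute)
qed

lemma grid_index_grid: "grid_index j (real k * \<delta> j) = k"
proof -
  have "real k * \<delta> j * 2 ^ j = real k" by (simp add: \<delta>_def power_divide)
  then show ?thesis by (simp only: grid_index_def floor_of_nat nat_int)
qed

lemma grid_index_unique: "real k * \<delta> j \<le> t \<Longrightarrow> t < real (Suc k) * \<delta> j \<Longrightarrow> 0 \<le> t \<Longrightarrow> grid_index j t = k"
proof -
  assume "real k * \<delta> j \<le> t" "t < real (Suc k) * \<delta> j" "0 \<le> t"
  then have "real k * \<delta> j < real (Suc (grid_index j t)) * \<delta> j" "real (grid_index j t) * \<delta> j < real (Suc k) * \<delta> j"
    using grid_index_bounds[of t j] by auto
  then have "real k < real (Suc (grid_index j t))" "real (grid_index j t) < real (Suc k)"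
    using \<delta>_pos(1)[of j] by (simp_all only: mult_less_cancel_right_pos)
  then show "grid_index j t = k" by linarith
qed

lemma grid_index_Suc: "0 \<le> t \<Longrightarrow> grid_index (Suc j) t = 2 * grid_index j t \<or> grid_index (Suc j) t = Suc (2 * grid_index j t)"
proof -
  assume t: "0 \<le> t"
  have "real (2 * grid_index j t) * \<delta> (Suc j) = real (grid_index j t) * \<delta> j" "real (Suc (Suc (2 * grid_index j t))) * \<delta> (Suc j) = real (Suc (grid_index j t)) * \<delta> j"
    by (simp_all add: \<delta>_pos(4) algebra_simps)
  then have "real (2 * grid_index j t) * \<delta> (Suc j) \<le> t" "t < real (Suc (Suc (2 * grid_index j t))) * \<delta> (Suc j)"
    using grid_index_bounds[OF t, of j] by (simp_all only:)
  then show ?thesis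
    using grid_index_unique[of "2 * grid_index j t" "Suc j" t] grid_index_unique[of "Suc (2 * grid_index j t)" "Suc j" t] t
    by (cases "t < real (Suc (2 * grid_index j t)) * \<delta> (Suc j)") auto
qed

lemma measurable_u [measurable]: "u j t \<in> borel_measurable borel"
  by (simp add: u_def)

lemma measurable_sol [measurable]: "sol t \<in> borel_measurable borel"
  unfolding sol_def[abs_def] by (rule borel_measurable_lim_metric) simp

lemma u_bd: "0 \<le> t \<Longrightarrow> t \<le> T \<Longrightarrow> N a (u j t) \<le> ennreal (growth_bound T)"
  unfolding u_def using grid_index_bounds(1)[of t j] by (intro iterate_bd) linarith

lemma iterate_increment:
  assumes T: "real (k + m) * \<delta> j \<le> T" and s: "0 \<le> s" "s \<le> q"
  shows "N s (\<lambda>v. iterate j (k + m) v - iterate j k v) \<le> ennreal (4 * (growth_bound T)\<^sup>2 * (real m * \<delta> j))"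
  using T
proof (induction m)
  case 0
  then show ?case by (simp add: N_def)
next
  case (Suc m)
  have T': "real (k + m) * \<delta> j \<le> T" using Suc.prems \<delta>_pos(2)[of j] by (simp add: algebra_simps)
  have T0: "0 \<le> T" using T' \<delta>_pos(2)[of j] by (auto intro: order.trans[rotated])
  have "N s (\<lambda>v. iterate j (k + Suc m) v - iterate j k v) \<le>
     N s (\<lambda>v. iterate j (k + Suc m) v - iterate j (k + m) v) + N s (\<lambda>v. iterate j (k + m) v - iterate j k v)"
    by (rule N_diff_trans) auto
  also have "\<dots> \<le> ennreal (4 * (growth_bound T)\<^sup>2 * \<delta> j) + ennreal (4 * (growth_bound T)\<^sup>2 * (real m * \<delta> j))"
  proof (rule add_mono)
    show "N s (\<lambda>v. iterate j (k + Suc m) v - iterate j (k + m) v) \<le> ennreal (4 * (growth_bound T)\<^sup>2 * \<delta> j)"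
      unfolding add_Suc_right iterate_Suc
      by (rule euler_increment) (use rate_cutoff[OF n_pos(2)] iterate_bd[OF T'] growth_bound_ge_1[OF T0] s \<delta>_pos in auto)
    show "N s (\<lambda>v. iterate j (k + m) v - iterate j k v) \<le> ennreal (4 * (growth_bound T)\<^sup>2 * (real m * \<delta> j))"
      by (rule Suc.IH[OF T'])
  qed
  also have "\<dots> = ennreal (4 * (growth_bound T)\<^sup>2 * \<delta> j + 4 * (growth_bound T)\<^sup>2 * (real m * \<delta> j))"
    using \<delta>_pos(2)[of j] by (intro ennreal_plus[symmetric]) auto
  finally show ?case by (simp add: algebra_simps)
qed

definition grid_const :: "real \<Rightarrow> real" where
  "grid_const T = T * refine_const (growth_bound T) * exp (4 * growth_bound T * T) + 2 * (growth_bound T)\<^sup>2"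

lemma grid_const_nonneg: "0 \<le> T \<Longrightarrow> 0 \<le> grid_const T"
  unfolding grid_const_def using refine_const_nonneg[of "growth_bound T"] growth_bound_ge_1(2)[of T] by simp

text \<open>At a time \<open>t\<close> between grid points, the finer grid may already be one step ahead of the coarser one.\<close>

lemma u_step:
  assumes t: "0 \<le> t" "t \<le> T"
  shows "N q (\<lambda>v. u j t v - u (Suc j) t v) \<le> ennreal (grid_const T * \<delta> j powr \<beta>)"
proof -
  define k where "k = grid_index j t"
  have T0: "0 \<le> T" using t by simp
  have B: "0 \<le> growth_bound T" using growth_bound_ge_1(2)[OF T0] .
  have kT: "real k * \<delta> j \<le> T" using grid_index_bounds(1)[OF t(1), of j] t by (simp add: k_def)
  have b: "0 \<le> refine_const (growth_bound T)" using refine_const_nonneg[OF B] .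
  have A: "N q (\<lambda>v. iterate j k v - iterate (Suc j) (2 * k) v) \<le> ennreal (T * (refine_const (growth_bound T) * \<delta> j powr \<beta>) * exp (4 * growth_bound T * T))"
  proof (rule order.trans[OF grid_comparison[OF kT]], rule ennreal_leI)
    show "real k * \<delta> j * (refine_const (growth_bound T) * \<delta> j powr \<beta>) * exp (4 * growth_bound T * (real k * \<delta> j))
      \<le> T * (refine_const (growth_bound T) * \<delta> j powr \<beta>) * exp (4 * growth_bound T * T)"
    proof (rule mult_mono)
      show "real k * \<delta> j * (refine_const (growth_bound T) * \<delta> j powr \<beta>) \<le> T * (refine_const (growth_bound T) * \<delta> j powr \<beta>)"
        using kT b by (intro mult_right_mono) auto
      show "exp (4 * growth_bound T * (real k * \<delta> j)) \<le> exp (4 * growth_bound T * T)"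
        using kT B by (simp add: mult_left_mono)
    qed (use T0 b in auto)
  qed
  have C: "N q (\<lambda>v. iterate (Suc j) (2 * k) v - u (Suc j) t v) \<le> ennreal (2 * (growth_bound T)\<^sup>2 * \<delta> j powr \<beta>)"
  proof (cases "grid_index (Suc j) t = 2 * k")
    case True
    then show ?thesis by (simp add: u_def N_def)
  next
    case False
    then have i: "grid_index (Suc j) t = 2 * k + 1" using grid_index_Suc[OF t(1), of j] by (simp add: k_def)
    have "N q (\<lambda>v. iterate (Suc j) (2 * k + 1) v - iterate (Suc j) (2 * k) v) \<le> ennreal (4 * (growth_bound T)\<^sup>2 * (real 1 * \<delta> (Suc j)))"
    proof (rule iterate_increment)
      show "real (2 * k + 1) * \<delta> (Suc j) \<le> T" using grid_index_bounds(1)[OF t(1), of "Suc j"] t i by simp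
    qed (use exponents in auto)
    also have "\<dots> = ennreal (2 * (growth_bound T)\<^sup>2 * \<delta> j)" by (simp add: \<delta>_pos(4) mult_ac)
    also have "\<dots> \<le> ennreal (2 * (growth_bound T)\<^sup>2 * \<delta> j powr \<beta>)"
      using \<beta>(5) by (intro ennreal_leI mult_left_mono) auto
    finally show ?thesis unfolding u_def i by (subst N_diff_commute)
  qed
  have "N q (\<lambda>v. u j t v - u (Suc j) t v) \<le> N q (\<lambda>v. iterate j k v - iterate (Suc j) (2 * k) v) + N q (\<lambda>v. iterate (Suc j) (2 * k) v - u (Suc j) t v)"
    unfolding u_def k_def by (rule N_diff_trans) auto
  also have "\<dots> \<le> ennreal (T * (refine_const (growth_bound T) * \<delta> j powr \<beta>) * exp (4 * growth_bound T * T)) + ennreal (2 * (growth_bound T)\<^sup>2 * \<delta> j powr \<beta>)"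
    by (intro add_mono A C)
  also have "\<dots> = ennreal (T * (refine_const (growth_bound T) * \<delta> j powr \<beta>) * exp (4 * growth_bound T * T) + 2 * (growth_bound T)\<^sup>2 * \<delta> j powr \<beta>)"
    using T0 b by (intro ennreal_plus[symmetric]) auto
  finally show ?thesis by (simp add: grid_const_def algebra_simps)
qed

definition \<rho> :: real where "\<rho> = (1 / 2) powr \<beta>"

lemma \<rho>: "0 < \<rho>" "\<rho> < 1" "\<delta> j powr \<beta> = \<rho> ^ j"
proof -
  show "0 < \<rho>" by (simp add: \<rho>_def)
  show "\<rho> < 1" using \<beta>(1) powr_less_mono'[of "1/2" 0 \<beta>] by (simp add: \<rho>_def)
  show "\<delta> j powr \<beta> = \<rho> ^ j"
    by (simp add: \<delta>_def \<rho>_def powr_powr mult.commute flip: powr_realpow)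
qed

definition lim_const :: "real \<Rightarrow> real" where "lim_const T = grid_const T / (1 - \<rho>)"

lemma lim_const_nonneg: "0 \<le> T \<Longrightarrow> 0 \<le> lim_const T"
  using grid_const_nonneg \<rho> by (simp add: lim_const_def)

lemma AE_u_tendsto_sol:
  assumes t: "0 \<le> t"
  shows "AE v in lborel. (\<lambda>j. u j t v) \<longlonglongrightarrow> sol t v"
  unfolding sol_def
  by (rule fast_limit(1)[where s=q, OF _ \<rho>(1,2) grid_const_nonneg[OF t]])
     (use u_step[OF t order.refl] in \<open>auto simp: \<rho>(3)\<close>)

lemma u_sol_le:
  assumes t: "0 \<le> t" "t \<le> T"
  shows "N q (\<lambda>v. u j t v - sol t v) \<le> ennreal (lim_const T * \<delta> j powr \<beta>)"
proof -
  have "N q (\<lambda>v. u j t v - sol t v) \<le> ennreal (grid_const T * \<rho> ^ j / (1 - \<rho>))"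
    unfolding sol_def
    by (rule fast_limit(2)[where u="\<lambda>j. u j t" and s=q, OF _ \<rho>(1,2) grid_const_nonneg])
       (use u_step[OF t] t in \<open>auto simp: \<rho>(3)\<close>)
  then show ?thesis by (simp add: lim_const_def \<rho>(3))
qed

lemma sol_0: "sol 0 = f0"
  by (simp add: sol_def[abs_def] u_def grid_index_def)

lemma sol_nonneg:
  assumes t: "0 \<le> t"
  shows "AE v in lborel. 0 \<le> sol t v"
  using AE_u_tendsto_sol[OF t]
proof eventually_elim
  case (elim v)
  then show ?case by (rule LIMSEQ_le_const) (auto simp: u_def iterate_nonneg)
qed

lemma sol_bd: "0 \<le> t \<Longrightarrow> t \<le> T \<Longrightarrow> N a (sol t) \<le> ennreal (growth_bound T)"
  by (rule N_fatou[OF _ AE_u_tendsto_sol]) (auto intro!: always_eventually u_bd)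

lemma sol_mass: "0 \<le> t \<Longrightarrow> N 0 (sol t) \<le> N 0 f0"
  by (rule N_fatou[OF _ AE_u_tendsto_sol]) (auto intro!: always_eventually simp: u_def iterate_mass)

lemma sol_energy: "0 \<le> t \<Longrightarrow> energy (sol t) \<le> energy f0"
proof -
  assume t: "0 \<le> t"
  have "(\<integral>\<^sup>+v. ennreal (\<bar>sol t v\<bar> * (norm v)\<^sup>2) \<partial>lborel) \<le> energy f0"
    by (rule weighted_fatou[OF _ _ AE_u_tendsto_sol[OF t]])
       (use iterate_energy in \<open>auto intro!: always_eventually simp: u_def iterate_nonneg energy_def\<close>)
  also have "(\<integral>\<^sup>+v. ennreal (\<bar>sol t v\<bar> * (norm v)\<^sup>2) \<partial>lborel) = energy (sol t)"
    unfolding energy_def by (intro nn_integral_cong_AE) (use sol_nonneg[OF t] in \<open>auto elim!: eventually_mono\<close>)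
  finally show ?thesis .
qed

lemma \<delta>_tendsto: "\<delta> \<longlonglongrightarrow> 0"
  unfolding \<delta>_def[abs_def] by (rule LIMSEQ_power_zero) simp

text \<open>Grid points are rounded down, so an extra \<open>\<delta> j\<close> appears; it vanishes in the limit.\<close>

lemma sol_lipschitz:
  assumes t: "0 \<le> s" "s \<le> t" "t \<le> T"
  shows "N q (\<lambda>v. sol t v - sol s v) \<le> ennreal (4 * (growth_bound T)\<^sup>2 * (t - s))"
proof (rule LIMSEQ_le_const)
  show "(\<lambda>j. ennreal (4 * (growth_bound T)\<^sup>2 * (t - s + \<delta> j))) \<longlonglongrightarrow> ennreal (4 * (growth_bound T)\<^sup>2 * (t - s))"
    using tendsto_add[OF tendsto_const \<delta>_tendsto, of "t - s"]
    by (intro tendsto_ennrealI tendsto_mult_left) simp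
  have "N q (\<lambda>v. sol t v - sol s v) \<le> ennreal (4 * (growth_bound T)\<^sup>2 * (t - s + \<delta> j))" for j
  proof (rule N_fatou)
    show "AE v in lborel. (\<lambda>i. u i t v - u i s v) \<longlonglongrightarrow> sol t v - sol s v"
    proof -
      have "AE v in lborel. (\<lambda>i. u i t v) \<longlonglongrightarrow> sol t v" "AE v in lborel. (\<lambda>i. u i s v) \<longlonglongrightarrow> sol s v"
        using t by (auto intro: AE_u_tendsto_sol)
      then show ?thesis by eventually_elim (rule tendsto_diff)
    qed
    have "N q (\<lambda>v. u i t v - u i s v) \<le> ennreal (4 * (growth_bound T)\<^sup>2 * (t - s + \<delta> j))" if "i \<ge> j" for i
    proof -
      have t0: "0 \<le> t" using t by simp
      note bs = grid_index_bounds[OF t(1), of i] and bt = grid_index_bounds[OF t0, of i]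
      have "real (grid_index i s) * \<delta> i < real (Suc (grid_index i t)) * \<delta> i" using bs(1) bt(2) t by linarith
      then have "real (grid_index i s) < real (Suc (grid_index i t))" using \<delta>_pos(1)[of i] by (simp only: mult_less_cancel_right_pos)
      then have le: "grid_index i s \<le> grid_index i t" by linarith
      define m where "m = grid_index i t - grid_index i s"
      have m: "grid_index i t = grid_index i s + m" using le by (simp add: m_def)
      have "N q (\<lambda>v. u i t v - u i s v) \<le> ennreal (4 * (growth_bound T)\<^sup>2 * (real m * \<delta> i))"
        unfolding u_def m using bt(1) t exponents by (intro iterate_increment) (auto simp flip: m)
      also have "\<dots> \<le> ennreal (4 * (growth_bound T)\<^sup>2 * (t - s + \<delta> j))"
      proof (intro ennreal_leI mult_left_mono)
        have "real m * \<delta> i \<le> t - s + \<delta> i"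
          using bt(1) bs(2) unfolding m by (simp add: algebra_simps)
        moreover have "\<delta> i \<le> \<delta> j" unfolding \<delta>_def using that by (intro power_decreasing) auto
        ultimately show "real m * \<delta> i \<le> t - s + \<delta> j" by linarith
      qed auto
      finally show ?thesis .
    qed
    then show "\<forall>\<^sub>F i in sequentially. N q (\<lambda>v. u i t v - u i s v) \<le> ennreal (4 * (growth_bound T)\<^sup>2 * (t - s + \<delta> j))"
      by (auto simp: eventually_sequentially)
  qed measurable
  then show "\<exists>N'. \<forall>j\<ge>N'. N q (\<lambda>v. sol t v - sol s v) \<le> ennreal (4 * (growth_bound T)\<^sup>2 * (t - s + \<delta> j))"
    by auto
qed

text \<open>Interpolation between the Lipschitz bound in order \<open>q\<close> and the bound in order \<open>a\<close>.\<close>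

lemma sol_holder:
  assumes t: "0 \<le> s" "0 \<le> t" "s \<le> T" "t \<le> T" "s \<noteq> t" "\<bar>t - s\<bar> \<le> 1" and r: "0 \<le> r" "r \<le> a"
  shows "N r (\<lambda>v. sol t v - sol s v) \<le> ennreal ((4 * (growth_bound T)\<^sup>2 + 2 * growth_bound T) * \<bar>t - s\<bar> powr (1 - r / a))"
proof -
  have B: "0 \<le> growth_bound T" using growth_bound_ge_1(2)[of T] t by simp
  have q: "N q (\<lambda>v. sol t v - sol s v) \<le> ennreal (4 * (growth_bound T)\<^sup>2 * \<bar>t - s\<bar>)"
  proof (cases "s \<le> t")
    case True
    then show ?thesis using sol_lipschitz[of s t T] t by simp
  next
    case False
    then show ?thesis using sol_lipschitz[of t s T] t by (subst N_diff_commute) simp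
  qed
  have "N a (\<lambda>v. sol t v - sol s v) \<le> ennreal (2 * growth_bound T)"
    using t B by (intro N_diff_le_double sol_bd) auto
  then show ?thesis
    using t r B exponents by (intro N_interpolation[OF _ _ _ _ _ _ _ q]) auto
qed

end

section \<open>The weak equation for the limit\<close>

lemma pairing_bound:
  fixes u \<phi> :: "'a::euclidean_space \<Rightarrow> real"
  assumes [measurable]: "u \<in> borel_measurable borel" "\<phi> \<in> borel_measurable borel"
    and \<phi>: "\<And>v. \<bar>\<phi> v\<bar> \<le> c * weight v powr s" and c: "0 \<le> c"
    and N: "N s u \<le> ennreal x" and x: "0 \<le> x"
  shows "integrable lborel (\<lambda>v. u v * \<phi> v)" "\<bar>LINT v|lborel. u v * \<phi> v\<bar> \<le> c * x"
proof -
  have le: "(\<integral>\<^sup>+v. ennreal (norm (u v * \<phi> v)) \<partial>lborel) \<le> ennreal (c * x)"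
  proof -
    have "(\<integral>\<^sup>+v. ennreal (norm (u v * \<phi> v)) \<partial>lborel) \<le> (\<integral>\<^sup>+v. ennreal c * ennreal (\<bar>u v\<bar> * weight v powr s) \<partial>lborel)"
    proof (rule nn_integral_mono)
      fix v
      have "\<bar>u v\<bar> * \<bar>\<phi> v\<bar> \<le> \<bar>u v\<bar> * (c * weight v powr s)" by (intro mult_left_mono \<phi>) auto
      then show "ennreal (norm (u v * \<phi> v)) \<le> ennreal c * ennreal (\<bar>u v\<bar> * weight v powr s)"
        using c by (simp flip: ennreal_mult add: abs_mult mult.left_commute ennreal_leI)
    qed
    also have "\<dots> = ennreal c * N s u" unfolding N_def by (rule nn_integral_cmult) measurable
    also have "\<dots> \<le> ennreal c * ennreal x" by (intro mult_left_mono N) auto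
    finally show ?thesis using c x by (simp flip: ennreal_mult)
  qed
  show int: "integrable lborel (\<lambda>v. u v * \<phi> v)"
    by (rule integrableI_bounded) (use le in \<open>auto elim!: le_less_trans\<close>)
  have "ennreal \<bar>LINT v|lborel. u v * \<phi> v\<bar> \<le> ennreal (c * x)"
    using integral_norm_bound_ennreal[OF int] le by simp
  then show "\<bar>LINT v|lborel. u v * \<phi> v\<bar> \<le> c * x" using c x by simp
qed

text \<open>A sequence whose increments over steps of length \<open>d\<close> are \<open>d b\<close> up to \<open>o(d)\<close> follows the integral of \<open>b\<close>.\<close>

lemma riemann_limit:
  fixes b :: "real \<Rightarrow> real" and x :: "nat \<Rightarrow> nat \<Rightarrow> real" and d E :: "nat \<Rightarrow> real" and m :: "nat \<Rightarrow> nat"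
  assumes cont: "continuous_on {0..T} b" and T: "0 \<le> T" and d: "\<And>j. 0 < d j" "d \<longlonglongrightarrow> 0" and E: "E \<longlonglongrightarrow> 0"
    and m: "\<And>j. real (m j) * d j \<le> T" "\<And>j. T < real (Suc (m j)) * d j"
    and step: "\<And>j k. real (Suc k) * d j \<le> T \<Longrightarrow> \<bar>x j (Suc k) - x j k - d j * b (real k * d j)\<bar> \<le> d j * E j"
  shows "(\<lambda>j. x j (m j) - x j 0) \<longlonglongrightarrow> integral {0..T} b"
proof -
  define I where "I s = integral {0..s} b" for s
  have int: "b integrable_on {r..s}" if "0 \<le> r" "s \<le> T" for r s
    using continuous_on_subset[OF cont, of "{r..s}"] that by (intro integrable_continuous_real) auto
  have I: "I s - I r = integral {r..s} b" if "0 \<le> r" "r \<le> s" "s \<le> T" for r s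
    using Henstock_Kurzweil_Integration.integral_combine[of 0 r s b] int[of 0 s] that by (simp add: I_def)
  have "(\<lambda>j. x j (m j) - x j 0 - I (real (m j) * d j)) \<longlonglongrightarrow> 0"
  proof (rule LIMSEQ_I)
    fix r :: real assume r: "0 < r"
    \<comment> \<open>Two errors of size \<open>e\<close> per unit time, local and from the modulus of continuity of \<open>b\<close>, add up to
    \<open>2 e (T + 1) = 2/3 r\<close>.\<close>
    define e where "e = r / (3 * (T + 1))"
    have e: "0 < e" using r T by (simp add: e_def)
    have "uniformly_continuous_on {0..T} b" using cont by (intro compact_uniformly_continuous) auto
    then obtain \<eta> where \<eta>: "0 < \<eta>" "\<And>s t. s \<in> {0..T} \<Longrightarrow> t \<in> {0..T} \<Longrightarrow> dist t s < \<eta> \<Longrightarrow> dist (b t) (b s) < e"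
      using e unfolding uniformly_continuous_on_def by meson
    have "\<forall>\<^sub>F j in sequentially. d j < \<eta>" "\<forall>\<^sub>F j in sequentially. E j < e"
      using order_tendstoD(2)[OF d(2) \<eta>(1)] order_tendstoD(2)[OF E e] by auto
    then have "\<forall>\<^sub>F j in sequentially. norm (x j (m j) - x j 0 - I (real (m j) * d j) - 0) < r"
    proof eventually_elim
      case (elim j)
      \<comment> \<open>Global error by induction on the number of steps.\<close>
      have "\<bar>x j k - x j 0 - I (real k * d j)\<bar> \<le> real k * d j * (2 * e)" if "real k * d j \<le> T" for k
        using that
      proof (induction k)
        case 0
        then show ?case by (simp add: I_def)
      next
        case (Suc k)
        let ?s = "real k * d j" and ?t = "real (Suc k) * d j"
        have st: "0 \<le> ?s" "?s \<le> ?t" "?t \<le> T" "?t - ?s = d j" using Suc.prems d(1)[of j] by (auto simp: algebra_simps)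
        have "\<bar>integral {?s..?t} (\<lambda>r. b r - b ?s)\<bar> \<le> e * (?t - ?s)"
        proof -
          have "norm (integral {?s..?t} (\<lambda>r. b r - b ?s)) \<le> e * (?t - ?s)"
          proof (rule integral_bound)
            show "continuous_on {?s..?t} (\<lambda>r. b r - b ?s)"
              using st by (intro continuous_intros continuous_on_subset[OF cont]) auto
            show "norm (b r - b ?s) \<le> e" if "r \<in> {?s..?t}" for r
            proof -
              have "?s \<in> {0..T}" "r \<in> {0..T}" "dist r ?s < \<eta>"
                using that st elim(1) unfolding dist_real_def atLeastAtMost_iff by linarith+
              then show ?thesis using \<eta>(2)[of ?s r] by (simp add: dist_real_def)
            qed
          qed (use st in auto)
          then show ?thesis by simp
        qed
        moreover have "integral {?s..?t} (\<lambda>r. b r - b ?s) = I ?t - I ?s - d j * b ?s"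
          using st int[of ?s ?t] I[of ?s ?t] by (subst Henstock_Kurzweil_Integration.integral_diff) auto
        ultimately have 1: "\<bar>I ?t - I ?s - d j * b ?s\<bar> \<le> e * d j" using st(4) by simp
        have 2: "\<bar>x j (Suc k) - x j k - d j * b ?s\<bar> \<le> d j * E j" by (rule step[OF st(3)])
        have 3: "d j * E j \<le> d j * e" using elim(2) d(1)[of j] by (intro mult_left_mono) auto
        have 4: "\<bar>x j k - x j 0 - I ?s\<bar> \<le> ?s * (2 * e)" using Suc st by auto
        have 5: "?t * (2 * e) = ?s * (2 * e) + d j * e + e * d j" by (simp add: algebra_simps)
        show ?case unfolding 5 using 1 2 3 4 by linarith
      qed
      then have "\<bar>x j (m j) - x j 0 - I (real (m j) * d j)\<bar> \<le> real (m j) * d j * (2 * e)" using m by auto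
      also have "\<dots> \<le> T * (2 * e)" using m(1)[of j] e by (intro mult_right_mono) auto
      also have "\<dots> \<le> (T + 1) * (2 * e)" using e by (intro mult_right_mono) auto
      also have "\<dots> = 2 / 3 * r"
      proof -
        have "T + 1 \<noteq> 0" using T by linarith
        then have "e * (T + 1) = r / 3" unfolding e_def by (simp add: divide_simps)
        moreover have "(T + 1) * (2 * e) = 2 * (e * (T + 1))" by simp
        ultimately show ?thesis by simp
      qed
      also have "\<dots> < r" using r by simp
      finally show ?case by simp
    qed
    then show "\<exists>no. \<forall>j\<ge>no. norm (x j (m j) - x j 0 - I (real (m j) * d j) - 0) < r"
      by (simp add: eventually_sequentially)
  qed
  moreover have "(\<lambda>j. I (real (m j) * d j)) \<longlonglongrightarrow> I T"
  proof (rule continuous_on_tendsto_compose[where s="{0..T}" and f=I and g="\<lambda>j. real (m j) * d j"])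
    show "continuous_on {0..T} I"
      unfolding I_def using int[of 0 T] by (intro indefinite_integral_continuous_1) auto
    show "(\<lambda>j. real (m j) * d j) \<longlonglongrightarrow> T"
    proof (rule real_tendsto_sandwich[of "\<lambda>j. T - d j" _ _ "\<lambda>_. T"])
      show "\<forall>\<^sub>F j in sequentially. T - d j \<le> real (m j) * d j"
        using m(2) by (intro always_eventually allI) (simp add: algebra_simps less_imp_le)
      show "(\<lambda>j. T - d j) \<longlonglongrightarrow> T" using tendsto_diff[OF tendsto_const d(2), of T] by simp
    qed (use m(1) in auto)
    show "\<forall>\<^sub>F j in sequentially. real (m j) * d j \<in> {0..T}"
      using m(1) d(1) by (intro always_eventually allI) (auto intro!: mult_nonneg_nonneg less_imp_le[OF d(1)])
  qed (use T in auto)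
  ultimately have "(\<lambda>j. (x j (m j) - x j 0 - I (real (m j) * d j)) + I (real (m j) * d j)) \<longlonglongrightarrow> 0 + I T"
    by (rule tendsto_add)
  then show ?thesis by (simp add: I_def)
qed

context initial_value
begin

lemma collision_pairing_continuous:
  assumes [measurable]: "\<phi> \<in> borel_measurable borel" and \<phi>: "\<And>v. \<bar>\<phi> v\<bar> \<le> c" and c: "0 \<le> c"
  shows "continuous_on {0..T} (\<lambda>s. LINT v|lborel. collide (pairs hard (sol s)) v * \<phi> v)"
proof (cases "0 \<le> T")
  case True
  define b where "b s = (LINT v|lborel. collide (pairs hard (sol s)) v * \<phi> v)" for s
  define M where "M = growth_bound T"
  define A where "A = 4 * M\<^sup>2 + 2 * M"
  have M: "0 \<le> M" using growth_bound_ge_1(2)[OF True] by (simp add: M_def)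
  have A: "0 \<le> A" using M by (simp add: A_def)
  note [measurable] = rateD(1)[OF rate_hard]
  have ds: "\<bar>b t - b s\<bar> \<le> c * (8 * M * (A * \<bar>t - s\<bar> powr \<theta>))"
    if st: "s \<in> {0..T}" "t \<in> {0..T}" "s \<noteq> t" "\<bar>t - s\<bar> \<le> 1" for s t
  proof -
    have Ns: "N a (sol s) \<le> ennreal M" "N a (sol t) \<le> ennreal M"
      using st by (auto simp: M_def intro: sol_bd)
    have diff: "N 0 (\<lambda>v. collide (pairs hard (sol t)) v - collide (pairs hard (sol s)) v) \<le> ennreal (8 * M * (A * \<bar>t - s\<bar> powr \<theta>))"
    proof (rule hard_collide_diff)
      show "N p (sol t) \<le> ennreal M" "N p (sol s) \<le> ennreal M" by (auto intro: N_p_le Ns)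
      have "N 0 (sol t) \<le> ennreal M" using exponents by (intro N_le_a[OF _ Ns(2)]) auto
      then show "N 0 (sol t) < \<infinity>" by (rule le_less_trans) simp
      show "N p (\<lambda>v. sol t v - sol s v) \<le> ennreal (A * \<bar>t - s\<bar> powr \<theta>)"
        unfolding \<theta>_def A_def M_def using st exponents by (intro sol_holder) auto
    qed (use M A exponents in auto)
    have fin: "N 0 (collide (pairs hard (sol r))) \<le> ennreal (4 * M\<^sup>2)" if "r \<in> {s, t}" for r
      using that Ns M exponents by (intro collide_bound rate_hard) auto
    have int: "integrable lborel (\<lambda>v. collide (pairs hard (sol r)) v * \<phi> v)" if "r \<in> {s, t}" for r
      by (rule pairing_bound(1)[OF _ _ _ c fin[OF that]]) (use \<phi> in auto)
    have "b t - b s = (LINT v|lborel. (collide (pairs hard (sol t)) v - collide (pairs hard (sol s)) v) * \<phi> v)"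
      unfolding b_def using int by (simp add: left_diff_distrib)
    also have "\<bar>\<dots>\<bar> \<le> c * (8 * M * (A * \<bar>t - s\<bar> powr \<theta>))"
      by (rule pairing_bound(2)[OF _ _ _ c diff]) (use \<phi> M A in auto)
    finally show ?thesis .
  qed
  have "continuous_on {0..T} b"
    unfolding continuous_on_def
  proof
    fix s assume s: "s \<in> {0..T}"
    have "((\<lambda>t. b t - b s) \<longlongrightarrow> 0) (at s within {0..T})"
    proof (rule Lim_null_comparison)
      have "\<forall>\<^sub>F t in at s within {0..T}. t \<noteq> s \<and> t \<in> {0..T} \<and> \<bar>t - s\<bar> \<le> 1"
        by (auto simp: eventually_at dist_real_def intro!: exI[of _ 1])
      then show "\<forall>\<^sub>F t in at s within {0..T}. norm (b t - b s) \<le> c * (8 * M * (A * \<bar>t - s\<bar> powr \<theta>))"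
        by eventually_elim (use ds[of s] s in auto)
      have "((\<lambda>t. \<bar>t - s\<bar> powr \<theta>) \<longlongrightarrow> \<bar>s - s\<bar> powr \<theta>) (at s within {0..T})"
        using exponents by (intro tendsto_intros tendsto_powr') auto
      then have "((\<lambda>t. \<bar>t - s\<bar> powr \<theta>) \<longlongrightarrow> 0) (at s within {0..T})" by simp
      then have "((\<lambda>t. c * (8 * M * (A * \<bar>t - s\<bar> powr \<theta>))) \<longlongrightarrow> c * (8 * M * (A * 0))) (at s within {0..T})"
        by (intro tendsto_mult tendsto_const)
      then show "((\<lambda>t. c * (8 * M * (A * \<bar>t - s\<bar> powr \<theta>))) \<longlongrightarrow> 0) (at s within {0..T})" by simp
    qed
    then show "(b \<longlongrightarrow> b s) (at s within {0..T})" by (simp add: LIM_zero_iff)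
  qed
  then show ?thesis by (simp add: b_def[abs_def])
qed simp

text \<open>Consistency of the scheme: it uses the truncated rate at an approximate density.\<close>

lemma scheme_collision_error:
  assumes t: "0 \<le> t" "t \<le> T" and T: "0 \<le> T"
  shows "N 0 (\<lambda>v. collide (pairs hard (sol t)) v - collide (pairs (cutoff (n j)) (u j t)) v) \<le>
    ennreal (8 * growth_bound T * ((lim_const T + 2 * growth_bound T) * (\<delta> j powr \<beta>) powr \<theta>) + 4 * (growth_bound T)\<^sup>2 * n j powr (- \<kappa>))"
proof (rule cutoff_collide_diff[OF n_pos(1) rate_hard])
  have B: "0 \<le> growth_bound T" using growth_bound_ge_1(2)[OF T] .
  show "\<bar>hard r - cutoff (n j) r\<bar> \<le> n j powr (- \<kappa>) * r powr (\<gamma> * (1 + \<kappa>))" for r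
    using cutoff_hard_diff[OF n_pos(1), of j r] by (simp add: abs_minus_commute)
  show "N a (sol t) \<le> ennreal (growth_bound T)" "N a (u j t) \<le> ennreal (growth_bound T)" using t by (auto intro: sol_bd u_bd)
  then have Na: "N a (\<lambda>v. sol t v - u j t v) \<le> ennreal (2 * growth_bound T)" by (intro N_diff_le_double B) auto
  have Nq: "N q (\<lambda>v. sol t v - u j t v) \<le> ennreal (lim_const T * \<delta> j powr \<beta>)"
    using u_sol_le[OF t, of j] by (subst N_diff_commute)
  show "N p (\<lambda>v. sol t v - u j t v) \<le> ennreal ((lim_const T + 2 * growth_bound T) * (\<delta> j powr \<beta>) powr \<theta>)"
    by (rule N_p_interpolation[OF _ _ _ _ Nq Na])
       (use B lim_const_nonneg[OF T] exponents \<delta>_pos(1,3)[of j] \<beta>(1) in \<open>auto intro!: powr_le1\<close>)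
  show "0 \<le> (lim_const T + 2 * growth_bound T) * (\<delta> j powr \<beta>) powr \<theta>"
    using B lim_const_nonneg[OF T] by simp
qed (use growth_bound_ge_1(2)[OF T] exponents in auto)

text \<open>The scheme paired with \<open>\<phi>\<close> is a Riemann sum up to the consistency error.\<close>

lemma sol_weak_form:
  assumes [measurable]: "\<phi> \<in> borel_measurable borel" and \<phi>: "\<And>v. \<bar>\<phi> v\<bar> \<le> c" and c: "0 \<le> c" and t: "0 \<le> t"
  shows "(LINT v|lborel. sol t v * \<phi> v) = (LINT v|lborel. f0 v * \<phi> v) +
    (LINT s:{0..t}|lborel. (LINT v|lborel. collide (pairs hard (sol s)) v * \<phi> v))"
proof -
  define b where "b s = (LINT v|lborel. collide (pairs hard (sol s)) v * \<phi> v)" for s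
  define x where "x j k = (LINT v|lborel. iterate j k v * \<phi> v)" for j k
  define e where "e j = 8 * growth_bound t * ((lim_const t + 2 * growth_bound t) * (\<delta> j powr \<beta>) powr \<theta>) + 4 * (growth_bound t)\<^sup>2 * n j powr (- \<kappa>)" for j
  have B: "0 \<le> growth_bound t" using growth_bound_ge_1(2)[OF t] .
  note [measurable] = rateD(1)[OF rate_hard] rateD(1)[OF rate_cutoff[OF n_pos(2)]]
  have \<phi>0: "\<bar>\<phi> v\<bar> \<le> c * weight v powr 0" for v using \<phi> by simp
  have e0: "0 \<le> e j" for j using B lim_const_nonneg[OF t] by (simp add: e_def)
  have cb: "continuous_on {0..t} b"
    unfolding b_def by (rule collision_pairing_continuous[OF _ \<phi> c]) simp
  have elim: "e \<longlonglongrightarrow> 0"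
  proof -
    have z: "(\<lambda>j. \<delta> j powr r) \<longlonglongrightarrow> 0" if "0 < r" for r
      using tendsto_powr'[OF \<delta>_tendsto tendsto_const, of r] that \<delta>_pos by (auto simp: eventually_sequentially)
    have "(\<lambda>j. n j powr (- \<kappa>)) \<longlonglongrightarrow> 0"
    proof (rule real_tendsto_sandwich[of "\<lambda>_. 0" _ _ "\<lambda>j. M0 * \<delta> j powr \<kappa>"])
      show "(\<lambda>j. M0 * \<delta> j powr \<kappa>) \<longlonglongrightarrow> 0" using tendsto_mult_left[OF z, of \<kappa> M0] exponents by simp
    qed (auto simp: n_powr_le)
    moreover have "(\<lambda>j. (\<delta> j powr \<beta>) powr \<theta>) \<longlonglongrightarrow> 0"
      unfolding powr_powr using z[of "\<beta> * \<theta>"] \<beta>(1) exponents by simp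
    ultimately have "e \<longlonglongrightarrow> 8 * growth_bound t * ((lim_const t + 2 * growth_bound t) * 0) + 4 * (growth_bound t)\<^sup>2 * 0"
      unfolding e_def by (intro tendsto_intros)
    then show ?thesis by simp
  qed
  have itM: "N 0 (iterate j k) \<le> ennreal M0" for j k by (rule iterate_mass_M0)
  have int_it: "integrable lborel (\<lambda>v. iterate j k v * \<phi> v)" for j k
    by (rule pairing_bound(1)[OF _ _ \<phi>0 c itM]) (use M0 in auto)
  have step: "\<bar>x j (Suc k) - x j k - \<delta> j * b (real k * \<delta> j)\<bar> \<le> \<delta> j * (c * e j)"
    if kT: "real (Suc k) * \<delta> j \<le> t" for j k
  proof -
    let ?s = "real k * \<delta> j"
    have s: "0 \<le> ?s" "?s \<le> t" using kT \<delta>_pos(2)[of j] by (auto simp: algebra_simps)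
    have us: "u j ?s = iterate j k" by (simp only: u_def grid_index_grid)
    have Nc: "N 0 (collide (pairs (cutoff (n j)) (iterate j k))) \<le> ennreal (4 * (growth_bound t)\<^sup>2)"
      using iterate_bd[OF s(2)] B exponents by (intro collide_bound rate_cutoff n_pos) auto
    have Nh: "N 0 (collide (pairs hard (sol ?s))) \<le> ennreal (4 * (growth_bound t)\<^sup>2)"
      using sol_bd[OF s] B exponents by (intro collide_bound rate_hard) auto
    have ic: "integrable lborel (\<lambda>v. collide (pairs (cutoff (n j)) (iterate j k)) v * \<phi> v)"
      by (rule pairing_bound(1)[OF _ _ \<phi>0 c Nc]) auto
    have ih: "integrable lborel (\<lambda>v. collide (pairs hard (sol ?s)) v * \<phi> v)"
      by (rule pairing_bound(1)[OF _ _ \<phi>0 c Nh]) auto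
    have "x j (Suc k) = (LINT v|lborel. iterate j k v * \<phi> v + \<delta> j * (collide (pairs (cutoff (n j)) (iterate j k)) v * \<phi> v))"
      unfolding x_def iterate_Suc euler_def by (simp add: algebra_simps)
    also have "\<dots> = x j k + \<delta> j * (LINT v|lborel. collide (pairs (cutoff (n j)) (iterate j k)) v * \<phi> v)"
      unfolding x_def using int_it ic by (subst Bochner_Integration.integral_add) auto
    finally have "x j (Suc k) - x j k - \<delta> j * b ?s =
       - \<delta> j * (LINT v|lborel. (collide (pairs hard (sol ?s)) v - collide (pairs (cutoff (n j)) (iterate j k)) v) * \<phi> v)"
      using ic ih by (simp add: b_def left_diff_distrib algebra_simps)
    moreover have "\<bar>LINT v|lborel. (collide (pairs hard (sol ?s)) v - collide (pairs (cutoff (n j)) (iterate j k)) v) * \<phi> v\<bar> \<le> c * e j"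
      by (rule pairing_bound(2)[OF _ _ \<phi>0 c]) (use scheme_collision_error[OF s t, of j] e0 in \<open>auto simp: e_def us\<close>)
    ultimately show ?thesis
      using \<delta>_pos(2)[of j] by (simp add: abs_mult mult_left_mono)
  qed
  have "(\<lambda>j. x j (grid_index j t) - x j 0) \<longlonglongrightarrow> integral {0..t} b"
  proof (rule riemann_limit[OF cb t \<delta>_pos(1) \<delta>_tendsto _ grid_index_bounds[OF t] step])
    show "(\<lambda>j. c * e j) \<longlonglongrightarrow> 0" using tendsto_mult_left[OF elim, of c] by simp
  qed
  moreover have "(\<lambda>j. x j (grid_index j t) - x j 0) \<longlonglongrightarrow> (LINT v|lborel. sol t v * \<phi> v) - (LINT v|lborel. f0 v * \<phi> v)"
  proof -
    have sM: "N 0 (sol t) \<le> ennreal M0" 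
      using sol_mass[OF t] N_le_a[OF _ M0(2), of 0] exponents by (auto intro: order.trans)
    have int_sol: "integrable lborel (\<lambda>v. sol t v * \<phi> v)"
      by (rule pairing_bound(1)[OF _ _ \<phi>0 c sM]) (use M0 in auto)
    have "(\<lambda>j. x j (grid_index j t) - (LINT v|lborel. sol t v * \<phi> v)) \<longlonglongrightarrow> 0"
    proof (rule Lim_null_comparison)
      show "\<forall>\<^sub>F j in sequentially. norm (x j (grid_index j t) - (LINT v|lborel. sol t v * \<phi> v)) \<le> c * (lim_const t * \<rho> ^ j)"
      proof (intro always_eventually allI)
        fix j
        have "x j (grid_index j t) - (LINT v|lborel. sol t v * \<phi> v) = (LINT v|lborel. (u j t v - sol t v) * \<phi> v)"
          unfolding x_def u_def using int_it int_sol by (simp add: left_diff_distrib)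
        also have "\<bar>\<dots>\<bar> \<le> c * (lim_const t * \<delta> j powr \<beta>)"
        proof (rule pairing_bound(2)[OF _ _ \<phi>0 c])
          show "N 0 (\<lambda>v. u j t v - sol t v) \<le> ennreal (lim_const t * \<delta> j powr \<beta>)"
            using N_mono_exponent[of 0 q "\<lambda>v. u j t v - sol t v"] u_sol_le[OF t order.refl, of j] exponents by auto
        qed (use lim_const_nonneg[OF t] in auto)
        finally show "norm (x j (grid_index j t) - (LINT v|lborel. sol t v * \<phi> v)) \<le> c * (lim_const t * \<rho> ^ j)"
          by (simp add: \<rho>(3))
      qed
      have "(\<lambda>j. \<rho> ^ j) \<longlonglongrightarrow> 0" by (rule LIMSEQ_realpow_zero) (use \<rho>(1,2) in auto)
      then have "(\<lambda>j. c * (lim_const t * \<rho> ^ j)) \<longlonglongrightarrow> c * (lim_const t * 0)" by (rule tendsto_mult_left[OF tendsto_mult_left])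
      then show "(\<lambda>j. c * (lim_const t * \<rho> ^ j)) \<longlonglongrightarrow> 0" by simp
    qed
    then have "(\<lambda>j. x j (grid_index j t)) \<longlonglongrightarrow> (LINT v|lborel. sol t v * \<phi> v)" by (simp add: LIM_zero_iff)
    then show ?thesis by (intro tendsto_diff) (auto simp: x_def)
  qed
  ultimately have "(LINT v|lborel. sol t v * \<phi> v) - (LINT v|lborel. f0 v * \<phi> v) = integral {0..t} b"
    by (rule LIMSEQ_unique[rotated])
  also have "\<dots> = (LINT s:{0..t}|lborel. b s)"
    by (intro set_borel_integral_eq_integral(2)[symmetric] borel_integrable_atLeastAtMost' cb)
  finally show ?thesis by (simp add: b_def)
qed

end

section \<open>Test functions and duality\<close>

definition C1 :: "('a::euclidean_space \<Rightarrow> real) \<Rightarrow> bool" where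
  "C1 f \<longleftrightarrow> (\<exists>G. (\<forall>x. GDERIV f x :> G x) \<and> continuous_on UNIV G)"

lemma C1_I: "(\<And>x. GDERIV f x :> G x) \<Longrightarrow> continuous_on UNIV G \<Longrightarrow> C1 f"
  by (auto simp: C1_def)

lemma C1_continuous:
  assumes "C1 f"
  shows "continuous_on UNIV f"
proof -
  obtain G where "\<And>x. GDERIV f x :> G x" using assms by (auto simp: C1_def)
  then have "isCont f x" for x by (auto simp: gderiv_def intro: has_derivative_continuous)
  then show ?thesis by (simp add: continuous_on_eq_continuous_at)
qed

lemma C1_const: "C1 (\<lambda>_. c)"
  by (rule C1_I[OF GDERIV_const]) simp

lemma C1_add:
  assumes "C1 f" "C1 g"
  shows "C1 (\<lambda>x. f x + g x)"
proof -
  obtain F G where F: "\<And>x. GDERIV f x :> F x" "continuous_on UNIV F"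
    and G: "\<And>x. GDERIV g x :> G x" "continuous_on UNIV G"
    using assms by (auto simp: C1_def)
  show ?thesis
    by (rule C1_I[OF GDERIV_add[OF F(1) G(1)]]) (intro continuous_intros F(2) G(2))
qed

lemma C1_mult:
  assumes "C1 f" "C1 g"
  shows "C1 (\<lambda>x. f x * g x)"
proof -
  obtain F G where F: "\<And>x. GDERIV f x :> F x" "continuous_on UNIV F"
    and G: "\<And>x. GDERIV g x :> G x" "continuous_on UNIV G"
    using assms by (auto simp: C1_def)
  show ?thesis
    by (rule C1_I[OF GDERIV_mult[OF F(1) G(1)]])
       (intro continuous_intros F(2) G(2) C1_continuous assms)
qed

lemma C1_compose:
  assumes g: "C1 g" and f: "\<And>x. (f has_real_derivative f' x) (at x)" "continuous_on UNIV f'"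
  shows "C1 (\<lambda>x. f (g x))"
proof -
  obtain G where G: "\<And>x. GDERIV g x :> G x" "continuous_on UNIV G"
    using g by (auto simp: C1_def)
  have "continuous_on UNIV (\<lambda>x. f' (g x))"
    by (rule continuous_on_compose2[OF f(2) C1_continuous[OF g]]) simp
  then show ?thesis
    by (intro C1_I[OF GDERIV_DERIV_compose[OF G(1) f(1)]] continuous_intros G(2))
qed

lemma C1_bounded_linear:
  fixes f :: "'a::euclidean_space \<Rightarrow> real"
  assumes f: "bounded_linear f"
  shows "C1 f"
proof (rule C1_I)
  fix x
  interpret bounded_linear f by (rule f)
  have "h \<bullet> (\<Sum>b\<in>Basis. f b *\<^sub>R b) = f h" for h
  proof -
    have "f h = f (\<Sum>b\<in>Basis. (h \<bullet> b) *\<^sub>R b)" by (simp add: euclidean_representation)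
    also have "\<dots> = (\<Sum>b\<in>Basis. (h \<bullet> b) * f b)" by (simp add: sum scaleR)
    finally show ?thesis by (simp add: inner_sum_right mult.commute)
  qed
  then show "GDERIV f x :> (\<Sum>b\<in>Basis. f b *\<^sub>R b)"
    unfolding gderiv_def using bounded_linear_imp_has_derivative[OF f] by simp
qed simp

lemma C1_real_polynomial_function:
  fixes f :: "'a::euclidean_space \<Rightarrow> real"
  assumes "real_polynomial_function f"
  shows "C1 f"
  using assms by induction (auto intro: C1_bounded_linear C1_const C1_add C1_mult)

lemma C1_norm_square: "C1 (\<lambda>v::'a::euclidean_space. (norm v)\<^sup>2)"
proof (rule C1_I)
  fix x :: 'a
  have "((\<lambda>v. v \<bullet> v) has_derivative (\<lambda>h. x \<bullet> h + h \<bullet> x)) (at x)"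
    by (auto intro!: derivative_eq_intros)
  then show "GDERIV (\<lambda>v. (norm v)\<^sup>2) x :> 2 *\<^sub>R x"
    by (simp add: gderiv_def power2_norm_eq_inner inner_commute)
qed (intro continuous_intros)

text \<open>The square of the positive part is the simplest continuously differentiable function that vanishes on a half-line;
two of them make a bump.\<close>

definition pos_square :: "real \<Rightarrow> real" where "pos_square x = (max 0 x)\<^sup>2"

lemma DERIV_pos_square: "(pos_square has_real_derivative 2 * max 0 x) (at x)"
proof -
  consider "x > 0" | "x < 0" | "x = 0" by linarith
  then show ?thesis
  proof cases
    case 1
    have "((\<lambda>x. x\<^sup>2) has_real_derivative 2 * x) (at x)" by (auto intro!: derivative_eq_intros)
    then have "(pos_square has_real_derivative 2 * x) (at x)"
      by (rule has_field_derivative_transform_within_open[where S="{0<..}"]) (use 1 in \<open>auto simp: pos_square_def\<close>)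
    then show ?thesis using 1 by simp
  next
    case 2
    have "((\<lambda>x. 0) has_real_derivative 0) (at x)" by simp
    then have "(pos_square has_real_derivative 0) (at x)"
      by (rule has_field_derivative_transform_within_open[where S="{..<0}"]) (use 2 in \<open>auto simp: pos_square_def\<close>)
    then show ?thesis using 2 by simp
  next
    case 3
    have "((\<lambda>h. pos_square h / h) \<longlongrightarrow> 0) (at 0)"
    proof (rule Lim_null_comparison)
      show "\<forall>\<^sub>F h in at 0. norm (pos_square h / h) \<le> \<bar>h\<bar>"
        by (intro always_eventually allI) (auto simp: pos_square_def max_def power2_eq_square)
      show "((\<lambda>h. \<bar>h\<bar>) \<longlongrightarrow> 0) (at (0::real))" by (auto intro!: tendsto_eq_intros)
    qed
    then show ?thesis using 3 by (simp add: DERIV_def pos_square_def)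
  qed
qed

lemma C1_pos_square: "C1 g \<Longrightarrow> C1 (\<lambda>x. pos_square (g x))"
  by (rule C1_compose[OF _ DERIV_pos_square]) (auto intro!: continuous_intros)

definition bump :: "real \<Rightarrow> 'a::euclidean_space \<Rightarrow> real" where
  "bump R v = pos_square (1 - pos_square ((norm v)\<^sup>2 / R\<^sup>2 - 1))"

lemma C1_bump: "C1 (bump R :: 'a::euclidean_space \<Rightarrow> real)"
proof -
  have "C1 (\<lambda>v::'a. pos_square (1 + (- 1) * pos_square ((1 / R\<^sup>2) * (norm v)\<^sup>2 + (- 1))))"
    by (intro C1_pos_square C1_add C1_mult C1_const C1_norm_square)
  then show ?thesis by (simp add: bump_def[abs_def])
qed

lemma bump_bounds: "0 \<le> bump R v" "bump R v \<le> 1"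
  by (auto simp: bump_def pos_square_def max_def power_le_one)

lemma bump_inside: "0 < R \<Longrightarrow> norm v \<le> R \<Longrightarrow> bump R v = 1"
proof -
  assume R: "0 < R" "norm v \<le> R"
  have "(norm v)\<^sup>2 \<le> R\<^sup>2" using R by (intro power_mono) auto
  then have "(norm v)\<^sup>2 / R\<^sup>2 \<le> 1" using R by simp
  then show ?thesis by (simp add: bump_def pos_square_def)
qed

lemma bump_outside: "0 < R \<Longrightarrow> 2 * R < norm v \<Longrightarrow> bump R v = 0"
proof -
  assume R: "0 < R" "2 * R < norm v"
  have "(2 * R)\<^sup>2 \<le> (norm v)\<^sup>2" using R by (intro power_mono) auto
  then have "4 * R\<^sup>2 \<le> (norm v)\<^sup>2" by (simp add: power_mult_distrib)
  then have "2 * R\<^sup>2 \<le> (norm v)\<^sup>2" using zero_le_power2[of R] by linarith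
  then have "2 \<le> (norm v)\<^sup>2 / R\<^sup>2" using R by (simp add: pos_le_divide_eq)
  then have "1 \<le> (max 0 ((norm v)\<^sup>2 / R\<^sup>2 - 1))\<^sup>2" by (intro one_le_power) simp
  then show ?thesis by (simp add: bump_def pos_square_def)
qed

lemma C1_compact_support_iff:
  "C1_compact_support f \<longleftrightarrow> C1 f \<and> compact (closure {x. f x \<noteq> 0})"
  by (auto simp: C1_compact_support_def C1_def)

text \<open>A measurable function is an almost everywhere limit of continuous functions. Clamp these to \<open>[-w, w]\<close>,
approximate them on large balls by polynomials, divide by \<open>1 + e\<close> to return below \<open>w\<close>, and cut off.\<close>

lemma C1_compact_support_approximation:
  fixes \<phi> w :: "'a::euclidean_space \<Rightarrow> real"
  assumes \<phi>: "\<phi> \<in> borel_measurable borel" and w: "continuous_on UNIV w" "\<And>v. 1 \<le> w v"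
    and le: "\<And>v. \<bar>\<phi> v\<bar> \<le> w v"
  obtains \<rho> where "\<And>k. C1_compact_support (\<rho> k)" "\<And>k v. \<bar>\<rho> k v\<bar> \<le> w v"
    "AE v in lborel. (\<lambda>k. \<rho> k v) \<longlonglongrightarrow> \<phi> v"
proof -
  have "\<phi> \<in> borel_measurable lebesgue" using \<phi> by (simp add: measurable_completion)
  then have "\<phi> measurable_on UNIV"
    using lebesgue_measurable_imp_measurable_on[of \<phi> UNIV] by simp
  then obtain N g where N: "negligible N" and g: "\<And>n. continuous_on UNIV (g n)"
    and conv: "\<And>v. v \<notin> N \<Longrightarrow> (\<lambda>n. g n v) \<longlonglongrightarrow> \<phi> v"
    unfolding measurable_on_def by auto
  define h where "h n v = max (- w v) (min (w v) (g n v))" for n v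
  have h: "continuous_on UNIV (h n)" for n
    unfolding h_def by (intro continuous_intros w g)
  have hw: "\<bar>h n v\<bar> \<le> w v" for n v using w(2)[of v] by (auto simp: h_def)
  have hconv: "(\<lambda>n. h n v) \<longlonglongrightarrow> \<phi> v" if "v \<notin> N" for v
  proof -
    have "(\<lambda>n. h n v) \<longlonglongrightarrow> max (- w v) (min (w v) (\<phi> v))"
      unfolding h_def by (intro tendsto_intros conv that)
    also have "max (- w v) (min (w v) (\<phi> v)) = \<phi> v" using le[of v] by (auto simp: abs_le_iff)
    finally show ?thesis .
  qed
  define e where "e n = 1 / real (Suc n)" for n
  have e: "0 < e n" for n by (simp add: e_def)
  have "\<exists>P. real_polynomial_function P \<and> (\<forall>x\<in>cball 0 (2 * real (Suc n)). \<bar>h n x - P x\<bar> < e n)" for n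
    using Stone_Weierstrass_real_polynomial_function[OF compact_cball continuous_on_subset[OF h subset_UNIV] e]
    by metis
  then obtain P where P: "\<And>n. real_polynomial_function (P n)"
      "\<And>n x. x \<in> cball 0 (2 * real (Suc n)) \<Longrightarrow> \<bar>h n x - P n x\<bar> < e n" by metis
  define \<rho> where "\<rho> n v = bump (real (Suc n)) v * ((1 / (1 + e n)) * P n v)" for n v
  have "C1_compact_support (\<rho> n)" for n
    unfolding C1_compact_support_iff
  proof
    show "C1 (\<rho> n)" unfolding \<rho>_def
      by (intro C1_mult C1_const C1_bump C1_real_polynomial_function P)
    have "{x. \<rho> n x \<noteq> 0} \<subseteq> cball 0 (2 * real (Suc n))"
    proof
      fix x assume "x \<in> {x. \<rho> n x \<noteq> 0}"
      then have "bump (real (Suc n)) x \<noteq> 0" by (auto simp: \<rho>_def)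
      then have "\<not> 2 * real (Suc n) < norm x" using bump_outside[of "real (Suc n)" x] by auto
      then show "x \<in> cball 0 (2 * real (Suc n))" by simp
    qed
    then have "bounded {x. \<rho> n x \<noteq> 0}" by (rule bounded_subset[OF bounded_cball])
    then show "compact (closure {x. \<rho> n x \<noteq> 0})" by simp
  qed
  moreover have "\<bar>\<rho> n v\<bar> \<le> w v" for n v
  proof (cases "v \<in> cball 0 (2 * real (Suc n))")
    case True
    have en: "e n \<le> e n * w v" using e[of n] w(2)[of v] by simp
    have "\<bar>P n v\<bar> \<le> w v + e n * w v" using P(2)[OF True] hw[of n v] en by linarith
    then have "\<bar>P n v\<bar> \<le> w v * (1 + e n)" by (simp add: algebra_simps)
    then have "\<bar>(1 / (1 + e n)) * P n v\<bar> \<le> w v" using e[of n] by (simp add: abs_mult field_simps)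
    then have "bump (real (Suc n)) v * \<bar>(1 / (1 + e n)) * P n v\<bar> \<le> 1 * w v"
      using bump_bounds[of "real (Suc n)" v] by (intro mult_mono) auto
    then show ?thesis using bump_bounds(1)[of "real (Suc n)" v] by (simp add: \<rho>_def abs_mult)
  next
    case False
    then have "bump (real (Suc n)) v = 0" by (intro bump_outside) auto
    then show ?thesis using w(2)[of v] by (simp add: \<rho>_def)
  qed
  moreover have "AE v in lborel. (\<lambda>k. \<rho> k v) \<longlonglongrightarrow> \<phi> v"
  proof -
    have e0: "e \<longlonglongrightarrow> 0" unfolding e_def[abs_def] by (rule LIMSEQ_Suc[OF lim_1_over_n])
    have conv\<rho>: "(\<lambda>k. \<rho> k v) \<longlonglongrightarrow> \<phi> v" if v: "v \<notin> N" for v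
    proof -
      obtain n0 :: nat where n0: "norm v \<le> real n0" using real_arch_simple by blast
      have "(\<lambda>k. h k v - P k v) \<longlonglongrightarrow> 0"
      proof (rule Lim_null_comparison[OF _ e0])
        show "\<forall>\<^sub>F k in sequentially. norm (h k v - P k v) \<le> e k"
        proof (intro eventually_sequentiallyI[of n0])
          fix k assume "n0 \<le> k"
          then have "v \<in> cball 0 (2 * real (Suc k))" using n0 by simp
          then show "norm (h k v - P k v) \<le> e k" using P(2)[of v k] by simp
        qed
      qed
      then have "(\<lambda>k. h k v - (h k v - P k v)) \<longlonglongrightarrow> \<phi> v - 0" by (intro tendsto_diff hconv v)
      then have Pc: "(\<lambda>k. P k v) \<longlonglongrightarrow> \<phi> v" by simp
      have "(\<lambda>k. (1 / (1 + e k)) * P k v) \<longlonglongrightarrow> (1 / (1 + 0)) * \<phi> v"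
        by (intro tendsto_intros e0 Pc) simp
      then have lim: "(\<lambda>k. (1 / (1 + e k)) * P k v) \<longlonglongrightarrow> \<phi> v" by simp
      have ev: "\<forall>\<^sub>F k in sequentially. (1 / (1 + e k)) * P k v = \<rho> k v"
      proof (intro eventually_sequentiallyI[of n0])
        fix k assume "n0 \<le> k"
        then have "bump (real (Suc k)) v = 1" using n0 by (intro bump_inside) auto
        then show "(1 / (1 + e k)) * P k v = \<rho> k v" by (simp add: \<rho>_def)
      qed
      show ?thesis by (rule Lim_transform_eventually[OF lim ev])
    qed
    have "AE v in lebesgue. v \<notin> N" using N by (intro AE_not_in) (simp add: negligible_iff_null_sets)
    then have "AE v in lborel. v \<notin> N" by (simp add: AE_completion_iff)
    then show ?thesis by eventually_elim (rule conv\<rho>)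
  qed
  ultimately show thesis by (rule that)
qed

lemma C1_compact_support_measurable:
  "C1_compact_support \<rho> \<Longrightarrow> \<rho> \<in> borel_measurable borel"
  by (auto simp: C1_compact_support_iff intro: borel_measurable_continuous_onI C1_continuous)

text \<open>Approximate \<open>sgn u \<cdot> w\<^sup>s\<close> by test functions that it dominates.\<close>

lemma N_duality:
  fixes u :: "'a::euclidean_space \<Rightarrow> real"
  assumes u[measurable]: "u \<in> borel_measurable borel" and fin: "N s u < \<infinity>" and s: "0 \<le> s" and X: "0 \<le> X"
    and le: "\<And>\<rho>. C1_compact_support \<rho> \<Longrightarrow> (\<And>v. \<bar>\<rho> v\<bar> \<le> weight v powr s) \<Longrightarrow> (LINT v|lborel. u v * \<rho> v) \<le> X"
  shows "N s u \<le> ennreal X"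
proof -
  define \<phi> where "\<phi> v = sgn (u v) * weight v powr s" for v
  have [measurable]: "\<phi> \<in> borel_measurable borel" unfolding \<phi>_def[abs_def] by measurable
  have cw: "continuous_on UNIV (\<lambda>v::'a. weight v powr s)"
    unfolding weight_def by (intro continuous_intros) (auto simp: add_nonneg_eq_0_iff)
  obtain \<rho> where \<rho>: "\<And>k. C1_compact_support (\<rho> k)" "\<And>k v. \<bar>\<rho> k v\<bar> \<le> weight v powr s"
    "AE v in lborel. (\<lambda>k. \<rho> k v) \<longlonglongrightarrow> \<phi> v"
  proof (rule C1_compact_support_approximation[of \<phi> "\<lambda>v. weight v powr s"])
    show "\<bar>\<phi> v\<bar> \<le> weight v powr s" for v by (auto simp: \<phi>_def abs_mult sgn_if)
  qed (use cw s in auto)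
  note [measurable] = C1_compact_support_measurable[OF \<rho>(1)]
  have int: "integrable lborel (\<lambda>v. \<bar>u v\<bar> * weight v powr s)"
    by (rule integrableI_bounded) (use fin in \<open>auto simp: N_def abs_mult\<close>)
  have "(\<lambda>k. LINT v|lborel. u v * \<rho> k v) \<longlonglongrightarrow> (LINT v|lborel. u v * \<phi> v)"
  proof (rule integral_dominated_convergence[OF _ _ int])
    show "AE v in lborel. (\<lambda>k. u v * \<rho> k v) \<longlonglongrightarrow> u v * \<phi> v"
      using \<rho>(3) by eventually_elim (rule tendsto_mult_left)
    show "AE v in lborel. norm (u v * \<rho> k v) \<le> \<bar>u v\<bar> * weight v powr s" for k
      by (intro AE_I2) (auto simp: abs_mult intro!: mult_left_mono \<rho>(2))
  qed measurable
  then have "(LINT v|lborel. u v * \<phi> v) \<le> X"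
    by (rule LIMSEQ_le_const2) (use le \<rho> in auto)
  moreover have "(LINT v|lborel. u v * \<phi> v) = (LINT v|lborel. \<bar>u v\<bar> * weight v powr s)"
    by (intro Bochner_Integration.integral_cong) (auto simp: \<phi>_def abs_sgn)
  moreover have "N s u = ennreal (LINT v|lborel. \<bar>u v\<bar> * weight v powr s)"
    unfolding N_def by (rule nn_integral_eq_integral[OF int]) auto
  ultimately show ?thesis using X by (simp add: ennreal_leI)
qed

section \<open>Weak evolutions and their truncated moments\<close>

lemma integrable_of_N:
  fixes u :: "'a::euclidean_space \<Rightarrow> real"
  assumes [measurable]: "u \<in> borel_measurable borel" and "N s u < \<infinity>"
  shows "integrable lborel (\<lambda>v. \<bar>u v\<bar> * weight v powr s)"
    "N s u = ennreal (LINT v|lborel. \<bar>u v\<bar> * weight v powr s)"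
proof -
  show int: "integrable lborel (\<lambda>v. \<bar>u v\<bar> * weight v powr s)"
    by (rule integrableI_bounded) (use assms in \<open>auto simp: N_def abs_mult\<close>)
  show "N s u = ennreal (LINT v|lborel. \<bar>u v\<bar> * weight v powr s)"
    unfolding N_def by (rule nn_integral_eq_integral[OF int]) auto
qed

text \<open>The class in which solutions are unique, in terms of the norms \<open>N s\<close>: \<open>E0\<close> bounds mass plus energy at all
times, \<open>M0\<close> the moment of order \<open>a\<close> at time 0.\<close>

locale weak_evolution = annihilation B \<gamma> \<alpha> for B :: "'a::euclidean_space \<Rightarrow> 'a \<Rightarrow> real" and \<gamma> \<alpha> +
  fixes g :: "real \<Rightarrow> 'a \<Rightarrow> real" and E0 M0 :: real
  assumes g_measurable: "0 \<le> t \<Longrightarrow> g t \<in> borel_measurable borel"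
    and g_nonneg: "0 \<le> t \<Longrightarrow> AE v in lborel. 0 \<le> g t v"
    and E0: "0 \<le> E0" and M0: "0 \<le> M0"
    and g_N1: "0 \<le> t \<Longrightarrow> N 1 (g t) \<le> ennreal E0"
    and g_cont: "0 \<le> t \<Longrightarrow> 0 < e \<Longrightarrow> \<exists>d>0. \<forall>s\<ge>0. \<bar>s - t\<bar> < d \<longrightarrow> N 1 (\<lambda>v. g s v - g t v) \<le> ennreal e"
    and g_weak: "C1_compact_support \<rho> \<Longrightarrow> 0 \<le> t \<Longrightarrow> (LINT v|lborel. g t v * \<rho> v) =
      (LINT v|lborel. g 0 v * \<rho> v) + (LINT s:{0..t}|lborel. (LINT v|lborel. collide (pairs hard (g s)) v * \<rho> v))"
    and g_local: "0 < s \<Longrightarrow> s \<le> t \<Longrightarrow> set_integrable lborel {s..t} (\<lambda>r. LINT v|lborel. \<bar>g r v\<bar> * weight v powr a)"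
    and g_finite: "AE r in lborel. 0 < r \<longrightarrow> N a (g r) < \<infinity>"
    and g_init: "N a (g 0) \<le> ennreal M0"
begin

definition coll :: "real \<Rightarrow> 'a \<Rightarrow> real" where "coll r = collide (pairs hard (g r))"
definition coll_pairing :: "('a \<Rightarrow> real) \<Rightarrow> real \<Rightarrow> real" where
  "coll_pairing \<phi> r = (LINT v|lborel. coll r v * \<phi> v)"

lemma measurable_coll: "0 \<le> r \<Longrightarrow> coll r \<in> borel_measurable borel"
proof -
  assume r: "0 \<le> r"
  note [measurable] = rateD(1)[OF rate_hard] g_measurable[OF r]
  show ?thesis unfolding coll_def by measurable
qed

lemma coll_N0: "0 \<le> r \<Longrightarrow> N 0 (coll r) \<le> ennreal (4 * E0\<^sup>2)"
proof -
  assume r: "0 \<le> r"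
  have "N (0 + \<gamma> / 2) (g r) \<le> ennreal E0"
    using N_mono_exponent[of "0 + \<gamma> / 2" 1 "g r"] g_N1[OF r] \<gamma> by auto
  then have "4 * (N (0 + \<gamma> / 2) (g r) * N (0 + \<gamma> / 2) (g r)) \<le> ennreal 4 * (ennreal E0 * ennreal E0)"
    by (intro mult_mono) auto
  moreover have "N 0 (coll r) \<le> 4 * (N (0 + \<gamma> / 2) (g r) * N (0 + \<gamma> / 2) (g r))"
    unfolding coll_def by (rule N_collide_pairs_le[OF rate_hard g_measurable[OF r]]) simp
  ultimately have "N 0 (coll r) \<le> ennreal 4 * (ennreal E0 * ennreal E0)" by (rule order.trans[rotated])
  then show ?thesis using E0 by (simp del: ennreal_numeral flip: ennreal_mult add: power2_eq_square)
qed

lemma coll_N0_diff: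
  assumes r: "0 \<le> r" "0 \<le> s" and e: "N 1 (\<lambda>v. g r v - g s v) \<le> ennreal e" "0 \<le> e"
  shows "N 0 (\<lambda>v. coll r v - coll s v) \<le> ennreal (8 * E0 * e)"
proof -
  note [measurable] = g_measurable[OF r(1)] g_measurable[OF r(2)]
  have N1: "N (0 + \<gamma> / 2) h \<le> x" if "N 1 h \<le> x" for h :: "'a \<Rightarrow> real" and x
    using N_mono_exponent[of "0 + \<gamma> / 2" 1 h] that \<gamma> by auto
  have "N 0 (\<lambda>v. coll r v - coll s v) \<le>
      4 * (N (0 + \<gamma> / 2) (\<lambda>v. g r v - g s v) * (N (0 + \<gamma> / 2) (g r) + N (0 + \<gamma> / 2) (g s))) +
      ennreal (4 * 0) * (N (0 + \<gamma> * (1 + 0) / 2) (g s) * N (0 + \<gamma> * (1 + 0) / 2) (g s))"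
    unfolding coll_def using N1[OF g_N1[OF r(1)]] N1[OF g_N1[OF r(2)]]
    by (intro N_collide_pairs_diff_le rate_hard) (auto elim!: le_less_trans)
  also have "\<dots> \<le> ennreal 4 * (ennreal e * (ennreal E0 + ennreal E0)) + 0"
    by (intro add_mono mult_left_mono mult_mono N1 e g_N1 r) auto
  also have "\<dots> = ennreal (8 * E0 * e)"
    using E0 e by (simp del: ennreal_numeral flip: ennreal_mult ennreal_plus add: mult_ac)
  finally show ?thesis .
qed

lemma coll_integrable:
  assumes "0 \<le> r" "\<phi> \<in> borel_measurable borel" "\<And>v. \<bar>\<phi> v\<bar> \<le> c" "0 \<le> c"
  shows "integrable lborel (\<lambda>v. coll r v * \<phi> v)" "\<bar>coll_pairing \<phi> r\<bar> \<le> c * (4 * E0\<^sup>2)"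
proof -
  have \<phi>: "\<bar>\<phi> v\<bar> \<le> c * weight v powr 0" for v using assms(3) by simp
  show "integrable lborel (\<lambda>v. coll r v * \<phi> v)"
    by (rule pairing_bound(1)[OF measurable_coll assms(2) \<phi> assms(4) coll_N0]) (use assms in auto)
  show "\<bar>coll_pairing \<phi> r\<bar> \<le> c * (4 * E0\<^sup>2)" unfolding coll_pairing_def
    by (rule pairing_bound(2)[OF measurable_coll assms(2) \<phi> assms(4) coll_N0]) (use assms in auto)
qed

lemma g_integrable:
  assumes "0 \<le> r" "\<phi> \<in> borel_measurable borel" "\<And>v. \<bar>\<phi> v\<bar> \<le> c * weight v" "0 \<le> c"
  shows "integrable lborel (\<lambda>v. g r v * \<phi> v)"
  by (rule pairing_bound(1)[OF g_measurable assms(2) _ assms(4) g_N1]) (use assms E0 in auto)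

lemma coll_pairing_continuous:
  assumes \<phi>: "\<phi> \<in> borel_measurable borel" "\<And>v. \<bar>\<phi> v\<bar> \<le> c" "0 \<le> c"
  shows "continuous_on {0..} (coll_pairing \<phi>)"
  unfolding continuous_on_iff
proof (intro ballI allI impI)
  fix t e :: real assume t: "t \<in> {0..}" and e: "0 < e"
  define e' where "e' = e / (2 * (c * (8 * E0) + 1))"
  have pos: "0 < c * (8 * E0) + 1" using assms E0 by (simp add: add_nonneg_pos)
  then have e': "0 < e'" using e by (simp add: e'_def)
  obtain d where d: "0 < d" "\<And>s. 0 \<le> s \<Longrightarrow> \<bar>s - t\<bar> < d \<Longrightarrow> N 1 (\<lambda>v. g s v - g t v) \<le> ennreal e'"
    using g_cont[of t e'] t e' by auto
  have "dist (coll_pairing \<phi> s) (coll_pairing \<phi> t) < e" if s: "s \<in> {0..}" "dist s t < d" for s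
  proof -
    have s0: "0 \<le> s" "0 \<le> t" using s t by auto
    have N1: "N 1 (\<lambda>v. g s v - g t v) \<le> ennreal e'" using d(2)[of s] s by (auto simp: dist_real_def)
    note [measurable] = measurable_coll[OF s0(1)] measurable_coll[OF s0(2)]
    have "coll_pairing \<phi> s - coll_pairing \<phi> t = (LINT v|lborel. (coll s v - coll t v) * \<phi> v)"
      unfolding coll_pairing_def using coll_integrable(1)[OF s0(1) \<phi>] coll_integrable(1)[OF s0(2) \<phi>]
      by (simp add: left_diff_distrib)
    also have "\<bar>\<dots>\<bar> \<le> c * (8 * E0 * e')"
      by (rule pairing_bound(2)[OF _ \<phi>(1) _ \<phi>(3) coll_N0_diff[OF s0 N1]]) (use \<phi> e' E0 in auto)
    also have "\<dots> \<le> (c * (8 * E0) + 1) * e'" using e' by (simp add: algebra_simps)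
    also have "\<dots> = e / 2"
    proof -
      define z where "z = c * (8 * E0) + 1"
      show ?thesis using pos unfolding e'_def z_def[symmetric] by simp
    qed
    also have "\<dots> < e" using e by simp
    finally show ?thesis by (simp add: dist_real_def)
  qed
  then show "\<exists>d>0. \<forall>x'\<in>{0..}. dist x' t < d \<longrightarrow> dist (coll_pairing \<phi> x') (coll_pairing \<phi> t) < e"
    using d(1) by blast
qed

text \<open>Dominated convergence extends the weak equation from test functions to bounded measurable functions.\<close>

lemma weak_bounded:
  assumes \<phi>: "\<phi> \<in> borel_measurable borel" "\<And>v. \<bar>\<phi> v\<bar> \<le> c" "1 \<le> c" and t: "0 \<le> t"
  shows "(LINT v|lborel. g t v * \<phi> v) = (LINT v|lborel. g 0 v * \<phi> v) + integral {0..t} (coll_pairing \<phi>)"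
proof -
  have c0: "0 \<le> c" using \<phi>(3) by simp
  obtain \<rho> where \<rho>: "\<And>k. C1_compact_support (\<rho> k)" "\<And>k v. \<bar>\<rho> k v\<bar> \<le> c"
    "AE v in lborel. (\<lambda>k. \<rho> k v) \<longlonglongrightarrow> \<phi> v"
    by (rule C1_compact_support_approximation[OF \<phi>(1) _ _ \<phi>(2)]) (use \<phi>(3) in auto)
  have \<rho>m[measurable]: "\<rho> k \<in> borel_measurable borel" for k by (rule C1_compact_support_measurable[OF \<rho>(1)])
  note [measurable] = \<phi>(1)
  have pair: "(\<lambda>k. LINT v|lborel. x v * \<rho> k v) \<longlonglongrightarrow> (LINT v|lborel. x v * \<phi> v)"
    if [measurable]: "x \<in> borel_measurable borel" and fin: "N 0 x < \<infinity>" for x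
  proof (rule integral_dominated_convergence)
    have "integrable lborel (\<lambda>v. c * (\<bar>x v\<bar> * weight v powr 0))"
      using integrable_of_N(1)[OF that] by simp
    then show "integrable lborel (\<lambda>v. c * \<bar>x v\<bar>)" by simp
    show "AE v in lborel. (\<lambda>k. x v * \<rho> k v) \<longlonglongrightarrow> x v * \<phi> v"
      using \<rho>(3) by eventually_elim (rule tendsto_mult_left)
    show "AE v in lborel. norm (x v * \<rho> k v) \<le> c * \<bar>x v\<bar>" for k
      using mult_left_mono[OF \<rho>(2), of "\<bar>x v\<bar>" for v] by (intro AE_I2) (simp add: abs_mult mult.commute)
  qed measurable
  have gfin: "N 0 (g r) < \<infinity>" if "0 \<le> r" for r
    by (rule le_less_trans[OF order.trans[OF N_mono_exponent g_N1[OF that]]]) auto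
  have lim1: "(\<lambda>k. LINT v|lborel. g r v * \<rho> k v) \<longlonglongrightarrow> (LINT v|lborel. g r v * \<phi> v)" if "0 \<le> r" for r
    by (rule pair[OF g_measurable[OF that] gfin[OF that]])
  have limc: "(\<lambda>k. coll_pairing (\<rho> k) r) \<longlonglongrightarrow> coll_pairing \<phi> r" if "0 \<le> r" for r
    unfolding coll_pairing_def using coll_N0[OF that]
    by (intro pair measurable_coll that) (auto elim!: le_less_trans)
  have mc: "(\<lambda>r. indicator {0..t} r *\<^sub>R coll_pairing \<psi> r) \<in> borel_measurable lborel"
    if "\<psi> \<in> borel_measurable borel" "\<And>v. \<bar>\<psi> v\<bar> \<le> c" for \<psi>
    using borel_measurable_continuous_on_indicator[of "{0..t}" "coll_pairing \<psi>"]
      continuous_on_subset[OF coll_pairing_continuous[OF that c0], of "{0..t}"] by auto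
  have lim2: "(\<lambda>k. LINT r:{0..t}|lborel. coll_pairing (\<rho> k) r) \<longlonglongrightarrow> (LINT r:{0..t}|lborel. coll_pairing \<phi> r)"
    unfolding set_lebesgue_integral_def
  proof (rule integral_dominated_convergence)
    show "(\<lambda>r. indicator {0..t} r *\<^sub>R coll_pairing \<phi> r) \<in> borel_measurable lborel" by (rule mc[OF \<phi>(1,2)])
    show "(\<lambda>r. indicator {0..t} r *\<^sub>R coll_pairing (\<rho> k) r) \<in> borel_measurable lborel" for k by (rule mc[OF \<rho>m \<rho>(2)])
    show "integrable lborel (\<lambda>r. indicator {0..t} r *\<^sub>R (c * (4 * E0\<^sup>2)))"
      using borel_integrable_atLeastAtMost'[of 0 t "\<lambda>_. c * (4 * E0\<^sup>2)"] by (simp add: set_integrable_def)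
    show "AE r in lborel. (\<lambda>k. indicator {0..t} r *\<^sub>R coll_pairing (\<rho> k) r) \<longlonglongrightarrow> indicator {0..t} r *\<^sub>R coll_pairing \<phi> r"
      using limc by (intro AE_I2) (auto simp: indicator_def)
    show "AE r in lborel. norm (indicator {0..t} r *\<^sub>R coll_pairing (\<rho> k) r) \<le> indicator {0..t} r *\<^sub>R (c * (4 * E0\<^sup>2))" for k
      using coll_integrable(2)[OF _ \<rho>m \<rho>(2) c0] by (intro AE_I2) (auto simp: indicator_def)
  qed
  have "(LINT v|lborel. g t v * \<rho> k v) = (LINT v|lborel. g 0 v * \<rho> k v) + (LINT r:{0..t}|lborel. coll_pairing (\<rho> k) r)" for k
    using g_weak[OF \<rho>(1) t] by (simp add: coll_pairing_def coll_def)
  then have "(\<lambda>k. LINT v|lborel. g t v * \<rho> k v) \<longlonglongrightarrow> (LINT v|lborel. g 0 v * \<phi> v) + (LINT r:{0..t}|lborel. coll_pairing \<phi> r)"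
    using tendsto_add[OF lim1[OF order.refl] lim2] by simp
  then have "(LINT v|lborel. g t v * \<phi> v) = (LINT v|lborel. g 0 v * \<phi> v) + (LINT r:{0..t}|lborel. coll_pairing \<phi> r)"
    by (rule LIMSEQ_unique[OF lim1[OF t]])
  also have "(LINT r:{0..t}|lborel. coll_pairing \<phi> r) = integral {0..t} (coll_pairing \<phi>)"
    by (intro set_borel_integral_eq_integral(2) borel_integrable_atLeastAtMost'
        continuous_on_subset[OF coll_pairing_continuous[OF \<phi>(1,2) c0]]) auto
  finally show ?thesis .
qed

lemma coll_pairing_integrable_on:
  assumes \<phi>: "\<phi> \<in> borel_measurable borel" "\<And>v. \<bar>\<phi> v\<bar> \<le> c" "0 \<le> c" and st: "0 \<le> s"
  shows "coll_pairing \<phi> integrable_on {s..t}"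
  by (intro integrable_continuous_real continuous_on_subset[OF coll_pairing_continuous[OF \<phi>]]) (use st in auto)

lemma weak_increment:
  assumes \<phi>: "\<phi> \<in> borel_measurable borel" "\<And>v. \<bar>\<phi> v\<bar> \<le> c" and st: "0 \<le> s" "s \<le> t"
  shows "(LINT v|lborel. g t v * \<phi> v) - (LINT v|lborel. g s v * \<phi> v) = integral {s..t} (coll_pairing \<phi>)"
proof -
  define c' where "c' = max 1 c"
  have c': "1 \<le> c'" "\<And>v. \<bar>\<phi> v\<bar> \<le> c'" using \<phi>(2) by (auto simp: c'_def intro: max.coboundedI2)
  have "integral {0..s} (coll_pairing \<phi>) + integral {s..t} (coll_pairing \<phi>) = integral {0..t} (coll_pairing \<phi>)"
    using st c' by (intro Henstock_Kurzweil_Integration.integral_combine coll_pairing_integrable_on[OF \<phi>(1) c'(2)]) auto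
  then show ?thesis using weak_bounded[OF \<phi>(1) c'(2,1), of t] weak_bounded[OF \<phi>(1) c'(2,1), of s] st by simp
qed

lemma loss_upper:
  assumes r: "0 \<le> r"
  shows "AE v in lborel. 0 \<le> loss (pairs hard (g r)) v \<and> loss (pairs hard (g r)) v \<le> 2 * E0 * (\<bar>g r v\<bar> * weight v powr (\<gamma> / 2))"
proof -
  note [measurable] = rateD(1)[OF rate_hard] g_measurable[OF r]
  have Ng: "N (\<gamma> / 2) (g r) \<le> ennreal E0"
    using N_mono_exponent[of "\<gamma> / 2" 1 "g r"] g_N1[OF r] \<gamma> by auto
  have "AE v in lborel. 0 \<le> loss (pairs hard (g r)) v \<and>
    ennreal (loss (pairs hard (g r)) v) = (\<integral>\<^sup>+w. ennreal \<bar>pairs hard (g r) (v, w)\<bar> \<partial>lborel)"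
    using Ng by (intro AE_loss_pairs rate_hard g_nonneg r) (auto elim!: le_less_trans)
  then show ?thesis
  proof eventually_elim
    case (elim v)
    have "(\<integral>\<^sup>+w. ennreal \<bar>pairs hard (g r) (v, w)\<bar> \<partial>lborel) \<le>
      (\<integral>\<^sup>+w. ennreal (2 * (\<bar>g r v\<bar> * weight v powr (\<gamma> / 2))) * ennreal (\<bar>g r w\<bar> * weight w powr (\<gamma> / 2)) \<partial>lborel)"
    proof (rule nn_integral_mono)
      fix w
      have "\<bar>pairs hard (g r) (v, w)\<bar> = norm (v - w) powr \<gamma> * (\<bar>g r v\<bar> * \<bar>g r w\<bar>)"
        by (simp add: pairs_def hard_def abs_mult)
      also have "\<dots> \<le> (2 * (weight v powr (\<gamma> / 2) * weight w powr (\<gamma> / 2))) * (\<bar>g r v\<bar> * \<bar>g r w\<bar>)"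
        using \<gamma> by (intro mult_right_mono norm_diff_powr_le_product) auto
      finally show "ennreal \<bar>pairs hard (g r) (v, w)\<bar> \<le>
         ennreal (2 * (\<bar>g r v\<bar> * weight v powr (\<gamma> / 2))) * ennreal (\<bar>g r w\<bar> * weight w powr (\<gamma> / 2))"
        by (simp flip: ennreal_mult add: ennreal_leI mult_ac)
    qed
    also have "\<dots> = ennreal (2 * (\<bar>g r v\<bar> * weight v powr (\<gamma> / 2))) * N (\<gamma> / 2) (g r)"
      unfolding N_def by (rule nn_integral_cmult) measurable
    also have "\<dots> \<le> ennreal (2 * (\<bar>g r v\<bar> * weight v powr (\<gamma> / 2))) * ennreal E0"
      by (intro mult_left_mono Ng) auto
    finally have "ennreal (loss (pairs hard (g r)) v) \<le> ennreal (2 * E0 * (\<bar>g r v\<bar> * weight v powr (\<gamma> / 2)))"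
      using elim E0 by (simp flip: ennreal_mult add: mult_ac)
    then show ?case using elim E0 by (subst (asm) ennreal_le_iff) auto
  qed
qed

text \<open>The truncated weight is cut at \<open>w \<le> m\<close> to make it bounded. Dropping the cut only increases the
gain. In the loss, the part above level \<open>m\<close> remains as an error, which the moment of order \<open>a\<close> controls.\<close>

lemma coll_moment_upper:
  assumes r: "0 \<le> r" and fin: "N a (g r) < \<infinity>" and R: "1 \<le> R" and m: "0 \<le> m"
  defines "\<psi> \<equiv> \<lambda>v::'a. trunc_weight \<gamma> R (weight v)" and "\<psi>k \<equiv> \<lambda>v::'a. trunc_weight \<gamma> R (weight v) * indicator {..m} (weight v)"
  shows "coll_pairing \<psi>k r \<le> povzner_const * E0\<^sup>2 + 2 * E0 * R powr (\<gamma> / 2) *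
    (LINT v|lborel. \<bar>g r v\<bar> * weight v powr a * indicator {m<..} (weight v))"
proof -
  note [measurable] = rateD(1)[OF rate_hard] g_measurable[OF r]
  let ?L = "loss (pairs hard (g r))" and ?G = "gain (pairs hard (g r))" and ?Ra = "R powr (\<gamma> / 2)"
  have [measurable]: "\<psi> \<in> borel_measurable borel" "\<psi>k \<in> borel_measurable borel"
    unfolding \<psi>_def \<psi>k_def by measurable
  have \<psi>: "0 \<le> \<psi> v" "\<psi> v \<le> ?Ra * weight v" for v
    unfolding \<psi>_def using trunc_weight_bounds[OF R] by auto
  have \<psi>k: "0 \<le> \<psi>k v" "\<psi>k v \<le> \<psi> v" for v
    using \<psi>(1)[of v] by (auto simp: \<psi>k_def \<psi>_def indicator_def)
  have gain_fin: "N 1 ?G < \<infinity>" and loss_fin: "N 1 ?L < \<infinity>"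
  proof -
    have "N2 1 (pairs hard (g r)) \<le> 2 * (N (1 + \<gamma> / 2) (g r) * N (1 + \<gamma> / 2) (g r))"
      by (rule N2_pairs[OF rate_hard]) simp
    also have "\<dots> < \<infinity>" using fin by (simp add: a_def ennreal_mult_less_top)
    finally have "N2 1 (pairs hard (g r)) < \<infinity>" .
    then show "N 1 ?G < \<infinity>" "N 1 ?L < \<infinity>"
      using N_gain_le[of "pairs hard (g r)" 1] N_loss_le[of "pairs hard (g r)" 1] by (auto elim!: le_less_trans)
  qed
  have int: "integrable lborel (\<lambda>v. x v * \<zeta> v)"
    if [measurable]: "x \<in> borel_measurable borel" "\<zeta> \<in> borel_measurable borel" and f: "N 1 x < \<infinity>" and \<zeta>: "\<And>v. 0 \<le> \<zeta> v" "\<And>v. \<zeta> v \<le> \<psi> v" for x \<zeta>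
  proof -
    obtain X where X: "N 1 x = ennreal X" "0 \<le> X" using f by (cases "N 1 x") auto
    have \<zeta>b: "\<bar>\<zeta> v\<bar> \<le> ?Ra * weight v powr 1" for v
      using \<zeta>(1)[of v] \<zeta>(2)[of v] \<psi>(2)[of v] by simp
    show ?thesis
      by (rule pairing_bound(1)[OF that(1,2) \<zeta>b _ _ X(2)]) (simp_all add: X(1))
  qed
  have gain_abs_fin: "N 1 (\<lambda>v. \<bar>?G v\<bar>) < \<infinity>" using gain_fin by (simp add: N_def)
  have iGk: "integrable lborel (\<lambda>v. ?G v * \<psi>k v)" by (rule int[OF _ _ gain_fin \<psi>k]) measurable
  have iLk: "integrable lborel (\<lambda>v. ?L v * \<psi>k v)" by (rule int[OF _ _ loss_fin \<psi>k]) measurable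
  have iL: "integrable lborel (\<lambda>v. ?L v * \<psi> v)" by (rule int[OF _ _ loss_fin \<psi>(1) order.refl]) measurable
  have iG: "integrable lborel (\<lambda>v. \<bar>?G v\<bar> * \<psi> v)" by (rule int[OF _ _ gain_abs_fin \<psi>(1) order.refl]) measurable
  have L: "AE v in lborel. 0 \<le> ?L v \<and> ?L v \<le> 2 * E0 * (\<bar>g r v\<bar> * weight v powr (\<gamma> / 2))"
    by (rule loss_upper[OF r])
  have main: "(1 - \<alpha>) * (LINT v|lborel. \<bar>?G v\<bar> * \<psi> v) \<le> (LINT v|lborel. ?L v * \<psi> v) + povzner_const * E0\<^sup>2"
  proof -
    have Ng: "N (\<gamma> / 2) (g r) < \<infinity>"
      using N_mono_exponent[of "\<gamma> / 2" 1 "g r"] g_N1[OF r] \<gamma> by (auto elim!: le_less_trans)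
    have "2 * (ennreal (1 - \<alpha>) * (\<integral>\<^sup>+v. ennreal (\<bar>?G v\<bar> * \<psi> v) \<partial>lborel)) \<le>
      2 * (\<integral>\<^sup>+v. ennreal (?L v * \<psi> v) \<partial>lborel) + ennreal (2 * povzner_const) * (N 1 (g r) * N 1 (g r))"
      by (rule gain_moment_le[OF rate_hard _ _ g_nonneg[OF r] Ng \<psi>(1)])
         (use povzner_const_nonneg collision_bound_trunc[OF rate_hard R] in \<open>auto simp: \<psi>_def\<close>)
    also have "\<dots> \<le> 2 * (\<integral>\<^sup>+v. ennreal (?L v * \<psi> v) \<partial>lborel) + ennreal (2 * povzner_const) * (ennreal E0 * ennreal E0)"
      by (intro add_left_mono mult_left_mono mult_mono g_N1 r) auto
    also have "(\<integral>\<^sup>+v. ennreal (?L v * \<psi> v) \<partial>lborel) = ennreal (LINT v|lborel. ?L v * \<psi> v)"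
      by (rule nn_integral_eq_integral[OF iL]) (use L in eventually_elim, simp add: \<psi>)
    also have "(\<integral>\<^sup>+v. ennreal (\<bar>?G v\<bar> * \<psi> v) \<partial>lborel) = ennreal (LINT v|lborel. \<bar>?G v\<bar> * \<psi> v)"
      by (rule nn_integral_eq_integral[OF iG]) (simp add: \<psi>)
    finally have e: "2 * (ennreal (1 - \<alpha>) * ennreal (LINT v|lborel. \<bar>?G v\<bar> * \<psi> v)) \<le>
        2 * ennreal (LINT v|lborel. ?L v * \<psi> v) + ennreal (2 * povzner_const) * (ennreal E0 * ennreal E0)" .
    have nn: "0 \<le> (LINT v|lborel. \<bar>?G v\<bar> * \<psi> v)" "0 \<le> (LINT v|lborel. ?L v * \<psi> v)"
    proof -
      show "0 \<le> (LINT v|lborel. \<bar>?G v\<bar> * \<psi> v)" by (intro integral_nonneg_AE AE_I2) (simp add: \<psi>)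
      show "0 \<le> (LINT v|lborel. ?L v * \<psi> v)"
        by (rule integral_nonneg_AE, use L in eventually_elim) (simp add: \<psi>)
    qed
    have "2 * (ennreal (1 - \<alpha>) * ennreal (LINT v|lborel. \<bar>?G v\<bar> * \<psi> v)) = ennreal (2 * ((1 - \<alpha>) * (LINT v|lborel. \<bar>?G v\<bar> * \<psi> v)))"
      using nn \<alpha> by (simp add: ennreal_mult)
    moreover have "2 * ennreal (LINT v|lborel. ?L v * \<psi> v) + ennreal (2 * povzner_const) * (ennreal E0 * ennreal E0) =
       ennreal (2 * (LINT v|lborel. ?L v * \<psi> v) + 2 * povzner_const * (E0 * E0))"
      using nn povzner_const_nonneg E0 by (simp add: ennreal_mult ennreal_plus)
    ultimately have "ennreal (2 * ((1 - \<alpha>) * (LINT v|lborel. \<bar>?G v\<bar> * \<psi> v))) \<le> ennreal (2 * (LINT v|lborel. ?L v * \<psi> v) + 2 * povzner_const * (E0 * E0))"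
      using e by simp
    moreover have "0 \<le> 2 * (LINT v|lborel. ?L v * \<psi> v) + 2 * povzner_const * (E0 * E0)"
      using nn povzner_const_nonneg E0 by simp
    ultimately show ?thesis by (simp add: power2_eq_square)
  qed
  have "coll_pairing \<psi>k r = (LINT v|lborel. (1 - \<alpha>) * (?G v * \<psi>k v) - ?L v * \<psi>k v)"
    unfolding coll_pairing_def coll_def collide_def by (intro Bochner_Integration.integral_cong) (auto simp: algebra_simps)
  also have "\<dots> = (1 - \<alpha>) * (LINT v|lborel. ?G v * \<psi>k v) - (LINT v|lborel. ?L v * \<psi>k v)"
    using iGk iLk by (subst Bochner_Integration.integral_diff) auto
  also have "(1 - \<alpha>) * (LINT v|lborel. ?G v * \<psi>k v) \<le> (1 - \<alpha>) * (LINT v|lborel. \<bar>?G v\<bar> * \<psi> v)"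
  proof (intro mult_left_mono integral_mono iGk iG)
    fix v
    have "?G v * \<psi>k v \<le> \<bar>?G v\<bar> * \<psi>k v" using \<psi>k by (intro mult_right_mono) auto
    also have "\<dots> \<le> \<bar>?G v\<bar> * \<psi> v" using \<psi>k by (intro mult_left_mono) auto
    finally show "?G v * \<psi>k v \<le> \<bar>?G v\<bar> * \<psi> v" .
  qed (use \<alpha> in auto)
  also note main
  also have "(LINT v|lborel. ?L v * \<psi> v) + povzner_const * E0\<^sup>2 - (LINT v|lborel. ?L v * \<psi>k v) =
      povzner_const * E0\<^sup>2 + (LINT v|lborel. ?L v * \<psi> v - ?L v * \<psi>k v)"
    using iL iLk by simp
  also have "(LINT v|lborel. ?L v * \<psi> v - ?L v * \<psi>k v) \<le>
      (LINT v|lborel. 2 * E0 * ?Ra * (\<bar>g r v\<bar> * weight v powr a * indicator {m<..} (weight v)))"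
  proof (rule integral_mono_AE)
    show "integrable lborel (\<lambda>v. ?L v * \<psi> v - ?L v * \<psi>k v)" using iL iLk by simp
    have "integrable lborel (\<lambda>v. \<bar>g r v\<bar> * weight v powr a * indicator {m<..} (weight v))"
      by (rule Bochner_Integration.integrable_bound[OF integrable_of_N(1)[OF _ fin]])
         (auto simp: indicator_def)
    then show "integrable lborel (\<lambda>v. 2 * E0 * ?Ra * (\<bar>g r v\<bar> * weight v powr a * indicator {m<..} (weight v)))"
      by simp
    show "AE v in lborel. ?L v * \<psi> v - ?L v * \<psi>k v \<le> 2 * E0 * ?Ra * (\<bar>g r v\<bar> * weight v powr a * indicator {m<..} (weight v))"
      using L
    proof eventually_elim
      case (elim v)
      show ?case
      proof (cases "weight v \<le> m")
        case True
        then show ?thesis by (simp add: \<psi>_def \<psi>k_def)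
      next
        case False
        have "?L v * \<psi> v \<le> (2 * E0 * (\<bar>g r v\<bar> * weight v powr (\<gamma> / 2))) * (?Ra * weight v)"
          using elim \<psi> E0 by (intro mult_mono) auto
        also have "\<dots> = 2 * E0 * ?Ra * (\<bar>g r v\<bar> * (weight v powr 1 * weight v powr (\<gamma> / 2)))"
          by (simp add: mult_ac)
        also have "weight v powr 1 * weight v powr (\<gamma> / 2) = weight v powr a"
          unfolding a_def by (rule powr_add[symmetric])
        finally show ?thesis using False by (simp add: \<psi>k_def)
      qed
    qed
  qed
  finally show ?thesis by simp
qed

end

section \<open>Moment bound and local expansion of weak evolutions\<close>

lemma C1_compact_support_bounded:
  fixes \<rho> :: "'a::euclidean_space \<Rightarrow> real"
  assumes "C1_compact_support \<rho>"
  obtains c where "0 \<le> c" "\<And>v. \<bar>\<rho> v\<bar> \<le> c"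
proof -
  let ?S = "closure {x. \<rho> x \<noteq> 0}"
  have "continuous_on ?S \<rho>" "compact ?S"
    using assms continuous_on_subset[OF C1_continuous[of \<rho>] subset_UNIV] by (simp_all add: C1_compact_support_iff)
  then have "bounded (\<rho> ` ?S)" by (intro compact_imp_bounded compact_continuous_image)
  then obtain c where c: "0 < c" "\<And>x. x \<in> \<rho> ` ?S \<Longrightarrow> norm x \<le> c" by (auto simp: bounded_pos)
  have "\<bar>\<rho> v\<bar> \<le> c" for v
  proof (cases "\<rho> v = 0")
    case False
    then have "v \<in> {x. \<rho> x \<noteq> 0}" by simp
    then have "v \<in> ?S" by (rule subsetD[OF closure_subset])
    then show ?thesis using c(2)[of "\<rho> v"] by simp
  qed (use c in simp)
  then show thesis using c(1) by (intro that[of c]) auto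
qed

context weak_evolution
begin

text \<open>Stated for a contraction \<open>m\<close> of the real line so that it covers both \<open>g\<close> and \<open>|g|\<close>.\<close>

lemma g_pairing_continuous:
  assumes \<zeta>: "\<zeta> \<in> borel_measurable borel" "\<And>v. \<bar>\<zeta> v\<bar> \<le> c * weight v" "0 \<le> c"
    and m: "m \<in> borel_measurable borel" "\<And>x y. \<bar>m x - m y\<bar> \<le> \<bar>x - y\<bar>" "m 0 = 0"
  shows "continuous_on {0..} (\<lambda>r. LINT v|lborel. m (g r v) * \<zeta> v)"
  unfolding continuous_on_iff
proof (intro ballI allI impI)
  fix t e :: real assume t: "t \<in> {0..}" and e: "0 < e"
  define e' where "e' = e / (2 * (c + 1))"
  have e': "0 < e'" using e \<zeta>(3) by (simp add: e'_def)
  obtain d where d: "0 < d" "\<And>s. 0 \<le> s \<Longrightarrow> \<bar>s - t\<bar> < d \<Longrightarrow> N 1 (\<lambda>v. g s v - g t v) \<le> ennreal e'"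
    using g_cont[of t e'] t e' by auto
  have \<zeta>1: "\<bar>\<zeta> v\<bar> \<le> c * weight v powr 1" for v using \<zeta>(2)[of v] by simp
  have mint: "integrable lborel (\<lambda>v. m (g s v) * \<zeta> v)" if s: "0 \<le> s" for s
  proof (rule pairing_bound(1)[OF _ \<zeta>(1) \<zeta>1 \<zeta>(3)])
    show "(\<lambda>v. m (g s v)) \<in> borel_measurable borel" using m(1) g_measurable[OF s] by measurable
    have "\<bar>m x\<bar> \<le> \<bar>x\<bar>" for x using m(2)[of x 0] m(3) by simp
    then have "N 1 (\<lambda>v. m (g s v)) \<le> N 1 (g s)" by (intro N_mono_AE) auto
    then show "N 1 (\<lambda>v. m (g s v)) \<le> ennreal E0" using g_N1[OF s] by (rule order.trans)
  qed (rule E0)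
  have "dist (LINT v|lborel. m (g s v) * \<zeta> v) (LINT v|lborel. m (g t v) * \<zeta> v) < e" if s: "s \<in> {0..}" "dist s t < d" for s
  proof -
    have s0: "0 \<le> s" "0 \<le> t" using s t by auto
    have mm: "(\<lambda>v. m (g s v) - m (g t v)) \<in> borel_measurable borel"
      using m(1) g_measurable[OF s0(1)] g_measurable[OF s0(2)] by measurable
    have N1: "N 1 (\<lambda>v. g s v - g t v) \<le> ennreal e'" using d(2)[of s] s by (auto simp: dist_real_def)
    have "N 1 (\<lambda>v. m (g s v) - m (g t v)) \<le> N 1 (\<lambda>v. g s v - g t v)" by (intro N_mono_AE) (auto simp: m(2))
    then have N1m: "N 1 (\<lambda>v. m (g s v) - m (g t v)) \<le> ennreal e'" using N1 by (rule order.trans)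
    have "(LINT v|lborel. m (g s v) * \<zeta> v) - (LINT v|lborel. m (g t v) * \<zeta> v) = (LINT v|lborel. (m (g s v) - m (g t v)) * \<zeta> v)"
      using mint[OF s0(1)] mint[OF s0(2)] by (simp add: left_diff_distrib)
    also have "\<bar>\<dots>\<bar> \<le> c * e'"
      by (rule pairing_bound(2)[OF mm \<zeta>(1) \<zeta>1 \<zeta>(3) N1m]) (use e' in auto)
    also have "\<dots> \<le> (c + 1) * e'" using e' by (simp add: algebra_simps)
    also have "\<dots> = e / 2" using \<zeta>(3) unfolding e'_def by (simp add: field_simps)
    also have "\<dots> < e" using e by simp
    finally show ?thesis by (simp add: dist_real_def)
  qed
  then show "\<exists>d>0. \<forall>x'\<in>{0..}. dist x' t < d \<longrightarrow>
      dist (LINT v|lborel. m (g x' v) * \<zeta> v) (LINT v|lborel. m (g t v) * \<zeta> v) < e"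
    using d(1) by blast
qed

text \<open>Integrate the bound of \<open>coll_moment_upper\<close> over \<open>[s, t]\<close> and let the cut level tend to infinity. The error is
the time integral of the tail of the moment of order \<open>a\<close>; it vanishes by dominated convergence, since that
moment is integrable over \<open>[s, t]\<close>.\<close>

lemma trunc_moment_increment:
  assumes R: "1 \<le> R" and st: "0 < s" "s \<le> t"
  defines "\<psi> \<equiv> \<lambda>v::'a. trunc_weight \<gamma> R (weight v)"
  shows "(LINT v|lborel. g t v * \<psi> v) - (LINT v|lborel. g s v * \<psi> v) \<le> povzner_const * E0\<^sup>2 * (t - s)"
proof -
  define Ra where "Ra = R powr (\<gamma> / 2)"
  define \<psi>k where "\<psi>k k v = trunc_weight \<gamma> R (weight v) * indicator {..real k} (weight v)" for k :: nat and v :: 'a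
  define \<zeta> where "\<zeta> k v = weight v powr a * indicator {..real k} (weight v)" for k :: nat and v :: 'a
  define H where "H r = (LINT v|lborel. \<bar>g r v\<bar> * weight v powr a)" for r
  define l where "l k r = (LINT v|lborel. \<bar>g r v\<bar> * \<zeta> k v)" for k r
  define A where "A = povzner_const * E0\<^sup>2"
  have Ra: "0 \<le> Ra" by (simp add: Ra_def)
  have [measurable]: "\<psi> \<in> borel_measurable borel" "\<psi>k k \<in> borel_measurable borel" "\<zeta> k \<in> borel_measurable borel" for k
    unfolding \<psi>_def \<psi>k_def[abs_def] \<zeta>_def[abs_def] by measurable
  have \<psi>: "0 \<le> \<psi> v" "\<psi> v \<le> Ra * weight v" for v
    unfolding \<psi>_def Ra_def using trunc_weight_bounds[OF R] by auto
  have \<psi>k: "0 \<le> \<psi>k k v" "\<psi>k k v \<le> \<psi> v" for k v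
    using \<psi>(1)[of v] by (auto simp: \<psi>k_def \<psi>_def indicator_def)
  have \<psi>kb: "\<bar>\<psi>k k v\<bar> \<le> Ra * real k" for k v
  proof (cases "weight v \<le> real k")
    case True
    have "\<psi>k k v \<le> Ra * weight v" using \<psi>k(2)[of k v] \<psi>(2)[of v] by linarith
    also have "\<dots> \<le> Ra * real k" using True Ra by (intro mult_left_mono)
    finally show ?thesis using \<psi>k(1)[of k v] by simp
  qed (use Ra in \<open>simp add: \<psi>k_def\<close>)
  have \<zeta>b: "\<bar>\<zeta> k v\<bar> \<le> real k powr (\<gamma> / 2) * weight v" for k v
  proof (cases "weight v \<le> real k")
    case True
    have "weight v powr a = weight v powr (\<gamma> / 2) * weight v"
      using powr_add[of "weight v" "\<gamma> / 2" 1] by (simp add: a_def add.commute)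
    also have "\<dots> \<le> real k powr (\<gamma> / 2) * weight v"
      using True \<gamma> by (intro mult_right_mono powr_mono2) auto
    finally show ?thesis by (simp add: \<zeta>_def indicator_def)
  qed (simp add: \<zeta>_def)
  have lcont: "continuous_on {s..t} (l k)" for k
    unfolding l_def using st
    by (intro continuous_on_subset[OF g_pairing_continuous[OF _ \<zeta>b _ _ abs_triangle_ineq3]]) auto
  have Hint: "set_integrable lborel {s..t} H" unfolding H_def using g_local st by simp
  have lint: "set_integrable lborel {s..t} (l k)" for k by (rule borel_integrable_atLeastAtMost'[OF lcont])
  have fin: "AE r in lborel. r \<in> {s..t} \<longrightarrow> N a (g r) < \<infinity>"
    using g_finite by eventually_elim (use st in auto)
  \<comment> \<open>\<open>H - l k\<close> is the tail of the moment of order \<open>a\<close> above level \<open>k\<close>.\<close>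
  have Hl: "(LINT v|lborel. \<bar>g r v\<bar> * weight v powr a * indicator {real k<..} (weight v)) = H r - l k r \<and> 0 \<le> H r - l k r \<and> 0 \<le> l k r"
    if r: "0 \<le> r" "N a (g r) < \<infinity>" for r k
  proof -
    note [measurable] = g_measurable[OF r(1)]
    have i1: "integrable lborel (\<lambda>v. \<bar>g r v\<bar> * weight v powr a)" by (rule integrable_of_N(1)) (use r in auto)
    have i2: "integrable lborel (\<lambda>v. \<bar>g r v\<bar> * \<zeta> k v)"
      by (rule Bochner_Integration.integrable_bound[OF i1]) (auto simp: \<zeta>_def indicator_def)
    have "H r - l k r = (LINT v|lborel. \<bar>g r v\<bar> * weight v powr a - \<bar>g r v\<bar> * \<zeta> k v)"
      unfolding H_def l_def using i1 i2 by simp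
    also have "\<dots> = (LINT v|lborel. \<bar>g r v\<bar> * weight v powr a * indicator {real k<..} (weight v))"
      by (intro Bochner_Integration.integral_cong) (auto simp: \<zeta>_def indicator_def)
    finally have e: "H r - l k r = (LINT v|lborel. \<bar>g r v\<bar> * weight v powr a * indicator {real k<..} (weight v))" .
    moreover have "0 \<le> \<dots>" by (intro integral_nonneg_AE) auto
    moreover have "0 \<le> l k r" unfolding l_def \<zeta>_def by (intro integral_nonneg_AE) auto
    ultimately show ?thesis by simp
  qed
  have cpk: "continuous_on {s..t} (coll_pairing (\<psi>k k))" for k
    using st Ra by (intro continuous_on_subset[OF coll_pairing_continuous[OF _ \<psi>kb]]) auto
  define D where "D k = (LINT r:{s..t}|lborel. H r - l k r)" for k
  have iA: "set_integrable lborel {s..t} (\<lambda>_. A)" by (rule borel_integrable_atLeastAtMost') simp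
  have step: "(LINT v|lborel. g t v * \<psi>k k v) - (LINT v|lborel. g s v * \<psi>k k v) \<le> A * (t - s) + 2 * E0 * Ra * D k" for k
  proof -
    have "(LINT v|lborel. g t v * \<psi>k k v) - (LINT v|lborel. g s v * \<psi>k k v) = integral {s..t} (coll_pairing (\<psi>k k))"
      by (rule weak_increment[OF _ \<psi>kb]) (use st in auto)
    also have "\<dots> = (LINT r:{s..t}|lborel. coll_pairing (\<psi>k k) r)"
      by (intro set_borel_integral_eq_integral(2)[symmetric] borel_integrable_atLeastAtMost' cpk)
    also have "\<dots> \<le> (LINT r:{s..t}|lborel. A + 2 * E0 * Ra * (H r - l k r))"
    proof (rule set_integral_mono_AE)
      show "set_integrable lborel {s..t} (coll_pairing (\<psi>k k))" by (rule borel_integrable_atLeastAtMost'[OF cpk])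
      show "set_integrable lborel {s..t} (\<lambda>r. A + 2 * E0 * Ra * (H r - l k r))"
        by (intro set_integral_add(1) set_integrable_mult_right set_integral_diff(1) Hint lint iA)
      show "AE r\<in>{s..t} in lborel. coll_pairing (\<psi>k k) r \<le> A + 2 * E0 * Ra * (H r - l k r)"
        using fin
      proof eventually_elim
        case (elim r)
        show ?case
        proof
          assume r: "r \<in> {s..t}"
          have r0: "0 \<le> r" "N a (g r) < \<infinity>" using r elim st by auto
          show "coll_pairing (\<psi>k k) r \<le> A + 2 * E0 * Ra * (H r - l k r)"
            using coll_moment_upper[OF r0 R, of "real k"] Hl[OF r0, of k]
            by (simp add: \<psi>k_def[abs_def] A_def Ra_def)
        qed
      qed
    qed
    also have "\<dots> = (LINT r:{s..t}|lborel. A) + 2 * E0 * Ra * D k"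
    proof -
      have "set_integrable lborel {s..t} (\<lambda>r. 2 * E0 * Ra * (H r - l k r))"
        by (intro set_integrable_mult_right set_integral_diff(1) Hint lint)
      then show ?thesis
        unfolding D_def using iA by (simp add: set_integral_add(2) set_integral_mult_right)
    qed
    also have "(LINT r:{s..t}|lborel. A) = integral {s..t} (\<lambda>_. A)"
      by (rule set_borel_integral_eq_integral(2)[OF iA])
    also have "\<dots> = A * (t - s)" using st by simp
    finally show ?thesis .
  qed
  \<comment> \<open>Dominated convergence in time, and for each time in velocity.\<close>
  have Dlim: "D \<longlonglongrightarrow> 0"
  proof -
    have "(\<lambda>k. LINT r|lborel. indicator {s..t} r *\<^sub>R (H r - l k r)) \<longlonglongrightarrow> (LINT r|(lborel :: real measure). (0::real))"
    proof (rule integral_dominated_convergence)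
      show "integrable lborel (\<lambda>r. indicator {s..t} r *\<^sub>R H r)" using Hint by (simp add: set_integrable_def)
      show "(\<lambda>r. indicator {s..t} r *\<^sub>R (H r - l k r)) \<in> borel_measurable lborel" for k
        using set_integral_diff(1)[OF Hint lint[of k]] unfolding set_integrable_def by (rule borel_measurable_integrable)
      show "AE r in lborel. norm (indicator {s..t} r *\<^sub>R (H r - l k r)) \<le> indicator {s..t} r *\<^sub>R H r" for k
        using fin
      proof eventually_elim
        case (elim r)
        then show ?case using Hl[of r k] st by (auto simp: indicator_def)
      qed
      show "AE r in lborel. (\<lambda>k. indicator {s..t} r *\<^sub>R (H r - l k r)) \<longlonglongrightarrow> 0"
        using fin
      proof eventually_elim
        case (elim r)
        show ?case
        proof (cases "r \<in> {s..t}")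
          case True
          have r0: "0 \<le> r" "N a (g r) < \<infinity>" using True elim st by auto
          note [measurable] = g_measurable[OF r0(1)]
          have "(\<lambda>k. l k r) \<longlonglongrightarrow> H r"
            unfolding l_def H_def
          proof (rule integral_dominated_convergence)
            show "integrable lborel (\<lambda>v. \<bar>g r v\<bar> * weight v powr a)" by (rule integrable_of_N(1)) (use r0 in auto)
            show "AE v in lborel. (\<lambda>k. \<bar>g r v\<bar> * \<zeta> k v) \<longlonglongrightarrow> \<bar>g r v\<bar> * weight v powr a"
            proof (intro AE_I2 tendsto_mult_left)
              fix v :: 'a
              obtain k0 :: nat where "weight v \<le> real k0" using real_arch_simple by blast
              then have "\<forall>\<^sub>F k in sequentially. \<zeta> k v = weight v powr a"
                by (intro eventually_sequentiallyI[of k0]) (auto simp: \<zeta>_def indicator_def)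
              then show "(\<lambda>k. \<zeta> k v) \<longlonglongrightarrow> weight v powr a" by (rule tendsto_eventually)
            qed
          qed (auto simp: \<zeta>_def indicator_def)
          then have "(\<lambda>k. H r - l k r) \<longlonglongrightarrow> H r - H r" by (intro tendsto_diff tendsto_const)
          then show ?thesis using True by simp
        qed simp
      qed
    qed simp
    then show ?thesis by (simp add: D_def[abs_def] set_lebesgue_integral_def)
  qed
  have lim: "(\<lambda>k. LINT v|lborel. g r v * \<psi>k k v) \<longlonglongrightarrow> (LINT v|lborel. g r v * \<psi> v)" if r: "0 \<le> r" for r
  proof -
    note [measurable] = g_measurable[OF r]
    have "integrable lborel (\<lambda>v. \<bar>g r v\<bar> * weight v powr 1)"
      using g_N1[OF r] by (intro integrable_of_N(1)) (auto elim!: le_less_trans)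
    then have i: "integrable lborel (\<lambda>v. Ra * (\<bar>g r v\<bar> * weight v))" by simp
    show ?thesis
    proof (rule integral_dominated_convergence[OF _ _ i])
      show "AE v in lborel. (\<lambda>k. g r v * \<psi>k k v) \<longlonglongrightarrow> g r v * \<psi> v"
      proof (intro AE_I2 tendsto_mult_left)
        fix v :: 'a
        obtain k0 :: nat where "weight v \<le> real k0" using real_arch_simple by blast
        then have "\<forall>\<^sub>F k in sequentially. \<psi>k k v = \<psi> v"
          by (intro eventually_sequentiallyI[of k0]) (auto simp: \<psi>k_def \<psi>_def indicator_def)
        then show "(\<lambda>k. \<psi>k k v) \<longlonglongrightarrow> \<psi> v" by (rule tendsto_eventually)
      qed
      show "AE v in lborel. norm (g r v * \<psi>k k v) \<le> Ra * (\<bar>g r v\<bar> * weight v)" for k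
      proof (rule AE_I2)
        fix v
        have "\<bar>g r v\<bar> * \<psi>k k v \<le> \<bar>g r v\<bar> * (Ra * weight v)"
          using \<psi>k(2)[of k v] \<psi>(2)[of v] by (intro mult_left_mono) auto
        then show "norm (g r v * \<psi>k k v) \<le> Ra * (\<bar>g r v\<bar> * weight v)"
          using \<psi>k(1)[of k v] by (simp add: abs_mult mult_ac)
      qed
    qed measurable
  qed
  have "(LINT v|lborel. g t v * \<psi> v) - (LINT v|lborel. g s v * \<psi> v) \<le> A * (t - s) + 2 * E0 * Ra * 0"
    by (rule LIMSEQ_le[OF tendsto_diff[OF lim lim] tendsto_add[OF tendsto_const tendsto_mult_left[OF Dlim]]])
       (use step st in auto)
  then show ?thesis by (simp add: A_def)
qed

definition moment_cap :: "real \<Rightarrow> real" where "moment_cap T = M0 + povzner_const * E0\<^sup>2 * T"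

lemma moment_cap_nonneg: "0 \<le> T \<Longrightarrow> 0 \<le> moment_cap T"
  using M0 povzner_const_nonneg by (simp add: moment_cap_def)

text \<open>Let \<open>s\<close> tend to 0 in the increment of the truncated moment, which is continuous up to time 0, and then
remove the truncation.\<close>

lemma moment_bound:
  assumes t: "0 \<le> t" "t \<le> T"
  shows "N a (g t) \<le> ennreal (moment_cap T)"
proof (cases "t = 0")
  case True
  have "M0 \<le> moment_cap T" using t povzner_const_nonneg by (simp add: moment_cap_def)
  then show ?thesis using g_init True by (auto intro: order.trans ennreal_leI)
next
  case False
  then have t0: "0 < t" using t by simp
  show ?thesis
  proof (rule N_a_le_of_trunc[OF g_measurable[OF t(1)] g_nonneg[OF t(1)]])
    fix R :: nat assume "1 \<le> R"
    then have R: "1 \<le> real R" by simp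
    define \<psi> where "\<psi> v = trunc_weight \<gamma> (real R) (weight v)" for v :: 'a
    have [measurable]: "\<psi> \<in> borel_measurable borel" unfolding \<psi>_def[abs_def] by measurable
    have \<psi>: "0 \<le> \<psi> v" "\<bar>\<psi> v\<bar> \<le> real R powr (\<gamma> / 2) * weight v" for v
      unfolding \<psi>_def using trunc_weight_bounds[OF R, of v] by auto
    have nn: "(\<integral>\<^sup>+v. ennreal (g r v * \<psi> v) \<partial>lborel) = ennreal (LINT v|lborel. g r v * \<psi> v)" if "0 \<le> r" for r
      by (intro nn_integral_eq_integral g_integrable[OF that _ \<psi>(2)])
         (use g_nonneg[OF that] \<psi>(1) in \<open>auto elim!: eventually_mono\<close>)
    have cont: "continuous_on {0..} (\<lambda>r. LINT v|lborel. g r v * \<psi> v)"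
      by (rule g_pairing_continuous[where m="\<lambda>x. x", OF _ \<psi>(2)]) simp_all
    have to0: "(\<lambda>i. t / real (Suc i)) \<longlonglongrightarrow> 0"
      using tendsto_mult_left[OF LIMSEQ_Suc[OF lim_1_over_n], of t] by simp
    have lim: "(\<lambda>i. LINT v|lborel. g (t / real (Suc i)) v * \<psi> v) \<longlonglongrightarrow> (LINT v|lborel. g 0 v * \<psi> v)"
      by (rule continuous_on_tendsto_compose[OF cont to0]) (use t in simp_all)
    have "(LINT v|lborel. g t v * \<psi> v) - povzner_const * E0\<^sup>2 * t \<le> (LINT v|lborel. g 0 v * \<psi> v)"
    proof (rule LIMSEQ_le_const[OF lim], intro exI allI impI)
      fix i :: nat
      define s where "s = t / real (Suc i)"
      have s: "0 < s" "s \<le> t" using t0 by (auto simp: s_def divide_simps)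
      have "povzner_const * E0\<^sup>2 * (t - s) \<le> povzner_const * E0\<^sup>2 * t"
        using s povzner_const_nonneg by (intro mult_left_mono) auto
      then show "(LINT v|lborel. g t v * \<psi> v) - povzner_const * E0\<^sup>2 * t \<le> (LINT v|lborel. g (t / real (Suc i)) v * \<psi> v)"
        using trunc_moment_increment[OF R s] unfolding \<psi>_def s_def[symmetric] by linarith
    qed
    moreover have "(LINT v|lborel. g 0 v * \<psi> v) \<le> M0"
    proof -
      have "ennreal (LINT v|lborel. g 0 v * \<psi> v) \<le> N a (g 0)"
        unfolding nn[OF order.refl, symmetric] unfolding \<psi>_def by (rule trunc_moment_le_N_a[OF g_measurable R]) simp
      also note g_init
      finally show ?thesis using M0 by simp
    qed
    moreover have "povzner_const * E0\<^sup>2 * t \<le> povzner_const * E0\<^sup>2 * T"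
      using t povzner_const_nonneg by (intro mult_left_mono) auto
    ultimately have "(LINT v|lborel. g t v * \<psi> v) \<le> moment_cap T" by (simp add: moment_cap_def)
    then show "(\<integral>\<^sup>+v. ennreal (g t v * trunc_weight \<gamma> (real R) (weight v)) \<partial>lborel) \<le> ennreal (moment_cap T)"
      using nn[OF t(1)] by (simp add: \<psi>_def ennreal_leI)
  qed
qed

text \<open>Uniform continuity on a compact time interval, by a Lebesgue number.\<close>

lemma uniform_N1:
  assumes T: "0 \<le> T" and e: "0 < e"
  obtains \<eta> where "0 < \<eta>" "\<And>s t. s \<in> {0..T} \<Longrightarrow> t \<in> {0..T} \<Longrightarrow> \<bar>s - t\<bar> < \<eta> \<Longrightarrow> N 1 (\<lambda>v. g s v - g t v) \<le> ennreal e"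
proof -
  have "\<forall>t\<in>{0..T}. \<exists>d>0. \<forall>s\<ge>0. \<bar>s - t\<bar> < d \<longrightarrow> N 1 (\<lambda>v. g s v - g t v) \<le> ennreal (e / 2)"
    using g_cont[of _ "e / 2"] e by auto
  then obtain d where d: "\<And>t. t \<in> {0..T} \<Longrightarrow> 0 < d t"
     "\<And>t s. t \<in> {0..T} \<Longrightarrow> 0 \<le> s \<Longrightarrow> \<bar>s - t\<bar> < d t \<Longrightarrow> N 1 (\<lambda>v. g s v - g t v) \<le> ennreal (e / 2)"
    by metis
  have "\<exists>\<eta>>0. \<forall>x\<in>{0..T}. \<exists>G\<in>(\<lambda>t. ball t (d t)) ` {0..T}. ball x \<eta> \<subseteq> G"
  proof -
    have cov: "{0..T} \<subseteq> \<Union> ((\<lambda>t. ball t (d t)) ` {0..T})" using d(1) by force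
    show ?thesis
    proof (rule Heine_Borel_lemma[OF compact_Icc cov])
      show "open G" if "G \<in> (\<lambda>t. ball t (d t)) ` {0..T}" for G using that by auto
      fix \<eta> :: real
      assume "0 < \<eta>" "\<And>x. x \<in> {0..T} \<Longrightarrow> \<exists>G\<in>(\<lambda>t. ball t (d t)) ` {0..T}. ball x \<eta> \<subseteq> G"
      then show ?thesis by blast
    qed
  qed
  then obtain \<eta> where \<eta>: "0 < \<eta>" "\<And>x. x \<in> {0..T} \<Longrightarrow> \<exists>t\<in>{0..T}. ball x \<eta> \<subseteq> ball t (d t)" by auto
  show thesis
  proof (rule that[OF \<eta>(1)])
    fix s t assume st: "s \<in> {0..T}" "t \<in> {0..T}" "\<bar>s - t\<bar> < \<eta>"
    obtain r where r: "r \<in> {0..T}" "ball s \<eta> \<subseteq> ball r (d r)" using \<eta>(2)[OF st(1)] by auto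
    have "s \<in> ball r (d r)" "t \<in> ball r (d r)" using r(2) st(3) \<eta>(1) by (auto simp: dist_real_def subset_iff)
    then have sr: "N 1 (\<lambda>v. g s v - g r v) \<le> ennreal (e / 2)" "N 1 (\<lambda>v. g t v - g r v) \<le> ennreal (e / 2)"
      using st r(1) by (auto intro!: d(2) simp: dist_real_def abs_minus_commute)
    have "N 1 (\<lambda>v. g s v - g t v) \<le> N 1 (\<lambda>v. g s v - g r v) + N 1 (\<lambda>v. g r v - g t v)"
      using st r by (intro N_diff_trans g_measurable) auto
    also have "\<dots> \<le> ennreal (e / 2) + ennreal (e / 2)"
      using sr N_diff_commute[of 1 "g r" "g t"] by (intro add_mono) auto
    also have "\<dots> = ennreal e" using e by (simp flip: ennreal_plus)
    finally show "N 1 (\<lambda>v. g s v - g t v) \<le> ennreal e" .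
  qed
qed

text \<open>Uniform continuity in order 1 and boundedness in order \<open>a\<close> interpolate to order \<open>p\<close>.\<close>

lemma uniform_Np:
  assumes T: "0 \<le> T" and e: "0 < e"
  obtains \<eta> where "0 < \<eta>" "\<And>s t. s \<in> {0..T} \<Longrightarrow> t \<in> {0..T} \<Longrightarrow> \<bar>s - t\<bar> < \<eta> \<Longrightarrow> N p (\<lambda>v. g s v - g t v) \<le> ennreal e"
proof -
  define M where "M = moment_cap T"
  have M: "0 \<le> M" using moment_cap_nonneg[OF T] by (simp add: M_def)
  define x where "x = e / (1 + 2 * M)"
  have x: "0 < x" using e M by (simp add: x_def)
  \<comment> \<open>Chosen so that \<open>(1 + 2 M) e1\<^sup>\<theta> \<le> e\<close> and \<open>e1 \<le> 1\<close>.\<close>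
  define e1 where "e1 = min 1 (x powr (1 / \<theta>))"
  have e1: "0 < e1" "e1 \<le> 1" using x by (auto simp: e1_def)
  have "e1 powr \<theta> \<le> (x powr (1 / \<theta>)) powr \<theta>"
    using e1 exponents by (intro powr_mono2) (auto simp: e1_def)
  also have "\<dots> = x" using x exponents by (simp add: powr_powr)
  finally have "(1 + 2 * M) * e1 powr \<theta> \<le> (1 + 2 * M) * x" using M by (intro mult_left_mono) auto
  also have "\<dots> = e" using M by (simp add: x_def)
  finally have le: "(1 + 2 * M) * e1 powr \<theta> \<le> e" .
  obtain \<eta> where \<eta>: "0 < \<eta>" "\<And>s t. s \<in> {0..T} \<Longrightarrow> t \<in> {0..T} \<Longrightarrow> \<bar>s - t\<bar> < \<eta> \<Longrightarrow> N 1 (\<lambda>v. g s v - g t v) \<le> ennreal e1"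
    using uniform_N1[OF T e1(1)] by blast
  show thesis
  proof (rule that[OF \<eta>(1)])
    fix s t assume st: "s \<in> {0..T}" "t \<in> {0..T}" "\<bar>s - t\<bar> < \<eta>"
    note m = g_measurable[of s] g_measurable[of t]
    have Na: "N a (\<lambda>v. g s v - g t v) \<le> ennreal (2 * M)"
      unfolding M_def using st T by (intro N_diff_le_double moment_bound moment_cap_nonneg g_measurable) auto
    have N1: "N 1 (\<lambda>v. g s v - g t v) \<le> ennreal (1 * e1)" using \<eta>(2)[OF st] by simp
    have "N p (\<lambda>v. g s v - g t v) \<le> ennreal ((1 + 2 * M) * e1 powr \<theta>)"
      by (rule N_p_interpolation[OF _ e1 _ N1 Na]) (use m st M in auto)
    also have "\<dots> \<le> ennreal e" using le by (rule ennreal_leI)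
    finally show "N p (\<lambda>v. g s v - g t v) \<le> ennreal e" .
  qed
qed

text \<open>Differentiability in the norm of order \<open>q\<close>, uniformly on bounded time intervals, obtained by duality: paired with a test
function, the remainder is the time integral of \<open>Q(g(r)) - Q(g(s))\<close>, which is small in order \<open>q\<close>.\<close>

lemma local_expansion:
  assumes T: "0 \<le> T" and e: "0 < e"
  obtains \<eta> where "0 < \<eta>" "\<And>s t. 0 \<le> s \<Longrightarrow> s \<le> t \<Longrightarrow> t \<le> T \<Longrightarrow> t - s < \<eta> \<Longrightarrow>
    N q (\<lambda>v. g t v - g s v - (t - s) * coll s v) \<le> ennreal ((t - s) * e)"
proof -
  define M where "M = moment_cap T"
  have M: "0 \<le> M" using moment_cap_nonneg[OF T] by (simp add: M_def)
  define e1 where "e1 = e / (8 * M + 1)"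
  have e1: "0 < e1" using e M by (simp add: e1_def)
  have "8 * M * e1 \<le> (8 * M + 1) * e1" using e1 by (simp add: algebra_simps)
  also have "\<dots> = e" using M by (simp add: e1_def)
  finally have le: "8 * M * e1 \<le> e" .
  obtain \<eta> where \<eta>: "0 < \<eta>" "\<And>s t. s \<in> {0..T} \<Longrightarrow> t \<in> {0..T} \<Longrightarrow> \<bar>s - t\<bar> < \<eta> \<Longrightarrow> N p (\<lambda>v. g s v - g t v) \<le> ennreal e1"
    using uniform_Np[OF T e1] by blast
  show thesis
  proof (rule that[OF \<eta>(1)])
    fix s t assume st: "0 \<le> s" "s \<le> t" "t \<le> T" "t - s < \<eta>"
    have Ma: "N a (g r) \<le> ennreal M" if "r \<in> {s..t}" for r
      unfolding M_def using that st by (intro moment_bound) auto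
    have Mp: "N r' (g r) \<le> ennreal M" if "r \<in> {s..t}" "r' \<le> a" for r r'
      using N_mono_exponent[OF that(2)] Ma[OF that(1)] by (rule order.trans)
    have cd: "N q (\<lambda>v. coll r v - coll s v) \<le> ennreal e" if r: "r \<in> {s..t}" for r
    proof -
      have "N q (\<lambda>v. coll r v - coll s v) \<le> ennreal (8 * M * e1)"
        unfolding coll_def
      proof (rule hard_collide_diff)
        show "N p (\<lambda>v. g r v - g s v) \<le> ennreal e1" using r st by (intro \<eta>(2)) auto
        show "N q (g r) < \<infinity>" using Mp[OF r, of q] exponents by (auto elim!: le_less_trans)
      qed (use Mp[OF r, of p] Mp[of s p] st r exponents M e1 in \<open>auto intro!: g_measurable\<close>)
      also have "\<dots> \<le> ennreal e" using le by (rule ennreal_leI)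
      finally show ?thesis .
    qed
    note [measurable] = g_measurable[OF st(1)] g_measurable[OF order.trans[OF st(1,2)]] measurable_coll[OF st(1)]
    have cq: "N q (coll s) \<le> ennreal (4 * M\<^sup>2)"
      unfolding coll_def using Ma[of s] M st exponents by (intro collide_bound rate_hard) auto
    show "N q (\<lambda>v. g t v - g s v - (t - s) * coll s v) \<le> ennreal ((t - s) * e)"
    proof (rule N_duality)
      have "N q (\<lambda>v. g t v - g s v - (t - s) * coll s v) \<le> N q (\<lambda>v. g t v - g s v) + N q (\<lambda>v. (t - s) * coll s v)"
        by (rule N_triangle) auto
      also have "\<dots> \<le> (N q (g t) + N q (g s)) + ennreal (t - s) * N q (coll s)"
        using st N_mult[of "coll s" q "t - s"] by (intro add_mono N_diff_le) auto
      also have "\<dots> < \<infinity>"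
      proof -
        have "N q (coll s) < \<infinity>" "N q (g s) < \<infinity>" "N q (g t) < \<infinity>"
          using le_less_trans[OF cq ennreal_less_top] le_less_trans[OF Mp[of s q] ennreal_less_top]
            le_less_trans[OF Mp[of t q] ennreal_less_top] st exponents by auto
        then show ?thesis by (simp add: ennreal_mult_less_top)
      qed
      finally show "N q (\<lambda>v. g t v - g s v - (t - s) * coll s v) < \<infinity>" .
      show "0 \<le> (t - s) * e" using st e by simp
      fix \<rho> :: "'a \<Rightarrow> real" assume \<rho>: "C1_compact_support \<rho>" and \<rho>q: "\<And>v. \<bar>\<rho> v\<bar> \<le> weight v powr q"
      obtain c where c: "0 \<le> c" "\<And>v. \<bar>\<rho> v\<bar> \<le> c" using C1_compact_support_bounded[OF \<rho>] by blast
      have \<rho>m[measurable]: "\<rho> \<in> borel_measurable borel" by (rule C1_compact_support_measurable[OF \<rho>])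
      have cw: "\<bar>\<rho> v\<bar> \<le> c * weight v" for v
        using c(2)[of v] mult_left_mono[OF weight_ge_1[of v] c(1)] by simp
      have i: "integrable lborel (\<lambda>v. g t v * \<rho> v)" "integrable lborel (\<lambda>v. g s v * \<rho> v)"
        using st by (auto intro!: g_integrable[OF _ \<rho>m cw c(1)])
      have ic: "integrable lborel (\<lambda>v. coll r v * \<rho> v)" if "0 \<le> r" for r
        by (rule coll_integrable(1)[OF that \<rho>m c(2,1)])
      have "(LINT v|lborel. (g t v - g s v - (t - s) * coll s v) * \<rho> v) =
          (LINT v|lborel. g t v * \<rho> v - g s v * \<rho> v - (t - s) * (coll s v * \<rho> v))"
        by (simp add: algebra_simps)
      also have "\<dots> = (LINT v|lborel. g t v * \<rho> v) - (LINT v|lborel. g s v * \<rho> v) - (t - s) * coll_pairing \<rho> s"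
        using i ic[OF st(1)] by (simp add: coll_pairing_def)
      also have "\<dots> = integral {s..t} (coll_pairing \<rho>) - (t - s) * coll_pairing \<rho> s"
        using weak_increment[OF \<rho>m c(2) st(1,2)] by simp
      also have "\<dots> = integral {s..t} (\<lambda>r. coll_pairing \<rho> r - coll_pairing \<rho> s)"
        using st coll_pairing_integrable_on[OF \<rho>m c(2,1) st(1), of t]
        by (subst Henstock_Kurzweil_Integration.integral_diff) auto
      also have "\<dots> \<le> norm (integral {s..t} (\<lambda>r. coll_pairing \<rho> r - coll_pairing \<rho> s))" by simp
      also have "\<dots> \<le> e * (t - s)"
      proof (rule integral_bound)
        show "continuous_on {s..t} (\<lambda>r. coll_pairing \<rho> r - coll_pairing \<rho> s)"
          using st by (intro continuous_intros continuous_on_subset[OF coll_pairing_continuous[OF \<rho>m c(2,1)]]) auto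
        fix r assume r: "r \<in> {s..t}"
        have r0: "0 \<le> r" using r st by auto
        have "coll_pairing \<rho> r - coll_pairing \<rho> s = (LINT v|lborel. (coll r v - coll s v) * \<rho> v)"
          unfolding coll_pairing_def using ic[OF r0] ic[OF st(1)] by (simp add: left_diff_distrib)
        also have "\<bar>\<dots>\<bar> \<le> 1 * e"
          by (rule pairing_bound(2)[OF _ \<rho>m _ _ cd[OF r]])
             (use \<rho>q e measurable_coll[OF r0] measurable_coll[OF st(1)] in auto)
        finally show "norm (coll_pairing \<rho> r - coll_pairing \<rho> s) \<le> e" by simp
      qed (use st in auto)
      finally show "(LINT v|lborel. (g t v - g s v - (t - s) * coll s v) * \<rho> v) \<le> (t - s) * e"
        by (simp add: mult.commute)
    qed (use exponents in auto)
  qed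
qed

end

section \<open>Uniqueness of weak evolutions\<close>

context annihilation
begin

lemma cutoff_euler_consistency:
  assumes n: "0 < n" and [measurable]: "f \<in> borel_measurable borel" "f' \<in> borel_measurable borel"
    and M: "N a f \<le> ennreal M" "0 \<le> M" and \<delta>: "0 \<le> \<delta>" and e: "0 \<le> e"
    and exp: "N q (\<lambda>v. f' v - f v - \<delta> * collide (pairs hard f) v) \<le> ennreal (\<delta> * e)"
  shows "N q (\<lambda>v. f' v - euler (cutoff n) \<delta> f v) \<le> ennreal (\<delta> * (e + 4 * M\<^sup>2 * n powr (- \<kappa>)))"
proof -
  have n0: "0 \<le> n" using n by simp
  note [measurable] = rateD(1)[OF rate_hard] rateD(1)[OF rate_cutoff[OF n0]]
  let ?d = "\<lambda>v. collide (pairs hard f) v - collide (pairs (cutoff n) f) v"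
  have kk: "\<bar>hard r - cutoff n r\<bar> \<le> n powr (- \<kappa>) * r powr (\<gamma> * (1 + \<kappa>))" for r
    using cutoff_hard_diff[OF n, of r] by (simp add: abs_minus_commute)
  have z: "N p (\<lambda>v. f v - f v) \<le> ennreal 0" by (simp add: N_def)
  have d: "N q ?d \<le> ennreal (8 * M * 0 + 4 * M\<^sup>2 * n powr (- \<kappa>))"
    by (rule cutoff_collide_diff[OF n rate_hard kk _ _ M(1) M(1) M(2) z]) (use exponents in auto)
  have "N q (\<lambda>v. f' v - euler (cutoff n) \<delta> f v) \<le>
      N q (\<lambda>v. f' v - f v - \<delta> * collide (pairs hard f) v) + N q (\<lambda>v. \<delta> * ?d v)"
  proof (rule N_triangle)
    fix v
    have "f' v - euler (cutoff n) \<delta> f v = (f' v - f v - \<delta> * collide (pairs hard f) v) + \<delta> * ?d v"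
      by (simp add: euler_def algebra_simps)
    then show "\<bar>f' v - euler (cutoff n) \<delta> f v\<bar> \<le> \<bar>f' v - f v - \<delta> * collide (pairs hard f) v\<bar> + \<bar>\<delta> * ?d v\<bar>"
      by linarith
  qed measurable
  also have "N q (\<lambda>v. \<delta> * ?d v) = ennreal \<delta> * N q ?d" using \<delta> N_mult[of ?d q \<delta>] by simp
  also have "N q (\<lambda>v. f' v - f v - \<delta> * collide (pairs hard f) v) + ennreal \<delta> * N q ?d
      \<le> ennreal (\<delta> * e) + ennreal \<delta> * ennreal (8 * M * 0 + 4 * M\<^sup>2 * n powr (- \<kappa>))"
    by (intro add_mono mult_left_mono exp d) auto
  also have "\<dots> = ennreal (\<delta> * e + \<delta> * (4 * M\<^sup>2 * n powr (- \<kappa>)))"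
    using \<delta> e by (simp flip: ennreal_mult ennreal_plus)
  finally show ?thesis by (simp add: distrib_left)
qed

text \<open>Both evolutions are compared at the times \<open>k \<delta>\<close>. Each follows an Euler step up to \<open>2 \<delta> e\<close>, and one
Euler step enlarges the distance at most by a factor \<open>1 + 4 M \<delta>\<close>.\<close>

lemma weak_evolution_unique:
  assumes wf: "weak_evolution B \<gamma> \<alpha> f E0 M0" and wg: "weak_evolution B \<gamma> \<alpha> g E0 M0"
    and init: "AE v in lborel. f 0 v = g 0 v" and T: "0 < T"
  shows "AE v in lborel. f T v = g T v"
proof -
  interpret F: weak_evolution B \<gamma> \<alpha> f E0 M0 by (rule wf)
  interpret G: weak_evolution B \<gamma> \<alpha> g E0 M0 by (rule wg)
  define M where "M = F.moment_cap T"
  have M: "0 \<le> M" using F.moment_cap_nonneg T by (simp add: M_def)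
  have Ma: "N a (f t) \<le> ennreal M" "N a (g t) \<le> ennreal M" if "0 \<le> t" "t \<le> T" for t
    using F.moment_bound[OF that] G.moment_bound[OF that] by (auto simp: M_def F.moment_cap_def G.moment_cap_def)
  define E1 where "E1 = max 1 E0"
  have E1: "0 < E1" by (simp add: E1_def)
  have N0: "N 0 (f t) \<le> ennreal E1" "N 0 (g t) \<le> ennreal E1" if "0 \<le> t" for t
  proof -
    have "ennreal E0 \<le> ennreal E1" by (intro ennreal_leI) (simp add: E1_def)
    then show "N 0 (f t) \<le> ennreal E1" "N 0 (g t) \<le> ennreal E1"
      using order.trans[OF N_mono_exponent F.g_N1[OF that], of 0] order.trans[OF N_mono_exponent G.g_N1[OF that], of 0]
      by (auto intro: order.trans)
  qed
  have bound: "N q (\<lambda>v. f T v - g T v) \<le> ennreal (T * (4 * e) * exp (4 * M * T))" if e: "0 < e" for e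
  proof -
    obtain \<eta>f where \<eta>f: "0 < \<eta>f" "\<And>s t. 0 \<le> s \<Longrightarrow> s \<le> t \<Longrightarrow> t \<le> T \<Longrightarrow> t - s < \<eta>f \<Longrightarrow>
      N q (\<lambda>v. f t v - f s v - (t - s) * F.coll s v) \<le> ennreal ((t - s) * e)"
      using F.local_expansion[OF less_imp_le[OF T] e] by blast
    obtain \<eta>g where \<eta>g: "0 < \<eta>g" "\<And>s t. 0 \<le> s \<Longrightarrow> s \<le> t \<Longrightarrow> t \<le> T \<Longrightarrow> t - s < \<eta>g \<Longrightarrow>
      N q (\<lambda>v. g t v - g s v - (t - s) * G.coll s v) \<le> ennreal ((t - s) * e)"
      using G.local_expansion[OF less_imp_le[OF T] e] by blast
    have l1: "(\<lambda>K. T / real (Suc K)) \<longlonglongrightarrow> 0"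
      using tendsto_mult_left[OF LIMSEQ_Suc[OF lim_1_over_n], of T] by simp
    have "(\<lambda>K. (T * E1 / real (Suc K)) powr \<kappa>) \<longlonglongrightarrow> 0"
      using exponents T E1 tendsto_mult_left[OF LIMSEQ_Suc[OF lim_1_over_n], of "T * E1"]
      by (intro tendsto_zero_powrI[where b=\<kappa>]) auto
    then have l2: "(\<lambda>K. 4 * M\<^sup>2 * (T * E1 / real (Suc K)) powr \<kappa>) \<longlonglongrightarrow> 0"
      using tendsto_mult_left[of _ 0 _ "4 * M\<^sup>2"] by simp
    have "\<forall>\<^sub>F K in sequentially. T / real (Suc K) < \<eta>f \<and> T / real (Suc K) < \<eta>g \<and> 4 * M\<^sup>2 * (T * E1 / real (Suc K)) powr \<kappa> < e"
      by (intro eventually_conj order_tendstoD(2)[OF l1] order_tendstoD(2)[OF l2] \<eta>f(1) \<eta>g(1) e)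
    \<comment> \<open>So many steps that both expansions apply and the cutoff error is below \<open>e\<close>.\<close>
    then obtain K :: nat where K: "T / real (Suc K) < \<eta>f" "T / real (Suc K) < \<eta>g"
      "4 * M\<^sup>2 * (T * E1 / real (Suc K)) powr \<kappa> < e"
      by (auto simp: eventually_sequentially)
    define \<delta> where "\<delta> = T / real (Suc K)"
    have \<delta>: "0 < \<delta>" "0 \<le> \<delta>" using T by (auto simp: \<delta>_def)
    have K\<delta>: "real (Suc K) * \<delta> = T" by (simp add: \<delta>_def)
    \<comment> \<open>The largest cutoff to which \<open>euler_contraction\<close> applies with steps of length \<open>\<delta>\<close>; it tends to infinity as \<open>\<delta>\<close> tends to 0.\<close>
    define n where "n = 1 / (\<delta> * E1)"
    have n: "0 < n" "0 \<le> n" using \<delta> E1 by (auto simp: n_def)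
    have n1: "\<delta> * (n * E1) \<le> 1" using \<delta> E1 by (simp add: n_def)
    have "n powr (- \<kappa>) = (\<delta> * E1) powr \<kappa>"
      using \<delta> E1 by (simp add: n_def powr_minus_divide powr_divide)
    then have nk: "4 * M\<^sup>2 * n powr (- \<kappa>) \<le> e" using K(3) by (simp add: \<delta>_def mult.commute)
    let ?E = "euler (cutoff n) \<delta>"
    define b where "b = 4 * e"
    have b: "0 \<le> b" using e by (simp add: b_def)
    have "N q (\<lambda>v. f (real k * \<delta>) v - g (real k * \<delta>) v) \<le> ennreal (real k * \<delta> * b * exp (4 * M * (real k * \<delta>)))"
      if "k \<le> Suc K" for k
      using that
    proof (induction k)
      case 0
      have "N q (\<lambda>v. f 0 v - g 0 v) = N q (\<lambda>v::'a. 0)" by (rule N_cong_AE) (use init in \<open>auto elim!: eventually_mono\<close>)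
      then show ?case by (simp add: N_def)
    next
      case (Suc k)
      let ?s = "real k * \<delta>" and ?t = "real (Suc k) * \<delta>"
      have ts: "?t - ?s = \<delta>" by (simp add: algebra_simps)
      have "?t \<le> real (Suc K) * \<delta>" using Suc.prems \<delta> by (intro mult_right_mono) auto
      then have st: "0 \<le> ?s" "?s \<le> ?t" "?t \<le> T" "?s \<le> T" "0 \<le> ?t" using \<delta> ts K\<delta> by auto
      note [measurable] = F.g_measurable[OF st(1)] G.g_measurable[OF st(1)] F.g_measurable[OF st(5)] G.g_measurable[OF st(5)]
        measurable_euler[OF rate_cutoff[OF n(2)]]
      have Ms: "N a (f ?s) \<le> ennreal M" "N a (g ?s) \<le> ennreal M" using st by (auto intro: Ma)
      have ef: "N q (\<lambda>v. f ?t v - ?E (f ?s) v) \<le> ennreal (\<delta> * (2 * e))"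
      proof -
        have "N q (\<lambda>v. f ?t v - ?E (f ?s) v) \<le> ennreal (\<delta> * (e + 4 * M\<^sup>2 * n powr (- \<kappa>)))"
        proof (rule cutoff_euler_consistency[OF n(1) _ _ Ms(1) M \<delta>(2)])
          show "N q (\<lambda>v. f ?t v - f ?s v - \<delta> * collide (pairs hard (f ?s)) v) \<le> ennreal (\<delta> * e)"
            using \<eta>f(2)[OF st(1-3)] K(1) unfolding ts F.coll_def by (simp add: \<delta>_def)
        qed (use e st in \<open>auto simp del: of_nat_Suc intro!: F.g_measurable\<close>)
        also have "\<dots> \<le> ennreal (\<delta> * (2 * e))" using nk \<delta> by (intro ennreal_leI mult_left_mono) auto
        finally show ?thesis .
      qed
      have eg: "N q (\<lambda>v. ?E (g ?s) v - g ?t v) \<le> ennreal (\<delta> * (2 * e))"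
      proof -
        have "N q (\<lambda>v. g ?t v - ?E (g ?s) v) \<le> ennreal (\<delta> * (e + 4 * M\<^sup>2 * n powr (- \<kappa>)))"
        proof (rule cutoff_euler_consistency[OF n(1) _ _ Ms(2) M \<delta>(2)])
          show "N q (\<lambda>v. g ?t v - g ?s v - \<delta> * collide (pairs hard (g ?s)) v) \<le> ennreal (\<delta> * e)"
            using \<eta>g(2)[OF st(1-3)] K(2) unfolding ts G.coll_def by (simp add: \<delta>_def)
        qed (use e st in \<open>auto simp del: of_nat_Suc intro!: G.g_measurable\<close>)
        also have "\<dots> \<le> ennreal (\<delta> * (2 * e))" using nk \<delta> by (intro ennreal_leI mult_left_mono) auto
        finally show ?thesis by (subst N_diff_commute)
      qed
      let ?d = "N q (\<lambda>v. f ?s v - g ?s v)"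
      have Np: "N p h \<le> ennreal M" if "N a h \<le> ennreal M" for h :: "'a \<Rightarrow> real"
        using N_mono_exponent[of p a h] that exponents by auto
      have Mp: "N p (\<lambda>v. f ?s v + g ?s v) \<le> ennreal (2 * M)"
      proof -
        have "N p (\<lambda>v. f ?s v + g ?s v) \<le> N p (f ?s) + N p (g ?s)" by (rule N_triangle) auto
        also have "\<dots> \<le> ennreal M + ennreal M" by (intro add_mono Np Ms)
        finally show ?thesis using M by (simp flip: ennreal_plus)
      qed
      have fin: "N p (f ?s) < \<infinity>" "N p (g ?s) < \<infinity>"
        using Np[OF Ms(1)] Np[OF Ms(2)] by (auto elim!: le_less_trans)
      have con: "N q (\<lambda>v. ?E (f ?s) v - ?E (g ?s) v) \<le> ?d + ennreal (2 * \<delta>) * (N p (\<lambda>v. f ?s v + g ?s v) * ?d)"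
        unfolding p_def
        by (rule euler_contraction[OF rate_cutoff[OF n(2)] cutoff_le _ _ F.g_nonneg[OF st(1)] G.g_nonneg[OF st(1)] N0(1)[OF st(1)] N0(2)[OF st(1)]])
           (use E1 \<delta> n1 q_bounds fin in \<open>auto simp: p_def\<close>)
      have "N q (\<lambda>v. f ?t v - g ?t v) \<le> N q (\<lambda>v. f ?t v - ?E (f ?s) v) + N q (\<lambda>v. ?E (f ?s) v - g ?t v)"
        by (rule N_diff_trans) measurable
      also have "N q (\<lambda>v. ?E (f ?s) v - g ?t v) \<le> N q (\<lambda>v. ?E (f ?s) v - ?E (g ?s) v) + N q (\<lambda>v. ?E (g ?s) v - g ?t v)"
        by (rule N_diff_trans) measurable
      finally have "N q (\<lambda>v. f ?t v - g ?t v) \<le> N q (\<lambda>v. f ?t v - ?E (f ?s) v) +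
          (N q (\<lambda>v. ?E (f ?s) v - ?E (g ?s) v) + N q (\<lambda>v. ?E (g ?s) v - g ?t v))"
        by (simp add: add_left_mono)
      also have "\<dots> \<le> ennreal (\<delta> * (2 * e)) + ((?d + ennreal (2 * \<delta>) * (ennreal (2 * M) * ?d)) + ennreal (\<delta> * (2 * e)))"
        by (intro add_mono ef eg order.trans[OF con] mult_left_mono mult_right_mono Mp) auto
      also have "\<dots> = ennreal (1 + 4 * M * \<delta>) * ?d + ennreal (\<delta> * b)"
      proof -
        have 1: "ennreal (1 + 4 * M * \<delta>) = 1 + ennreal (2 * \<delta>) * ennreal (2 * M)"
          using M \<delta>(2) by (simp flip: ennreal_mult ennreal_plus ennreal_1 add: mult_ac)
        have 2: "ennreal (\<delta> * b) = ennreal (\<delta> * (2 * e)) + ennreal (\<delta> * (2 * e))"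
          using \<delta>(2) e by (simp flip: ennreal_plus add: b_def)
        show ?thesis unfolding 1 2 by (simp add: distrib_right mult.assoc ac_simps)
      qed
      also have "\<dots> \<le> ennreal (1 + 4 * M * \<delta>) * ennreal (?s * b * exp (4 * M * ?s)) + ennreal (\<delta> * b)"
        using Suc by (intro add_mono mult_left_mono) auto
      also have "\<dots> = ennreal ((1 + 4 * M * \<delta>) * (?s * b * exp (4 * M * ?s)) + \<delta> * b)"
        using M \<delta>(2) b by (simp flip: ennreal_mult ennreal_plus)
      also have "\<dots> \<le> ennreal (?t * b * exp (4 * M * ?t))"
        using M \<delta>(2) b by (intro ennreal_leI gronwall_step) auto
      finally show ?case .
    qed
    from this[of "Suc K"] show ?thesis unfolding K\<delta> by (simp add: b_def)
  qed
  note [measurable] = F.g_measurable[OF less_imp_le[OF T]] G.g_measurable[OF less_imp_le[OF T]]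
  have "N q (\<lambda>v. f T v - g T v) \<le> 0"
  proof (rule LIMSEQ_le_const)
    have "(\<lambda>i. ennreal (T * (4 * (1 / real (Suc i))) * exp (4 * M * T))) \<longlonglongrightarrow> ennreal (T * (4 * 0) * exp (4 * M * T))"
      by (intro tendsto_ennrealI tendsto_intros LIMSEQ_Suc[OF lim_1_over_n])
    then show "(\<lambda>i. ennreal (T * (4 * (1 / real (Suc i))) * exp (4 * M * T))) \<longlonglongrightarrow> 0" by simp
    show "\<exists>N'. \<forall>i\<ge>N'. N q (\<lambda>v. f T v - g T v) \<le> ennreal (T * (4 * (1 / real (Suc i))) * exp (4 * M * T))"
      using bound[of "1 / real (Suc i)" for i] by auto
  qed
  then have "N q (\<lambda>v. f T v - g T v) = 0" by simp
  then have "AE v in lborel. ennreal (\<bar>f T v - g T v\<bar> * weight v powr q) = 0"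
    unfolding N_def by (subst (asm) nn_integral_0_iff_AE) auto
  then show ?thesis
    by eventually_elim (auto simp: ennreal_eq_0_iff mult_le_0_iff)
qed

end

section \<open>Existence and uniqueness of admissible solutions\<close>

text \<open>The angular factor \<open>b\<close> is given on \<open>[-1, 1]\<close>; extension by 0 makes the kernel Borel.\<close>

definition angular_kernel :: "(real \<Rightarrow> real) \<Rightarrow> 'a::euclidean_space \<Rightarrow> 'a \<Rightarrow> real" where
  "angular_kernel b x y = indicator {-1..1} (x \<bullet> y) * b (x \<bullet> y)"

lemma sphere_area_nonneg: "0 \<le> sphere_area n"
  by (simp add: sphere_area_def)

lemma scattering_angular_kernel:
  assumes d: "2 \<le> CARD('n::finite)" and b: "b \<in> borel_measurable (restrict_space borel {-1..1})"
    and b0: "\<And>t. t \<in> {-1..1} \<Longrightarrow> 0 \<le> b t"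
    and mass: "sphere_area (CARD('n) - 1) *
           (LINT t:{-1..1}|lborel. b t * (1 - t\<^sup>2) powr ((real CARD('n) - 3) / 2)) = 1"
  shows "scattering (angular_kernel b :: real ^ 'n \<Rightarrow> _)"
proof
  let ?b = "\<lambda>t. indicator {-1..1} t * b t :: real"
  have m[measurable]: "?b \<in> borel_measurable borel"
    using b by (subst (asm) borel_measurable_restrict_space_iff) (auto simp: indicator_def mult.commute)
  show "case_prod (angular_kernel b :: real ^ 'n \<Rightarrow> _) \<in> borel_measurable (borel \<Otimes>\<^sub>M borel)"
  proof -
    have "(\<lambda>p. ?b (fst p \<bullet> snd p)) \<in> borel_measurable (borel \<Otimes>\<^sub>M borel :: ((real^'n) \<times> (real^'n)) measure)"
      by (rule measurable_compose[OF _ m]) measurable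
    then show ?thesis by (simp add: angular_kernel_def[abs_def] case_prod_beta')
  qed
  fix x y :: "real ^ 'n"
  show "0 \<le> angular_kernel b x y" using b0[of "x \<bullet> y"] by (simp add: angular_kernel_def indicator_def)
  show "angular_kernel b x y = angular_kernel b y x" by (simp add: angular_kernel_def inner_commute)
  show "angular_kernel b (- x) (- y) = angular_kernel b x y" by (simp add: angular_kernel_def)
next
  fix \<omega> :: "real ^ 'n" assume \<omega>: "norm \<omega> = 1"
  let ?w = "\<lambda>t. (1 - t\<^sup>2) powr ((real CARD('n) - 3) / 2)"
  let ?h = "\<lambda>t. indicator {-1..1} t * (b t * ?w t) :: real"
  let ?A = "sphere_area (CARD('n) - 1)"
  have m[measurable]: "(\<lambda>t. indicator {-1..1} t * b t :: real) \<in> borel_measurable borel"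
    using b by (subst (asm) borel_measurable_restrict_space_iff) (auto simp: indicator_def mult.commute)
  have I: "?A * (LINT t|lborel. ?h t) = 1" using mass by (simp add: set_lebesgue_integral_def)
  \<comment> \<open>A Bochner integral that is not 0 belongs to an integrable function.\<close>
  then have i: "integrable lborel ?h" using not_integrable_integral_eq by fastforce
  have nn: "(\<integral>\<^sup>+t. ennreal (?h t) \<partial>lborel) = ennreal (LINT t|lborel. ?h t)"
    by (rule nn_integral_eq_integral[OF i]) (use b0 in \<open>auto simp: indicator_def\<close>)
  have "AE t in lborel. t \<noteq> -1 \<and> t \<noteq> (1::real)"
    using AE_lborel_singleton[of "-1 :: real"] AE_lborel_singleton[of "1 :: real"] by eventually_elim auto
  then have "AE t in lborel. ennreal (indicator {-1..1} t * b t) * ennreal (?w t) * indicator {-1<..<1} t = ennreal (?h t)"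
    by eventually_elim (use b0 in \<open>auto simp: indicator_def ennreal_mult\<close>)
  then have e: "(\<integral>\<^sup>+t. ennreal (indicator {-1..1} t * b t) * ennreal (?w t) * indicator {-1<..<1} t \<partial>lborel)
      = (\<integral>\<^sup>+t. ennreal (?h t) \<partial>lborel)"
    by (rule nn_integral_cong_AE)
  have "(\<integral>\<^sup>+\<sigma>. ennreal (angular_kernel b \<omega> \<sigma>) \<partial>sphere_borel) = ennreal ?A *
     (\<integral>\<^sup>+t. ennreal (indicator {-1..1} t * b t) * ennreal (?w t) * indicator {-1<..<1} t \<partial>lborel)"
    unfolding angular_kernel_def
    by (rule nn_integral_sphere_borel_slices[OF \<omega> d, of "\<lambda>t. ennreal (indicator {-1..1} t * b t)"]) measurable
  also have "\<dots> = ennreal (?A * (LINT t|lborel. ?h t))"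
    unfolding e nn by (rule ennreal_mult'[symmetric]) (rule sphere_area_nonneg)
  finally show "(\<integral>\<^sup>+\<sigma>. ennreal (angular_kernel b \<omega> \<sigma>) \<partial>sphere_borel) = 1" unfolding I by simp
qed

lemma L1_weight_eq: "L1_weight \<eta> v = weight v powr (\<eta> / 2)"
  by (simp add: L1_weight_def weight_def)

lemma L1_norm_eq:
  assumes [measurable]: "f \<in> borel_measurable borel"
  shows "L1_norm \<eta> f = enn2real (N (\<eta> / 2) f)"
  unfolding L1_norm_def N_def L1_weight_eq by (rule integral_eq_nn_integral) auto

lemma L1_iff: "f \<in> L1 \<eta> \<longleftrightarrow> f \<in> borel_measurable borel \<and> N (\<eta> / 2) f < \<infinity>"
  by (auto simp: L1_def L1_weight_eq N_def integrable_iff_bounded abs_mult)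

lemma N_eq_L1_norm: "f \<in> L1 \<eta> \<Longrightarrow> N (\<eta> / 2) f = ennreal (L1_norm \<eta> f)"
  by (simp add: L1_iff L1_norm_eq less_top)

lemma L1_diff:
  assumes "f \<in> L1 \<eta>" "g \<in> L1 \<eta>"
  shows "(\<lambda>v. f v - g v) \<in> L1 \<eta>"
proof -
  have [measurable]: "f \<in> borel_measurable borel" "g \<in> borel_measurable borel" using assms by (auto simp: L1_iff)
  have "N (\<eta> / 2) (\<lambda>v. f v - g v) \<le> N (\<eta> / 2) f + N (\<eta> / 2) g" by (rule N_triangle) auto
  also have "\<dots> < \<infinity>" using assms by (simp add: L1_iff)
  finally show ?thesis by (simp add: L1_iff)
qed

lemma L1_norm_diff_ge:
  assumes f: "f \<in> L1 \<eta>" and g: "g \<in> L1 \<eta>"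
  shows "\<bar>L1_norm \<eta> f - L1_norm \<eta> g\<bar> \<le> L1_norm \<eta> (\<lambda>v. f v - g v)"
proof -
  have i: "integrable lborel (\<lambda>v. \<bar>f v\<bar> * L1_weight \<eta> v)" "integrable lborel (\<lambda>v. \<bar>g v\<bar> * L1_weight \<eta> v)"
     "integrable lborel (\<lambda>v. \<bar>f v - g v\<bar> * L1_weight \<eta> v)"
    using f g L1_diff[OF f g] by (auto simp: L1_def)
  have "\<bar>L1_norm \<eta> f - L1_norm \<eta> g\<bar> = \<bar>LINT v|lborel. \<bar>f v\<bar> * L1_weight \<eta> v - \<bar>g v\<bar> * L1_weight \<eta> v\<bar>"
    using i by (simp add: L1_norm_def)
  also have "\<dots> \<le> (LINT v|lborel. \<bar>\<bar>f v\<bar> * L1_weight \<eta> v - \<bar>g v\<bar> * L1_weight \<eta> v\<bar>)"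
    by (rule integral_abs_bound)
  also have "\<dots> \<le> L1_norm \<eta> (\<lambda>v. f v - g v)" unfolding L1_norm_def
  proof (rule integral_mono)
    fix v
    have "\<bar>\<bar>f v\<bar> * L1_weight \<eta> v - \<bar>g v\<bar> * L1_weight \<eta> v\<bar> = \<bar>\<bar>f v\<bar> - \<bar>g v\<bar>\<bar> * L1_weight \<eta> v"
      by (simp add: L1_weight_def abs_mult flip: left_diff_distrib)
    also have "\<dots> \<le> \<bar>f v - g v\<bar> * L1_weight \<eta> v" by (intro mult_right_mono) (auto simp: L1_weight_def)
    finally show "\<bar>\<bar>f v\<bar> * L1_weight \<eta> v - \<bar>g v\<bar> * L1_weight \<eta> v\<bar> \<le> \<bar>f v - g v\<bar> * L1_weight \<eta> v" .
  qed (use i in auto)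
  finally show ?thesis .
qed

context initial_value
begin

lemma sol_L1: "0 \<le> t \<Longrightarrow> \<eta> / 2 \<le> a \<Longrightarrow> sol t \<in> L1 \<eta>"
  using le_less_trans[OF order.trans[OF N_mono_exponent sol_bd[of t t]] ennreal_less_top, of "\<eta> / 2"]
  by (simp add: L1_iff)

definition holder_const :: "real \<Rightarrow> real" where "holder_const T = 4 * (growth_bound T)\<^sup>2 + 2 * growth_bound T"

lemma holder_const_nonneg: "0 \<le> T \<Longrightarrow> 0 \<le> holder_const T"
  using growth_bound_ge_1(2)[of T] by (simp add: holder_const_def)

lemma sol_holder_N1:
  assumes "0 \<le> s" "0 \<le> t" "s \<le> T" "t \<le> T" "\<bar>t - s\<bar> \<le> 1"
  shows "N 1 (\<lambda>v. sol t v - sol s v) \<le> ennreal (holder_const T * \<bar>t - s\<bar> powr (1 - 1 / a))"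
proof (cases "s = t")
  case True then show ?thesis by (simp add: N_def)
next
  case False then show ?thesis using sol_holder[of s t T 1] assms exponents by (simp add: holder_const_def)
qed

lemma continuous_L1_sol: "continuous_L1 2 {0..} sol"
  unfolding continuous_L1_def
proof (intro conjI ballI)
  fix t :: real assume "t \<in> {0..}"
  then have t: "0 \<le> t" by simp
  then show "sol t \<in> L1 2" using exponents by (intro sol_L1) auto
  show "((\<lambda>s. L1_norm 2 (\<lambda>v. sol s v - sol t v)) \<longlongrightarrow> 0) (at t within {0..})"
  proof (rule tendsto_sandwich[OF _ _ tendsto_const])
    show "\<forall>\<^sub>F s in at t within {0..}. 0 \<le> L1_norm 2 (\<lambda>v. sol s v - sol t v)"
      by (auto simp: L1_norm_def L1_weight_def)
    have "\<forall>\<^sub>F s in at t within {0..}. dist s t < 1" unfolding eventually_at by (auto intro: exI[of _ 1])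
    moreover have "\<forall>\<^sub>F s in at t within {0..}. 0 \<le> s" by (auto simp: eventually_at_filter)
    ultimately show "\<forall>\<^sub>F s in at t within {0..}. L1_norm 2 (\<lambda>v. sol s v - sol t v) \<le> holder_const (t + 1) * \<bar>s - t\<bar> powr (1 - 1 / a)"
    proof eventually_elim
      case (elim s)
      then have "N 1 (\<lambda>v. sol s v - sol t v) \<le> ennreal (holder_const (t + 1) * \<bar>s - t\<bar> powr (1 - 1 / a))"
        using t by (intro sol_holder_N1) (auto simp: dist_real_def)
      then show ?case using holder_const_nonneg[of "t + 1"] t
        by (simp add: L1_norm_eq enn2real_leI)
    qed
    have "((\<lambda>s. \<bar>s - t\<bar>) \<longlongrightarrow> 0) (at t within {0..})" by (intro tendsto_eq_intros) auto
    then have "((\<lambda>s. \<bar>s - t\<bar> powr (1 - 1 / a)) \<longlongrightarrow> 0) (at t within {0..})"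
      using exponents by (intro tendsto_zero_powrI[where b="1 - 1 / a"]) auto
    then show "((\<lambda>s. holder_const (t + 1) * \<bar>s - t\<bar> powr (1 - 1 / a)) \<longlongrightarrow> 0) (at t within {0..})"
      using tendsto_mult_left[of _ 0 _ "holder_const (t + 1)"] by simp
  qed
qed

text \<open>The exponent balances the two errors in \<open>sample_tendsto\<close>: with \<open>m = Suc i\<close>, the cut costs a factor
\<open>level i\<^bsup>a-1\<^esup> = m\<^bsup>(1-1/a)/2\<^esup>\<close>, and the time step gains \<open>m\<^bsup>-(1-1/a)\<^esup>\<close>.\<close>

definition level :: "nat \<Rightarrow> real" where "level i = real (Suc i) powr (1 / (2 * a))"

text \<open>Simple functions approximating the solution in the norm of order \<open>a\<close>: values on a grid of width
\<open>1 / Suc i\<close> in \<open>[0, Suc i)\<close>, cut at a weight level; the index \<open>-1\<close> marks times outside.\<close>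

definition sample :: "nat \<Rightarrow> real \<Rightarrow> 'a \<Rightarrow> real" where
  "sample i t = (let z = (if 0 \<le> t \<and> t < real (Suc i) then \<lfloor>t * real (Suc i)\<rfloor> else - 1) in
     (\<lambda>v. if 0 \<le> z \<and> weight v \<le> level i then sol (real_of_int z / real (Suc i)) v else 0))"

lemma simple_function_sample: "simple_function lborel (sample i)"
proof -
  let ?z = "\<lambda>t. if 0 \<le> t \<and> t < real (Suc i) then \<lfloor>t * real (Suc i)\<rfloor> else - 1"
  have "?z t \<in> {-1..int (Suc i) * int (Suc i)}" for t
  proof -
    have "\<lfloor>t * real (Suc i)\<rfloor> \<le> int (Suc i) * int (Suc i)" if "0 \<le> t" "t < real (Suc i)"
    proof -
      have "t * real (Suc i) \<le> real (Suc i) * real (Suc i)" using that by (intro mult_right_mono) auto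
      also have "\<dots> < real_of_int (int (Suc i) * int (Suc i)) + 1" by (simp del: of_nat_Suc)
      finally have "t * real (Suc i) < real_of_int (int (Suc i) * int (Suc i)) + 1" .
      then show ?thesis by (simp only: floor_le_iff)
    qed
    moreover have "0 \<le> \<lfloor>t * real (Suc i)\<rfloor>" if "0 \<le> t" using that by simp
    moreover have "0 \<le> int (Suc i) * int (Suc i)" by simp
    ultimately show ?thesis unfolding atLeastAtMost_iff by (smt (verit, best))
  qed
  then have fin: "finite (range ?z)" by (intro finite_subset[OF _ finite_atLeastAtMost_int]) blast
  have m: "?z \<in> borel \<rightarrow>\<^sub>M count_space UNIV" by measurable
  have "simple_function lborel ?z" unfolding simple_function_def
    using fin measurable_sets[OF m] by auto
  from simple_function_compose1[OF this,
    of "\<lambda>z v. if 0 \<le> z \<and> weight v \<le> level i then sol (real_of_int z / real (Suc i)) v else 0"]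
  show ?thesis unfolding sample_def[abs_def] Let_def .
qed

lemma sample_L1: "sample i t \<in> L1 (2 + \<gamma>)"
proof -
  let ?z = "if 0 \<le> t \<and> t < real (Suc i) then \<lfloor>t * real (Suc i)\<rfloor> else - 1"
  let ?s = "real_of_int ?z / real (Suc i)"
  have [measurable]: "sample i t \<in> borel_measurable borel"
    unfolding sample_def Let_def by measurable
  show ?thesis
  proof (cases "0 \<le> ?z")
    case True
    have "N ((2 + \<gamma>) / 2) (sample i t) \<le> N ((2 + \<gamma>) / 2) (sol ?s)"
      by (intro N_mono_AE AE_I2) (auto simp: sample_def Let_def)
    moreover have "sol ?s \<in> L1 (2 + \<gamma>)" by (rule sol_L1) (use True in \<open>auto simp: a_def simp del: of_nat_Suc\<close>)
    ultimately show ?thesis by (auto simp: L1_iff elim: le_less_trans)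
  next
    case False
    then have "sample i t = (\<lambda>v. 0)" by (auto simp: sample_def Let_def)
    then show ?thesis by (simp add: L1_iff N_def)
  qed
qed

text \<open>In order \<open>a\<close> the solution is merely bounded. Below the cut level the norm of order 1, in which it is Holder
continuous, controls the norm of order \<open>a\<close>; the part of \<open>sol t\<close> above it is a tail that vanishes by dominated
convergence.\<close>

lemma sample_tendsto:
  assumes t: "0 \<le> t"
  shows "(\<lambda>i. L1_norm (2 + \<gamma>) (\<lambda>v. sample i t v - sol t v)) \<longlonglongrightarrow> 0"
proof -
  have a2: "(2 + \<gamma>) / 2 = a" by (simp add: a_def)
  let ?\<theta> = "1 - 1 / a"
  let ?C = "holder_const t"
  let ?tail = "\<lambda>i v. if weight v \<le> level i then 0 else sol t v"
  have [measurable]: "sample i t \<in> borel_measurable borel" for i using sample_L1 by (simp add: L1_iff)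
  have tail: "(\<lambda>i. N a (?tail i)) \<longlonglongrightarrow> N a (\<lambda>v::'a. 0)"
    unfolding N_def
  proof (rule nn_integral_dominated_convergence[where w="\<lambda>v. ennreal (\<bar>sol t v\<bar> * weight v powr a)"])
    show "(\<integral>\<^sup>+v. ennreal (\<bar>sol t v\<bar> * weight v powr a) \<partial>lborel) < \<infinity>"
      using sol_bd[OF t order.refl] by (simp add: N_def le_less_trans)
    have "filterlim level at_top sequentially"
      unfolding level_def[abs_def] using exponents
      by (intro filterlim_compose[OF real_powr_at_top] filterlim_compose[OF filterlim_real_sequentially filterlim_Suc]) auto
    then have ev: "\<forall>\<^sub>F i in sequentially. weight v \<le> level i" for v :: 'a
      by (simp add: filterlim_at_top)
    have "\<forall>\<^sub>F i in sequentially. ennreal (\<bar>?tail i v\<bar> * weight v powr a) = ennreal (\<bar>0\<bar> * weight v powr a)" for v :: 'a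
      using ev[of v] by (rule eventually_mono) simp
    then show "AE v in lborel. (\<lambda>i. ennreal (\<bar>?tail i v\<bar> * weight v powr a)) \<longlonglongrightarrow> ennreal (\<bar>0\<bar> * weight v powr a)"
      by (intro AE_I2 tendsto_eventually)
  qed (auto intro!: AE_I2 ennreal_leI)
  \<comment> \<open>The error of sampling and cutting, once \<open>t\<close> lies in the sampled range.\<close>
  have main: "N a (\<lambda>v. sample i t v - sol t v) \<le> ennreal (?C * real (Suc i) powr (- ?\<theta> / 2)) + N a (?tail i)"
    if i: "t < real (Suc i)" for i
  proof -
    let ?h = "real (Suc i)"
    define s where "s = real_of_int \<lfloor>t * ?h\<rfloor> / ?h"
    have h: "1 \<le> ?h" by simp
    have fl: "0 \<le> \<lfloor>t * ?h\<rfloor>" using t by simp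
    have s: "0 \<le> s" "s \<le> t" "t - s \<le> 1 / ?h"
    proof -
      show "0 \<le> s" using fl unfolding s_def by (intro divide_nonneg_pos) auto
      show "s \<le> t" unfolding s_def using of_int_floor_le[of "t * ?h"] by (simp add: pos_divide_le_eq del: of_nat_Suc)
      have "t * ?h \<le> real_of_int \<lfloor>t * ?h\<rfloor> + 1" by linarith
      then have "t \<le> (real_of_int \<lfloor>t * ?h\<rfloor> + 1) / ?h" by (subst pos_le_divide_eq) auto
      then show "t - s \<le> 1 / ?h" by (simp add: s_def add_divide_distrib)
    qed
    have sa: "sample i t v = (if weight v \<le> level i then sol s v else 0)" for v
      using t i fl by (simp add: sample_def Let_def s_def)
    let ?x = "\<lambda>v. if weight v \<le> level i then sol t v - sol s v else 0"
    have "N a (\<lambda>v. sample i t v - sol t v) \<le> N a ?x + N a (?tail i)"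
      by (rule N_triangle) (auto simp: sa)
    also have "N a ?x \<le> ennreal (level i powr (a - 1)) * N 1 (\<lambda>v. sol t v - sol s v)"
    proof -
      have "N a ?x \<le> (\<integral>\<^sup>+v. ennreal (level i powr (a - 1)) * ennreal (\<bar>sol t v - sol s v\<bar> * weight v powr 1) \<partial>lborel)"
        unfolding N_def
      proof (rule nn_integral_mono)
        fix v :: 'a
        have "weight v powr a \<le> level i powr (a - 1) * weight v powr 1" if "weight v \<le> level i"
        proof -
          have "weight v powr a = weight v powr (a - 1) * weight v powr 1"
            by (subst powr_add[symmetric]) simp
          also have "\<dots> \<le> level i powr (a - 1) * weight v powr 1"
            using that exponents by (intro mult_right_mono powr_mono2) auto
          finally show ?thesis .
        qed
        then have "\<bar>?x v\<bar> * weight v powr a \<le> level i powr (a - 1) * (\<bar>sol t v - sol s v\<bar> * weight v powr 1)"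
          using mult_left_mono[of "weight v powr a" "level i powr (a - 1) * weight v powr 1" "\<bar>sol t v - sol s v\<bar>"]
          by (auto simp: mult_ac)
        then show "ennreal (\<bar>?x v\<bar> * weight v powr a) \<le> ennreal (level i powr (a - 1)) * ennreal (\<bar>sol t v - sol s v\<bar> * weight v powr 1)"
          by (subst ennreal_mult[symmetric]) (auto intro: ennreal_leI)
      qed
      also have "\<dots> = ennreal (level i powr (a - 1)) * N 1 (\<lambda>v. sol t v - sol s v)"
        unfolding N_def by (rule nn_integral_cmult) measurable
      finally show ?thesis .
    qed
    also have "N 1 (\<lambda>v. sol t v - sol s v) \<le> ennreal (?C * ?h powr (- ?\<theta>))"
    proof -
      have "t - s \<le> 1" using order.trans[OF s(3)] h by simp
      then have "N 1 (\<lambda>v. sol t v - sol s v) \<le> ennreal (?C * \<bar>t - s\<bar> powr ?\<theta>)"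
        using s t by (intro sol_holder_N1) auto
      also have "\<dots> \<le> ennreal (?C * (1 / ?h) powr ?\<theta>)"
        using s exponents holder_const_nonneg[OF t] by (intro ennreal_leI mult_left_mono powr_mono2) auto
      also have "(1 / ?h) powr ?\<theta> = ?h powr (- ?\<theta>)" by (simp only: powr_divide powr_one_eq_one powr_minus_divide)
      finally show ?thesis .
    qed
    also have "ennreal (level i powr (a - 1)) * ennreal (?C * ?h powr (- ?\<theta>)) = ennreal (?C * ?h powr (- ?\<theta> / 2))"
    proof -
      have "level i powr (a - 1) * ?h powr (- ?\<theta>) = ?h powr (1 / (2 * a) * (a - 1) + - ?\<theta>)"
        unfolding level_def powr_powr by (rule powr_add[symmetric])
      also have "1 / (2 * a) * (a - 1) + - ?\<theta> = - ?\<theta> / 2" using exponents by (simp add: field_simps)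
      finally show ?thesis using holder_const_nonneg[OF t] by (subst ennreal_mult[symmetric]) (auto simp: mult.left_commute)
    qed
    finally show ?thesis by (simp add: mult_left_mono add_right_mono)
  qed
  have "(\<lambda>i. N a (\<lambda>v. sample i t v - sol t v)) \<longlonglongrightarrow> 0"
  proof (rule tendsto_sandwich[OF _ _ tendsto_const])
    show "\<forall>\<^sub>F i in sequentially. 0 \<le> N a (\<lambda>v. sample i t v - sol t v)" by simp
    have "filterlim (\<lambda>i. real (Suc i)) at_top sequentially"
      by (rule filterlim_compose[OF filterlim_real_sequentially filterlim_Suc])
    then have "\<forall>\<^sub>F i in sequentially. t < real (Suc i)" by (simp add: filterlim_at_top_dense)
    then show "\<forall>\<^sub>F i in sequentially. N a (\<lambda>v. sample i t v - sol t v) \<le>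
        ennreal (?C * real (Suc i) powr (- ?\<theta> / 2)) + N a (?tail i)"
      by eventually_elim (rule main)
    have "(\<lambda>i. real (Suc i) powr (- ?\<theta> / 2)) \<longlonglongrightarrow> 0"
      using exponents by (intro tendsto_neg_powr filterlim_compose[OF filterlim_real_sequentially filterlim_Suc]) auto
    then have "(\<lambda>i. ennreal (?C * real (Suc i) powr (- ?\<theta> / 2))) \<longlonglongrightarrow> ennreal (?C * 0)"
      by (intro tendsto_ennrealI tendsto_mult_left)
    moreover have "N a (\<lambda>v::'a. 0) = 0" by (simp add: N_def)
    ultimately show "(\<lambda>i. ennreal (?C * real (Suc i) powr (- ?\<theta> / 2)) + N a (?tail i)) \<longlonglongrightarrow> 0"
      using tendsto_add[OF _ tail, of _ 0] by simp
  qed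
  then have "(\<lambda>i. enn2real (N a (\<lambda>v. sample i t v - sol t v))) \<longlonglongrightarrow> enn2real 0"
    by (intro tendsto_enn2real) auto
  then show ?thesis by (simp add: L1_norm_eq a2)
qed

text \<open>The norm is measurable in time as a limit of the norms of the simple functions.\<close>

lemma locally_integrable_L1_sol: "locally_integrable_L1 (2 + \<gamma>) {0<..} sol"
  unfolding locally_integrable_L1_def
proof (intro conjI exI[of _ sample] allI impI)
  show "simple_function lborel (sample i)" "sample i t \<in> L1 (2 + \<gamma>)" for i t
    by (rule simple_function_sample sample_L1)+
  have L: "sol t \<in> L1 (2 + \<gamma>)" if "0 \<le> t" for t using that by (rule sol_L1) (simp add: a_def)
  then show "AE t in lborel. t \<in> {0<..} \<longrightarrow> sol t \<in> L1 (2 + \<gamma>)" by simp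
  show "AE t in lborel. t \<in> {0<..} \<longrightarrow> (\<lambda>i. L1_norm (2 + \<gamma>) (\<lambda>v. sample i t v - sol t v)) \<longlonglongrightarrow> 0"
    using sample_tendsto by simp
  fix K :: "real set" assume K: "compact K \<and> K \<subseteq> {0<..}"
  then obtain T where T: "\<And>t. t \<in> K \<Longrightarrow> t \<le> T"
    using compact_imp_bounded[of K] unfolding bounded_real by (meson abs_le_D1)
  have Kb[measurable]: "K \<in> sets borel" using K by (intro borel_compact) auto
  have nonneg: "0 \<le> L1_norm (2 + \<gamma>) u" for u :: "'a \<Rightarrow> real" by (simp add: L1_norm_def L1_weight_def)
  have lim: "(\<lambda>i. L1_norm (2 + \<gamma>) (sample i t)) \<longlonglongrightarrow> L1_norm (2 + \<gamma>) (sol t)" if "0 \<le> t" for t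
  proof -
    have "(\<lambda>i. L1_norm (2 + \<gamma>) (sample i t) - L1_norm (2 + \<gamma>) (sol t)) \<longlonglongrightarrow> 0"
      by (rule Lim_null_comparison[OF _ sample_tendsto[OF that]])
         (use L1_norm_diff_ge[OF sample_L1 L[OF that]] in \<open>auto intro!: always_eventually\<close>)
    then show ?thesis by (rule LIM_zero_cancel)
  qed
  have "(\<lambda>t. indicator K t * L1_norm (2 + \<gamma>) (sol t)) \<in> borel_measurable lborel"
  proof (rule borel_measurable_LIMSEQ_real)
    show "(\<lambda>i. indicator K t * L1_norm (2 + \<gamma>) (sample i t)) \<longlonglongrightarrow> indicator K t * L1_norm (2 + \<gamma>) (sol t)" for t
      using K lim[of t] by (cases "t \<in> K") (auto simp: less_imp_le subset_iff)
    fix i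
    have "simple_function lborel (\<lambda>t. L1_norm (2 + \<gamma>) (sample i t))"
      by (rule simple_function_compose1[OF simple_function_sample])
    then have "(\<lambda>t. L1_norm (2 + \<gamma>) (sample i t)) \<in> borel_measurable lborel"
      by (rule borel_measurable_simple_function)
    then show "(\<lambda>t. indicator K t * L1_norm (2 + \<gamma>) (sample i t)) \<in> borel_measurable lborel" by measurable
  qed
  moreover have "L1_norm (2 + \<gamma>) (sol t) \<le> growth_bound T" if t: "t \<in> K" for t
  proof -
    have t0: "0 \<le> t" "t \<le> T" using K T t by (auto simp: less_imp_le subset_iff)
    have "(2 + \<gamma>) / 2 = a" by (simp add: a_def)
    then show ?thesis
      using sol_bd[OF t0] growth_bound_ge_1(2)[of T] t0 by (simp add: L1_norm_eq enn2real_leI)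
  qed
  ultimately show "set_integrable lborel K (\<lambda>t. L1_norm (2 + \<gamma>) (sol t))"
    unfolding set_integrable_def
    by (intro integrableI_bounded_set[of K _ _ "growth_bound T"])
       (use K nonneg emeasure_compact_finite[of K] in \<open>auto simp: indicator_def\<close>)
qed

end

context
  fixes b :: "real \<Rightarrow> real" and \<gamma> \<alpha> :: real
  assumes ann: "annihilation (angular_kernel b :: 'a::euclidean_space \<Rightarrow> _) \<gamma> \<alpha>"
begin

interpretation annihilation "angular_kernel b :: 'a \<Rightarrow> _" \<gamma> \<alpha> by (rule ann)

lemma Q_plus_eq_gain:
  assumes [measurable]: "f \<in> borel_measurable borel"
  shows "Q_plus \<gamma> b f v = gain (pairs hard f) v"
proof -
  note [measurable] = rateD(1)[OF rate_hard]
  let ?G = "\<lambda>p :: 'a \<times> 'a. angular_kernel b (sgn (v - fst p)) (snd p) *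
     pairs hard f (post_coll v (fst p) (snd p), post_coll_star v (fst p) (snd p))"
  let ?M = "lborel \<Otimes>\<^sub>M sphere_measure :: ('a \<times> 'a) measure"
  have m: "(\<lambda>x. x) \<in> measurable sphere_measure (borel :: 'a measure)"
    by (rule measurable_id_sphere_measure)
  have "distr lborel borel (\<lambda>x. x) \<Otimes>\<^sub>M distr sphere_measure borel (\<lambda>x. x) =
      distr ?M (borel \<Otimes>\<^sub>M borel) (\<lambda>(x, y). (x, y))"
    by (rule pair_measure_distr) (use m finite_measure.axioms[OF finite_measure_sphere_borel] in \<open>auto simp: sphere_borel_def\<close>)
  then have "lborel \<Otimes>\<^sub>M sphere_borel = distr ?M (borel \<Otimes>\<^sub>M borel) (\<lambda>p. p)"
    by (simp add: sphere_borel_def distr_id2 id_def)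
  then have "gain (pairs hard f) v = integral\<^sup>L (distr ?M (borel \<Otimes>\<^sub>M borel) (\<lambda>p. p)) ?G"
    unfolding gain_def by simp
  also have "\<dots> = (LINT p|?M. ?G p)"
  proof (rule integral_distr)
    show "(\<lambda>p. p) \<in> ?M \<rightarrow>\<^sub>M borel \<Otimes>\<^sub>M borel"
      using m by (intro measurable_pair) (auto simp: comp_def intro: measurable_compose[OF measurable_snd])
    show "?G \<in> borel_measurable (borel \<Otimes>\<^sub>M borel)" unfolding pairs_def by measurable
  qed
  also have "\<dots> = Q_plus \<gamma> b f v"
    unfolding Q_plus_def
  proof (rule Bochner_Integration.integral_cong)
    fix p :: "'a \<times> 'a" assume "p \<in> space ?M"
    then have s: "norm (snd p) = 1"
      by (auto simp: space_pair_measure sphere_measure_def space_scale_measure space_restrict_space)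
    obtain w \<sigma> where p: "p = (w, \<sigma>)" by force
    have cd: "cos_dev v w \<sigma> = sgn (v - w) \<bullet> \<sigma>" by (simp add: cos_dev_def sgn_div_norm)
    have "\<bar>sgn (v - w) \<bullet> \<sigma>\<bar> \<le> norm (sgn (v - w)) * norm \<sigma>" by (rule Cauchy_Schwarz_ineq2)
    also have "\<dots> \<le> 1" using s p by (simp add: norm_sgn)
    finally have "sgn (v - w) \<bullet> \<sigma> \<in> {-1..1}" by (simp add: abs_le_iff)
    then show "?G p = (case p of (w, \<sigma>) \<Rightarrow> norm (v - w) powr \<gamma> * b (cos_dev v w \<sigma>) * f (post_coll v w \<sigma>) * f (post_coll_star v w \<sigma>))"
      using s p norm_post_coll_diff[of \<sigma> v w] by (simp add: angular_kernel_def pairs_def hard_def cd)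
  qed simp
  finally show ?thesis ..
qed

lemma collision_operator_eq_collide:
  assumes f: "f \<in> borel_measurable borel"
  shows "(1 - \<alpha>) * Q_plus \<gamma> b f v - Q_minus \<gamma> f v = collide (pairs hard f) v"
  by (simp add: collide_def Q_plus_eq_gain[OF f] loss_pairs freq_def Q_minus_def hard_def)

text \<open>Mass and energy together are the norm of order 1.\<close>

lemma weak_evolution_admissible:
  assumes f0: "f0 \<in> L1 (2 + \<gamma>)" and f0_nonneg: "AE v in lborel. 0 \<le> f0 v"
    and sol: "admissible_solution \<gamma> \<alpha> b f0 (f :: real \<Rightarrow> 'a \<Rightarrow> real)"
  shows "weak_evolution (angular_kernel b) \<gamma> \<alpha> f
    ((LINT v|lborel. f0 v) + (LINT v|lborel. f0 v * (norm v)\<^sup>2)) (L1_norm (2 + \<gamma>) f0)"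
    (is "weak_evolution _ _ _ _ ?E _")
proof
  note sol = sol[unfolded admissible_solution_def]
  have a2: "(2 + \<gamma>) / 2 = a" by (simp add: a_def)
  have f1: "f t \<in> L1 2" if "0 \<le> t" for t using sol that by (auto simp: continuous_L1_def)
  show fm: "f t \<in> borel_measurable borel" if "0 \<le> t" for t using f1[OF that] by (simp add: L1_iff)
  show fn: "AE v in lborel. 0 \<le> f t v" if "0 \<le> t" for t using sol that by blast
  show "0 \<le> L1_norm (2 + \<gamma>) f0" by (simp add: L1_norm_def L1_weight_def)
  have E1: "N 1 g = ennreal ((LINT v|lborel. g v) + (LINT v|lborel. g v * (norm v)\<^sup>2))"
      "0 \<le> (LINT v|lborel. g v)" "0 \<le> (LINT v|lborel. g v * (norm v)\<^sup>2)"
    if g: "g \<in> L1 2" "AE v in lborel. 0 \<le> g v" for g :: "'a \<Rightarrow> real"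
  proof -
    show p: "0 \<le> (LINT v|lborel. g v)" "0 \<le> (LINT v|lborel. g v * (norm v)\<^sup>2)"
      by (rule integral_nonneg_AE, use g(2) in \<open>auto elim!: eventually_mono\<close>)+
    have gm[measurable]: "g \<in> borel_measurable borel" using g by (simp add: L1_iff)
    have "N 1 g < \<infinity>" using g by (simp add: L1_iff)
    then have fin: "N 0 g < \<infinity>" "energy g < \<infinity>" unfolding N_1_eq[OF gm g(2)] by auto
    have "N 0 g = ennreal (LINT v|lborel. g v)" unfolding N_0_eq[OF g(2)]
      by (rule nn_integral_eq_integral[OF _ g(2)])
         (rule integrableI_nonneg[OF _ g(2)], use fin in \<open>auto simp: N_0_eq[OF g(2)]\<close>)
    moreover have "AE v in lborel. 0 \<le> g v * (norm v)\<^sup>2" using g(2) by eventually_elim simp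
    then have "energy g = ennreal (LINT v|lborel. g v * (norm v)\<^sup>2)" unfolding energy_def
      by (intro nn_integral_eq_integral integrableI_nonneg) (use fin in \<open>auto simp: energy_def\<close>)
    ultimately show "N 1 g = ennreal ((LINT v|lborel. g v) + (LINT v|lborel. g v * (norm v)\<^sup>2))"
      unfolding N_1_eq[OF gm g(2)] using p by simp
  qed
  have f02: "f0 \<in> L1 2"
    using f0 N_mono_exponent[of 1 a f0] exponents by (auto simp: L1_iff a2)
  show "0 \<le> ?E" using E1(2,3)[OF f02 f0_nonneg] by simp
  show "N 1 (f t) \<le> ennreal ?E" if "0 \<le> t" for t
    unfolding E1(1)[OF f1[OF that] fn[OF that]] using sol that by (intro ennreal_leI add_mono) auto
  show "\<exists>d>0. \<forall>s\<ge>0. \<bar>s - t\<bar> < d \<longrightarrow> N 1 (\<lambda>v. f s v - f t v) \<le> ennreal e" if t: "0 \<le> t" and e: "0 < e" for t e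
  proof -
    have "((\<lambda>s. L1_norm 2 (\<lambda>v. f s v - f t v)) \<longlongrightarrow> 0) (at t within {0..})"
      using sol t by (auto simp: continuous_L1_def)
    then have "\<forall>\<^sub>F s in at t within {0..}. L1_norm 2 (\<lambda>v. f s v - f t v) < e"
      using e by (rule order_tendstoD)
    then obtain d where d: "0 < d" "\<And>s. 0 \<le> s \<Longrightarrow> s \<noteq> t \<Longrightarrow> dist s t < d \<Longrightarrow> L1_norm 2 (\<lambda>v. f s v - f t v) < e"
      unfolding eventually_at by auto
    have "N 1 (\<lambda>v. f s v - f t v) \<le> ennreal e" if s: "0 \<le> s" "\<bar>s - t\<bar> < d" for s
    proof (cases "s = t")
      case False
      then have "L1_norm 2 (\<lambda>v. f s v - f t v) \<le> e" using d(2)[of s] s by (simp add: dist_real_def)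
      then show ?thesis using N_eq_L1_norm[OF L1_diff[OF f1[OF s(1)] f1[OF t]]] by (simp add: ennreal_leI)
    qed (simp add: N_def)
    then show ?thesis using d(1) by blast
  qed
  have init: "AE v in lborel. f 0 v = f0 v" using sol by blast
  have "N a (f 0) = N a f0" by (rule N_cong_AE[OF init])
  then show "N a (f 0) \<le> ennreal (L1_norm (2 + \<gamma>) f0)" using N_eq_L1_norm[OF f0] unfolding a2 by simp
  have loc: "AE t in lborel. t \<in> {0<..} \<longrightarrow> f t \<in> L1 (2 + \<gamma>)"
    "\<And>K. compact K \<Longrightarrow> K \<subseteq> {0<..} \<Longrightarrow> set_integrable lborel K (\<lambda>t. L1_norm (2 + \<gamma>) (f t))"
    using sol by (auto simp: locally_integrable_L1_def)
  show "AE r in lborel. 0 < r \<longrightarrow> N a (f r) < \<infinity>"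
    using loc(1) by eventually_elim (auto simp: L1_iff a2)
  show "set_integrable lborel {s..t} (\<lambda>r. LINT v|lborel. \<bar>f r v\<bar> * weight v powr a)" if "0 < s" "s \<le> t" for s t
  proof -
    have "{s..t} \<subseteq> {0<..}" using that by auto
    then show ?thesis using loc(2)[of "{s..t}"] by (simp add: L1_norm_def L1_weight_eq a2)
  qed
  show "(LINT v|lborel. f t v * \<rho> v) = (LINT v|lborel. f 0 v * \<rho> v) +
      (LINT s:{0..t}|lborel. (LINT v|lborel. collide (pairs hard (f s)) v * \<rho> v))"
    if \<rho>: "C1_compact_support \<rho>" and t: "0 \<le> t" for \<rho> t
  proof -
    note [measurable] = C1_compact_support_measurable[OF \<rho>] fm[of 0]
    have [measurable]: "f0 \<in> borel_measurable borel" using f0 by (simp add: L1_iff)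
    have "(LINT v|lborel. f 0 v * \<rho> v) = (LINT v|lborel. f0 v * \<rho> v)"
      by (rule integral_cong_AE) (use init in \<open>auto elim!: eventually_mono\<close>)
    moreover have "(LINT s:{0..t}|lborel. (LINT v|lborel. collide (pairs hard (f s)) v * \<rho> v)) =
      (LINT s:{0..t}|lborel. (LINT v|lborel. ((1 - \<alpha>) * Q_plus \<gamma> b (f s) v - Q_minus \<gamma> (f s) v) * \<rho> v))"
      by (rule set_lebesgue_integral_cong) (auto simp: collision_operator_eq_collide[OF fm])
    ultimately show ?thesis using sol \<rho> t by (simp add: weak_solution_def)
  qed
qed

text \<open>The scheme starts from the positive part of \<open>f0\<close>, a representative that is nonnegative everywhere.\<close>

lemma admissible_solution_exists:
  assumes f0: "f0 \<in> L1 (2 + \<gamma>)" and f0_nonneg: "AE v in lborel. 0 \<le> f0 v"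
  shows "\<exists>f :: real \<Rightarrow> 'a \<Rightarrow> real. admissible_solution \<gamma> \<alpha> b f0 f"
proof -
  have a2: "(2 + \<gamma>) / 2 = a" by (simp add: a_def)
  define g0 where "g0 = (\<lambda>v. max 0 (f0 v))"
  have [measurable]: "f0 \<in> borel_measurable borel" using f0 by (simp add: L1_iff)
  have m[measurable]: "g0 \<in> borel_measurable borel" unfolding g0_def by measurable
  have eq: "AE v in lborel. g0 v = f0 v" using f0_nonneg by eventually_elim (simp add: g0_def)
  have Na: "N a g0 = ennreal (L1_norm (2 + \<gamma>) f0)"
    using N_eq_L1_norm[OF f0] N_cong_AE[OF eq, of a] by (simp add: a2)
  interpret initial_value "angular_kernel b :: 'a \<Rightarrow> _" \<gamma> \<alpha> g0 "max 1 (L1_norm (2 + \<gamma>) f0)"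
    by unfold_locales (auto simp: Na intro!: ennreal_leI, simp add: g0_def)
  have moment: "(LINT v|lborel. sol t v * \<phi> v) \<le> (LINT v|lborel. f0 v * \<phi> v)"
    if t: "0 \<le> t" and [measurable]: "\<phi> \<in> borel_measurable borel" and \<phi>: "\<And>v. 0 \<le> \<phi> v" "\<And>v. \<phi> v \<le> weight v"
      and le: "(\<integral>\<^sup>+v. ennreal (sol t v * \<phi> v) \<partial>lborel) \<le> (\<integral>\<^sup>+v. ennreal (g0 v * \<phi> v) \<partial>lborel)" for t \<phi>
  proof -
    have "(LINT v|lborel. sol t v * \<phi> v) = enn2real (\<integral>\<^sup>+v. ennreal (sol t v * \<phi> v) \<partial>lborel)"
      by (rule integral_eq_nn_integral) (use sol_nonneg[OF t] \<phi> in \<open>auto elim!: eventually_mono\<close>)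
    also have "\<dots> \<le> enn2real (\<integral>\<^sup>+v. ennreal (g0 v * \<phi> v) \<partial>lborel)"
    proof (rule enn2real_mono[OF le])
      have "(\<integral>\<^sup>+v. ennreal (g0 v * \<phi> v) \<partial>lborel) \<le> N 1 g0"
        unfolding N_def by (intro nn_integral_mono ennreal_leI) (auto simp: g0_def intro!: mult_mono \<phi>)
      also have "N 1 g0 \<le> N a g0" using exponents by (intro N_mono_exponent) auto
      also have "\<dots> < top" by (simp add: Na)
      finally show "(\<integral>\<^sup>+v. ennreal (g0 v * \<phi> v) \<partial>lborel) < top" .
    qed
    also have "\<dots> = (LINT v|lborel. g0 v * \<phi> v)"
      by (rule integral_eq_nn_integral[symmetric]) (auto simp: g0_def \<phi>)
    also have "\<dots> = (LINT v|lborel. f0 v * \<phi> v)"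
      by (rule integral_cong_AE) (use eq in \<open>auto elim!: eventually_mono\<close>)
    finally show ?thesis .
  qed
  have "admissible_solution \<gamma> \<alpha> b f0 sol"
    unfolding admissible_solution_def weak_solution_def
  proof (intro conjI allI impI)
    show "AE v in lborel. 0 \<le> sol t v" if "0 \<le> t" for t by (rule sol_nonneg[OF that])
    show "continuous_L1 2 {0..} sol" by (rule continuous_L1_sol)
    show "locally_integrable_L1 (2 + \<gamma>) {0<..} sol" by (rule locally_integrable_L1_sol)
    show "AE v in lborel. sol 0 v = f0 v" using eq by (simp add: sol_0)
    show "(LINT v|lborel. sol t v) \<le> (LINT v|lborel. f0 v)" if "0 \<le> t" for t
      using moment[OF that, of "\<lambda>_. 1"] sol_mass[OF that] sol_nonneg[OF that] N_0_eq[of "sol t"] N_0_eq[of g0]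
      by (simp add: g0_def)
    show "(LINT v|lborel. sol t v * (norm v)\<^sup>2) \<le> (LINT v|lborel. f0 v * (norm v)\<^sup>2)" if "0 \<le> t" for t
      using moment[OF that, of "\<lambda>v. (norm v)\<^sup>2"] sol_energy[OF that] by (simp add: energy_def weight_def)
    show "(LINT v|lborel. sol t v * \<rho> v) = (LINT v|lborel. f0 v * \<rho> v) + (LINT s:{0..t}|lborel. (LINT v|lborel.
           ((1 - \<alpha>) * Q_plus \<gamma> b (sol s) v - Q_minus \<gamma> (sol s) v) * \<rho> v))"
      if "C1_compact_support \<rho> \<and> 0 \<le> t" for \<rho> t
    proof -
      have \<rho>: "C1_compact_support \<rho>" and t: "0 \<le> t" using that by auto
      obtain c where c: "0 \<le> c" "\<And>v. \<bar>\<rho> v\<bar> \<le> c" using C1_compact_support_bounded[OF \<rho>] by blast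
      have [measurable]: "\<rho> \<in> borel_measurable borel" by (rule C1_compact_support_measurable[OF \<rho>])
      have "(LINT v|lborel. g0 v * \<rho> v) = (LINT v|lborel. f0 v * \<rho> v)"
        by (rule integral_cong_AE) (use eq in \<open>auto elim!: eventually_mono\<close>)
      then show ?thesis
        using sol_weak_form[OF _ c(2,1) t] by (simp add: collision_operator_eq_collide)
    qed
  qed
  then show ?thesis by (rule exI[of _ sol])
qed

lemma admissible_solution_unique:
  assumes f0: "f0 \<in> L1 (2 + \<gamma>)" "AE v in lborel. 0 \<le> f0 v"
    and f: "admissible_solution \<gamma> \<alpha> b f0 (f :: real \<Rightarrow> 'a \<Rightarrow> real)"
    and g: "admissible_solution \<gamma> \<alpha> b f0 g" and t: "0 \<le> t"
  shows "AE v in lborel. f t v = g t v"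
proof -
  have init: "AE v in lborel. f 0 v = g 0 v"
  proof -
    have "AE v in lborel. f 0 v = f0 v" "AE v in lborel. g 0 v = f0 v"
      using f g by (auto simp: admissible_solution_def)
    then show ?thesis by eventually_elim simp
  qed
  show ?thesis
  proof (cases "t = 0")
    case False
    then show ?thesis
      using t by (intro weak_evolution_unique[OF weak_evolution_admissible[OF f0 f] weak_evolution_admissible[OF f0 g] init]) simp
  qed (use init in simp)
qed

end

theorem theorem1p10:
  fixes \<gamma> \<alpha> :: real and b :: "real \<Rightarrow> real" and f0 :: "real ^ 'n \<Rightarrow> real"
  assumes "CARD('n) \<ge> 2"
    and "0 < \<gamma>" "\<gamma> \<le> 1" and "0 < \<alpha>" "\<alpha> < 1"
    and "b \<in> borel_measurable (restrict_space borel {-1..1})"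
    and "\<And>t. t \<in> {-1..1} \<Longrightarrow> 0 \<le> b t"
    and "sphere_area (CARD('n) - 1) *
           (LINT t:{-1..1}|lborel. b t * (1 - t\<^sup>2) powr ((real CARD('n) - 3) / 2)) = 1"
    and "f0 \<in> L1 (2 + \<gamma>)" and "AE v in lborel. 0 \<le> f0 v"
  shows "(\<exists>f. admissible_solution \<gamma> \<alpha> b f0 f) \<and>
         (\<forall>f g. admissible_solution \<gamma> \<alpha> b f0 f \<and> admissible_solution \<gamma> \<alpha> b f0 g \<longrightarrow>
            (\<forall>t\<ge>0. AE v in lborel. f t v = g t v))"
proof -
  have ann: "annihilation (angular_kernel b :: real ^ 'n \<Rightarrow> _) \<gamma> \<alpha>"
    using scattering_angular_kernel[OF assms(1,6,7,8)] assms(2-5)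
    by (simp add: annihilation_def annihilation_axioms_def)
  show ?thesis
    using admissible_solution_exists[OF ann assms(9,10)] admissible_solution_unique[OF ann assms(9,10)] by blast
qed

end
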